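(* Let $G$ be a torsion-free countable group, let $n\in \mathbb{N}$, $n \ge 2$, and let non-empty subsets $X_i \subset G\setminus \{1\}$, $i =1,\dots,n-1$, be independent in $G$. Then $G$ can be embedded into a $2$-generated torsion-free group $M$ which has the property ($n$CC), so that the subsets $X_i$, $i=1,\dots, n-1$, stay independent in $M$. Moreover, one can choose $M$ to be $2$-boundedly simple.
   Context: A group $M$ has the property ($n$CC), for an integer $n\ge 2$, if there are exactly $n$ conjugacy classes of elements in $M$ (the class of the identity is counted). Two elements $x,y$ of a group $G$ are commensurable in $G$ if there exist $k,l \in \mathbb{Z}\setminus\{0\}$ such that $x^k$ is conjugate to $y^l$ in $G$. A family of subsets $X_i \subset G$, $i \in I$, is independent in $G$ if no element of $X_i$ is commensurable in $G$ with an element of $X_j$ whenever $i \neq j$, $i,j\in I$. A group $G$ is $k$-boundedly simple if for any $x,y \in G\setminus \{1\}$ there exist $l \le k$ and $g_1,\dots,g_l \in G$ such that $x = g_1yg_1^{-1}\cdots g_lyg_l^{-1}$ in $G$. *)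

theory Defs
  imports
    "HOL-Algebra.Group_Action"
    "HOL-Algebra.Generated_Groups"
    "HOL-Library.Countable_Set"
begin

definition torsion_free :: "('a, 'b) monoid_scheme \<Rightarrow> bool" where
  "torsion_free G \<longleftrightarrow>
     (\<forall>x\<in>carrier G. \<forall>k::nat. k > 0 \<longrightarrow> x [^]\<^bsub>G\<^esub> k = \<one>\<^bsub>G\<^esub> \<longrightarrow> x = \<one>\<^bsub>G\<^esub>)"

definition two_generated :: "('a, 'b) monoid_scheme \<Rightarrow> bool" where
  "two_generated G \<longleftrightarrow> (\<exists>a\<in>carrier G. \<exists>b\<in>carrier G. generate G {a, b} = carrier G)"

definition conjugate :: "('a, 'b) monoid_scheme \<Rightarrow> 'a \<Rightarrow> 'a \<Rightarrow> bool" where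
  "conjugate G x y \<longleftrightarrow> (\<exists>g\<in>carrier G. y = g \<otimes>\<^bsub>G\<^esub> x \<otimes>\<^bsub>G\<^esub> inv\<^bsub>G\<^esub> g)"

text \<open>The action below is the one of the library theorem \<open>group.action_by_conjugation\<close>.\<close>

definition conjugacy_classes :: "('a, 'b) monoid_scheme \<Rightarrow> 'a set set" where
  "conjugacy_classes G =
     orbits G (carrier G) (\<lambda>g. \<lambda>h\<in>carrier G. g \<otimes>\<^bsub>G\<^esub> h \<otimes>\<^bsub>G\<^esub> inv\<^bsub>G\<^esub> g)"

lemma conjugacy_classes_conjugate:
  "conjugacy_classes G = (\<lambda>x. {y. conjugate G x y}) ` carrier G"
  by (auto simp: conjugacy_classes_def orbits_def orbit_def conjugate_def)

text \<open>Finiteness is required separately since \<open>card\<close> of an infinite set is \<open>0\<close>.\<close>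

definition has_nCC :: "('a, 'b) monoid_scheme \<Rightarrow> nat \<Rightarrow> bool" where
  "has_nCC G n \<longleftrightarrow> finite (conjugacy_classes G) \<and> card (conjugacy_classes G) = n"

definition commensurable :: "('a, 'b) monoid_scheme \<Rightarrow> 'a \<Rightarrow> 'a \<Rightarrow> bool" where
  "commensurable G x y \<longleftrightarrow>
     (\<exists>(k::int) (l::int). k \<noteq> 0 \<and> l \<noteq> 0 \<and> conjugate G (x [^]\<^bsub>G\<^esub> k) (y [^]\<^bsub>G\<^esub> l))"

definition independent_family ::
  "('a, 'b) monoid_scheme \<Rightarrow> 'i set \<Rightarrow> ('i \<Rightarrow> 'a set) \<Rightarrow> bool" where
  "independent_family G I X \<longleftrightarrow>
     (\<forall>i\<in>I. X i \<subseteq> carrier G) \<and>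
     (\<forall>i\<in>I. \<forall>j\<in>I. i \<noteq> j \<longrightarrow> (\<forall>x\<in>X i. \<forall>y\<in>X j. \<not> commensurable G x y))"

text \<open>The list \<open>gs\<close> is \<open>g\<^sub>1, \<dots>, g\<^sub>l\<close>, and the fold is the product
  \<open>g\<^sub>1 y g\<^sub>1\<^sup>-\<^sup>1 \<dots> g\<^sub>l y g\<^sub>l\<^sup>-\<^sup>1\<close>.\<close>

definition boundedly_simple :: "nat \<Rightarrow> ('a, 'b) monoid_scheme \<Rightarrow> bool" where
  "boundedly_simple k G \<longleftrightarrow>
     (\<forall>x\<in>carrier G - {\<one>\<^bsub>G\<^esub>}. \<forall>y\<in>carrier G - {\<one>\<^bsub>G\<^esub>}.
        \<exists>gs. length gs \<le> k \<and> set gs \<subseteq> carrier G \<and>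
          x = foldr (\<otimes>\<^bsub>G\<^esub>) (map (\<lambda>g. g \<otimes>\<^bsub>G\<^esub> y \<otimes>\<^bsub>G\<^esub> inv\<^bsub>G\<^esub> g) gs) \<one>\<^bsub>G\<^esub>)"

end

theory Submission
  imports Defs
begin

text \<open>All groups of the construction are quotients \<open>L / N\<close> of one countable free group \<open>L\<close>; \<open>M\<close> is the
quotient by the union of an increasing chain of such \<open>N\<close>. A subgroup \<open>P\<close> of \<open>L\<close> maps onto
\<open>G \<times> \<int>\<^sup>2\<close>, which is coloured by \<open>1, \<dots>, n - 1\<close> so that powers and conjugates keep their colour, \<open>X i\<close> has
colour \<open>i\<close>, and every colour contains the product of two elements of any given colour. No step of the
chain makes elements of \<open>P\<close> of different colours conjugate, and in the limit every nontrivial element is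
conjugate into \<open>P\<close> and equal colours are conjugate; the products of colours give the bounded simplicity.

A step adds \<open>Y g Y\<^sup>-\<^sup>1 p0\<^sup>-\<^sup>1\<close> to \<open>N\<close> for a given \<open>g\<close>, some \<open>p0\<close> in \<open>P\<close> and a long word \<open>Y\<close> in the two
generators. Instead of a hyperbolic Cayley graph, \<open>L / N\<close> carries an action on the cosets of a cyclic
subgroup with a strong projection system in the sense of Bestvina, Bromberg, Fujiwara and Sisto. Coning off
the translates of the orbit of \<open>P\<close> and \<open>Y g Y\<^sup>-\<^sup>1\<close> along the word \<open>Y\<close> turns the new relators into large
rotations about cone points, the windmills of Dahmani, Guirardel and Osin control the group they generate,
and the orbits of two further long words provide the projection systems for the next step.\<close>

section \<open>Groups as a type class\<close>

text \<open>The factor \<open>Z^2\<close> supplies what \<open>G\<close> may lack: an infinite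
  cyclic subgroup for the two free factors, and nontrivial elements of every colour with prescribed
  colours of products. The colouring of \<open>P\<close> stands for the future conjugacy classes; a
  step only has to respect it, so the target \<open>p0\<close> of \<open>g\<close> may be any
  nontrivial element of the colour forced by powers of \<open>g\<close> that are already conjugate
  into \<open>P\<close>. All conjugators lie in \<open>S\<close>, the subgroup of the two
  generators: once its image contains one nontrivial element of \<open>P\<close>, the products of
  colours put all of \<open>P\<close> into it. Two projection systems are carried along because the
  chain built on \<open>r\<close> cannot treat an element with a power fixing a coset of
  \<open>pwr r N\<close>; for two incommensurable \<open>r1\<close>, \<open>r2\<close> this does not
  happen twice. Roots and colours in the quotient are controlled by lifting to tight pairs, which
  have minimal distance and which no rotation shortens noticeably. The constants are generous: 120
  bounds the separating points lost along a geodesic that misses an apex, and 120000 is 1000 times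
  that.\<close>

notation inverse ("_^-" [1000] 1000)

class grp = monoid_mult + inverse +
 assumes left_inv [simp]: "x^- * x = 1"
begin

lemma right_inv [simp]: "x * x^- = 1"
by (metis left_inv mult_1_left mult_assoc)

lemma inv_cancel_left [simp]: "x^- * (x * y) = y"
 by (metis left_inv mult_1_left mult_assoc)

lemma cancel_inv_left [simp]: "x * (x^- * y) = y"
 by (metis right_inv mult_1_left mult_assoc)

lemma grp_left_cancel [simp]: "x * y = x * z \<longleftrightarrow> y = z"
 by (metis inv_cancel_left)

lemma grp_right_cancel [simp]: "y * x = z * x \<longleftrightarrow> y = z"
 by (metis mult_1_right mult_assoc right_inv)

lemma inv_unique: "x * y = 1 ==> x^- = y"
 by (metis inv_cancel_left mult_1_right)

lemma inv_inv [simp]: "x^-^- = x"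
 by (rule inv_unique) simp

lemma inv_one [simp]: "inverse 1 = 1"
 by (rule inv_unique) simp

lemma inv_mult [simp]: "(x * y)^- = y^- * x^-"
 by (rule inv_unique) (simp add: mult_assoc)

lemma inv_eq_1 [simp]: "x^- = 1 \<longleftrightarrow> x = 1"
 by (metis inv_inv inv_one)

end

section \<open>Integer powers, subgroups and generated subgroups\<close>

lemma inv_power: "(x ^ n)^- = (x::'a::grp)^- ^ n"
 by (induction n) (simp_all add: power_commutes)

lemma conj_power: "(h * x * h^-) ^ n = h * x ^ n * (h::'a::grp)^-"
 by (induction n) (simp_all add: mult.assoc)

definition zpow :: "'a::grp => int => 'a" where
 "zpow x k = (if 0 <= k then x ^ nat k else x^- ^ nat (- k))"

lemma zpow_0 [simp]: "zpow x 0 = 1" by (simp add: zpow_def)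
lemma zpow_1 [simp]: "zpow x 1 = x" by (simp add: zpow_def)
lemma zpow_m1 [simp]: "zpow x (-1) = x^-" by (simp add: zpow_def)
lemma zpow_one [simp]: "zpow 1 k = 1" by (simp add: zpow_def)
lemma zpow_of_nat: "zpow x (int n) = x ^ n" by (simp add: zpow_def)

lemma zpow_Suc: "zpow x (k + 1) = x * zpow x k"
proof (cases "0 <= k")
 case True
 thus ?thesis by (simp add: zpow_def nat_add_distrib)
next
 case False
 hence "nat (- k) = Suc (nat (- k - 1))" by simp
 thus ?thesis by (auto simp: zpow_def)
qed

lemma zpow_pred: "zpow x (k - 1) = x^- * zpow x k"
 using zpow_Suc[of x "k - 1"] by simp

lemma zpow_add: "zpow x (k + l) = zpow x k * zpow x l"
proof (induction k rule: int_induct[where k = 0])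
 case base show ?case by simp
next
 case (step1 i)
 have "zpow x (i + 1 + l) = x * zpow x (i + l)"
  by (metis zpow_Suc algebra_simps)
 thus ?case by (simp add: step1 zpow_Suc mult.assoc)
next
 case (step2 i)
 have "zpow x (i - 1 + l) = x^- * zpow x (i + l)"
  by (simp add: zpow_pred algebra_simps)
 thus ?case by (simp add: step2 zpow_pred mult.assoc)
qed

lemma zpow_minus: "zpow x (- k) = (zpow x k)^-"
 by (rule inv_unique[symmetric]) (simp add: zpow_add[symmetric])

lemma zpow_conj: "zpow (h * x * h^-) k = h * zpow x k * h^-"
proof -
 have "(h * x * h^-)^- = h * x^- * h^-"
  by (simp add: mult.assoc)
 thus ?thesis by (simp add: zpow_def conj_power)
qed

lemma zpow_mult: "zpow x (k * l) = zpow (zpow x k) l"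
proof (induction l rule: int_induct[where k = 0])
 case base show ?case by simp
next
 case (step1 i)
 have "zpow x (k * (i + 1)) = zpow x k * zpow x (k * i)"
  by (simp add: zpow_add algebra_simps)
 thus ?case by (simp add: step1 zpow_Suc)
next
 case (step2 i)
 have "zpow x (k * (i - 1)) = (zpow x k)^- * zpow x (k * i)"
  by (simp add: zpow_minus[symmetric] zpow_add[symmetric] algebra_simps)
 thus ?case by (simp add: step2 zpow_pred)
qed

definition subgrp :: "'a::grp set => bool" where
 "subgrp H \<longleftrightarrow> 1 : H & (ALL x:H. ALL y:H. x * y : H) & (ALL x:H. x^- : H)"

lemma subgrpD: "subgrp H ==> 1 : H" "subgrp H ==> x : H ==> y : H ==> x * y : H"
 "subgrp H ==> x : H ==> x^- : H"
 by (auto simp: subgrp_def)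

lemma subgrp_zpow: "subgrp H ==> x : H ==> zpow x k : H"
proof -
 assume H: "subgrp H" and x: "x : H"
 have "y : H ==> y ^ n : H" for y and n :: nat
  by (induction n) (auto simp: subgrpD[OF H])
 thus ?thesis using subgrpD[OF H] x by (auto simp: zpow_def)
qed

lemma subgrp_inv_iff: "subgrp H ==> x^- : H \<longleftrightarrow> x : H"
 by (metis inv_inv subgrpD(3))

definition normal_sub :: "'a::grp set => bool" where
 "normal_sub H \<longleftrightarrow> subgrp H & (ALL x:H. \<forall>g. g * x * g^- : H)"

lemma normal_subD: "normal_sub H ==> subgrp H" "normal_sub H ==> x : H ==> g * x * g^- : H"
 by (auto simp: normal_sub_def)

text \<open>Words grow on the left by one generator or inverse of a generator, so that induction
  treats a single letter at a time.\<close>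

inductive_set gen :: "'a::grp set => 'a set" for S where
 gen_one: "1 : gen S"
| gen_mult: "s : S \<or> s^- : S ==> x : gen S ==> s * x : gen S"

lemma gen_incl: "s : S ==> s : gen S"
 using gen_mult[OF _ gen_one, of s] by simp

lemma gen_mult_closed: "x : gen S ==> y : gen S ==> x * y : gen S"
 by (induction rule: gen.induct) (auto simp: mult.assoc intro: gen_mult)

lemma gen_inverse: "x : gen S ==> x^- : gen S"
proof (induction rule: gen.induct)
 case gen_one show ?case by (simp add: gen.gen_one)
next
 case (gen_mult s x)
 have "s^- : gen S" using gen.gen_mult[OF _ gen.gen_one, of "s^-"] gen_mult by auto
 thus ?case using gen_mult_closed gen_mult by auto
qed

lemma subgrp_gen: "subgrp (gen S)"
 by (auto simp: subgrp_def gen_one gen_mult_closed gen_inverse)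

lemma gen_least: "subgrp H ==> S <= H ==> gen S <= H"
proof
 fix x assume H: "subgrp H" "S <= H" and "x : gen S"
 from \<open>x : gen S\<close> show "x : H"
 proof (induction rule: gen.induct)
  case (gen_mult s x)
  hence "s : H" using H subgrp_inv_iff by blast
  thus ?case using gen_mult H subgrpD by blast
 qed (use H subgrpD in blast)
qed

lemma gen_mono: "S <= T ==> gen S <= gen T"
 using gen_least subgrp_gen gen_incl by blast

lemma gen_normal:
 assumes "\<And>s g. s : S ==> g * s * g^- : gen S"
 shows "normal_sub (gen S)"
proof -
 have "g * x * g^- : gen S" if "x : gen S" for x g
  using that
 proof (induction rule: gen.induct)
  case (gen_mult s x)
  have "g * s * g^- : gen S"
  proof (cases "s : S")
   case False
   hence "(g * s^- * g^-)^- : gen S"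
    using gen_mult assms gen_inverse by blast
   thus ?thesis by (simp add: mult.assoc)
  qed (use assms in blast)
  from gen_mult_closed[OF this gen_mult.IH] show ?case by (simp add: mult.assoc)
 qed (simp add: gen_one)
 thus ?thesis by (auto simp: normal_sub_def subgrp_gen)
qed

section \<open>Strong projection systems\<close>

text \<open>A strong projection system: \<open>ang y\<close> is a pseudometric on the points other than \<open>y\<close>, and
 a point between \<open>x\<close> and \<open>z\<close> hides \<open>x\<close> from \<open>z\<close> completely.\<close>

locale sps =
 fixes Y :: "'y set" and ang :: "'y => 'y => 'y => nat" and th :: nat
 assumes ang_self: "[|y : Y; x : Y; x ~= y|] ==> ang y x x = 0"
  and ang_sym: "[|y : Y; x : Y; z : Y; x ~= y; z ~= y|] ==> ang y x z = ang y z x"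
  and ang_tri: "[|y : Y; x : Y; w : Y; z : Y; x ~= y; w ~= y; z ~= y|] ==>
   ang y x z <= ang y x w + ang y w z"
  and ang_strong: "[|x : Y; y : Y; z : Y; x ~= y; z ~= y; x ~= z; th < ang y x z|] ==> ang z x y = 0"
  and ang_fin: "[|x : Y; z : Y|] ==> finite {y : Y - {x, z}. th < ang y x z}"
begin

lemma ang_strong': "[|x : Y; y : Y; z : Y; x ~= y; z ~= y; x ~= z; th < ang y x z|] ==> ang x z y = 0"
 using ang_strong ang_sym by simp

lemma ang_zero_cong: "[|y : Y; x : Y; w : Y; z : Y; x ~= y; w ~= y; z ~= y; ang y x w = 0|] ==>
  ang y x z = ang y w z"
 using ang_tri[of y x w z] ang_tri[of y w x z] ang_sym[of y x w] by simp

lemma ang_zero_cong': "[|y : Y; x : Y; w : Y; z : Y; x ~= y; w ~= y; z ~= y; ang y x w = 0|] ==>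
  ang y z x = ang y z w"
 by (metis ang_zero_cong ang_sym)

lemma ang_split: "[|y : Y; x : Y; w : Y; z : Y; x ~= y; w ~= y; z ~= y; 2 * th < ang y x z|] ==>
  th < ang y x w \<or> th < ang y w z"
 using ang_tri[of y x w z] by linarith

text \<open>One part of the turn at \<open>y\<close>, from \<open>x\<close> to \<open>w\<close> or
  from \<open>w\<close> to \<open>z\<close>, exceeds \<open>th\<close>; by the strong axiom the
  corresponding endpoint and \<open>y\<close> then coincide as seen from \<open>w\<close>.\<close>

lemma ang_bet:
 assumes "x : Y" "y : Y" "z : Y" "x ~= y" "z ~= y" "2 * th < ang y x z" "w : Y" "w ~= x" "w ~= z" "w ~= y"
 shows "ang w x y = 0 \<or> ang w y z = 0"
 by (metis ang_split ang_strong' assms ang_sym)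

section \<open>Separating points and their linear order\<close>

definition sep :: "nat => 'y => 'y => 'y set" where
 "sep K x z = {y : Y - {x, z}. K < ang y x z}"

lemma finite_sep: "[|th <= K; x : Y; z : Y|] ==> finite (sep K x z)"
 unfolding sep_def by (rule finite_subset[OF _ ang_fin[of x z]]) auto

lemma sep_sym: "[|x : Y; z : Y|] ==> sep K x z = sep K z x"
 by (auto simp: sep_def ang_sym)

lemma sep_refl: "x : Y ==> sep K x x = {}"
 by (auto simp: sep_def ang_self)

lemma sepD: "y : sep K x z ==> y : Y & y ~= x & y ~= z & K < ang y x z"
 by (auto simp: sep_def)

lemma sep_ne: "[|y : sep K x z; x : Y; z : Y|] ==> x ~= z"
 by (auto simp: sep_def ang_self)

lemma sep_zero: "[|th <= K; x : Y; z : Y; y : sep K x z|] ==> ang z x y = 0 & ang z y x = 0 & ang x y z = 0 & ang x z y = 0"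
 using ang_strong[of x y z] ang_strong'[of x y z] sep_ne[of y K x z] ang_sym[of z x y] ang_sym[of x y z]
 by (auto simp: sep_def)

text \<open>From \<open>y\<close> the points \<open>x\<close> and \<open>w\<close> coincide, and
  from \<open>w\<close> so do \<open>y\<close> and \<open>z\<close>; hence exchanging these
  endpoints changes neither angle.\<close>

lemma sep_inner:
 assumes K: "th <= K" and xz: "x : Y" "z : Y" and y: "y : sep K x z" and w: "w : sep K x y"
 shows "w : sep K x z & ang w x z = ang w x y & y : sep K w z & ang y w z = ang y x z"
proof -
 note Y = sepD[OF y] and W = sepD[OF w]
 have a: "ang y x w = 0" using sep_zero[OF K _ _ w] xz Y by auto
 have wz: "w ~= z"
 proof
  assume "w = z"
  hence "ang w x y = 0" using sep_zero[OF K _ _ y] xz by auto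
  thus False using W by simp
 qed
 have b: "ang y w z = ang y x z" by (metis ang_zero_cong a xz Y W)
 have y': "y : sep K w z" using Y W wz b by (auto simp: sep_def)
 have "ang w y z = 0" using sep_zero[OF K _ _ y'] W xz by auto
 hence "ang w x z = ang w x y" by (metis ang_zero_cong' xz Y W wz)
 thus ?thesis using y' b W wz by (auto simp: sep_def)
qed

lemma sep_inner':
 assumes K: "th <= K" and xz: "x : Y" "z : Y" and y: "y : sep K x z" and w: "w : sep K y z"
 shows "w : sep K x z & ang w x z = ang w y z & y : sep K x w & ang y x w = ang y x z"
proof -
 have "y : Y" "w : Y" "w ~= y" "y ~= x" "y ~= z" using y w by (auto simp: sep_def)
 moreover have "y : sep K z x" "w : sep K z y" using sep_sym y w xz \<open>y : Y\<close> by blast+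
 note sep_inner[OF K xz(2) xz(1) this]
 moreover from this have "w ~= x" "w ~= z" by (auto simp: sep_def)
 ultimately show ?thesis using xz ang_sym sep_sym by metis
qed

text \<open>The turn at \<open>u\<close> passes \<open>v\<close> either on the way from
  \<open>x\<close> or on the way to \<open>z\<close>. In either case the strong axiom fixes what
  \<open>v\<close> sees of \<open>u\<close>, and this orders the two points.\<close>

lemma sep_total:
 assumes K: "2 * th <= K" and xz: "x : Y" "z : Y" and uv: "u : sep K x z" "v : sep K x z" "u ~= v"
 shows "(u : sep K x v & v : sep K u z) \<or> (v : sep K x u & u : sep K v z)"
proof -
 note U = sepD[OF uv(1)] and V = sepD[OF uv(2)]
 have "th < ang u x v \<or> th < ang u v z" using ang_split[of u x v z] U V uv xz K by auto
 thus ?thesis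
 proof
  assume a: "th < ang u x v"
  have "ang v x u = 0" using ang_strong a U V xz uv by blast
  hence b: "ang v u z = ang v x z" by (metis ang_zero_cong U V xz uv)
  hence v: "v : sep K u z" using U V uv by (auto simp: sep_def)
  have "ang u v z = 0" using sep_zero[OF _ _ _ v] K U xz by auto
  hence "ang u x v = ang u x z" using ang_zero_cong' U V xz uv by blast
  thus ?thesis using v U V uv by (auto simp: sep_def)
 next
  assume a: "th < ang u v z"
  have "ang v u z = 0" by (metis ang_strong' a U V xz uv ang_sym)
  hence b: "ang v x u = ang v x z" using ang_zero_cong' U V xz uv by blast
  hence v: "v : sep K x u" using U V uv by (auto simp: sep_def)
  have "ang u x v = 0" using sep_zero[OF _ _ _ v] K U xz by auto
  hence "ang u v z = ang u x z" by (metis ang_zero_cong U V xz uv)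
  thus ?thesis using v U V uv by (auto simp: sep_def)
 qed
qed

end

context sps
begin

lemma sep_mid:
 assumes K: "2 * th <= K" and xz: "x : Y" "z : Y"
  and abc: "a : sep K x z" "b : sep K x z" "c : sep K x z" "a ~= b" "b ~= c" "a ~= c"
 shows "b : sep K a c \<or> a : sep K b c \<or> c : sep K a b"
proof -
 have *: "b : sep K a c \<or> a : sep K b c \<or> c : sep K a b"
  if "a : sep K x b" "b : sep K a z" "b : sep K x z" "a : sep K x z" "c : sep K x z" "a ~= b" "b ~= c" "a ~= c"
  for a b c
 proof -
  have Y: "a : Y" "b : Y" "c : Y" using that by (auto simp: sep_def)
  from sep_total[OF K xz \<open>c : sep K x z\<close> \<open>b : sep K x z\<close>] that
  consider "c : sep K x b" | "b : sep K x c" "c : sep K b z" by blast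
  thus ?thesis
  proof cases
   case 1
   from sep_total[OF K xz(1) Y(2) \<open>a : sep K x b\<close> 1 \<open>a ~= c\<close>]
   show ?thesis using sep_sym Y by blast
  next
   case 2
   from sep_inner'[OF _ Y(1) xz(2) \<open>b : sep K a z\<close> 2(2)] K show ?thesis by simp
  qed
 qed
 have Y: "a : Y" "b : Y" "c : Y" using abc by (auto simp: sep_def)
 from sep_total[OF K xz abc(1,2,4)] show ?thesis
  using *[of a b c] *[of b a c] abc sep_sym[of a b] sep_sym[of b a] Y by blast
qed

lemma card_le_2: "(\<And>a b c. [|a : X; b : X; c : X; a ~= b; b ~= c; a ~= c|] ==> False) ==> finite X ==> card X <= 2"
proof (rule ccontr)
 assume A: "\<And>a b c. [|a : X; b : X; c : X; a ~= b; b ~= c; a ~= c|] ==> False" "finite X" "\<not> card X <= 2"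
 hence "3 <= card X" by simp
 then obtain T where "T <= X" "card T = 3" by (meson obtain_subset_with_card_n)
 then obtain a b c where "T = {a, b, c}" "a ~= b" "b ~= c" "a ~= c" by (auto simp: card_3_iff)
 thus False using A(1)[of a b c] \<open>T <= X\<close> by auto
qed

lemma card_le_1: "(\<And>a b. [|a : X; b : X; a ~= b|] ==> False) ==> card X <= 1"
 by (cases "finite X") (auto simp: card_le_Suc0_iff_eq)

text \<open>A separator of \<open>x\<close> and \<open>z\<close> that is lost on both halves still
  turns by more than \<open>th\<close> towards \<open>w\<close> on one side. Each side loses only
  one: a second lost point, farther from \<open>w\<close>, would see \<open>w\<close> where it sees
  the first and so keep its angle. With \<open>w\<close> itself this gives the 3. The set
  \<open>F\<close> allows counting the separators of one family only.\<close>

lemma sep_quasi: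
 assumes K: "2 * th <= K" and Y: "x : Y" "w : Y" "z : Y"
 shows "card (sep K x z \<inter> F) <= card (sep K x w \<inter> F) + card (sep K w z \<inter> F) + 3"
proof -
 define R where "R = sep K x z - sep K x w - sep K w z - {w}"
 have fin: "finite (sep K x z)" using finite_sep K Y by simp
 have *: "card {u : R. th < ang u x w} <= 1"
 proof (rule card_le_1)
  have "False" if "u : R" "v : R" "th < ang u x w" "th < ang v x w" "u : sep K x v" for u v
  proof -
   have YY: "u : Y" "v : Y" "u ~= v" "u ~= x" "v ~= x" "u ~= w" "v ~= w"
    using that by (auto simp: R_def sep_def)
   have "ang v x u = 0" using sep_zero[OF _ _ _ that(5)] YY Y K by auto
   hence "th < ang v u w" using ang_zero_cong[of v x u w] that YY Y by auto
   hence "ang u w v = 0" using ang_strong' YY Y by simp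
   hence "ang u x w = ang u x v" using ang_zero_cong' YY Y by blast
   hence "u : sep K x w" using that(5) YY by (auto simp: sep_def)
   thus False using that by (auto simp: R_def)
  qed
  thus False if "u : {u : R. th < ang u x w}" "v : {u : R. th < ang u x w}" "u ~= v" for u v
   using that sep_total[OF K Y(1,3), of u v] by (auto simp: R_def)
 qed
 have **: "card {u : R. th < ang u w z} <= 1"
 proof (rule card_le_1)
  have "False" if "u : R" "v : R" "th < ang u w z" "th < ang v w z" "v : sep K u z" "u ~= v" for u v
  proof -
   have YY: "u : Y" "v : Y" "u ~= v" "u ~= z" "v ~= z" "u ~= w" "v ~= w"
    using that by (auto simp: R_def sep_def)
   have "ang u v z = 0" using sep_zero[OF _ _ _ that(5)] YY Y K by auto
   hence "th < ang u w v" using ang_zero_cong'[of u v z w] that YY Y by auto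
   hence "ang v w u = 0" using ang_strong YY Y by simp
   hence "ang v w z = ang v u z" using ang_zero_cong YY Y by blast
   hence "v : sep K w z" using that(5) YY by (auto simp: sep_def)
   thus False using that by (auto simp: R_def)
  qed
  thus False if "u : {u : R. th < ang u w z}" "v : {u : R. th < ang u w z}" "u ~= v" for u v
   using that sep_total[OF K Y(1,3), of u v] by (auto simp: R_def)
 qed
 have "R <= {u : R. th < ang u x w} \<union> {u : R. th < ang u w z}"
 proof
  fix u assume u: "u : R"
  hence "u : Y" "u ~= x" "u ~= z" "u ~= w" "K < ang u x z" by (auto simp: R_def sep_def)
  thus "u : {u : R. th < ang u x w} \<union> {u : R. th < ang u w z}"
   using ang_split u Y K by simp
 qed
 hence "card R <= 2"
  using * ** card_Un_le[of "{u : R. th < ang u x w}" "{u : R. th < ang u w z}"]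
   card_mono[of "{u : R. th < ang u x w} \<union> {u : R. th < ang u w z}" R] fin
  by (auto simp: R_def)
 moreover have "finite (sep K x w)" "finite (sep K w z)" "finite R"
  using finite_sep K Y fin by (auto simp: R_def)
 moreover have "sep K x z \<inter> F <= (sep K x w \<inter> F) \<union> (sep K w z \<inter> F) \<union> (R \<union> {w})"
  by (auto simp: R_def)
 hence "card (sep K x z \<inter> F) <= card ((sep K x w \<inter> F) \<union> (sep K w z \<inter> F) \<union> (R \<union> {w}))"
  using calculation by (intro card_mono) auto
 moreover have "... <= card (sep K x w \<inter> F) + card (sep K w z \<inter> F) + (card R + 1)"
  using card_Un_le[of "(sep K x w \<inter> F) \<union> (sep K w z \<inter> F)" "R \<union> {w}"]
   card_Un_le[of "sep K x w \<inter> F" "sep K w z \<inter> F"] card_Un_le[of R "{w}"] by simp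
 ultimately show ?thesis by linarith
qed

lemma sep_add:
 assumes K: "2 * th <= K" and Y: "x : Y" "z : Y" and y: "y : sep K x z"
 shows "card (sep K x z) = card (sep K x y) + card (sep K y z) + 1"
proof -
 have yY: "y : Y" using y by (simp add: sep_def)
 have fin: "finite (sep K x y)" "finite (sep K y z)" using finite_sep K Y yY by auto
 have "sep K x z = insert y (sep K x y \<union> sep K y z)"
  using sep_total[OF K Y y] sep_inner[OF _ Y y] sep_inner'[OF _ Y y] y K by force
 moreover have "y ~: sep K x y \<union> sep K y z" by (auto simp: sep_def)
 moreover have "sep K x y \<inter> sep K y z = {}"
 proof -
  have False if "w : sep K x y" "w : sep K y z" for w
  proof -
   have "ang y w z = ang y x z" using sep_inner[OF _ Y y that(1)] K by auto
   moreover have "ang y w z = 0" using sep_zero[OF _ _ _ that(2)] K Y yY by auto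
   ultimately show False using y by (auto simp: sep_def)
  qed
  thus ?thesis by blast
 qed
 ultimately show ?thesis using fin by (simp add: card_Un_disjoint)
qed

end

section \<open>Coned-off graphs\<close>

locale cgraph =
 fixes V :: "'v set" and adj :: "'v => 'v => bool"
 assumes adjV: "adj x y ==> x : V & y : V"
  and adj_sym: "adj x y ==> adj y x"
  and conn: "[|x : V; y : V|] ==> \<exists>n. (adj ^^ n) x y"
begin

definition gd :: "'v => 'v => nat" where
 "gd x y = (LEAST n. (adj ^^ n) x y)"

lemma gd_walk: "[|x : V; y : V|] ==> (adj ^^ gd x y) x y"
 by (metis gd_def conn LeastI_ex)

lemma gd_le: "(adj ^^ n) x y ==> gd x y <= n"
 unfolding gd_def by (rule Least_le)

lemma gd_self [simp]: "gd x x = 0"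
 using gd_le[of 0 x x] by simp

lemma gd_sym: assumes "x : V" "y : V" shows "gd x y = gd y x"
proof -
 have "(adj ^^ n) x y ==> (adj ^^ n) y x" for x y n
 proof (induction n arbitrary: x)
  case (Suc n)
  then obtain z where "adj x z" "(adj ^^ n) z y" by (meson relpowp_Suc_E2)
  thus ?case using Suc.IH adj_sym by (meson relpowp_Suc_I)
 qed simp
 thus ?thesis by (simp add: gd_walk assms gd_le antisym)
qed

lemma gd_tri: assumes "x : V" "y : V" "z : V" shows "gd x z <= gd x y + gd y z"
 by (metis relpowp_trans gd_walk assms gd_le)

lemma gd_eq_0: "[|x : V; y : V|] ==> gd x y = 0 \<longleftrightarrow> x = y"
 using gd_walk[of x y] by auto

lemma gd_adj: "adj x y ==> gd x y <= 1"
 by (metis gd_le relpowp_1)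

lemma gd_adj': "adj x y ==> x ~= y ==> gd x y = 1"
 using gd_adj gd_eq_0 adjV by fastforce

lemma geodesic:
 assumes "x : V" "y : V"
 obtains p where "p 0 = x" "p (gd x y) = y" "\<And>i. i < gd x y ==> adj (p i) (p (Suc i))"
  "\<And>i. i <= gd x y ==> p i : V" "\<And>i j. [|i <= j; j <= gd x y|] ==> gd (p i) (p j) = j - i"
proof -
 obtain p where p: "p 0 = x" "p (gd x y) = y" "\<And>i. i < gd x y ==> adj (p i) (p (Suc i))"
  by (metis gd_walk assms relpowp_fun_conv)
 have pV: "p i : V" if "i <= gd x y" for i
 proof (cases "i = gd x y")
  case False thus ?thesis using p(3)[of i] adjV that by auto
 qed (use p assms in auto)
 have le: "gd (p i) (p j) <= j - i" if "i <= j" "j <= gd x y" for i j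
 proof -
  have "(adj ^^ (j - i)) (p i) (p j)"
   unfolding relpowp_fun_conv by (rule exI[of _ "\<lambda>k. p (i + k)"]) (use that p in auto)
  thus ?thesis by (rule gd_le)
 qed
 have "gd (p i) (p j) = j - i" if "i <= j" "j <= gd x y" for i j
 proof -
  have "gd x y <= gd (p 0) (p i) + gd (p i) (p j) + gd (p j) (p (gd x y))"
   using gd_tri[of "p 0" "p i" "p (gd x y)"] gd_tri[of "p i" "p j" "p (gd x y)"] pV that p by fastforce
  thus ?thesis using le[of 0 i] le[of i j] le[of j "gd x y"] that by simp
 qed
 thus ?thesis using p pV that by blast
qed

lemma gd_next:
 assumes "x : V" "y : V" "0 < gd x y"
 shows "\<exists>z. adj x z & gd z y + 1 = gd x y"
proof -
 obtain p where p: "p 0 = x" "p (gd x y) = y" "\<And>i. i < gd x y ==> adj (p i) (p (Suc i))"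
  "\<And>i j. [|i <= j; j <= gd x y|] ==> gd (p i) (p j) = j - i"
  by (metis geodesic assms)
 show ?thesis using p(1,2) p(3)[of 0] p(4)[of 1 "gd x y"] assms(3) by (intro exI[of _ "p 1"]) auto
qed

end

text \<open>Seen from a point \<open>w\<close>, a set in \<open>FF\<close> is either almost a point or turns at \<open>w\<close> by a large angle.\<close>

locale fam = sps Y ang th for Y :: "'y set" and ang th +
 fixes FF :: "'y set set" and B K kap :: nat
 assumes csts: "B + th <= K" "2 * th <= K" "K + th <= kap" "2 * B <= kap"
  and FFY: "F : FF ==> F <= Y & F ~= {}"
  and F1: "[|F : FF; f : F; f' : F; w : Y; w ~= f; w ~= f'; B < ang w f f'|] ==> w : F & kap < ang w f f'"
  and F2: "[|F : FF; G : FF; F ~= G; a : F \<inter> G; b : F \<inter> G; c : F \<inter> G; b : sep kap a c|] ==> False"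
begin

definition V :: "('y + 'y set) set" where
 "V = Inl ` Y \<union> Inr ` FF"

text \<open>The apex \<open>Inr F\<close> cones off \<open>F\<close>; since apices are never
  adjacent, the neighbours of an apex on a path are points of its set.\<close>

definition adj :: "'y + 'y set => 'y + 'y set => bool" where
 "adj u v = (case (u, v) of
   (Inl x, Inl y) => x : Y & y : Y & x ~= y & sep K x y = {}
  | (Inl x, Inr F) => F : FF & x : F
  | (Inr F, Inl x) => F : FF & x : F
  | (Inr F, Inr G) => False)"

lemma adj_simps [simp]:
 "adj (Inl x) (Inl y) \<longleftrightarrow> x : Y & y : Y & x ~= y & sep K x y = {}"
 "adj (Inl x) (Inr F) \<longleftrightarrow> F : FF & x : F"
 "adj (Inr F) (Inl x) \<longleftrightarrow> F : FF & x : F"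
 "\<not> adj (Inr F) (Inr G)"
 by (auto simp: adj_def)

text \<open>Subdivide at a separator: by \<open>sep_add\<close> both halves have fewer
  separators.\<close>

lemma walkY: "x : Y ==> z : Y ==> \<exists>n. (adj ^^ n) (Inl x) (Inl z)"
proof (induction "card (sep K x z)" arbitrary: x z rule: less_induct)
 case less
 show ?case
 proof (cases "sep K x z = {}")
  case True
  thus ?thesis
   using less.prems relpowp_1[of adj] by (cases "x = z") (metis relpowp_0_I, metis adj_simps(1))
 next
  case False
  then obtain y where y: "y : sep K x z" by blast
  hence yY: "y : Y" by (simp add: sep_def)
  have "card (sep K x y) < card (sep K x z)" "card (sep K y z) < card (sep K x z)"
   using sep_add[OF csts(2) less.prems y] by auto
  then obtain n m where "(adj ^^ n) (Inl x) (Inl y)" "(adj ^^ m) (Inl y) (Inl z)"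
   using less.hyps less.prems yY by blast
  thus ?thesis using relpowp_trans by metis
 qed
qed

lemma walk_pts: "u : V ==> \<exists>x n. x : Y & (adj ^^ n) u (Inl x) & (adj ^^ n) (Inl x) u"
proof (cases u)
 case (Inl x)
 assume "u : V"
 thus ?thesis using Inl by (intro exI[of _ x] exI[of _ 0]) (auto simp: V_def)
next
 case (Inr F)
 assume "u : V"
 hence F: "F : FF" using Inr by (auto simp: V_def)
 then obtain x where "x : F" using FFY by blast
 thus ?thesis using F FFY Inr by (intro exI[of _ x] exI[of _ 1]) (auto simp: relpowp_1)
qed

sublocale cgraph V adj
proof
 fix u v assume "adj u v" thus "u : V & v : V"
  using FFY by (cases u; cases v) (auto simp: V_def)
next
 fix u v assume "adj u v" thus "adj v u"
  by (cases u; cases v) (auto simp: sep_sym)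
next
 fix u v assume "u : V" "v : V"
 then obtain x z n m where "x : Y" "z : Y" "(adj ^^ n) u (Inl x)" "(adj ^^ m) (Inl z) v"
  using walk_pts by metis
 moreover obtain k where "(adj ^^ k) (Inl x) (Inl z)" using walkY calculation by blast
 ultimately show "\<exists>n. (adj ^^ n) u v" using relpowp_trans by metis
qed

lemma VI: "x : Y ==> Inl x : V" "F : FF ==> Inr F : V"
 and VD: "Inl x : V ==> x : Y" "Inr F : V ==> F : FF"
 by (auto simp: V_def)

end

section \<open>Geodesics that avoid an apex\<close>

context fam
begin

lemma th_le: "th <= K" "2 * th <= kap" "th <= kap" "B <= K" "K <= kap" "B <= kap"
 using csts by auto

lemma dist_in_F: "F : FF ==> x : F ==> y : F ==> gd (Inl x) (Inl y) <= 2"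
 using gd_tri[of "Inl x" "Inr F" "Inl y"] gd_adj[of "Inl x" "Inr F"] gd_adj[of "Inr F" "Inl y"] FFY VI
 by fastforce

lemma sep_first:
 assumes Y: "x : Y" "z : Y" and ne: "sep K x z ~= {}"
 obtains v where "v : sep K x z" "sep K v z = {}"
proof -
 have "\<exists>v. v : sep K x z & sep K v z = {}" if "v0 : sep K x z" for v0
  using that
 proof (induction "card (sep K v0 z)" arbitrary: v0 rule: less_induct)
  case less
  show ?case
  proof (cases "sep K v0 z = {}")
   case False
   then obtain v where v: "v : sep K v0 z" by blast
   have "v : sep K x z" using sep_inner'[OF _ Y less.prems v] th_le by blast
   moreover have "v0 : Y" using less.prems by (simp add: sep_def)
   hence "card (sep K v z) < card (sep K v0 z)" using sep_add csts Y v by simp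
   ultimately show ?thesis using less.hyps by blast
  qed (use less.prems in blast)
 qed
 thus ?thesis using ne that by blast
qed

text \<open>A turn around \<open>y\<close> without passing through \<open>y\<close> can only happen close to \<open>y\<close>: any point
 separating the turning step from \<open>y\<close> would hide the turn.\<close>

lemma near_edge:
 assumes Y: "w : Y" "w' : Y" "y : Y" "w ~= y" "w' ~= y" and e: "sep K w w' = {}" and t: "0 < ang y w w'"
 shows "gd (Inl w') (Inl y) <= 3"
proof -
 have ww: "w ~= w'" using t ang_self Y by force
 \<comment> \<open>A separator \<open>v\<close> of \<open>w\<close> and \<open>y\<close> that saw
   \<open>w'\<close> far from \<open>y\<close> would hide both ends of the edge from
   \<open>y\<close>, against the positive turn at \<open>y\<close>.\<close>
 have far: "ang v w' y <= th & w' ~= v" if "v : sep K w y" for v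
 proof -
  have v: "v : Y" "v ~= w" "v ~= y" using that by (auto simp: sep_def)
  have z: "ang y w v = 0" using sep_zero[OF _ _ _ that] th_le Y by auto
  have "w' ~= v" using z t by auto
  moreover have "ang v w' y <= th"
  proof (rule ccontr)
   assume "\<not> ?thesis"
   hence "ang y w' v = 0" using ang_strong[of w' v y] v Y \<open>w' ~= v\<close> by auto
   thus False using z t ang_zero_cong'[of y w' v w] v Y ang_sym by auto
  qed
  ultimately show ?thesis by simp
 qed
 have "gd (Inl w) (Inl y) <= 2"
 proof (cases "sep K w y = {}")
  case True thus ?thesis using gd_adj[of "Inl w" "Inl y"] Y by auto
 next
  case False
  obtain v1 where v1: "v1 : sep K w y" "sep K v1 y = {}" using sep_first[OF Y(1,3) False] .
  have v1Y: "v1 : Y" "v1 ~= w" "v1 ~= y" "w' ~= v1" using v1 far by (auto simp: sep_def)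
  \<comment> \<open>The turn at \<open>v1\<close> between \<open>w\<close> and \<open>w'\<close>
    exceeds \<open>th\<close>, so a separator \<open>v2\<close> of \<open>w\<close> and
    \<open>v1\<close> would see \<open>v1\<close> and \<open>w'\<close> alike and thus separate the
    edge from \<open>w\<close> to \<open>w'\<close>.\<close>
  have "sep K w v1 = {}"
  proof (rule ccontr)
   assume "sep K w v1 ~= {}"
   then obtain v2 where v2: "v2 : sep K w v1" by blast
   note v2Y = sepD[OF v2]
   have "th < ang v1 w w'"
    using ang_tri[of v1 w w' y] far[OF v1(1)] v1Y Y sepD[OF v1(1)] csts by auto
   moreover have "ang v1 w v2 = 0" using sep_zero v2 th_le Y v1Y by simp
   moreover have "w' ~= v2" using calculation by auto
   ultimately have "th < ang v1 v2 w'" by (metis ang_zero_cong Y v1Y v2Y)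
   hence "ang v2 w' v1 = 0" using ang_strong'[of v2 v1 w'] \<open>w' ~= v2\<close> v1Y v2Y Y ang_sym by metis
   hence "ang v2 w w' = ang v2 w v1" using ang_zero_cong'[of v2 w' v1 w] v1Y v2Y Y \<open>w' ~= v2\<close> by auto
   hence "v2 : sep K w w'" using v2 \<open>w' ~= v2\<close> by (auto simp: sep_def)
   thus False using e by simp
  qed
  hence "gd (Inl w) (Inl v1) <= 1" using gd_adj v1Y Y by simp
  moreover have "gd (Inl v1) (Inl y) <= 1" using gd_adj v1Y Y v1 by simp
  ultimately show ?thesis using gd_tri[of "Inl w" "Inl v1" "Inl y"] VI v1Y Y by auto
 qed
 moreover have "gd (Inl w') (Inl w) <= 1"
  using gd_adj Y ww e sep_sym by simp
 ultimately show ?thesis using gd_tri[of "Inl w'" "Inl w" "Inl y"] VI Y by auto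
qed

text \<open>As for an edge, but the last separator \<open>v\<close> before \<open>y\<close> must lie
  in \<open>G\<close>: otherwise it turns by at most \<open>B\<close> between \<open>w\<close> and
  \<open>w'\<close> by \<open>F1\<close>, and then hides \<open>w'\<close> from \<open>y\<close>
  just as it hides \<open>w\<close>.\<close>

lemma near_hop:
 assumes G: "G : FF" "w : G" "w' : G" and y: "y : Y" "w ~= y" "w' ~= y" and yG: "y ~: G" and t: "0 < ang y w w'"
 shows "gd (Inl w') (Inl y) <= 3"
proof -
 have Y: "w : Y" "w' : Y" using G FFY by auto
 have GV: "gd (Inl w') (Inr G) <= 1" "\<And>v. v : G ==> gd (Inr G) (Inl v) <= 1"
  using gd_adj[of "Inl w'" "Inr G"] gd_adj[of "Inr G"] G by auto
 have ww: "w ~= w'" using t ang_self Y y by force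
 show ?thesis
 proof (cases "sep K w y = {}")
  case True
  hence "gd (Inl w) (Inl y) <= 1" using gd_adj[of "Inl w" "Inl y"] Y y by auto
  thus ?thesis
   using gd_tri[of "Inl w'" "Inl w" "Inl y"] dist_in_F[of G w' w] G VI Y y by fastforce
 next
  case False
  obtain v where v: "v : sep K w y" "sep K v y = {}" using sep_first[OF Y(1) y(1) False] .
  note vY = sepD[OF v(1)]
  have vy: "gd (Inl v) (Inl y) <= 1" using gd_adj[of "Inl v" "Inl y"] vY y v by auto
  have z: "ang y w v = 0" using sep_zero[OF _ _ _ v(1)] th_le Y y by auto
  have wv: "w' ~= v" using z t by auto
  have "v : G"
  proof (rule ccontr)
   assume "v ~: G"
   hence "ang v w w' <= B" using F1[OF G] vY wv by force
   hence "th < ang v w' y" using ang_tri[of v w w' y] vY Y y wv csts by auto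
   hence "ang y w' v = 0" using ang_strong[of w' v y] vY Y y wv by auto
   thus False using z t ang_zero_cong'[of y w' v w] vY Y y ang_sym by auto
  qed
  hence "gd (Inl w') (Inl v) <= 2" using dist_in_F G by blast
  thus ?thesis using vy gd_tri[of "Inl w'" "Inl v" "Inl y"] VI vY Y y by fastforce
 qed
qed

text \<open>Each separator in \<open>F\<close> has a first time at which the path has visibly turned
  around it, and the path is then within 3 of it. Points of \<open>F\<close> are within 2 of each
  other, so these times lie in a window of 9, and at most 3 separators share a time.\<close>

lemma crossing:
 assumes F: "F : FF" and p: "p 0 = Inl x0" "p L = Inl xs"
  and padj: "\<And>i. i < L ==> adj (p i) (p (Suc i))" and pV: "\<And>i. i <= L ==> p i : V"
  and geo: "\<And>i j. i <= j ==> j <= L ==> gd (p i) (p j) = j - i"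
  and av: "\<And>i. i <= L ==> p i ~= Inr F"
 shows "card (sep kap x0 xs \<inter> F) <= 27"
proof -
 have Y: "x0 : Y" "xs : Y" using p pV[of 0] pV[of L] by (auto dest: VD)
 define S where "S = sep kap x0 xs \<inter> F"
 have S: "y : Y & y ~= x0 & y ~= xs & kap < ang y x0 xs & y : sep kap x0 xs & y : F" if "y : S" for y
  using that by (auto simp: S_def sep_def)
 define T where "T y t \<longleftrightarrow> t <= L & (\<exists>v. p t = Inl v & (v = y \<or> th < ang y x0 v))" for y t
 define tau where "tau y = (LEAST t. T y t)" for y
 have TL: "T y L" if "y : S" for y using S[OF that] p th_le by (auto simp: T_def)
 have tau: "T y (tau y)" "\<And>t. t < tau y ==> \<not> T y t" if "y : S" for y
  unfolding tau_def using TL[OF that] LeastI not_less_Least by (metis, metis)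
 have tauL: "tau y <= L" if "y : S" for y using tau(1)[OF that] by (simp add: T_def)
 have tau0: "0 < tau y" if "y : S" for y
  using tau(1)[OF that] S[OF that] p ang_self[of y x0] Y by (cases "tau y") (auto simp: T_def)
 define stp where "stp t w \<longleftrightarrow> (p (t - 1) = Inl w & 0 < t) \<or> (\<exists>G. p (t - 1) = Inr G & 2 <= t & p (t - 2) = Inl w)" for t w
 have step: "\<exists>w w'. p (tau y) = Inl w' & stp (tau y) w & w : Y & w' : Y & w ~= y & ang y x0 w <= th &
   (p (tau y - 1) = Inl w & sep K w w' = {} \<or> (EX G:FF. G ~= F & p (tau y - 1) = Inr G & w : G & w' : G))"
  if y: "y : S" for y
 proof -
  obtain t where t: "tau y = Suc t" using tau0[OF y] gr0_implies_Suc by blast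
  obtain w' where w': "p (tau y) = Inl w'" using tau(1)[OF y] by (auto simp: T_def)
  have a: "adj (p t) (Inl w')" using padj[of t] tauL[OF y] t w' by auto
  have w'Y: "w' : Y" using pV[OF tauL[OF y]] w' by (auto dest: VD)
  have noT: "w : Y & w ~= y & ang y x0 w <= th" if "p i = Inl w" "i < tau y" for i w
  proof -
   have "i <= L" using that tauL[OF y] by simp
   thus ?thesis using tau(2)[OF y that(2)] that pV[of i] by (auto simp: T_def dest: VD)
  qed
  show ?thesis
  proof (cases "p t")
   case (Inl w)
   thus ?thesis using a noT t w' by (simp add: stp_def)
  next
   case (Inr G)
   hence G: "G : FF" "w' : G" "G ~= F" using a av[of t] tauL[OF y] t by auto
   have "t ~= 0" by (metis Inr p sum.distinct)
   then obtain s where s: "t = Suc s" using not0_implies_Suc by blast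
   hence "adj (p s) (Inr G)" using padj[of s] tauL[OF y] t Inr by auto
   then obtain w where w: "p s = Inl w" "w : G" by (cases "p s") auto
   thus ?thesis using noT s w' t w'Y G Inr by (simp add: stp_def)
  qed
 qed
 have near: "gd (p (tau y)) (Inl y) <= 3" if y: "y : S" for y
 proof -
  obtain w w' where w: "p (tau y) = Inl w'" "w : Y" "w' : Y" "w ~= y" "ang y x0 w <= th"
   "p (tau y - 1) = Inl w & sep K w w' = {} \<or> (EX G:FF. G ~= F & p (tau y - 1) = Inr G & w : G & w' : G)"
   using step[OF y] by blast
  show ?thesis
  proof (cases "w' = y")
   case True thus ?thesis using w by simp
  next
   case False
   hence "th < ang y x0 w'" using tau(1)[OF y] w by (auto simp: T_def)
   hence t: "0 < ang y w w'" using ang_tri[of y x0 w w'] w S[OF y] Y False by auto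
   consider "sep K w w' = {}" | G where "G : FF" "w : G" "w' : G" using w by blast
   thus ?thesis
   proof cases
    case 1 thus ?thesis using near_edge[of w w' y] w t S[OF y] False by auto
   next
    case 2
    show ?thesis
    proof (cases "y : G")
     case True
     thus ?thesis using dist_in_F[of G w' y] 2 w by auto
    next
     case False
     thus ?thesis using near_hop[of G w w' y] 2 w t S[OF y] \<open>w' ~= y\<close> by auto
    qed
   qed
  qed
 qed
 \<comment> \<open>\<open>8 = 3 + 2 + 3\<close>: from the path to one separator, across the apex of
   \<open>F\<close> to the other, and back to the path.\<close>
 have close: "tau y <= tau y' + 8" if "y : S" "y' : S" for y y'
 proof (cases "tau y' <= tau y")
  case True
  have V': "p (tau y) : V" "p (tau y') : V" "Inl y : V" "Inl y' : V"
   using pV tauL that S VI by auto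
  have "tau y - tau y' = gd (p (tau y')) (p (tau y))" using geo[OF True tauL] that by simp
  also have "... <= gd (p (tau y')) (Inl y') + (gd (Inl y') (Inl y) + gd (Inl y) (p (tau y)))"
   using gd_tri[OF V'(2,4,1)] gd_tri[OF V'(4,3,1)] by linarith
  also have "... <= 3 + (2 + 3)"
   using near[OF that(1)] near[OF that(2)] dist_in_F[OF F, of y' y] S that gd_sym[OF V'(3,1)] by fastforce
  finally show ?thesis by simp
 qed simp
 \<comment> \<open>If \<open>y\<close> comes before \<open>l\<close> and both are first turned
   around at the same time, the step is a hop through the apex of some \<open>G\<close> containing
   \<open>y\<close>, because an edge has no separators. So at most one separator lies outside
   \<open>G\<close>, and three inside would be lined up in both \<open>F\<close> and
   \<open>G\<close>, against \<open>F2\<close>.\<close>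
 have fibre: "card {y : S. tau y = t} <= 3" for t
 proof -
  define X where "X = {y : S. tau y = t}"
  define G where "G = (case p (t - 1) of Inl w => {} | Inr G => G)"
  have inG: "y : G & G : FF & G ~= F" if y: "y : X" "l : X" "y : sep kap x0 l" for y l
  proof -
   have yS: "y : S" "tau y = t" "l : S" "tau l = t" using y by (auto simp: X_def)
   note Sy = S[OF yS(1)] and Sl = S[OF yS(3)]
   obtain w w' where w: "p t = Inl w'" "w : Y" "w' : Y" "w ~= y" "ang y x0 w <= th"
    "p (t - 1) = Inl w & sep K w w' = {} \<or> (EX G:FF. G ~= F & p (t - 1) = Inr G & w : G & w' : G)"
    by (metis step yS)
   have yl: "y ~= l" using y(3) by (auto simp: sep_def)
   have lw: "w' = l \<or> th < ang l x0 w'" using tau(1)[OF yS(3)] w yS by (auto simp: T_def)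
   have z: "ang l x0 y = 0" using sep_zero[OF _ _ _ y(3)] th_le Sl Y by auto
   have w'y: "w' ~= y" using lw z yl by auto
   have "ang y x0 w' = ang y x0 l"
   proof (cases "w' = l")
    case False
    hence "th < ang l x0 w'" using lw by simp
    hence "th < ang l y w'" using ang_zero_cong[of l x0 y w'] z Sy Sl Y yl w False by auto
    hence "ang y w' l = 0" using ang_strong'[of y l w'] Sy Sl yl w False w'y ang_sym by metis
    thus ?thesis using ang_zero_cong' Sy Sl yl w w'y Y by blast
   qed simp
   hence "kap < ang y x0 w'" using y(3) by (auto simp: sep_def)
   hence big: "K < ang y w w'" using ang_tri[of y x0 w w'] w Sy w'y Y csts by auto
   have ww: "w ~= w'" using big ang_self[of y w] w Sy by auto
   have "\<not> sep K w w' = {}" using big Sy w w'y by (auto simp: sep_def)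
   then obtain G' where G': "G' : FF" "G' ~= F" "p (t - 1) = Inr G'" "w : G'" "w' : G'" using w by blast
   hence "y : G'" using F1[of G' w w' y] big th_le Sy w w'y by auto
   thus ?thesis using G' by (simp add: G_def)
  qed
  have tot: "y : sep kap x0 l \<or> l : sep kap x0 y" if "y : X" "l : X" "y ~= l" for y l
   using sep_total[OF th_le(2) Y, of y l] that S by (auto simp: X_def)
  have fin: "finite X" using finite_sep[OF th_le(3) Y] by (auto simp: X_def S_def)
  have "card (X - G) <= 1" by (rule card_le_1) (use tot inG in blast)
  moreover have "card (X \<inter> G) <= 2"
  proof (rule card_le_2)
   fix a b c assume abc: "a : X \<inter> G" "b : X \<inter> G" "c : X \<inter> G" "a ~= b" "b ~= c" "a ~= c"
   hence "G : FF" "G ~= F" using inG tot by blast+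
   moreover have "a : F \<inter> G" "b : F \<inter> G" "c : F \<inter> G" using abc S by (auto simp: X_def)
   moreover have "b : sep kap a c \<or> a : sep kap b c \<or> c : sep kap a b"
    using sep_mid th_le Y abc S by (simp add: X_def)
   ultimately show False using F2[OF F] by blast
  qed (use fin in auto)
  moreover have "card X <= card (X - G) + card (X \<inter> G)"
   by (metis card_Un_le Un_Diff_Int)
  ultimately show ?thesis by (simp add: X_def)
 qed
 show ?thesis
 proof (cases "S = {}")
  case False
  have "finite (tau ` S)" using finite_sep[OF th_le(3) Y] by (auto simp: S_def)
  hence "Min (tau ` S) : tau ` S" using False by (intro Min_in) auto
  then obtain y0 where y0S: "y0 : S" "Min (tau ` S) = tau y0" by blast
  have y0: "tau y0 <= tau y" if "y : S" for y
   using Min_le[OF \<open>finite (tau ` S)\<close>, of "tau y"] that y0S by simp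
  have "S = (\<Union>t\<in>{tau y0..tau y0 + 8}. {y \<in> S. tau y = t})"
   using y0 close y0S by auto
  hence "card S <= (\<Sum>t\<in>{tau y0..tau y0 + 8}. card {y \<in> S. tau y = t})"
   using card_UN_le[of "{tau y0..tau y0 + 8}" "\<lambda>t. {y : S. tau y = t}"] by simp
  also have "... <= (\<Sum>t\<in>{tau y0..tau y0 + 8}. 3)" using fibre by (intro sum_mono) auto
  finally show ?thesis by (simp add: S_def)
 qed (simp add: S_def)
qed

end

text \<open>Graphs with apices, distances only being a pseudometric: the same axioms describe a coned-off
 graph and its quotient by a group generated by rotations.\<close>

locale apexg =
 fixes V :: "'v set" and D :: "'v => 'v => nat" and Ap :: "'v set" and nb :: "'v => 'v set"
  and nu :: "'v => 'v => 'v => nat" and Th :: nat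
 assumes D_self: "x : V ==> D x x = 0"
  and D_sym: "[|x : V; y : V|] ==> D x y = D y x"
  and D_tri: "[|x : V; y : V; z : V|] ==> D x z <= D x y + D y z"
  and ApV: "Ap <= V"
  and nbV: "F : Ap ==> nb F <= V"
  and nbD: "[|F : Ap; e : nb F|] ==> D F e = 1"
  and nbA: "[|F : Ap; G : Ap; e : nb F|] ==> 0 < D G e"
  and nbex: "[|F : Ap; x : V; 0 < D F x|] ==> EX e:nb F. D e x + 1 = D F x"
  and nu_sym: "[|F : Ap; e : nb F; e' : nb F|] ==> nu F e e' = nu F e' e"
  and nu_tri: "[|F : Ap; e : nb F; e' : nb F; e'' : nb F|] ==> nu F e e'' <= nu F e e' + nu F e' e''"
  and A1e: "[|F : Ap; x : V; z : V; e : nb F; e' : nb F; D e x + 1 = D F x; D e' z + 1 = D F z;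
   Th < nu F e e'|] ==> D x z = D x F + D F z"
begin

definition ES :: "'v => 'v => 'v set" where
 "ES F x = {e : nb F. D e x + 1 = D F x}"

text \<open>The angle at \<open>F\<close>, made exactly zero when the same first steps lead to both
  points, because the strong axiom asks for vanishing and not for a bound. Taking both arguments
  from the union makes it symmetric.\<close>

definition Phi :: "'v => 'v => 'v => nat" where
 "Phi F x z = (if ES F x = ES F z then 0
   else Sup {nu F e e' |e e'. e : ES F x \<union> ES F z & e' : ES F x \<union> ES F z})"

lemma ES_ne: "[|F : Ap; x : V; 0 < D F x|] ==> ES F x ~= {}"
 using nbex by (auto simp: ES_def)

lemma FV: "F : Ap ==> F : V" using ApV by auto

lemma ES_nb: "e : ES F x ==> e : nb F" by (simp add: ES_def)

lemma ES_V: "F : Ap ==> e : ES F x ==> e : V" using nbV by (auto simp: ES_def)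

lemma D0_cong: assumes "x : V" "y : V" "z : V" "D x y = 0" shows "D x z = D y z" "D z x = D z y"
 using D_tri[of x y z] D_tri[of y x z] D_sym assms by auto

lemma ES_cong: assumes "F : Ap" "x : V" "y : V" "D x y = 0" shows "ES F x = ES F y"
 unfolding ES_def using D0_cong[of x y] assms nbV FV by fastforce

lemma Phi_cong: assumes "F : Ap" "x : V" "y : V" "D x y = 0" shows "Phi F x z = Phi F y z" "Phi F z x = Phi F z y"
 using ES_cong[OF assms] by (auto simp: Phi_def)

text \<open>By \<open>A1e\<close> a larger angle would make \<open>D x x\<close> twice the distance
  from \<open>x\<close> to \<open>F\<close>.\<close>

lemma same_bd:
 assumes F: "F : Ap" "x : V" "0 < D F x" and e: "e : ES F x" "e' : ES F x"
 shows "nu F e e' <= Th"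
using A1e F e D_self by (fastforce simp: ES_def)

lemma cross_bd:
 assumes F: "F : Ap" "x : V" "0 < D F x" "z : V" "0 < D F z" and e0: "e0 : ES F x" "e0' : ES F z"
  and e: "e : ES F x \<union> ES F z" "e' : ES F x \<union> ES F z"
 shows "nu F e e' <= nu F e0 e0' + 2 * Th"
proof -
 have *: "nu F e e' <= nu F e0 e0' + 2 * Th" if "e : ES F x" "e' : ES F z" for e e'
  using nu_tri[of F e e0 e'] nu_tri[of F e0 e0' e'] same_bd[OF F(1-3) that(1) e0(1)]
   same_bd[OF F(1,4,5) e0(2) that(2)] that e0 ES_nb F(1) by fastforce
 show ?thesis
  using e *[of e e'] *[of e' e] nu_sym[of F e e'] same_bd[OF F(1-3), of e e'] same_bd[OF F(1,4,5), of e e'] ES_nb F(1)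
  by fastforce
qed

lemma Phi_bdd:
 assumes F: "F : Ap" "x : V" "0 < D F x" "z : V" "0 < D F z"
 shows "finite {nu F e e' |e e'. e : ES F x \<union> ES F z & e' : ES F x \<union> ES F z}"
  and "{nu F e e' |e e'. e : ES F x \<union> ES F z & e' : ES F x \<union> ES F z} ~= {}"
proof -
 obtain e0 e0' where e0: "e0 : ES F x" "e0' : ES F z" using ES_ne F by blast
 show "finite {nu F e e' |e e'. e : ES F x \<union> ES F z & e' : ES F x \<union> ES F z}"
  by (rule finite_subset[of _ "{..nu F e0 e0' + 2 * Th}"]) (use cross_bd[OF F e0] in auto)
 show "{nu F e e' |e e'. e : ES F x \<union> ES F z & e' : ES F x \<union> ES F z} ~= {}"
  using e0 by blast
qed

lemma Phi_upper:
 assumes F: "F : Ap" "x : V" "0 < D F x" "z : V" "0 < D F z" and e0: "e0 : ES F x" "e0' : ES F z"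
 shows "Phi F x z <= nu F e0 e0' + 2 * Th"
proof (cases "ES F x = ES F z")
 case False
 have "Sup {nu F e e' |e e'. e : ES F x \<union> ES F z & e' : ES F x \<union> ES F z} <= nu F e0 e0' + 2 * Th"
  by (rule cSup_least[OF Phi_bdd(2)[OF F]]) (use cross_bd[OF F e0] in auto)
 thus ?thesis by (simp add: Phi_def)
qed (simp add: Phi_def)

lemma Phi_lower:
 assumes F: "F : Ap" "x : V" "0 < D F x" "z : V" "0 < D F z" and ne: "ES F x ~= ES F z"
  and e: "e : ES F x \<union> ES F z" "e' : ES F x \<union> ES F z"
 shows "nu F e e' <= Phi F x z"
proof -
 have "nu F e e' : {nu F e e' |e e'. e : ES F x \<union> ES F z & e' : ES F x \<union> ES F z}" using e by blast
 thus ?thesis using cSup_upper[OF _ bdd_above_finite[OF Phi_bdd(1)[OF F]]] ne by (simp add: Phi_def)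
qed

lemma Phi_lower':
 assumes F: "F : Ap" "x : V" "0 < D F x" "z : V" "0 < D F z"
  and e: "e : ES F x" "e' : ES F z" "Th < nu F e e'"
 shows "nu F e e' <= Phi F x z"
 using Phi_lower F same_bd e by fastforce

text \<open>The supremum is a maximum over finitely many values; above \<open>Th\<close> it cannot
  come from two first steps to the same point, by \<open>same_bd\<close>.\<close>

lemma Phi_attain:
 assumes F: "F : Ap" "x : V" "0 < D F x" "z : V" "0 < D F z" and big: "Th < Phi F x z"
 obtains e e' where "e : ES F x" "e' : ES F z" "nu F e e' = Phi F x z"
proof -
 let ?S = "{nu F e e' |e e'. e : ES F x \<union> ES F z & e' : ES F x \<union> ES F z}"
 have "Phi F x z = Sup ?S" using big by (auto simp: Phi_def)
 also have "... = Max ?S" using cSup_eq_Max[OF Phi_bdd[OF F]] .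
 also have "... : ?S" using Max_in[OF Phi_bdd[OF F]] .
 finally have "\<exists>e e'. Phi F x z = nu F e e' & e : ES F x \<union> ES F z & e' : ES F x \<union> ES F z" by blast
 then obtain e e' where e: "e : ES F x \<union> ES F z" "e' : ES F x \<union> ES F z" "nu F e e' = Phi F x z" by metis
 hence "\<not> (e : ES F x & e' : ES F x)" "\<not> (e : ES F z & e' : ES F z)"
  using same_bd[OF F(1-3), of e e'] same_bd[OF F(1,4,5), of e e'] big by auto
 then consider "e : ES F x" "e' : ES F z" | "e' : ES F x" "e : ES F z" using e by blast
 thus ?thesis
  using that e(3) nu_sym[of F e e'] ES_nb F(1) by cases metis+
qed

lemma Phi_self [simp]: "Phi F x x = 0" by (simp add: Phi_def)

lemma Phi_sym: "Phi F x z = Phi F z x"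
by (simp add: Un_commute Phi_def)

lemma Phi_tri:
 assumes F: "F : Ap" and x: "x : V" "0 < D F x" and w: "w : V" "0 < D F w" and z: "z : V" "0 < D F z"
 shows "Phi F x z <= Phi F x w + Phi F w z"
proof -
 consider "ES F x = ES F z" | "ES F x = ES F w" | "ES F w = ES F z"
  | "ES F x ~= ES F z" "ES F x ~= ES F w" "ES F w ~= ES F z" by blast
 thus ?thesis
 proof cases
  case 2 thus ?thesis by (simp add: Phi_def)
 next
  case 3 thus ?thesis by (simp add: Phi_def)
 next
  case 4
  obtain u where u: "u : ES F w" using ES_ne F w by blast
  note xw = Phi_lower[OF F x w 4(2)] and wz = Phi_lower[OF F w z 4(3)]
  have *: "nu F e e' <= Phi F x w + Phi F w z" if "e : ES F x" "e' : ES F z" for e e'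
   using nu_tri[of F e u e'] xw[of e u] wz[of u e'] that u F ES_nb by fastforce
  have "nu F e e' <= Phi F x w + Phi F w z" if "e : ES F x \<union> ES F z" "e' : ES F x \<union> ES F z" for e e'
   using that *[of e e'] *[of e' e] nu_sym[of F e e'] xw[of e e'] wz[of e e'] ES_nb F by fastforce
  hence "Sup {nu F e e' |e e'. e : ES F x \<union> ES F z & e' : ES F x \<union> ES F z} <= Phi F x w + Phi F w z"
   by (intro cSup_least Phi_bdd(2)[OF F x z]) auto
  thus ?thesis using 4 by (simp add: Phi_def)
 qed (simp add: Phi_def)
qed

lemma Phi_A1:
 assumes F: "F : Ap" "x : V" "0 < D F x" "z : V" "0 < D F z" and big: "Th < Phi F x z"
 shows "D x z = D x F + D F z"
proof -
 obtain e e' where "e : ES F x" "e' : ES F z" "nu F e e' = Phi F x z" using Phi_attain[OF F big] .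
 thus ?thesis using A1e F big by (auto simp: ES_def)
qed

lemma Phi_adj:
 assumes F: "F : Ap" "x : V" "0 < D F x" "z : V" "0 < D F z" and "D x z <= 1"
 shows "Phi F x z <= Th"
proof (rule ccontr)
 assume "\<not> ?thesis"
 hence "D x z = D x F + D F z" using Phi_A1[OF F] by simp
 thus False using assms D_sym[of x F] FV by auto
qed

lemma ES_subset:
 assumes F: "F : Ap" "G : V" and x: "x : V" and add: "D F x = D F G + D G x" and e: "e : ES F G"
 shows "e : ES F x"
proof -
 have eV: "e : V" "e : nb F" "D F e = 1" using e F ES_V ES_nb nbD by auto
 have "D e x <= D e G + D G x" using D_tri eV F x by blast
 moreover have "D F x <= D F e + D e x" using D_tri[of F e x] eV F x FV by blast
 ultimately show ?thesis using e add eV by (auto simp: ES_def)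
qed

text \<open>Every geodesic from \<open>G\<close> to \<open>x\<close> passes through \<open>F\<close>, so it starts like a geodesic from \<open>G\<close> to \<open>F\<close>.\<close>

lemma Phi_strong:
 assumes F: "F : Ap" and G: "G : Ap" and x: "x : V" "0 < D F x" "0 < D G x" and FG: "0 < D F G"
  and big: "2 * Th < Phi F x G"
 shows "ES G x = ES G F" "Phi G x F = 0" "Phi G F x = 0" "\<And>z. Phi G x z = Phi G F z" "\<And>z. Phi G z x = Phi G z F"
proof -
 note V = FV[OF F] FV[OF G]
 have add: "D G x = D G F + D F x"
  using Phi_A1[OF F x(1,2) V(2) FG] big D_sym x V by auto
 show *: "ES G x = ES G F"
 proof
  show "ES G F <= ES G x" using ES_subset[OF G V(1) x(1) add] by blast
  show "ES G x <= ES G F"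
  proof
   fix e assume e: "e : ES G x"
   have eV: "e : V" "e : nb G" "D G e = 1" "0 < D F e" using e G F ES_V ES_nb nbD nbA by auto
   have "Phi F e G <= Th" using Phi_adj F eV V FG D_sym by simp
   moreover have "Phi F x G <= Phi F x e + Phi F e G" using Phi_tri[OF F x(1,2) eV(1,4) V(2) FG] .
   ultimately have "Th < Phi F x e" using big by simp
   hence "D x e = D x F + D F e" using Phi_A1[OF F x(1,2) eV(1,4)] by simp
   hence "D e x = D e F + D F x" using D_sym eV x V by auto
   thus "e : ES G F" using e add by (auto simp: ES_def)
  qed
 qed
 show "Phi G x F = 0" "Phi G F x = 0" "\<And>z. Phi G x z = Phi G F z" "\<And>z. Phi G z x = Phi G z F" using * by (auto simp: Phi_def)
qed

end

section \<open>The coned-off graph as a graph with apices\<close>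

context fam
begin

fun pts :: "'y + 'y set => 'y set" where
 "pts (Inl y) = {y}" | "pts (Inr G) = G"

lemma ptsY: "u : V ==> pts u <= Y & pts u ~= {}"
 using FFY by (cases u) (auto simp: V_def)

text \<open>By \<open>F1\<close> the separators of two points of \<open>G\<close> lie in
  \<open>G\<close> themselves, and three of them in \<open>F\<close> would contradict
  \<open>F2\<close>.\<close>

lemma card_pts:
 assumes F: "F : FF" and u: "u : V" "u ~= Inr F" and x: "x : pts u" "x' : pts u"
 shows "card (sep kap x x' \<inter> F) <= 2"
proof (cases u)
 case (Inl y)
 thus ?thesis using x u sep_refl by (auto simp: V_def)
next
 case (Inr G)
 hence G: "G : FF" "G ~= F" "x : G" "x' : G" using u x by (auto simp: V_def)
 hence Y: "x : Y" "x' : Y" using FFY by auto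
 have inG: "y : G" if "y : sep kap x x'" for y
  using F1[OF G(1,3,4), of y] sepD[OF that] th_le by auto
 show ?thesis
 proof (rule card_le_2)
  fix a b c assume abc: "a : sep kap x x' \<inter> F" "b : sep kap x x' \<inter> F" "c : sep kap x x' \<inter> F" "a ~= b" "b ~= c" "a ~= c"
  hence "b : sep kap a c \<or> a : sep kap b c \<or> c : sep kap a b"
   using sep_mid th_le Y by simp
  moreover have "a : F \<inter> G" "b : F \<inter> G" "c : F \<inter> G" using abc inG by auto
  ultimately show False using F2 F G by blast
 qed (use finite_sep[OF th_le(3) Y] in simp)
qed

text \<open>\<open>crossing\<close> starts and ends at points; an end that is an apex is replaced by
  the next vertex of the geodesic, a point of its set.\<close>

lemma avoid:
 assumes F: "F : FF" and u: "u : V" "u ~= Inr F" and v: "v : V" "v ~= Inr F"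
  and lt: "gd u v < gd u (Inr F) + gd (Inr F) v"
 shows "EX x:pts u. EX z:pts v. card (sep kap x z \<inter> F) <= 27"
proof -
 obtain p where p: "p 0 = u" "p (gd u v) = v" "\<And>i. i < gd u v ==> adj (p i) (p (Suc i))"
  "\<And>i. i <= gd u v ==> p i : V" "\<And>i j. [|i <= j; j <= gd u v|] ==> gd (p i) (p j) = j - i"
  using geodesic u v by blast
 define L where "L = gd u v"
 have av: "p i ~= Inr F" if "i <= L" for i
 proof
  assume "p i = Inr F"
  hence "gd u (Inr F) = i" "gd (Inr F) v = L - i"
   using p(5)[of 0 i] p(5)[of i L] p(1,2) that by (auto simp: L_def)
  thus False using lt that by (auto simp: L_def)
 qed
 have cr: "card (sep kap x z \<inter> F) <= 27" if "a <= b" "b <= L" "p a = Inl x" "p b = Inl z" for a b x z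
  by (rule crossing[OF F, of "\<lambda>i. p (a + i)" x "b - a" z]) (use that p av in \<open>auto simp: L_def\<close>)
 show ?thesis
 proof (cases "L = 0")
  case True
  hence "u = v" using p by (simp add: L_def)
  obtain x where "x : pts u" "x : Y" using ptsY[OF u(1)] by blast
  thus ?thesis using \<open>u = v\<close> sep_refl[of x] by (intro bexI[of _ x]) auto
 next
  case False
  have "\<exists>a x. a <= 1 & p a = Inl x & x : pts u & (a = 0 \<or> (\<exists>G. u = Inr G))"
  proof (cases u)
   case (Inl x) thus ?thesis using p by simp
  next
   case (Inr G)
   hence "adj (Inr G) (p 1)" using p(1) p(3)[of 0] False by (simp add: L_def)
   thus ?thesis using Inr by (cases "p 1") (auto intro!: exI[of _ 1])
  qed
  then obtain a x where a: "a <= 1" "p a = Inl x" "x : pts u" "a = 0 \<or> (\<exists>G. u = Inr G)" by blast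
  have "\<exists>b z. L - 1 <= b & b <= L & p b = Inl z & z : pts v & (b = L \<or> (\<exists>G. v = Inr G))"
  proof (cases v)
   case (Inl x) thus ?thesis using p by (simp add: L_def)
  next
   case (Inr G)
   hence "adj (p (L - 1)) (Inr G)" using p(2) p(3)[of "L - 1"] False by (simp add: L_def)
   thus ?thesis using Inr by (cases "p (L - 1)") (auto intro!: exI[of _ "L - 1"])
  qed
  then obtain b z where b: "L - 1 <= b" "b <= L" "p b = Inl z" "z : pts v" "b = L \<or> (\<exists>G. v = Inr G)" by blast
  have "a <= b"
  proof (rule ccontr)
   assume "\<not> a <= b"
   hence "a = 1" "b = 0" "L = 1" using a b False by auto
   then obtain G G' where "u = Inr G" "v = Inr G'" using a b by auto
   thus False using p(1) p(2) p(3)[of 0] \<open>L = 1\<close> by (auto simp: L_def)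
  qed
  thus ?thesis using cr a b by blast
 qed
qed

text \<open>27 from \<open>crossing\<close>, 2 for each change of a representing point, and 3 for
  each of the two uses of \<open>sep_quasi\<close>.\<close>

lemma avoid_all:
 assumes F: "F : FF" and u: "u : V" "u ~= Inr F" and v: "v : V" "v ~= Inr F"
  and lt: "gd u v < gd u (Inr F) + gd (Inr F) v" and xz: "x : pts u" "z : pts v"
 shows "card (sep kap x z \<inter> F) <= 37"
proof -
 obtain x' z' where x': "x' : pts u" "z' : pts v" "card (sep kap x' z' \<inter> F) <= 27"
  using avoid[OF F u v lt] by blast
 have Y: "x : Y" "z : Y" "x' : Y" "z' : Y" using ptsY[OF u(1)] ptsY[OF v(1)] xz x' by auto
 show ?thesis
  using sep_quasi[OF th_le(2) Y(1,3,2), of F] sep_quasi[OF th_le(2) Y(3,4,2), of F] x'(3)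
   card_pts[OF F u xz(1) x'(1)] card_pts[OF F v x'(2) xz(2)] by linarith
qed

lemma dirF:
 assumes F: "F : FF" and u: "u : V" "u ~= Inr F" and x: "x : pts u" and e: "e : F" "gd (Inl e) u + 1 = gd (Inr F) u"
 shows "card (sep kap x e \<inter> F) <= 37" "card (sep kap e x \<inter> F) <= 37"
proof -
 have eV: "Inl e : V" "e : Y" using e F FFY VI by auto
 have "x : Y" using ptsY[OF u(1)] x by auto
 have "gd (Inl e) u < gd (Inl e) (Inr F) + gd (Inr F) u" using e by simp
 thus "card (sep kap e x \<inter> F) <= 37" using avoid_all[OF F eV(1) _ u, of e x] x by simp
 thus "card (sep kap x e \<inter> F) <= 37" using sep_sym \<open>x : Y\<close> eV by simp
qed

text \<open>\<open>F1\<close> leaves a gap: two points of \<open>F\<close> are seen under an angle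
  of at most \<open>B\<close> or of more than \<open>kap\<close>, the latter only from points of
  \<open>F\<close>.\<close>

lemma sepF: "[|F : FF; e : F; e' : F|] ==> sep K e e' = sep kap e e' \<inter> F"
 using F1[of F e e'] th_le by (force simp: sep_def)

text \<open>The successor pays for the middle point that may itself be a separator, so that the
  triangle inequality \<open>nuf_tri\<close> holds exactly.\<close>

definition nuf :: "'y + 'y set => 'y + 'y set => 'y + 'y set => nat" where
 "nuf F u v = Suc (card (sep K (projl u) (projl v)))"

definition nbf :: "'y + 'y set => ('y + 'y set) set" where
 "nbf u = (case u of Inl y => {} | Inr F => Inl ` F)"

lemma nuf_tri:
 assumes F: "F : FF" "e : F" "e' : F" "e'' : F"
 shows "Suc (card (sep K e e'')) <= Suc (card (sep K e e')) + Suc (card (sep K e' e''))"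
proof -
 have Y: "e : Y" "e' : Y" "e'' : Y" using F FFY by auto
 have "sep K e e'' <= sep K e e' \<union> sep K e' e'' \<union> {e'}"
 proof
  fix u assume u: "u : sep K e e''"
  have "u : sep kap e e''" using u sepF F by simp
  hence uk: "u : Y" "u ~= e" "u ~= e''" "kap < ang u e e''" by (auto simp: sep_def)
  show "u : sep K e e' \<union> sep K e' e'' \<union> {e'}"
  proof (cases "u = e'")
   case False
   hence "B < ang u e e' \<or> B < ang u e' e''" using ang_tri uk Y csts by fastforce
   hence "kap < ang u e e' \<or> kap < ang u e' e''"
    using F1[OF F(1,2,3) uk(1,2) False] F1[OF F(1,3,4) uk(1) False uk(3)] by blast
   hence "K < ang u e e' \<or> K < ang u e' e''" using th_le by linarith
   thus ?thesis using uk False by (auto simp: sep_def)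
  qed simp
 qed
 hence "card (sep K e e'') <= card (sep K e e' \<union> sep K e' e'' \<union> {e'})"
  by (simp add: finite_sep th_le Y card_mono)
 also have "... <= card (sep K e e') + card (sep K e' e'') + 1"
  using card_Un_le[of "sep K e e' \<union> sep K e' e''" "{e'}"] card_Un_le[of "sep K e e'" "sep K e' e''"] by simp
 finally show ?thesis by simp
qed

text \<open>If the apex is missed, the way from \<open>e\<close> over points of \<open>u\<close> and
  \<open>v\<close> to \<open>e'\<close> consists of three stretches with at most 37 separators in
  \<open>F\<close> each. Two uses of \<open>sep_quasi\<close> give
  \<open>3 * 37 + 2 * 3 = 117\<close>, the origin of the threshold 120.\<close>

lemma A1f:
 assumes F: "F : FF" and u: "u : V" and v: "v : V"
  and e: "e : F" "gd (Inl e) u + 1 = gd (Inr F) u" "e' : F" "gd (Inl e') v + 1 = gd (Inr F) v"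
  and big: "120 < Suc (card (sep K e e'))"
 shows "gd u v = gd u (Inr F) + gd (Inr F) v"
proof (rule ccontr)
 assume ne: "\<not> ?thesis"
 have FV: "Inr F : V" using F VI by simp
 have uF: "u ~= Inr F" "v ~= Inr F" using e by auto
 have lt: "gd u v < gd u (Inr F) + gd (Inr F) v" using ne gd_tri[OF u FV v] by simp
 obtain x z where x: "x : pts u" "x : Y" and z: "z : pts v" "z : Y" using ptsY u v by blast
 have Y: "e : Y" "e' : Y" using e F FFY by auto
 have "card (sep kap e e' \<inter> F) <= 37 + (37 + 37 + 3) + 3"
  using sep_quasi[OF th_le(2) Y(1) x(2) Y(2), of F] sep_quasi[OF th_le(2) x(2) z(2) Y(2), of F]
   dirF(2)[OF F u uF(1) x(1) e(1,2)] dirF(1)[OF F v uF(2) z(1) e(3,4)]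
   avoid_all[OF F u uF(1) v uF(2) lt x(1) z(1)] by linarith
 thus False using big sepF F e by simp
qed

end

context fam begin

lemma nbfE: assumes "u : Inr ` FF" "e : nbf u" obtains F x where "u = Inr F" "F : FF" "e = Inl x" "x : F" "x : Y"
using assms FFY by (fastforce simp: nbf_def)

sublocale ag: apexg V gd "Inr ` FF" nbf nuf 120
proof (unfold_locales, goal_cases)
 case (1 x) show ?case by simp
next
 case (2 x y) thus ?case by (rule gd_sym)
next
 case (3 x y z) thus ?case by (rule gd_tri)
next
 case 4 thus ?case using VI by blast
next
 case (5 F) thus ?case by (metis VI nbfE subsetI)
next
 case (6 F e)
 then obtain H x where H: "F = Inr H" "H : FF" "e = Inl x" "x : H" using nbfE by metis
 thus ?case using gd_adj'[of F e] by simp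
next
 case (7 F G e)
 then obtain H x where H: "e = Inl x" "x : Y" using nbfE by metis
 moreover obtain K where "G = Inr K" "K : FF" using 7 by blast
 ultimately show ?case using gd_eq_0 VI by blast
next
 case (8 F x)
 then obtain H where H: "F = Inr H" "H : FF" by blast
 then obtain z where z: "adj F z" "gd z x + 1 = gd F x" using gd_next[of F x] 8 VI by metis
 then obtain y where "z = Inl y" "y : H" using H by (cases z) auto
 thus ?case using z H by (intro bexI[of _ z]) (auto simp: nbf_def)
next
 case (9 F e e')
 then obtain H x where "F = Inr H" "e = Inl x" "x : Y" using nbfE by metis
 moreover obtain x' where "e' = Inl x'" "x' : Y" using nbfE 9 by metis
 ultimately show ?case by (simp add: nuf_def sep_sym)
next
 case (10 F e e' e'')
 then obtain H x where H: "F = Inr H" "H : FF" "e = Inl x" "x : H" using nbfE by metis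
 moreover obtain x' where "e' = Inl x'" "x' : H" using nbfE 10 H by blast
 moreover obtain x'' where "e'' = Inl x''" "x'' : H" using nbfE 10 H by blast
 ultimately show ?case using nuf_tri by (simp add: nuf_def)
next
 case (11 F u v e e')
 then obtain H x where H: "F = Inr H" "H : FF" "e = Inl x" "x : H" using nbfE by metis
 moreover obtain x' where "e' = Inl x'" "x' : H" using nbfE 11 H by blast
 ultimately show ?case using A1f[of H u v x x'] 11 by (simp add: nuf_def)
qed

text \<open>Cut at the first and the last separator in \<open>F\<close>. The stretch before the
  first is kept, the one after the last is transported by \<open>phi\<close>, and the stretch
  between consists of separators in \<open>F\<close> only; so a drop of more than 20 in
  \<open>F\<close> outweighs the errors of \<open>sep_quasi\<close> in the total count.\<close>

lemma shrink:
 assumes F: "F : FF" and Y: "x : Y" "z : Y"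
  and phi: "\<And>a. a : Y ==> phi a : Y" "\<And>a. a : F ==> phi a : F"
   "\<And>a b. a : Y ==> b : Y ==> card (sep K (phi a) (phi b)) = card (sep K a b)"
   "\<And>a b. a : Y ==> b : Y ==> card (sep kap (phi a) (phi b) \<inter> F) = card (sep kap a b \<inter> F)"
  and lt: "card (sep kap x (phi z) \<inter> F) + 20 < card (sep kap x z \<inter> F)"
 shows "card (sep K x (phi z)) < card (sep K x z)"
proof -
 let ?n = "\<lambda>a b. card (sep kap a b \<inter> F)" and ?c = "\<lambda>a b. card (sep K a b)"
 have q: "?n a b <= ?n a w + ?n w b + 3" if "a : Y" "w : Y" "b : Y" for a w b
  using sep_quasi[OF th_le(2) that] .
 have qc: "?c a b <= ?c a w + ?c w b + 3" if "a : Y" "w : Y" "b : Y" for a w b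
  using sep_quasi[OF csts(2) that, of UNIV] by simp
 have first: "EX y:sep kap a b \<inter> F. sep kap a y \<inter> F = {}" if ab: "a : Y" "b : Y" and ne: "sep kap a b \<inter> F ~= {}" for a b
 proof -
  define m where "m = (LEAST m. EX y:sep kap a b \<inter> F. card (sep kap a y) = m)"
  obtain y where y: "y : sep kap a b \<inter> F" "card (sep kap a y) = m"
   unfolding m_def using ne by (smt (verit, best) LeastI equals0I)
  have "sep kap a y \<inter> F = {}"
  proof (rule ccontr)
   assume "sep kap a y \<inter> F ~= {}"
   then obtain w where w: "w : sep kap a y" "w : F" by blast
   have "w : sep kap a b" using sep_inner[OF th_le(3) ab, of y w] y w by blast
   hence "m <= card (sep kap a w)" unfolding m_def using w by (intro Least_le) blast
   moreover have "card (sep kap a w) < card (sep kap a y)"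
    using sep_add[OF th_le(2) ab(1) _ w(1)] y by (auto simp: sep_def)
   ultimately show False using y by simp
  qed
  thus ?thesis using y by blast
 qed
 have "sep kap x z \<inter> F ~= {}" using lt by (metis card.empty not_less_zero)
 then obtain y1 where y1: "y1 : sep kap x z" "y1 : F" "sep kap x y1 \<inter> F = {}" using first[OF Y] by blast
 have y1Y: "y1 : Y" using y1 by (simp add: sep_def)
 have n1: "?n x z <= ?n y1 z + 3" using q Y y1Y y1 by fastforce
 hence "?n y1 z ~= 0" using lt by linarith
 hence "sep kap z y1 \<inter> F ~= {}" by (metis sep_sym y1Y Y card.empty)
 then obtain yM where yM: "yM : sep kap z y1" "yM : F" "sep kap z yM \<inter> F = {}" using first[OF Y(2) y1Y] by blast
 have yMY: "yM : Y" using yM by (simp add: sep_def)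
 have sM: "sep kap yM z \<inter> F = {}" "yM : sep kap y1 z" using yM sep_sym Y yMY y1Y by blast+
 have n2: "?n y1 z <= ?n y1 yM + 3" using q[OF y1Y yMY Y(2)] sM by simp
 have "y1 : sep K x z" "yM : sep K y1 z" using y1(1) sM(2) th_le by (auto simp: sep_def)
 hence "?c x z = ?c x y1 + ?c y1 yM + ?c yM z + 2"
  using sep_add csts Y y1Y by simp
 moreover have "?c y1 yM = ?n y1 yM" using sepF F y1 yM by simp
 moreover have "?c y1 (phi yM) = ?n y1 (phi yM)" using sepF F y1 phi yM by simp
 moreover have "?n y1 (phi yM) <= ?n y1 x + (?n x (phi z) + ?n (phi z) (phi yM) + 3) + 3"
  using q[OF y1Y Y(1) phi(1)[OF yMY]] q[OF Y(1) phi(1)[OF Y(2)] phi(1)[OF yMY]] by linarith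
 moreover have "?n y1 x = 0" using y1 sep_sym Y y1Y by simp
 moreover have "?n (phi z) (phi yM) = 0" using phi Y yMY yM by simp
 moreover have "?c x (phi z) <= ?c x y1 + (?c y1 (phi yM) + ?c yM z + 3) + 3"
  using qc[OF Y(1) y1Y phi(1)[OF Y(2)]] qc[OF y1Y phi(1)[OF yMY] phi(1)[OF Y(2)]] phi(3)[OF yMY Y(2)] by linarith
 ultimately show ?thesis using lt n1 n2 by linarith
qed

text \<open>Both quantities are compared with the separators of two entry points, at a cost of
  \<open>2 * 37 + 2 * 3 = 80\<close>; the rest of 330 and 200 covers the slack of
  \<open>Phi_upper\<close>, which is \<open>2 * 120\<close>, and of \<open>Phi_lower'\<close>, which
  is 120.\<close>

lemma Phi_count:
 assumes F: "F : FF" and u: "u : V" "u ~= Inr F" and v: "v : V" "v ~= Inr F" and xz: "x : pts u" "z : pts v"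
 shows "ag.Phi (Inr F) u v <= card (sep kap x z \<inter> F) + 330" "card (sep kap x z \<inter> F) <= ag.Phi (Inr F) u v + 200"
proof -
 have FV: "Inr F : V" "Inr F : Inr ` FF" using F VI by auto
 have pos: "0 < gd (Inr F) u" "0 < gd (Inr F) v" using gd_eq_0[OF FV(1)] u v by auto
 obtain e0 e0' where e0: "e0 : ag.ES (Inr F) u" "e0' : ag.ES (Inr F) v"
  by (metis ag.ES_ne FV u v pos ex_in_conv)
 then obtain e e' where e: "e0 = Inl e" "e : F" "e0' = Inl e'" "e' : F"
   "gd (Inl e) u + 1 = gd (Inr F) u" "gd (Inl e') v + 1 = gd (Inr F) v"
  by (auto simp: ag.ES_def nbf_def)
 have Y: "x : Y" "z : Y" "e : Y" "e' : Y" using ptsY[OF u(1)] ptsY[OF v(1)] xz e F FFY by auto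
 note d = dirF[OF F u xz(1) e(2,5)] dirF[OF F v xz(2) e(4,6)]
 have nu: "nuf (Inr F) e0 e0' = Suc (card (sep kap e e' \<inter> F))" using sepF F e by (simp add: nuf_def)
 have "card (sep kap e e' \<inter> F) <= 37 + (card (sep kap x z \<inter> F) + 37 + 3) + 3"
  using sep_quasi[OF th_le(2) Y(3,1,4), of F] sep_quasi[OF th_le(2) Y(1,2,4), of F] d by linarith
 thus "ag.Phi (Inr F) u v <= card (sep kap x z \<inter> F) + 330"
  using ag.Phi_upper[OF FV(2) u(1) pos(1) v(1) pos(2) e0] nu by linarith
 have "card (sep kap x z \<inter> F) <= 37 + (card (sep kap e e' \<inter> F) + 37 + 3) + 3"
  using sep_quasi[OF th_le(2) Y(1,3,2), of F] sep_quasi[OF th_le(2) Y(3,4,2), of F] d by linarith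
 thus "card (sep kap x z \<inter> F) <= ag.Phi (Inr F) u v + 200"
  using ag.Phi_lower'[OF FV(2) u(1) pos(1) v(1) pos(2) e0] nu by linarith
qed

end

section \<open>Rotating families and windmills\<close>

text \<open>Large rotations about a family of apices; the subgroup they generate is controlled by growing
 windmills, i.e. invariant sets \<open>W\<close> that are small seen from every apex outside \<open>W\<close>.\<close>

locale rot = apexg V D Ap nb nu Th for V :: "'v set" and D Ap nb nu Th +
 fixes act :: "'g::grp => 'v => 'v" and N :: "'g set" and Q :: "'v set" and Kq :: "'v => 'g set" and BIG :: nat
 assumes D0: "[|x : V; y : V; D x y = 0|] ==> x = y"
  and act_one: "x : V ==> act 1 x = x"
  and act_mult: "x : V ==> act (g * h) x = act g (act h x)"
  and act_V: "x : V ==> act g x : V"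
  and act_D: "[|x : V; y : V|] ==> D (act g x) (act g y) = D x y"
  and act_Ap: "F : Ap ==> act g F : Ap"
  and act_nb: "[|F : Ap; e : nb F|] ==> act g e : nb (act g F)"
  and act_nu: "[|F : Ap; e : nb F; e' : nb F|] ==> nu (act g F) (act g e) (act g e') = nu F e e'"
  and N_normal: "normal_sub N"
  and N_triv: "[|n : N; x : V|] ==> act n x = x"
  and QAp: "Q <= Ap"
  and act_Q: "q : Q ==> act g q : Q"
  and Kq_sub: "q : Q ==> subgrp (Kq q)"
  and Kq_N: "q : Q ==> N <= Kq q"
  and Kq_fix: "[|q : Q; k : Kq q|] ==> act k q = q"
  and Kq_conj: "[|q : Q; k : Kq q|] ==> g * k * g^- : Kq (act g q)"
  and deep: "[|q : Q; k : Kq q; k ~: N; x : V; x ~= q|] ==> BIG < Phi q x (act k x)"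
  and BIG: "1000 * Th <= BIG" "0 < Th"
begin

lemma act_inv: assumes x: "x : V" shows "act g^- (act g x) = x" "act g (act g^- x) = x"
proof -
 show "act g^- (act g x) = x" unfolding act_mult[OF x, symmetric] by (simp add: act_one x)
 show "act g (act g^- x) = x" unfolding act_mult[OF x, symmetric] by (simp add: act_one x)
qed

lemma act_eq: assumes "x : V" "y : V" shows "act g x = act g y \<longleftrightarrow> x = y"
 by (metis act_inv assms)

lemma act_inv_eq: assumes "x : V" "y : V" shows "act g^- x = y \<longleftrightarrow> x = act g y"
 by (metis act_inv assms)

lemma QV: "q : Q ==> q : V" using QAp ApV by auto

lemma Dpos: "[|x : V; y : V; x ~= y|] ==> 0 < D x y" using D0 by blast

lemma act_ES: assumes F: "F : Ap" and x: "x : V" shows "ES (act g F) (act g x) = act g ` ES F x"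
proof -
 have *: "act g e : ES (act g F) (act g x)" if "F : Ap" "x : V" "e : ES F x" for g F x e
 proof -
  have e: "e : nb F" "D e x + 1 = D F x" "e : V" using that ES_V by (auto simp: ES_def)
  show ?thesis unfolding ES_def using act_nb[OF that(1) e(1)] act_D[OF e(3) that(2)] act_D[OF FV[OF that(1)] that(2)] e by simp
 qed
 show ?thesis
 proof
  show "ES (act g F) (act g x) <= act g ` ES F x"
  proof
   fix e assume e: "e : ES (act g F) (act g x)"
   have "act g^- e : ES (act g^- (act g F)) (act g^- (act g x))"
    by (rule *[OF act_Ap[OF F] act_V[OF x] e])
   hence "act g^- e : ES F x" by (simp only: act_inv[OF x] act_inv[OF FV[OF F]])
   moreover have "act g (act g^- e) = e" using act_inv ES_V act_Ap F e by blast
   ultimately show "e : act g ` ES F x" by (metis imageI)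
  qed
 qed (use *[OF F x] in blast)
qed

lemma act_Phi: assumes F: "F : Ap" and x: "x : V" "z : V" shows "Phi (act g F) (act g x) (act g z) = Phi F x z"
proof -
 have inj: "inj_on (act g) V" using act_eq by (auto simp: inj_on_def)
 have sub: "ES F x <= V" "ES F z <= V" using ES_V[OF F] by auto
 have eq: "ES (act g F) (act g x) = ES (act g F) (act g z) \<longleftrightarrow> ES F x = ES F z"
  unfolding act_ES[OF F x(1)] act_ES[OF F x(2)] using inj_on_image_eq_iff[OF inj sub] .
 have "{nu (act g F) e e' |e e'. e : act g ` ES F x \<union> act g ` ES F z & e' : act g ` ES F x \<union> act g ` ES F z}
   = {nu F e e' |e e'. e : ES F x \<union> ES F z & e' : ES F x \<union> ES F z}" (is "?A = ?B")
 proof -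
  have nu: "nu (act g F) (act g e) (act g e') = nu F e e'" if "e : ES F x \<union> ES F z" "e' : ES F x \<union> ES F z" for e e'
   using that act_nu[OF F] ES_nb by blast
  show ?thesis
  proof
   show "?A <= ?B"
   using nu by blast
   show "?B <= ?A"
   proof
    fix t assume "t : ?B"
    hence "\<exists>e e'. t = nu F e e' & e : ES F x \<union> ES F z & e' : ES F x \<union> ES F z" by blast
    then obtain e e' where t: "t = nu F e e'" "e : ES F x \<union> ES F z" "e' : ES F x \<union> ES F z" by blast
    have "t = nu (act g F) (act g e) (act g e')" using t nu by simp
    moreover have "act g e : act g ` ES F x \<union> act g ` ES F z" "act g e' : act g ` ES F x \<union> act g ` ES F z" using t by blast+
    ultimately show "t : ?A" by blast
   qed
  qed
 qed
 thus ?thesis unfolding Phi_def eq unfolding act_ES[OF F x(1)] act_ES[OF F x(2)] by (rule arg_cong)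
qed

lemma act_Phi': assumes "F : Ap" "x : V" "z : V" shows "Phi F (act g x) z = Phi (act g^- F) x (act g^- z)"
by (metis act_Phi assms act_V act_inv)

lemma triQ: "[|q : Ap; x : V; w : V; z : V; x ~= q; w ~= q; z ~= q|] ==> Phi q x z <= Phi q x w + Phi q w z"
 using Phi_tri Dpos FV by simp

text \<open>The threshold from which on the strong axiom holds, by
  \<open>Phi_strong\<close>.\<close>

definition th :: nat where "th = 2 * Th"

lemma th_BIG: "100 * th <= BIG" "0 < th" "Th <= th" "500 * th <= BIG" using BIG by (auto simp: th_def)

lemma strongQ:
 assumes "q : Ap" "q' : Ap" "q ~= q'" "x : V" "x ~= q" "x ~= q'" "th < Phi q x q'"
 shows "Phi q' x z = Phi q' q z" "Phi q' z x = Phi q' z q" "ES q' x = ES q' q"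
proof -
 have "0 < D q x" "0 < D q' x" "0 < D q q'" "2 * Th < Phi q x q'" using assms Dpos FV by (auto simp: th_def)
 note * = Phi_strong[OF assms(1,2,4) this]
 show "Phi q' x z = Phi q' q z" "Phi q' z x = Phi q' z q" "ES q' x = ES q' q" by (rule *)+
qed

lemma A1Q: "[|q : Ap; x : V; z : V; x ~= q; z ~= q; Th < Phi q x z|] ==> D x z = D x q + D q z"
 using Phi_A1 Dpos FV by simp

definition NN :: "'g set" where "NN = gen (N \<union> (\<Union>q\<in>Q. Kq q))"

definition HH :: "'v set => 'g set" where "HH W = gen (N \<union> (\<Union>q\<in>W \<inter> Q. Kq q))"

lemma HH_sub: "subgrp (HH W)" by (simp add: HH_def subgrp_gen)
lemma HH_N: "n : N ==> n : HH W" by (auto simp: HH_def intro: gen_incl)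
lemma HH_K: "q : W ==> q : Q ==> k : Kq q ==> k : HH W" by (auto simp: HH_def intro!: gen_incl)
lemma HH_mono: "W <= W' ==> HH W <= HH W'" unfolding HH_def by (rule gen_mono) auto

lemma HH_induct [consumes 1, case_names one N K]:
 assumes "n : HH W" "P 1" "\<And>k n. k : N ==> n : HH W ==> P n ==> P (k * n)"
  "\<And>q k n. q : W ==> q : Q ==> k : Kq q ==> n : HH W ==> P n ==> P (k * n)"
 shows "P n"
proof -
 have "n \<in> gen (N \<union> (\<Union>q\<in>W \<inter> Q. Kq q))" using assms(1) by (simp add: HH_def)
 thus ?thesis
 proof (induction rule: gen.induct)
  case (gen_mult s x)
  have x: "x : HH W" using gen_mult.hyps by (simp add: HH_def)
  have "s : N \<or> (EX q:W \<inter> Q. s : Kq q)"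
   using gen_mult.hyps subgrp_inv_iff normal_subD N_normal Kq_sub by blast
  then consider "s : N" | q where "q : W" "q : Q" "s : Kq q" by blast
  thus ?case
   by cases (use assms(3)[OF _ x gen_mult.IH] in simp, use assms(4)[OF _ _ _ x gen_mult.IH] in simp)
 qed (use assms(2) in simp)
qed

text \<open>A Greendlinger-type certificate for \<open>n\<close> as a product of rotations: unless
  \<open>n\<close> is in \<open>N\<close>, a rotation about some apex \<open>q\<close> cuts the
  angle at \<open>q\<close> between \<open>zt\<close> and its image from nearly \<open>BIG\<close>
  down to \<open>4 * th\<close>, and the new product is certified again. A rotation about
  \<open>zt\<close> itself leaves no such trace and has its own rule.\<close>

inductive red :: "'v => 'g => bool" for zt where
 red_N: "n : N ==> red zt n"
| red_base: "zt : Q ==> k : Kq zt ==> red zt (k * n) ==> red zt n"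
| red_step: "q : Q ==> q ~= zt ==> act n zt ~= q ==> k : Kq q ==> BIG - 4 * th < Phi q zt (act n zt) ==>
  Phi q zt (act (k * n) zt) <= 4 * th ==> red zt (k * n) ==> red zt n"

text \<open>The angle bound at apices outside is the form that quasi-convexity takes here; the last
  clause carries the certificates along while \<open>W\<close> grows.\<close>

definition windmill :: "'v => 'v set => bool" where
 "windmill zt W \<longleftrightarrow> W <= V & zt : W & (ALL h:HH W. ALL w:W. act h w : W) &
   (ALL q:Q - W. ALL w:W. ALL w':W. Phi q w w' <= 2 * th) & (ALL n:HH W. red zt n)"

lemma windmill_init: assumes zt: "zt : V" shows "windmill zt {zt}"
proof -
 define K where "K = (if zt : Q then Kq zt else N)"
 have sub: "HH {zt} <= K"
  by (simp add: HH_def gen_least Kq_sub normal_subD N_normal K_def Kq_N)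
 have *: "act n zt = zt & red zt n" if n: "n : K" for n
 proof (cases "zt : Q")
  case True
  hence k: "n : Kq zt" using n by (simp add: K_def)
  have "1 : N" by (simp add: normal_subD N_normal subgrpD)
  hence "red zt (n^- * n)" using red_N by simp
  hence "red zt n" using red_base[OF True subgrpD(3)[OF Kq_sub[OF True] k]] by blast
  thus ?thesis using Kq_fix True k by simp
 next
  case False
  thus ?thesis using n N_triv zt red_N by (simp add: K_def)
 qed
 show ?thesis unfolding windmill_def
  using zt * sub by (auto simp: subset_iff)
qed

text \<open>Normal forms as in a free product of rotation groups. The option records the apex of the
  outermost rotation, from which the next one has to differ, and \<open>y ~= v\<close> excludes
  rotations without effect. \<open>wrp\<close> is the same for group elements, with innermost factor
  in \<open>H\<close>.\<close>

inductive wpt :: "'v set => 'v set => 'v option => 'v => bool" for U V' where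
 wpt_0: "s : U ==> wpt U V' None s"
| wpt_S: "v : V' ==> k : Kq v ==> k ~: N ==> wpt U V' c y ==> c ~= Some v ==> y ~= v ==> wpt U V' (Some v) (act k y)"

inductive wrp :: "'g set => 'v set => 'v option => 'g => bool" for H V' where
 wrp_0: "h : H ==> wrp H V' None h"
| wrp_S: "v : V' ==> k : Kq v ==> k ~: N ==> wrp H V' c n ==> c ~= Some v ==> wrp H V' (Some v) (k * n)"

end

context rot begin

text \<open>The apex \<open>v0\<close>, which no other new apex separates from \<open>zt\<close>, is
  added with its orbit under \<open>HH W\<close>, then all apices that see two points of the result
  at more than \<open>2 * th\<close>. Seen from a new apex all this is nearly one point, so in a
  reduced product of rotations each factor leaves an angle close to \<open>BIG\<close> which the
  factors further out cannot cancel.\<close>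

lemma windmill_extend:
 assumes wm: "windmill zt W" and v0: "v0 : Q" "v0 ~: W"
  and near: "\<And>c. c : Q ==> c ~: W ==> c ~= v0 ==> Phi c zt v0 <= th"
 shows "\<exists>W'. windmill zt W' & W <= W' & v0 : W'"
proof -
 have WV: "W <= V" and ztW: "zt : W" and hW: "\<And>h w. h : HH W ==> w : W ==> act h w : W"
  and conv: "\<And>q w w'. q : Q ==> q ~: W ==> w : W ==> w' : W ==> Phi q w w' <= 2 * th"
  and redW: "\<And>n. n : HH W ==> red zt n" using wm by (auto simp: windmill_def)
 have ztV: "zt : V" using ztW WV by auto
 have Hinv: "h^- : HH W" if "h : HH W" for h using subgrpD(3)[OF HH_sub that] .
 have hW_iff: "act h w : W \<longleftrightarrow> w : W" if "h : HH W" "w : V" for h w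
  using hW[OF that(1)] hW[OF Hinv[OF that(1)], of "act h w"] act_inv that by auto
 define W1 where "W1 = W \<union> {act h v0 |h. h : HH W}"
 define U where "U = W1 \<union> {v : Q. EX a:W1 - {v}. EX b:W1 - {v}. 2 * th < Phi v a b}"
 define V' where "V' = U \<inter> Q - W"
 define W' where "W' = {act h u |h u. h : HH U & u : U}"
 have W1V: "W1 <= V" using WV v0 QV act_V by (auto simp: W1_def)
 have UV: "U <= V" using W1V QV by (auto simp: U_def)
 have hW1: "act h w : W1" if "h : HH W" "w : W1" for h w
 proof (cases "w : W")
  case False
  hence "\<exists>h'. h' : HH W & w = act h' v0" using that unfolding W1_def by blast
  then obtain h' where "h' : HH W" "w = act h' v0" by blast
  hence "act h w = act (h * h') v0" "h * h' : HH W"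
   using act_mult[OF QV[OF v0(1)]] subgrpD(2)[OF HH_sub] that by auto
  thus ?thesis unfolding W1_def by blast
 qed (use hW that W1_def in auto)
 have hU: "act h u : U" if h: "h : HH W" and u: "u : U" for h u
 proof (cases "u : W1")
  case False
  then obtain a b where ab: "u : Q" "a : W1 - {u}" "b : W1 - {u}" "2 * th < Phi u a b" using u by (auto simp: U_def)
  hence "act h a : W1 - {act h u}" "act h b : W1 - {act h u}" "2 * th < Phi (act h u) (act h a) (act h b)"
  proof -
   have V: "u : V" "a : V" "b : V" "u : Ap" using ab W1V QV QAp by auto
   show "act h a : W1 - {act h u}" "act h b : W1 - {act h u}" using hW1[OF h] ab act_eq[OF _ V(1)] V by auto
   show "2 * th < Phi (act h u) (act h a) (act h b)" using act_Phi V ab by simp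
  qed
  thus ?thesis using act_Q ab by (auto simp: U_def)
 qed (use hW1[OF h] U_def in auto)
 have QW1: "u : Q" if "u : U" "u ~: W" for u using that v0 act_Q by (auto simp: U_def W1_def)
 have inWU: "W <= U" "v0 : U"
 proof -
  show "W <= U" by (auto simp: U_def W1_def)
  have "act 1 v0 : W1" by (auto simp: W1_def subgrpD HH_sub)
  thus "v0 : U" using act_one QV v0 by (auto simp: U_def)
 qed
 \<comment> \<open>An apex \<open>u\<close> of \<open>U\<close> outside \<open>W1\<close> sees two
   points of \<open>W1\<close> far apart, hence at least one of them far from \<open>v\<close>; as
   seen from \<open>v\<close> that point and \<open>u\<close> coincide.\<close>
 have vis1: "EX a:W1 - {v}. \<forall>z. Phi v u z = Phi v a z & Phi v z u = Phi v z a" if v: "v : Q" and u: "u : U" "u ~= v" for u v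
 proof (cases "u : W1")
  case False
  then obtain a b where ab: "u : Q" "a : W1 - {u}" "b : W1 - {u}" "2 * th < Phi u a b" using u by (auto simp: U_def)
  have aV: "a : V" "b : V" "u : V" "v : V" "u : Ap" "v : Ap" using ab W1V QV v QAp by auto
  have *: "EX a:W1 - {v}. \<forall>z. Phi v u z = Phi v a z & Phi v z u = Phi v z a" if "c : W1" "c ~= u" "c ~= v" "th < Phi u c v" for c
   using strongQ[of u v c] that aV u W1V by (metis Diff_iff empty_iff insert_iff subset_iff)
  consider "v = a" | "v = b" | "v ~= a" "v ~= b" by blast
  thus ?thesis
  proof cases
   case 1
   hence "b ~= v" using ab by auto
   thus ?thesis using *[of b] ab 1 Phi_sym[of u a b] by auto
  next
   case 2
   hence "a ~= v" using ab by auto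
   thus ?thesis using *[of a] ab 2 by auto
  next
   case 3
   hence "th < Phi u a v \<or> th < Phi u v b" using triQ[of u a v b] aV ab u by auto
   thus ?thesis using *[of a] *[of b] 3 ab Phi_sym[of u v b] by auto
  qed
 qed (use u in blast)
 \<comment> \<open>\<open>th\<close> between the images of \<open>zt\<close> and \<open>v0\<close>,
   by \<open>near\<close>, and \<open>2 * th\<close> inside \<open>W\<close> give
   \<open>3 * th\<close> for an orbit point against \<open>W\<close>; a second orbit point costs
   another \<open>th\<close>.\<close>
 have small1: "Phi v a b <= 4 * th" if v: "v : Q" "v ~: W" and a: "a : W1 - {v}" and b: "b : W1 - {v}" for v a b
 proof -
  have VV: "v : V" "v : Ap" using v QV QAp by auto
  have far: "Phi v (act h zt) (act h v0) <= th" "act h zt ~= v" if h: "h : HH W" and "act h v0 ~= v" for h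
  proof -
   have "act h^- v ~= v0" using act_inv_eq[OF VV(1) QV[OF v0(1)]] that by auto
   moreover have "act h^- v : Q" "act h^- v ~: W"
    using v act_Q hW_iff[OF Hinv[OF h] VV(1)] by auto
   ultimately have "Phi (act h^- v) zt v0 <= th" using near by blast
   thus "Phi v (act h zt) (act h v0) <= th"
    using act_Phi' VV ztV act_V QV v0 act_inv by simp
   show "act h zt ~= v" using hW[OF h ztW] v by auto
  qed
  have zV: "act h zt : V" "act h v0 : V" for h using act_V ztV QV v0 by auto
  have one: "Phi v (act h v0) w <= 3 * th" if h: "h : HH W" "act h v0 ~= v" and w: "w : W" for h w
  proof -
   have wv: "w : V" "w ~= v" using w WV v by auto
   note triQ[OF VV(2) zV(2) zV(1) wv(1) h(2) far(2)[OF h] wv(2)]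
   moreover have "Phi v (act h v0) (act h zt) <= th" using far h Phi_sym by simp
   moreover note conv[OF v hW[OF h(1) ztW] w]
   ultimately show ?thesis by linarith
  qed
  consider "a : W" "b : W" | h where "h : HH W" "a = act h v0" "b : W" | h where "h : HH W" "b = act h v0" "a : W"
   | h h' where "h : HH W" "a = act h v0" "h' : HH W" "b = act h' v0" using a b unfolding W1_def by blast
  thus ?thesis
  proof cases
   case 1 thus ?thesis using conv[OF v 1] by linarith
  next
   case (2 h)
   have "Phi v a b <= 3 * th" unfolding 2(2) by (rule one[OF 2(1) _ 2(3)]) (use a 2(2) in blast)
   thus ?thesis by linarith
  next
   case (3 h)
   have "Phi v b a <= 3 * th" unfolding 3(2) by (rule one[OF 3(1) _ 3(3)]) (use b 3(2) in blast)
   thus ?thesis using Phi_sym[of v a b] by linarith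
  next
   case (4 h h')
   have h: "act h v0 ~= v" "act h' v0 ~= v" using a b 4 by auto
   note triQ[OF VV(2) zV(2) zV(1) zV(2) h(1) far(2)[OF 4(1) h(1)] h(2)]
   moreover have "Phi v (act h v0) (act h zt) <= th" using far(1)[OF 4(1) h(1)] Phi_sym[of v] by simp
   moreover note one[OF 4(3) h(2) hW[OF 4(1) ztW]]
   ultimately show ?thesis unfolding 4(2,4) using Phi_sym[of v "act h zt" "act h' v0"] by linarith
  qed
 qed
 have small: "Phi v u u' <= 4 * th" if v: "v : Q" "v ~: W" and u: "u : U" "u ~= v" "u' : U" "u' ~= v" for v u u'
  by (metis vis1 v u small1)
 have convU: "v : U" if v: "v : Q" and u: "u : U" "u ~= v" "u' : U" "u' ~= v" and big: "2 * th < Phi v u u'" for v u u'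
 proof -
  obtain a b where "a : W1 - {v}" "b : W1 - {v}" "Phi v a b = Phi v u u'" by (metis vis1 v u)
  thus ?thesis using v big unfolding U_def by (metis (mono_tags, lifting) UnI2 mem_Collect_eq)
 qed
 have V'D: "v : Q" "v ~: W" "v : U" "v : V" "v : Ap" if "v : V'" for v using that QV QAp by (auto simp: V'_def)
 have hV': "act h v : V'" if "h : HH W" "v : V'" for h v
  using hU[OF that(1)] V'D[OF that(2)] act_Q hW_iff[OF that(1)] by (auto simp: V'_def)
 note HUsub = HH_mono[OF inWU(1)]
 have conjN: "s * k * s^- : N \<longleftrightarrow> k : N" for s k
 proof
  assume "s * k * s^- : N"
  hence "s^- * (s * k * s^-) * s^-^- : N" using normal_subD(2)[OF N_normal] by blast
  thus "k : N" by (simp add: mult.assoc)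
 qed (use normal_subD(2)[OF N_normal] in blast)
 have inW'U: "U <= W'"
 proof
  fix u assume u: "u : U"
  hence "act 1 u = u" using act_one UV by blast
  moreover have "1 : HH U" by (rule subgrpD(1)[OF HH_sub])
  ultimately show "u : W'" unfolding W'_def using u by (metis (mono_tags, lifting) mem_Collect_eq)
 qed
 have W'V: "W' <= V" using UV act_V by (auto simp: W'_def)
 have W'inv: "act h w : W'" if h: "h : HH U" and w: "w : W'" for h w
 proof -
  obtain g u where g: "g : HH U" "u : U" "w = act g u" using w unfolding W'_def by blast
  have "act h w = act (h * g) u" using act_mult UV g by auto
  moreover note subgrpD(2)[OF HH_sub h g(1)]
  ultimately show ?thesis unfolding W'_def using g(2) by blast
 qed
 have KU: "k : HH U" if "v : V'" "k : Kq v" for v k by (rule HH_K[OF V'D(3)[OF that(1)] V'D(1)[OF that(1)] that(2)])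
 have wV: "y : V & (\<forall>v. c = Some v --> v : V')" if "wpt U V' c y" for c y
  using that by induction (use UV act_V in auto)
 have wH: "wpt U V' (map_option (act h) c) (act h y)" if h: "h : HH W" and "wpt U V' c y" for h c y
  using that(2)
 proof induction
  case (wpt_0 s) show ?case by (simp add: wpt.wpt_0 hU[OF h wpt_0])
 next
  case (wpt_S v k c y)
  have V: "y : V" "v : V" using wV[OF wpt_S(4)] V'D wpt_S by auto
  have 1: "act h (act k y) = act (h * k * h^-) (act h y)"
   using act_mult V act_V act_inv by simp
  have 2: "map_option (act h) c ~= Some (act h v)"
   using wpt_S(5) wV[OF wpt_S(4)] V'D(4) act_eq[OF _ V(2)] by (cases c) auto
  show ?case unfolding option.map 1
   by (rule wpt.wpt_S[OF hV'[OF h wpt_S(1)] Kq_conj[OF V'D(1)[OF wpt_S(1)] wpt_S(2)] _ wpt_S.IH 2])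
    (use wpt_S(3) conjN wpt_S(6) act_eq[OF V] in auto)
 qed
 have wK: "\<exists>c'. wpt U V' c' (act j y)" if q: "q : V'" "j : Kq q" and w: "wpt U V' c y" for q j c y
 proof -
  consider "j : N \<or> y = q" | "j ~: N" "y ~= q" "c ~= Some q" | "j ~: N" "y ~= q" "c = Some q" by blast
  thus ?thesis
  proof cases
   case 1
   hence "act j y = y" using N_triv wV w Kq_fix V'D q by blast
   thus ?thesis using w by auto
  next
   case 2
   show ?thesis using wpt_S[OF q 2(1) w 2(3,2)] by blast
  next
   case 3
   from w 3(3) obtain k c0 y0 where k: "k : Kq q" "wpt U V' c0 y0" "c0 ~= Some q" "y0 ~= q" "y = act k y0"
    by cases auto
   have y0: "y0 : V" using wV[OF k(2)] by simp
   have e: "act j y = act (j * k) y0" using act_mult[OF y0] k by simp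
   have jk: "j * k : Kq q" using subgrpD(2)[OF Kq_sub[OF V'D(1)[OF q(1)]]] q k by blast
   show ?thesis
   proof (cases "j * k : N")
    case True
    hence "act j y = y0" using e N_triv y0 by simp
    thus ?thesis using k by auto
   next
    case False
    show ?thesis unfolding e using wpt_S[OF q(1) jk False k(2-4)] by blast
   qed
  qed
 qed
 have wall: "\<exists>c. wpt U V' c (act n u)" if "n : HH U" and u: "u : U" for n u
  using that(1)
 proof (induction rule: HH_induct)
  case one
  have "act 1 u = u" using u UV act_one by blast
  thus ?case using wpt_0[OF u] by auto
 next
  case (N k n)
  hence "act (k * n) u = act n u" using act_mult u N_triv act_V UV by auto
  thus ?case using N by simp
 next
  case (K q k n)
  hence e: "act (k * n) u = act k (act n u)" using act_mult UV u by auto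
  show ?case
  proof (cases "q : W")
   case True
   thus ?thesis by (metis e K wH HH_K)
  next
   case False
   hence "q : V'" using K by (simp add: V'_def)
   thus ?thesis by (metis e K wK)
  qed
 qed
 \<comment> \<open>The apex \<open>v1\<close> of the outermost rotation sees \<open>y\<close> far
   from all of \<open>U\<close>, in particular from \<open>v\<close>; so from \<open>v\<close> the
   point \<open>y\<close> looks like \<open>v1\<close>, which lies in \<open>U\<close>.\<close>
 have vis: "EX u:U - {v}. \<forall>z. Phi v y z = Phi v u z"
  if v: "v : V'" "c ~= Some v" "y ~= v" and yV: "y : V" and A: "(c = None & y : U) \<or> (\<exists>v. c = Some v & v : V' & y ~= v & (ALL a:U - {v}. BIG - 4 * th < Phi v a y))" for v c y
 proof (cases "c = None")
  case True
  thus ?thesis using A v by auto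
 next
  case False
  then obtain v1 where v1: "c = Some v1" "v1 : V'" "y ~= v1" "ALL a:U - {v1}. BIG - 4 * th < Phi v1 a y" using A by blast
  hence "v ~= v1" using v by auto
  hence "BIG - 4 * th < Phi v1 y v" using v1 V'D v Phi_sym by simp
  hence "th < Phi v1 y v" using th_BIG by linarith
  hence "\<And>z. Phi v y z = Phi v v1 z"
   using strongQ V'D v1 v yV by simp
  thus ?thesis using V'D v1 v by blast
 qed
 \<comment> \<open>Before the rotation about \<open>v\<close> the point \<open>y\<close> looks like
   some \<open>u\<close> in \<open>U\<close>; the rotation moves this direction by more than
   \<open>BIG\<close>, whereas all of \<open>U\<close> spans at most \<open>4 * th\<close> at
   \<open>v\<close>.\<close>
 have A: "(c = None & y : U) \<or> (\<exists>v. c = Some v & v : V' & y ~= v & (ALL a:U - {v}. BIG - 4 * th < Phi v a y))"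
  if "wpt U V' c y" for c y using that
 proof induction
  case (wpt_S v k c y)
  have yV: "y : V" using wV[OF wpt_S(4)] by simp
  obtain u where u: "u : U - {v}" "\<And>z. Phi v y z = Phi v u z" by (metis vis wpt_S yV)
  have V: "v : V" "v : Ap" "u : V" using V'D[OF wpt_S(1)] u UV by auto
  have kv: "act k v = v" using Kq_fix V'D wpt_S by simp
  have kne: "act k y ~= v" "act k u ~= v" using act_eq[OF yV V(1), of k] act_eq[OF V(3,1), of k] kv wpt_S(6) u by auto
  have "BIG < Phi v u (act k u)" using deep V'D wpt_S V u by simp
  also have "... <= Phi v u (act k y) + Phi v (act k y) (act k u)"
   using triQ V act_V yV u kne by simp
  also have "Phi v (act k y) (act k u) = 0" using act_Phi[OF V(2) yV V(3), of k] kv u(2)[of u] by simp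
  finally have big: "BIG < Phi v u (act k y)" by simp
  have "BIG - 4 * th < Phi v a (act k y)" if a: "a : U - {v}" for a
  proof -
   have aV: "a : V" using a UV by auto
   have "Phi v u (act k y) <= Phi v u a + Phi v a (act k y)"
    using triQ V aV act_V yV u a kne by simp
   moreover have "Phi v u a <= 4 * th" using small V'D wpt_S u a by simp
   ultimately show ?thesis using big th_BIG by linarith
  qed
  thus ?case using wpt_S(1) kne(1) by auto
 qed simp
 \<comment> \<open>The large angle at \<open>v\<close> puts \<open>q\<close> on one side of it:
   between \<open>v\<close> and the rotated point, where rotating back by \<open>k\<close> leads to
   the induction hypothesis, or between \<open>u\<close> and \<open>v\<close>, where
   \<open>U\<close> is already convex.\<close>
 have conv': "q : W'" if "wpt U V' c y" "q : Q" "u : U" "u ~= q" "y ~= q" "2 * th < Phi q u y" for c y q u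
  using that
 proof (induction arbitrary: q u)
  case (wpt_0 s)
  thus ?case using convU inW'U by blast
 next
  case (wpt_S v k c y)
  have yV: "y : V" using wV[OF wpt_S(4)] by simp
  have V: "v : V" "v : Ap" "u : V" "q : V" "q : Ap" using V'D[OF wpt_S(1)] UV wpt_S QV QAp by auto
  have kyV: "act k y : V" using act_V yV by simp
  have kv: "act k v = v" using Kq_fix V'D wpt_S by simp
  have kq: "q : W'" if a: "2 * th < Phi q v (act k y)" and ne: "q ~= v"
  proof -
   have "Phi (act k^- q) y (act k^- v) = Phi q (act k y) v" using act_Phi' V yV by simp
   moreover have ikv: "act k^- v = v" using act_inv_eq V kv by simp
   ultimately have "2 * th < Phi (act k^- q) v y" using a Phi_sym by metis
   moreover have "v ~= act k^- q" by (metis act_inv_eq V kv ne)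
   moreover have "y ~= act k^- q" by (metis act_inv_eq V yV wpt_S.prems)
   ultimately have "act k^- q : W'" using act_Q V'D wpt_S by blast
   hence "act k (act k^- q) : W'" using W'inv KU wpt_S by simp
   thus ?thesis using act_inv V by simp
  qed
  show ?case
  proof (cases "q = v \<or> u = v")
   case True
   thus ?thesis using V'D wpt_S inW'U kq by blast
  next
   case False
   have kne: "act k y ~= v" by (metis act_eq yV V kv wpt_S)
   have "BIG - 4 * th < Phi v u (act k y)" using A[OF wpt.wpt_S[OF wpt_S(1-6)]] False wpt_S.prems by auto
   moreover have "Phi v u (act k y) <= Phi v u q + Phi v q (act k y)"
    using triQ[OF V(2,3,4) kyV] False kne by auto
   ultimately have "th < Phi v u q \<or> th < Phi v (act k y) q" using th_BIG Phi_sym by auto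
   thus ?thesis
   proof
    assume "th < Phi v u q"
    hence "Phi q u (act k y) = Phi q v (act k y)" using strongQ(1)[OF V(2,5) _ V(3)] False wpt_S.prems by metis
    hence "2 * th < Phi q v (act k y)" using wpt_S.prems(5) by linarith
    thus ?thesis using kq False by blast
   next
    assume "th < Phi v (act k y) q"
    hence "Phi q u (act k y) = Phi q u v" using strongQ(2)[OF V(2,5) _ kyV] False wpt_S.prems kne by metis
    hence "2 * th < Phi q u v" using wpt_S.prems(5) by linarith
    hence "q : U" using convU V'D wpt_S by blast
    thus ?thesis using inW'U by blast
   qed
  qed
 qed
 have rH: "wrp (HH W) V' (map_option (act h) c) (h * n)" if h: "h : HH W" and "wrp (HH W) V' c n" for h c n
  using that(2)
 proof induction
  case (wrp_0 n) thus ?case by (simp add: wrp.wrp_0 subgrpD HH_sub h)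
 next
  case (wrp_S v k c n)
  have cV: "c = Some x ==> x : V'" for x using wrp_S(4) by cases auto
  have 2: "map_option (act h) c ~= Some (act h v)"
   using wrp_S(5) cV V'D(4) act_eq[OF _ V'D(4)[OF wrp_S(1)]] by (cases c) auto
  have "wrp (HH W) V' (Some (act h v)) ((h * k * h^-) * (h * n))"
   by (rule wrp.wrp_S[OF hV'[OF h wrp_S(1)] Kq_conj[OF V'D(1)[OF wrp_S(1)] wrp_S(2)] _ wrp_S.IH 2])
    (use wrp_S(3) conjN in auto)
  thus ?case by (simp add: mult.assoc)
 qed
 have rK: "\<exists>c'. wrp (HH W) V' c' (j * n)" if q: "q : V'" "j : Kq q" and w: "wrp (HH W) V' c n" for q j c n
 proof -
  consider "j : N" | "j ~: N" "c ~= Some q" | "j ~: N" "c = Some q" by blast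
  thus ?thesis
  proof cases
   case 1
   thus ?thesis using rH[OF HH_N w] by blast
  next
   case 2
   show ?thesis using wrp_S[OF q 2(1) w 2(2)] by blast
  next
   case 3
   from w 3(2) obtain k c0 n0 where k: "k : Kq q" "wrp (HH W) V' c0 n0" "c0 ~= Some q" "n = k * n0"
    by cases auto
   have jk: "j * k : Kq q" using subgrpD(2)[OF Kq_sub[OF V'D(1)[OF q(1)]]] q k by blast
   have e: "j * n = (j * k) * n0" using k by (simp add: mult.assoc)
   show ?thesis
   proof (cases "j * k : N")
    case True
    thus ?thesis unfolding e using rH[OF HH_N k(2)] by blast
   next
    case False
    show ?thesis unfolding e using wrp_S[OF q(1) jk False k(2,3)] by blast
   qed
  qed
 qed
 have rall: "\<exists>c. wrp (HH W) V' c n" if "n : HH U" for n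
  using that
 proof (induction rule: HH_induct)
  case one
  thus ?case by (metis wrp_0 subgrpD HH_sub)
 next
  case (N k n)
  thus ?case using rH[OF HH_N] by blast
 next
  case (K q k n)
  show ?case
  proof (cases "q : W")
   case True
   thus ?thesis using K rH HH_K by blast
  next
   case False
   hence "q : V'" using K by (simp add: V'_def)
   thus ?thesis using K rK by blast
  qed
 qed
 have ztU: "zt : U" using inWU ztW by auto
 have rw: "wpt U V' c (act n zt) & red zt n" if "wrp (HH W) V' c n" for c n
  using that
 proof induction
  case (wrp_0 n)
  thus ?case using redW wpt_0 hU ztU by blast
 next
  case (wrp_S v k c n)
  have yV: "act n zt : V" using act_V ztV by simp
  note vV = V'D[OF wrp_S(1)]
  have w: "wpt U V' c (act n zt)" using wrp_S by blast
  note AA = A[OF w]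
  have zv: "zt ~= v" using ztW vV by auto
  have ne: "act n zt ~= v"
  proof
   assume v: "act n zt = v"
   from AA show False
   proof (elim disjE conjE exE)
    assume c: "c = None"
    have "n : HH W" using wrp_S(4) c by cases auto
    thus False using hW[OF _ ztW] vV(2) v by auto
   next
    fix v1 assume v1: "c = Some v1" "v1 : V'" "act n zt ~= v1" "ALL a:U - {v1}. BIG - 4 * th < Phi v1 a (act n zt)"
    have z1: "zt ~= v1" using ztW V'D v1 by blast
    hence "BIG - 4 * th < Phi v1 zt v" using v1 v ztU by auto
    moreover have "Phi v1 zt v <= 4 * th" using small V'D v1 ztU z1 vV v by simp
    ultimately show False using th_BIG by linarith
   qed
  qed
  have mm: "act (k * n) zt = act k (act n zt)" using act_mult ztV by simp
  have w': "wpt U V' (Some v) (act (k * n) zt)" using mm wpt_S wrp_S w ne by simp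
  have big: "act (k * n) zt ~= v" "BIG - 4 * th < Phi v zt (act (k * n) zt)" using A[OF w'] ztU zv by auto
  obtain u where u: "u : U - {v}" "\<And>z. Phi v (act n zt) z = Phi v u z" using vis wrp_S ne yV AA by blast
  have sm: "Phi v zt (act n zt) <= 4 * th"
   using small vV u ztU zv Phi_sym by simp
  have "red zt (k * n)"
   using red_step vV zv big subgrpD Kq_sub wrp_S sm by fastforce
  thus ?case using w' by simp
 qed
 have HHW': "HH W' <= HH U"
  unfolding HH_def[of W']
 proof (rule gen_least[OF HH_sub])
  show "N \<union> (\<Union>q\<in>W' \<inter> Q. Kq q) <= HH U"
  proof
   fix k assume "k \<in> N \<union> (\<Union>q\<in>W' \<inter> Q. Kq q)"
   then consider "k : N" | q where "q : W'" "q : Q" "k : Kq q" by blast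
   thus "k : HH U"
   proof cases
    case 2
    then obtain h u where h: "h : HH U" "u : U" "q = act h u" unfolding W'_def by blast
    have uV: "u : V" using h UV by auto
    hence u: "act h^- q = u" using h act_inv(1) by simp
    hence "u : Q" using act_Q[OF 2(2), of "h^-"] by simp
    moreover have "h^- * k * h^-^- : Kq u" using Kq_conj[OF 2(2,3), of "h^-"] u by simp
    ultimately have "h^- * k * h : HH U" using HH_K h by simp
    hence "h * (h^- * k * h) * h^- : HH U" using h subgrpD[OF HH_sub] by blast
    thus ?thesis by (simp add: mult.assoc)
   qed (rule HH_N)
  qed
 qed
 have "windmill zt W'" unfolding windmill_def
 proof (intro conjI ballI)
  show "W' <= V" by (rule W'V)
  show "zt : W'" using ztU inW'U by auto
  show "act h w : W'" if "h : HH W'" "w : W'" for h w using W'inv that HHW' by auto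
  show "red zt n" if "n : HH W'" for n using rall[of n] rw that HHW' by blast
  show "Phi q w w' <= 2 * th" if q: "q : Q - W'" and w: "w : W'" "w' : W'" for q w w'
  proof (rule ccontr)
   assume c: "\<not> Phi q w w' <= 2 * th"
   obtain h u where h: "h : HH U" "u : U" "w = act h u" using w unfolding W'_def by blast
   obtain h' u' where h': "h' : HH U" "u' : U" "w' = act h' u'" using w unfolding W'_def by blast
   have V: "q : V" "q : Ap" "u : V" "u' : V" "w' : V" using q QV QAp h(2) h'(2) UV w W'V by blast+
   define q' where "q' = act h^- q"
   have q': "q' : Q" "q' ~: W'"
   proof -
    show "q' : Q" using act_Q q by (simp add: q'_def)
    show "q' ~: W'"
    proof
     assume "q' : W'"
     hence "act h q' : W'" using W'inv h by blast
     thus False using q act_inv V by (simp add: q'_def)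
    qed
   qed
   have e: "act h^- w' = act (h^- * h') u'" using act_mult V h' by simp
   have hh: "h^- * h' : HH U" using subgrpD(2)[OF HH_sub subgrpD(3)[OF HH_sub h(1)] h'(1)] .
   obtain c where wp: "wpt U V' c (act (h^- * h') u')" using wall[OF hh h'(2)] by blast
   have "Phi q w w' = Phi q' u (act (h^- * h') u')"
    using e h act_Phi' V by (simp add: q'_def)
   hence "2 * th < Phi q' u (act (h^- * h') u')" using c by simp
   moreover have "act (h^- * h') u' : W'" using hh h'(2) unfolding W'_def by blast
   hence "act (h^- * h') u' ~= q'" using q' by auto
   moreover have "u ~= q'" using q' h inW'U by auto
   ultimately have "q' : W'" using conv' wp q' h by simp
   thus False using q' by simp
  qed
 qed
 thus ?thesis using inWU inW'U by blast
qed

text \<open>A maximal windmill, from Zorn, contains all of \<open>Q\<close>: otherwise an apex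
  outside it nearest to \<open>zt\<close> extends it, because an apex seeing a large angle on the
  way would be nearer by additivity of distances.\<close>

lemma windmill_all:
 assumes zt: "zt : V" and n: "n : NN"
 shows "red zt n"
proof -
 have "EX M:{W. windmill zt W}. ALL X:{W. windmill zt W}. M <= X --> X = M"
 proof (rule subset_Zorn)
  fix C assume C: "subset.chain {W. windmill zt W} C"
  show "EX U:{W. windmill zt W}. ALL X:C. X <= U"
  proof (cases "C = {}")
   case True
   thus ?thesis using windmill_init[OF zt] by blast
  next
   case False
   have CW: "windmill zt W" if "W : C" for W using C that by (auto simp: subset.chain_def)
   have Clin: "W <= W' \<or> W' <= W" if "W : C" "W' : C" for W W' using C that by (auto simp: subset_chain_def)
   have two: "EX W:C. A <= W & B <= W" if "A : C" "B : C" for A B using Clin[OF that] that by blast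
   have HC: "EX W:C. n : HH W" if "n \<in> HH (\<Union>C)" for n
    using that
   proof (induction rule: HH_induct)
    case one thus ?case using False subgrpD(1)[OF HH_sub] by blast
   next
    case (N k n)
    thus ?case by (metis subgrpD HH_sub HH_N)
   next
    case (K q k n)
    then obtain W A where W: "W : C" "n : HH W" "A : C" "q : A" by blast
    then obtain B where B: "B : C" "W <= B" "A <= B" using two by blast
    hence "k : HH B" "n : HH B" using HH_K[of q B k] K W HH_mono[of W B] by auto
    thus ?case using subgrpD(2)[OF HH_sub] B by blast
   qed
   have "windmill zt (\<Union>C)" unfolding windmill_def
   proof (intro conjI ballI)
    have CV: "W <= V & zt : W" if "W : C" for W using CW[OF that] by (simp add: windmill_def)
    show "\<Union>C <= V" using CV by blast
    show "zt \<in> \<Union>C" using CV False by blast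
    show "act h w \<in> \<Union>C" if hw: "h \<in> HH (\<Union>C)" "w \<in> \<Union>C" for h w
    proof -
     obtain A B where A: "A : C" "B : C" "h : HH A" "w : B" using HC hw by blast
     then obtain W where W: "W : C" "A <= W" "B <= W" using two by blast
     hence "h : HH W" "w : W" using A HH_mono by blast+
     thus ?thesis using CW[OF W(1)] W unfolding windmill_def by blast
    qed
    show "red zt m" if n: "m \<in> HH (\<Union>C)" for m by (metis HC n CW windmill_def)
    show "Phi q w w' <= 2 * th" if q: "q \<in> Q - \<Union>C" and w: "w \<in> \<Union>C" "w' \<in> \<Union>C" for q w w'
    proof -
     obtain A B where A: "A : C" "B : C" "w : A" "w' : B" using w by blast
     then obtain W where W: "W : C" "A <= W" "B <= W" using two by blast
     hence "q : Q - W" "w : W" "w' : W" using A q by auto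
     thus ?thesis using CW W by (simp add: windmill_def)
    qed
   qed
   thus ?thesis by blast
  qed
 qed
 then obtain W where W: "windmill zt W" "\<And>X. windmill zt X ==> W <= X ==> X = W" by blast
 have "Q <= W"
 proof (rule ccontr)
  assume "\<not> Q <= W"
  then obtain v where v: "v : Q - W" by blast
  define m where "m = (LEAST m. EX v:Q - W. D zt v = m)"
  have "\<exists>m. EX v:Q - W. D zt v = m" using v by blast
  from LeastI_ex[OF this] have "EX v:Q - W. D zt v = m" unfolding m_def .
  then obtain v0 where v0: "v0 : Q - W" "D zt v0 = m" by blast
  have min: "m <= D zt c" if "c : Q - W" for c unfolding m_def by (rule Least_le) (use that in blast)
  have near: "Phi c zt v0 <= th" if c: "c : Q" "c ~: W" "c ~= v0" for c
  proof (rule ccontr)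
   assume a: "\<not> ?thesis"
   have zW: "zt ~= c" by (metis W c windmill_def)
   have "Th < Phi c zt v0" using a th_BIG(3) by linarith
   moreover have "c : Ap" "v0 : V" "c : V" using c(1) QAp QV v0(1) by auto
   ultimately have "D zt v0 = D zt c + D c v0"
    using A1Q zt zW c by simp
   moreover note Dpos[OF \<open>c : V\<close> \<open>v0 : V\<close> c(3)]
   ultimately show False using min[of c] v0(2) c by auto
  qed
  obtain W' where "windmill zt W'" "W <= W'" "v0 : W'" using windmill_extend W near v0 by blast
  thus False using W(2) v0 by blast
 qed
 hence "NN <= HH W" unfolding NN_def HH_def by (intro gen_mono) auto
 thus ?thesis using W(1) n by (auto simp: windmill_def)
qed

lemma red_cases:
 assumes "zt : V" "n : NN"
 obtains "n : N" | k where "zt : Q" "k : Kq zt" "red zt (k * n)"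
  | q k where "q : Q" "q ~= zt" "act n zt ~= q" "k : Kq q" "BIG - 4 * th < Phi q zt (act n zt)"
    "Phi q zt (act (k * n) zt) <= 4 * th" "red zt (k * n)"
 using windmill_all[OF assms] by (cases rule: red.cases) blast+

end

section \<open>Quotients by rotations\<close>

context rot begin

lemma NN_incl: "n : N ==> n : NN" "[|q : Q; k : Kq q|] ==> k : NN"
 by (auto simp: NN_def intro!: gen_incl)

lemma NN_normal: "normal_sub NN"
 unfolding NN_def
proof (rule gen_normal)
 fix s g assume "s \<in> N \<union> (\<Union>q\<in>Q. Kq q)"
 then consider "s : N" | q where "q : Q" "s : Kq q" by blast
 hence "g * s * g^- : NN"
 proof cases
  case 1
  thus ?thesis using normal_subD(2)[OF N_normal] NN_incl by blast
 next
  case 2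
  show ?thesis by (rule NN_incl(2)[OF act_Q[OF 2(1)] Kq_conj[OF 2]])
 qed
 thus "g * s * g^- \<in> gen (N \<union> (\<Union>q\<in>Q. Kq q))" by (simp add: NN_def)
qed

lemma NN_sub: "subgrp NN" by (rule normal_subD(1)[OF NN_normal])
lemma NN1: "1 : NN" by (rule subgrpD(1)[OF NN_sub])
lemma NNm: "x : NN ==> y : NN ==> x * y : NN" by (rule subgrpD(2)[OF NN_sub])
lemma NNi: "x : NN ==> x^- : NN" by (rule subgrpD(3)[OF NN_sub])
lemma NNc: "x : NN ==> g * x * g^- : NN" by (rule normal_subD(2)[OF NN_normal])
lemma NNc': "x : NN ==> g^- * x * g : NN" using NNc[of x "g^-"] by simp

lemma act_swap: "x : V ==> act g (act n x) = act (g * n * g^-) (act g x)"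
proof -
 assume x: "x : V"
 have "act (g * n * g^-) (act g x) = act (g * n * g^- * g) x" by (rule act_mult[OF x, symmetric])
 also have "g * n * g^- * g = g * n" by (simp add: mult.assoc)
 finally show ?thesis using act_mult[OF x] by simp
qed

definition Dq :: "'v => 'v => nat" where
 "Dq x y = (LEAST d. EX n:NN. D x (act n y) = d)"

definition nuq :: "'v => 'v => 'v => nat" where
 "nuq F e e' = (LEAST d. EX k:NN. act k F = F & nu F e (act k e') = d)"

lemma Dq_le: "n : NN ==> Dq x y <= D x (act n y)"
 unfolding Dq_def by (rule Least_le) blast

lemma Dq_le1: "y : V ==> Dq x y <= D x y"
 by (metis Dq_le NN1 act_one)

lemma Dq_ex: obtains n where "n : NN" "D x (act n y) = Dq x y"
proof -
 have "\<exists>d. EX n:NN. D x (act n y) = d" using NN1 by blast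
 from LeastI_ex[OF this] show ?thesis using that unfolding Dq_def by blast
qed

lemma nuq_le: "[|k : NN; act k F = F|] ==> nuq F e e' <= nu F e (act k e')"
 unfolding nuq_def by (rule Least_le) blast

lemma nuq_ex:
 assumes F: "F : Ap" obtains k where "k : NN" "act k F = F" "nu F e (act k e') = nuq F e e'"
proof -
 have "\<exists>d. EX k:NN. act k F = F & nu F e (act k e') = d" using NN1 act_one FV[OF F] by blast
 from LeastI_ex[OF this] show ?thesis using that unfolding nuq_def by blast
qed

lemma Dq_act_le: assumes "x : V" "y : V" shows "Dq (act g x) (act g y) <= Dq x y"
proof -
 obtain n where n: "n : NN" "D x (act n y) = Dq x y" by (rule Dq_ex)
 have "Dq (act g x) (act g y) <= D (act g x) (act (g * n * g^-) (act g y))" by (rule Dq_le[OF NNc[OF n(1)]])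
 also have "... = D (act g x) (act g (act n y))" by (metis act_swap assms)
 also have "... = Dq x y" using act_D assms act_V n by simp
 finally show ?thesis .
qed

lemma Dq_act: assumes "x : V" "y : V" shows "Dq (act g x) (act g y) = Dq x y"
 using Dq_act_le[OF assms, of g] Dq_act_le[OF act_V[OF assms(1), of g] act_V[OF assms(2), of g], of "g^-"]
  act_inv(1)[OF assms(1)] act_inv(1)[OF assms(2)] by simp

lemma Dq_n: assumes "y : V" "n : NN" shows "Dq x (act n y) = Dq x y"
proof (rule antisym)
 have *: "Dq x (act n y) <= Dq x y" if "y : V" "n : NN" for y n
 proof -
  obtain m where m: "m : NN" "D x (act m y) = Dq x y" by (rule Dq_ex)
  have "act (m * n^-) (act n y) = act (m * n^- * n) y" by (rule act_mult[OF that(1), symmetric])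
  hence "act (m * n^-) (act n y) = act m y" by (simp add: mult.assoc)
  thus ?thesis using Dq_le[OF NNm[OF m(1) NNi[OF that(2)]], of x "act n y"] m(2) by simp
 qed
 show "Dq x (act n y) <= Dq x y" by (rule *[OF assms])
 show "Dq x y <= Dq x (act n y)" using *[OF act_V[OF assms(1)] NNi[OF assms(2)], of n] act_inv(1)[OF assms(1)] by simp
qed

lemma Dq_sym_le: assumes "x : V" "y : V" shows "Dq y x <= Dq x y"
proof -
 obtain n where n: "n : NN" "D x (act n y) = Dq x y" by (rule Dq_ex)
 have "Dq y x <= D y (act n^- x)" by (rule Dq_le[OF NNi[OF n(1)]])
 also have "... = D (act n y) (act n (act n^- x))" using act_D assms act_V by simp
 also have "... = D x (act n y)" using act_inv assms D_sym act_V by simp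
 finally show ?thesis using n by simp
qed

lemma Dq_sym: assumes "x : V" "y : V" shows "Dq x y = Dq y x"
 using Dq_sym_le[OF assms] Dq_sym_le[OF assms(2,1)] by simp

lemma Dq_n': assumes "x : V" "y : V" "n : NN" shows "Dq (act n x) y = Dq x y"
 using Dq_sym act_V assms Dq_n by simp

lemma Dq_tri: assumes "x : V" "y : V" "z : V" shows "Dq x z <= Dq x y + Dq y z"
proof -
 obtain n where n: "n : NN" "D x (act n y) = Dq x y" by (rule Dq_ex)
 obtain m where m: "m : NN" "D (act n y) (act m z) = Dq (act n y) z" by (rule Dq_ex)
 have "Dq x z <= D x (act m z)" by (rule Dq_le[OF m(1)])
 also have "... <= D x (act n y) + D (act n y) (act m z)" using D_tri assms act_V by blast
 finally show ?thesis using n m Dq_n' assms by simp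
qed

lemma Dq0: "[|x : V; y : V; Dq x y = 0|] ==> EX n:NN. x = act n y"
 by (metis Dq_ex D0 act_V)

lemma Dq_self: "x : V ==> Dq x x = 0"
 using Dq_le1[of x x] D_self by simp

lemma nu_inv: assumes "F : Ap" "act k F = F" "e : nb F" "e' : nb F" shows "nu F (act k e) (act k e') = nu F e e'"
 by (metis act_nu assms)

lemma nb_inv: "[|F : Ap; act k F = F; e : nb F|] ==> act k e : nb F"
 by (metis act_nb)

lemma nbV': "F : Ap ==> e : nb F ==> e : V" using nbV by blast

lemma stab_inv: "F : V ==> act k F = F ==> act k^- F = F"
 by (metis act_inv)

lemma nuq_sym_le: assumes F: "F : Ap" "e : nb F" "e' : nb F" shows "nuq F e' e <= nuq F e e'"
proof -
 obtain k where k: "k : NN" "act k F = F" "nu F e (act k e') = nuq F e e'" by (rule nuq_ex[OF F(1)])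
 note k' = NNi[OF k(1)] stab_inv[OF FV[OF F(1)] k(2)]
 have "nuq F e' e <= nu F e' (act k^- e)" by (rule nuq_le[OF k'])
 also have "... = nu F (act k e') (act k (act k^- e))"
  using nu_inv[OF F(1) k(2) F(3) nb_inv[OF F(1) k'(2) F(2)]] by simp
 also have "... = nu F e (act k e')"
  using act_inv(2)[OF nbV'[OF F(1,2)]] nu_sym[OF F(1,2) nb_inv[OF F(1) k(2) F(3)]] by simp
 finally show ?thesis using k by simp
qed

lemma nuq_tri: assumes F: "F : Ap" "e : nb F" "e' : nb F" "e'' : nb F" shows "nuq F e e'' <= nuq F e e' + nuq F e' e''"
proof -
 obtain k where k: "k : NN" "act k F = F" "nu F e (act k e') = nuq F e e'" by (rule nuq_ex[OF F(1)])
 obtain l where l: "l : NN" "act l F = F" "nu F e' (act l e'') = nuq F e' e''" by (rule nuq_ex[OF F(1)])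
 note FVx = FV[OF F(1)] and lb = nb_inv[OF F(1) l(2) F(4)]
 have kl: "act (k * l) F = F" using act_mult[OF FVx, of k l] k(2) l(2) by simp
 have "nuq F e e'' <= nu F e (act (k * l) e'')" by (rule nuq_le[OF NNm[OF k(1) l(1)] kl])
 also have "... = nu F e (act k (act l e''))" using act_mult nbV' F by simp
 also note nu_tri[OF F(1,2) nb_inv[OF F(1) k(2) F(3)] nb_inv[OF F(1) k(2) lb]]
 also note nu_inv[OF F(1) k(2) F(3) lb]
 finally show ?thesis using k l by simp
qed

lemma nuq_n: assumes F: "F : Ap" "e' : nb F" and k: "k : NN" "act k F = F" shows "nuq F e (act k e') <= nuq F e e'"
proof -
 obtain l where l: "l : NN" "act l F = F" "nu F e (act l e') = nuq F e e'" by (rule nuq_ex[OF F(1)])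
 have s: "act (l * k^-) F = F"
  using act_mult[OF FV[OF F(1)], of l "k^-"] stab_inv[OF FV[OF F(1)] k(2)] l(2) by simp
 have "act (l * k^-) (act k e') = act (l * k^- * k) e'" using act_mult nbV' F by simp
 hence "act (l * k^-) (act k e') = act l e'" by (simp add: mult.assoc)
 thus ?thesis using nuq_le[OF NNm[OF l(1) NNi[OF k(1)]] s, of e "act k e'"] l(3) by simp
qed

lemma nuq_n_eq: assumes F: "F : Ap" "e' : nb F" and k: "k : NN" "act k F = F" shows "nuq F e (act k e') = nuq F e e'"
 using nuq_n[OF F k, of e] nuq_n[OF F(1) nb_inv[OF F(1) k(2) F(2)] NNi[OF k(1)] stab_inv[OF FV[OF F(1)] k(2)], of e]
  act_inv(1)[OF nbV'[OF F]] by simp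

lemma nuq_act_le: assumes F: "F : Ap" "e : nb F" "e' : nb F" shows "nuq (act g F) (act g e) (act g e') <= nuq F e e'"
proof -
 obtain k where k: "k : NN" "act k F = F" "nu F e (act k e') = nuq F e e'" by (rule nuq_ex[OF F(1)])
 have s: "act (g * k * g^-) (act g F) = act g F" using act_swap[OF FV[OF F(1)], of g k] k(2) by simp
 have "nuq (act g F) (act g e) (act g e') <= nu (act g F) (act g e) (act (g * k * g^-) (act g e'))"
  by (rule nuq_le[OF NNc[OF k(1)] s])
 also have "... = nu (act g F) (act g e) (act g (act k e'))" by (metis act_swap nbV' F)
 also have "... = nu F e (act k e')" by (rule act_nu[OF F(1,2) nb_inv[OF F(1) k(2) F(3)]])
 finally show ?thesis using k by simp
qed

lemma nuq_act: assumes F: "F : Ap" "e : nb F" "e' : nb F" shows "nuq (act g F) (act g e) (act g e') = nuq F e e'"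
 using nuq_act_le[OF F, of g] nuq_act_le[OF act_Ap[OF F(1), of g] act_nb[OF F(1,2), of g] act_nb[OF F(1,3), of g], of "g^-"]
  act_inv(1)[OF FV[OF F(1)]] act_inv(1)[OF nbV'[OF F(1,2)]] act_inv(1)[OF nbV'[OF F(1,3)]] by simp

text \<open>Bending a polygon with minimal sides at the apices supplied by \<open>red\<close> until it closes up.\<close>

lemma polygon:
 assumes "red s n" and s: "s : V" and "n : NN" and F: "F : Ap" and x: "x : V"
  and "e : ES F s" "e' : ES F x"
  and "D s F = Dq s F" "D F x = Dq F x" "D x (act n s) = Dq x s" and "Dq s x < Dq s F + Dq F x"
 shows "nuq F e e' <= Th"
 using assms
proof (induction arbitrary: F x e e')
 case (red_N n)
 have FVx: "F : V" using red_N FV by blast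
 have "D x s = Dq x s" using N_triv red_N by simp
 hence lt: "D s x < D s F + D F x" using red_N D_sym Dq_sym by simp
 have "nu F e e' <= Th"
 proof (rule ccontr)
  assume "\<not> ?thesis"
  hence "D s x = D s F + D F x"
   using A1e red_N by (auto simp: ES_def)
  thus False using lt by simp
 qed
 moreover have "nuq F e e' <= nu F e (act 1 e')" by (rule nuq_le[OF NN1 act_one[OF FVx]])
 moreover have "act 1 e' = e'" using act_one ES_V red_N by blast
 ultimately show ?case by simp
next
 case (red_base k n)
 note p = red_base.prems
 have V: "F : V" "e : nb F" "e' : nb F" "e : V" "e' : V" using p FV ES_nb ES_V by blast+
 note ks = Kq_fix[OF red_base(1,2)]
 note kN = NN_incl(2)[OF red_base(1,2)]
 have "nuq (act k F) (act k e) (act k e') <= Th"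
 proof (rule red_base.IH[OF p(1) NNm[OF kN p(2)] act_Ap[OF p(3)] act_V[OF p(4)]])
  have "act k e : ES (act k F) (act k s)" using act_ES p by simp
  thus "act k e : ES (act k F) s" using ks by simp
  show "act k e' : ES (act k F) (act k x)" using act_ES p by simp
  have "D (act k s) (act k F) = Dq (act k s) (act k F)" using act_D p V Dq_act by simp
  thus "D s (act k F) = Dq s (act k F)" using ks by simp
  show "D (act k F) (act k x) = Dq (act k F) (act k x)" using act_D V p Dq_act by simp
  have "D (act k x) (act k (act n s)) = Dq (act k x) (act k s)"
   using act_D p act_V Dq_act by simp
  thus "D (act k x) (act (k * n) s) = Dq (act k x) s" using ks act_mult[OF p(1)] by simp
  have "Dq (act k s) (act k x) < Dq (act k s) (act k F) + Dq (act k F) (act k x)"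
   using Dq_act p V by simp
  thus "Dq s (act k x) < Dq s (act k F) + Dq (act k F) (act k x)" using ks by simp
 qed
 thus ?case using nuq_act p V by simp
next
 case (red_step q n k)
 note p = red_step.prems
 have V: "F : V" "e : nb F" "e' : nb F" "e : V" "e' : V" using p FV ES_nb ES_V by blast+
 have qV: "q : V" "q : Ap" using QV QAp red_step(1) by auto
 note kq = Kq_fix[OF red_step(1,4)]
 note kN = NN_incl(2)[OF red_step(1,4)]
 note knN = NNm[OF kN p(2)]
 have kn: "act (k * n) s = act k (act n s)" by (rule act_mult[OF p(1)])
 have nsV: "act n s : V" by (rule act_V[OF p(1)])
 have kD: "D q (act k y) = D q y" if "y : V" for y using act_D[OF qV(1) that, of k] kq by simp
 have kxs: "D (act k x) (act (k * n) s) = Dq (act k x) s"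
  using kn act_D p nsV Dq_n' kN by simp
 have kFx: "D (act k F) (act k x) = Dq (act k F) (act k x)" using act_D V p Dq_act by simp
 have kFx': "Dq (act k F) (act k x) = Dq F x" by (rule Dq_act[OF V(1) p(4)])
 have lt': "Dq s (act k x) < Dq s F + Dq F x" using Dq_n p kN by simp
 have ke': "act k e' : ES (act k F) (act k x)" using act_ES p by simp
 \<comment> \<open>If \<open>q\<close> is the corner \<open>F\<close> or \<open>x\<close>, the
   rotation fixes that corner. Otherwise the large angle at \<open>q\<close> falls on one of the
   three sides, which therefore passes through \<open>q\<close>; rotating everything behind
   \<open>q\<close> keeps all sides minimal.\<close>
 consider "q = F" | "q ~= F" "q = x" | "q ~= F" "q ~= x" by blast
 thus ?case
 proof cases
  case 1
  have "nuq F e (act k e') <= Th"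
   by (rule red_step.IH[OF p(1) knN p(3) act_V[OF p(4)] p(5) _ p(7) _ kxs])
    (use ke' kFx kq 1 lt' kFx' in simp_all)
  thus ?thesis using nuq_n_eq[OF p(3) V(3) kN] kq 1 by simp
 next
  case 2
  have "D x (act (k * n) s) = Dq x s" unfolding kn using kD[OF nsV] 2 p(9) by simp
  thus ?thesis using red_step.IH p knN by simp
 next
  case 3
  have ne: "s ~= q" "act n s ~= q" "F ~= q" "x ~= q" using red_step 3 by auto
  have "Phi q s (act n s) <= Phi q s F + (Phi q F x + Phi q x (act n s))"
   using triQ[OF qV(2) p(1) V(1) nsV ne(1,3,2)] triQ[OF qV(2) V(1) p(4) nsV ne(3,4,2)] by linarith
  then consider "th < Phi q s F" | "th < Phi q F x" | "th < Phi q x (act n s)"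
   using red_step(5) th_BIG by linarith
  thus ?thesis
  proof cases
   case 1
   have a: "D s F = D s q + D q F" using A1Q[OF qV(2) p(1) V(1) ne(1,3)] 1 th_BIG by linarith
   have "D s (act k F) <= D s q + D q (act k F)" using D_tri[OF p(1) qV(1) act_V[OF V(1)]] .
   moreover have "Dq s (act k F) <= D s (act k F)" by (rule Dq_le1[OF act_V[OF V(1)]])
   ultimately have b: "D s (act k F) = Dq s (act k F)" "D s (act k F) = D s q + D q (act k F)"
    using a kD[OF V(1)] Dq_n[OF V(1) kN, of s] p(7) by auto
   have "s ~= F" using p D_self by auto
   moreover have "th < Phi q s F" by fact
   ultimately have "ES F s = ES F q" using strongQ qV p ne by blast
   hence "e : ES F q" using p(5) by simp
   hence "act k e : ES (act k F) (act k q)" using act_ES p qV by simp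
   hence kq': "act k e : ES (act k F) q" using kq by simp
   have "D (act k F) s = D (act k F) q + D q s"
    using b D_sym p act_V V qV by simp
   from ES_subset[OF act_Ap[OF p(3)] qV(1) p(1) this kq'] have ke: "act k e : ES (act k F) s" .
   have "nuq (act k F) (act k e) (act k e') <= Th"
    by (metis red_step.IH p knN act_Ap act_V ke ke' b kFx kxs kFx' Dq_n V kN)
   thus ?thesis using nuq_act p V by simp
  next
   case 2
   have a: "D F x = D F q + D q x" using A1Q[OF qV(2) V(1) p(4) ne(3,4)] 2 th_BIG by linarith
   have "D F (act k x) <= D F q + D q (act k x)" using D_tri[OF V(1) qV(1) act_V[OF p(4)]] .
   moreover have "Dq F (act k x) <= D F (act k x)" by (rule Dq_le1[OF act_V[OF p(4)]])
   ultimately have b: "D F (act k x) = Dq F (act k x)" "D F (act k x) = D F q + D q (act k x)"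
    using a kD[OF p(4)] Dq_n[OF p(4) kN, of F] p(8) by auto
   have b2: "th < Phi q x F" using 2 Phi_sym[of q F x] by simp
   have xF: "x ~= F" using 2 Phi_self th_BIG by auto
   have "e' : ES F q" using strongQ qV p ne xF b2 by blast
   hence ke: "e' : ES F (act k x)"
    using ES_subset p act_V qV b by simp
   show ?thesis
    by (metis red_step.IH p knN act_V ke b kxs Dq_n kN)
  next
   case 3
   have a: "D x (act n s) = D x q + D q (act n s)" using A1Q[OF qV(2) p(4) nsV ne(4,2)] 3 th_BIG by linarith
   have "D x (act k (act n s)) <= D x q + D q (act k (act n s))" using D_tri[OF p(4) qV(1) act_V[OF nsV]] .
   moreover have "Dq x s <= D x (act (k * n) s)" by (rule Dq_le[OF knN])
   ultimately have "D x (act (k * n) s) = Dq x s" using a kD[OF nsV] p(9) kn by simp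
   thus ?thesis using red_step.IH p knN by simp
  qed
 qed
qed

lemma Dq_nb: assumes "F : Ap" "G : Ap" "e : nb F" shows "0 < Dq G e"
proof -
 obtain n where n: "n : NN" "D G (act n e) = Dq G e" by (rule Dq_ex)
 have "0 < D G (act n e)" using nbA act_Ap assms act_nb by blast
 thus ?thesis using n by simp
qed

lemma ESq_lift: assumes F: "F : Ap" "e : nb F" and x: "x : V" "Dq e x + 1 = Dq F x"
 obtains n where "n : NN" "e : ES F (act n x)" "D F (act n x) = Dq F x"
proof -
 obtain n where n: "n : NN" "D e (act n x) = Dq e x" by (rule Dq_ex)
 have "D F (act n x) <= D F e + D e (act n x)" using D_tri[OF FV[OF F(1)] nbV'[OF F] act_V[OF x(1)]] .
 moreover have "Dq F x <= D F (act n x)" by (rule Dq_le[OF n(1)])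
 ultimately have "D F (act n x) = Dq F x" using nbD[OF F] x(2) n(2) by simp
 thus ?thesis using that[OF n(1)] F n x by (simp add: ES_def)
qed

text \<open>Minimal distances and angles inherit the axioms by lifting; only \<open>A1e\<close> uses
  the rotations, through \<open>polygon\<close>.\<close>

sublocale qt: apexg V Dq Ap nb nuq Th
proof (unfold_locales, goal_cases)
 case (1 x) thus ?case by (rule Dq_self)
next
 case (2 x y) thus ?case by (rule Dq_sym)
next
 case (3 x y z) thus ?case by (rule Dq_tri)
next
 case 4 show ?case by (rule ApV)
next
 case (5 F) thus ?case by (rule nbV)
next
 case (6 F e)
 thus ?case using Dq_nb[OF 6(1,1,2)] Dq_le1[OF nbV'[OF 6], of F] nbD[OF 6] by simp
next
 case (7 F G e) thus ?case by (rule Dq_nb)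
next
 case (8 F x)
 obtain n where n: "n : NN" "D F (act n x) = Dq F x" by (rule Dq_ex)
 then obtain e where e: "e : nb F" "D e (act n x) + 1 = D F (act n x)"
  using nbex[OF 8(1) act_V[OF 8(2)], of n] 8(3) by auto
 have "Dq e x <= D e (act n x)" by (rule Dq_le[OF n(1)])
 moreover note Dq_tri[OF FV[OF 8(1)] nbV'[OF 8(1) e(1)] 8(2)]
 moreover have "Dq F e <= 1" using Dq_le1[OF nbV'[OF 8(1) e(1)], of F] nbD[OF 8(1) e(1)] by simp
 ultimately show ?case using e n bexI by fastforce
next
 case (9 F e e') thus ?case using nuq_sym_le[of F e e'] nuq_sym_le[of F e' e] by simp
next
 case (10 F e e' e'') thus ?case by (rule nuq_tri)
next
 case (11 F x z e e')
 show ?case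
 proof (rule ccontr)
  assume ne: "\<not> ?thesis"
  have FVx: "F : V" using FV 11 by blast
  obtain n where n: "n : NN" "e : ES F (act n x)" "D F (act n x) = Dq F x" using ESq_lift[OF 11(1,4,2,6)] .
  obtain m where m: "m : NN" "e' : ES F (act m z)" "D F (act m z) = Dq F z" using ESq_lift[OF 11(1,5,3,7)] .
  have V: "act n x : V" "act m z : V" using act_V 11 by auto
  obtain l where l: "l : NN" "D (act m z) (act l (act n x)) = Dq (act m z) (act n x)" by (rule Dq_ex)
  have e1: "Dq (act n x) F = Dq F x" using Dq_n'[OF 11(2) FVx n(1)] Dq_sym[OF 11(2) FVx] by simp
  have e2: "Dq F (act m z) = Dq F z" by (rule Dq_n[OF 11(3) m(1)])
  have e3: "Dq (act n x) (act m z) = Dq x z" using Dq_n[OF 11(3) m(1)] Dq_n'[OF 11(2,3) n(1)] by simp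
  have "nuq F e e' <= Th"
  proof (rule polygon[OF windmill_all[OF V(1) l(1)] V(1) l(1) 11(1) V(2) n(2) m(2) _ _ l(2)])
   show "D (act n x) F = Dq (act n x) F" using n e1 D_sym V FVx by simp
   show "D F (act m z) = Dq F (act m z)" using m(3) e2 by simp
   show "Dq (act n x) (act m z) < Dq (act n x) F + Dq F (act m z)"
    unfolding e1 e2 e3 using ne Dq_tri[OF 11(2) FVx 11(3)] Dq_sym[OF 11(2) FVx] by simp
  qed
  thus False using 11(8) by simp
 qed
qed

end

section \<open>Tight pairs and torsion in the quotient\<close>

lemma normal_power: assumes N: "normal_sub N" and n: "n : N" and x: "x ^ m : N" shows "(n * x) ^ m : (N::'g::grp set)"
proof -
 note sg = normal_subD(1)[OF N]
 have "(n * x) ^ j * (x ^ j)^- : N" for j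
 proof (induction j)
  case 0 show ?case using subgrpD(1)[OF sg] by simp
 next
  case (Suc j)
  have "(n * x) ^ Suc j * (x ^ Suc j)^- = n * (x * ((n * x) ^ j * (x ^ j)^-) * x^-)"
   by (simp add: mult.assoc)
  also have "... : N" by (simp add: subgrpD n normal_subD N Suc.IH)
  finally show ?case .
 qed
 from subgrpD(2)[OF sg this[of m] x] show ?thesis by (simp add: mult.assoc)
qed

locale rotm = rot V D Ap nb nu Th act N Q Kq BIG for V :: "'v set" and D Ap nb nu Th
  and act :: "'g::grp => 'v => 'v" and N Q Kq BIG +
 fixes ms :: "'v => 'v => nat"
 assumes ms_shrink: "[|q : Q; k : Kq q; u : V; v : V; u ~= q; v ~= q;
   Phi q u (act k v) + 6 * Th < Phi q u v|] ==> ms u (act k v) < ms u v"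
begin

text \<open>Minimal distance alone does not control the angle at an apex that a geodesic passes,
  since rotating there changes no length; the second clause does.\<close>

definition tight :: "'v => 'v => bool" where
 "tight u v \<longleftrightarrow> D u v = Dq u v &
   (ALL q:Q. ALL k:Kq q. q ~= u --> q ~= v --> Phi q u v <= Phi q u (act k v) + 4 * th)"

lemma tightD: "[|tight u v; q : Q; k : Kq q; q ~= u; q ~= v|] ==> Phi q u v <= Phi q u (act k v) + 4 * th"
 by (simp add: tight_def)

text \<open>Among the lifts of minimal distance one of minimal \<open>ms\<close> is taken. A
  rotation that reduces a large angle keeps the distance, which is additive at the apex, and would
  lower \<open>ms\<close>.\<close>

lemma tight_ex:
 assumes V: "u : V" "v : V"
 obtains n where "n : NN" "tight u (act n v)"
proof -
 define m where "m = (LEAST m. EX n:NN. D u (act n v) = Dq u v & ms u (act n v) = m)"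
 obtain n0 where "n0 : NN" "D u (act n0 v) = Dq u v" by (rule Dq_ex)
 hence "\<exists>m. EX n:NN. D u (act n v) = Dq u v & ms u (act n v) = m" by blast
 from LeastI_ex[OF this] obtain n where n: "n : NN" "D u (act n v) = Dq u v" "ms u (act n v) = m"
  unfolding m_def by blast
 have min: "m <= ms u (act n v)" if "n : NN" "D u (act n v) = Dq u v" for n
  unfolding m_def by (rule Least_le) (use that in blast)
 have "tight u (act n v)" unfolding tight_def
 proof (intro conjI ballI impI)
  show "D u (act n v) = Dq u (act n v)" using n Dq_n V by simp
  fix q k assume q: "q : Q" "k : Kq q" "q ~= u" "q ~= act n v"
  show "Phi q u (act n v) <= Phi q u (act k (act n v)) + 4 * th"
  proof (rule ccontr)
   assume "\<not> ?thesis"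
   hence big: "Phi q u (act k (act n v)) + 4 * th < Phi q u (act n v)" by simp
   have qV: "q : V" "q : Ap" using QV QAp q(1) by auto
   have nV: "act n v : V" by (rule act_V[OF V(2)])
   have a: "D u (act n v) = D u q + D q (act n v)"
    by (rule A1Q[OF qV(2) V(1) nV q(3)[symmetric] q(4)[symmetric]]) (use big th_BIG in linarith)
   have kn: "act (k * n) v = act k (act n v)" by (rule act_mult[OF V(2)])
   note kN = NNm[OF NN_incl(2)[OF q(1,2)] n(1)]
   have "D u (act k (act n v)) <= D u q + D q (act k (act n v))" using D_tri V qV act_V by simp
   moreover have "D q (act k (act n v)) = D q (act n v)"
    by (metis act_D qV nV Kq_fix q)
   moreover have "Dq u v <= D u (act (k * n) v)" by (rule Dq_le[OF kN])
   ultimately have e: "D u (act (k * n) v) = Dq u v" using a n(2) kn by simp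
   have "ms u (act k (act n v)) < ms u (act n v)"
    using ms_shrink q V nV big by (simp add: th_def)
   thus False using min[OF kN e] n(3) kn by simp
  qed
 qed
 thus ?thesis using that n(1) by blast
qed

lemma tight_act: assumes t: "tight u v" and V: "u : V" "v : V" shows "tight (act g u) (act g v)"
 unfolding tight_def
proof (intro conjI ballI impI)
 show "D (act g u) (act g v) = Dq (act g u) (act g v)"
  using t act_D V Dq_act by (simp add: tight_def)
 fix q k assume q: "q : Q" "k : Kq q" "q ~= act g u" "q ~= act g v"
 define q' where "q' = act g^- q"
 define k' where "k' = g^- * k * g"
 have qV: "q : V" "q : Ap" using QV QAp q(1) by auto
 have q': "q' : Q" "k' : Kq q'" using act_Q[OF q(1), of "g^-"] Kq_conj[OF q(1,2), of "g^-"]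
  by (simp_all add: q'_def k'_def)
 have ne: "q' ~= u" "q' ~= v" using act_inv_eq[OF qV(1) V(1), of g] act_inv_eq[OF qV(1) V(2), of g] q by (auto simp: q'_def)
 have "act g^- (act k (act g v)) = act k' v"
  using act_mult V act_V by (simp add: k'_def)
 hence 1: "Phi q (act g u) (act k (act g v)) = Phi q' u (act k' v)"
  using act_Phi' qV V act_V by (simp add: q'_def)
 have 2: "Phi q (act g u) (act g v) = Phi q' u v"
  using act_Phi' qV V act_V act_inv by (simp add: q'_def)
 show "Phi q (act g u) (act g v) <= Phi q (act g u) (act k (act g v)) + 4 * th"
  unfolding 1 2 by (rule tightD[OF t q' ne])
qed

text \<open>The rule \<open>red_step\<close> needs a large angle between \<open>s\<close> and its
  image, which is zero for a fixed point; only \<open>N\<close> and rotations about \<open>s\<close>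
  remain.\<close>

lemma stab_red: "red s n ==> s : V ==> act n s = s ==> n : N \<or> (s : Q & n : Kq s)"
proof (induction rule: red.induct)
 case (red_base k n)
 have "act (k * n) s = s" using act_mult red_base.prems Kq_fix red_base.hyps by simp
 hence "k * n : Kq s" using red_base.IH red_base.prems Kq_N red_base.hyps by blast
 hence "k^- * (k * n) : Kq s"
  using subgrpD Kq_sub red_base.hyps by blast
 thus ?case using red_base.hyps(1) by simp
next
 case (red_step q n k)
 thus ?case by simp
qed simp

lemma stabQ: "[|q : Q; n : NN; act n q = q|] ==> n : Kq q"
 using stab_red windmill_all QV Kq_N by blast

lemma stabV: "[|v : V; v ~: Q; n : NN; act n v = v|] ==> n : N"
 using stab_red[OF windmill_all] by blast

text \<open>Outside \<open>N\<close> the certificate exhibits an apex with an angle above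
  \<open>BIG - 4 * th\<close>, far more than \<open>50 * th\<close>; the rule for rotations about
  \<open>v\<close> is excluded as \<open>v\<close> is not in \<open>Q\<close>.\<close>

lemma small_N:
 assumes v: "v : V" "v ~: Q" and n: "n : NN" and small: "\<And>q. [|q : Q; q ~= v; q ~= act n v|] ==> Phi q v (act n v) <= 50 * th"
 shows "n : N"
 using v(1) n
proof (cases rule: red_cases)
 case (3 q k)
 thus ?thesis using small[of q] th_BIG by fastforce
qed (use v in auto)

lemma ESq_I: assumes q: "q : Ap" and u: "u : V" and eq: "D q u = Dq q u" and e: "e : ES q u" shows "e : qt.ES q u"
proof -
 have e': "e : nb q" "D e u + 1 = D q u" using e by (auto simp: ES_def)
 have "Dq e u <= D e u" by (rule Dq_le1[OF u])
 moreover note Dq_tri[OF FV[OF q] nbV'[OF q e'(1)] u]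
 moreover note qt.nbD[OF q e'(1)]
 ultimately show ?thesis using e' eq by (simp add: qt.ES_def)
qed

text \<open>The minimum in \<open>nuq\<close> is attained by an element of \<open>NN\<close> fixing
  \<open>q\<close>, which is in \<open>Kq q\<close> by \<open>stabQ\<close>; by tightness this
  rotation cannot have reduced the angle by more than \<open>4 * th\<close>.\<close>

lemma tight_bar:
 assumes t: "tight u v" and q: "q : Q" "0 < Dq q u" "0 < Dq q v" and V: "u : V" "v : V"
 shows "Phi q u v <= qt.Phi q u v + 8 * th"
proof (cases "Phi q u v <= Th")
 case True thus ?thesis using th_BIG by linarith
next
 case False
 hence big: "Th < Phi q u v" by simp
 have qV: "q : V" "q : Ap" using QV QAp q(1) by auto
 have ne: "q ~= u" "q ~= v" using q Dq_self V by auto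
 have pos: "0 < D q u" "0 < D q v" using Dpos[OF qV(1)] ne V by auto
 obtain e e' where e: "e : ES q u" "e' : ES q v" "nu q e e' = Phi q u v" using Phi_attain[OF qV(2) V(1) pos(1) V(2) pos(2) big] .
 note add = A1Q[OF qV(2) V ne[symmetric] big]
 have "D u v = Dq u v" using t by (simp add: tight_def)
 moreover note Dq_tri[OF V(1) qV(1) V(2)]
 moreover have "Dq u q <= D u q" "Dq q v <= D q v" by (rule Dq_le1[OF qV(1)], rule Dq_le1[OF V(2)])
 ultimately have "D u q = Dq u q" "D q v = Dq q v" using add by auto
 hence eq: "D q u = Dq q u" "D q v = Dq q v" using D_sym[OF V(1) qV(1)] Dq_sym[OF V(1) qV(1)] by auto
 note eq' = ESq_I[OF qV(2) V(1) eq(1) e(1)] ESq_I[OF qV(2) V(2) eq(2) e(2)]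
 have nq: "nuq q e e' <= qt.Phi q u v + Th"
  using qt.Phi_lower'[OF qV(2) V(1) q(2) V(2) q(3) eq'] by linarith
 obtain k where k: "k : NN" "act k q = q" "nu q e (act k e') = nuq q e e'" by (rule nuq_ex[OF qV(2)])
 note kK = stabQ[OF q(1) k(1,2)]
 have ke: "act k e' : ES q (act k v)" using act_ES[OF qV(2) V(2), of k] k(2) e(2) by simp
 have "D q (act k v) = D q v" using act_D[OF qV(1) V(2), of k] k(2) by simp
 hence "Phi q u (act k v) <= nu q e (act k e') + 2 * Th"
  using Phi_upper qV V pos act_V e ke by simp
 thus ?thesis using tightD[OF t q(1) kK ne] nq k(3) by (simp add: th_def)
qed

text \<open>In the quotient \<open>x\<close> has finite orbits. An apex whose orbit has least extent
  is either fixed, and \<open>tK\<close> applies, or its orbit is seen under small angles from every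
  apex. In the second case the powers of \<open>x\<close> have lifts \<open>g i\<close> that move a
  vertex little, \<open>g\<close> is a homomorphism modulo \<open>N\<close> by
  \<open>small_N\<close>, and \<open>tN\<close> applies to \<open>g 1\<close>.\<close>

lemma torsion:
 assumes Qne: "q0 : Q" and tN: "\<And>x m. 0 < m ==> x ^ m : N ==> x : N"
  and tK: "\<And>q x m. [|q : Q; act x q = q; 0 < m; x ^ m : Kq q|] ==> x : Kq q"
  and m: "0 < m" and xm: "x ^ m : NN"
 shows "x : NN"
proof -
 define X where "X i = act (zpow x i)" for i
 have XV: "X i v : V" if "v : V" for i v using act_V[OF that] by (simp add: X_def)
 have XX: "X i (X j v) = X (i + j) v" if "v : V" for i j v using act_mult[OF that] by (simp add: X_def zpow_add)
 have X0: "X 0 v = v" if "v : V" for v using act_one[OF that] by (simp add: X_def)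
 have XQ: "X i q : Q" if "q : Q" for i q using act_Q[OF that] by (simp add: X_def)
 have XD: "Dq (X i u) (X j v) = Dq u (X (j - i) v)" if "u : V" "v : V" for i j u v
 proof -
  have "X j v = X i (X (j - i) v)" using XX[OF that(2), of i "j - i"] by simp
  thus ?thesis using Dq_act[OF that(1) XV[OF that(2), of "j - i"], of "zpow x i"] by (simp add: X_def)
 qed
 have zm: "zpow x (int m * k) : NN" for k
  by (simp add: zpow_mult zpow_of_nat subgrp_zpow NN_sub xm)
 have per: "Dq q (X i q) = Dq q (X (i mod int m) q)" if "q : V" for q i
 proof -
  have "X i q = X (int m * (i div int m)) (X (i mod int m) q)" using XX[OF that] by simp
  thus ?thesis using Dq_n[OF XV[OF that] zm, of q] by (simp add: X_def)
 qed
 define bd where "bd q d \<longleftrightarrow> (\<forall>i. Dq q (X i q) <= d)" for q d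
 have "bd q0 (Max ((\<lambda>i. Dq q0 (X i q0)) ` {0..<int m}))" unfolding bd_def
 proof
  fix i
  have "i mod int m : {0..<int m}" using m by simp
  thus "Dq q0 (X i q0) <= Max ((\<lambda>i. Dq q0 (X i q0)) ` {0..<int m})"
   unfolding per[OF QV[OF Qne], of i] by (intro Max_ge) auto
 qed
 hence ex: "\<exists>d. EX q:Q. bd q d" using Qne by blast
 define d0 where "d0 = (LEAST d. EX q:Q. bd q d)"
 obtain q where q: "q : Q" "bd q d0" using LeastI_ex[OF ex] unfolding d0_def by blast
 have min: "d0 <= d" if "F : Q" "bd F d" for F d unfolding d0_def by (rule Least_le) (use that in blast)
 have qV: "q : V" "q : Ap" using QV QAp q(1) by auto
 have dab: "Dq (X a q) (X b q) <= d0" for a b using q XD qV by (simp add: bd_def)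
 show ?thesis
 proof (cases "Dq q (X 1 q) = 0")
  case True
  then obtain n where n: "n : NN" "q = act n (act x q)" using Dq0[OF qV(1) XV[OF qV(1)] True] by (auto simp: X_def)
  have f: "act (n * x) q = q" using act_mult qV n by simp
  note p = normal_power[OF NN_normal n(1) xm]
  have fp: "act ((n * x) ^ j) q = q" for j
  proof (induction j)
   case (Suc j) thus ?case using act_mult[OF qV(1), of "n * x" "(n * x) ^ j"] f by simp
  qed (use act_one qV in simp)
  note tK[OF q(1) f m stabQ[OF q(1) p fp]]
  note NN_incl(2)[OF q(1), OF this]
  from NNm[OF NNi[OF n(1)] this] show ?thesis by simp
 next
  case False
  hence d0: "0 < Dq q (X 1 q)" "0 < d0" using q(2)[unfolded bd_def, rule_format, of 1] by auto
  \<comment> \<open>If \<open>F\<close> saw two orbit points far apart, every vertex would be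
    reached from some orbit point through \<open>F\<close>, and the orbit of \<open>F\<close> would
    have extent at most \<open>d0 - 1\<close>.\<close>
  have claim: "qt.Phi F (X a q) (X b q) <= 2 * Th" if F: "F : Q" "0 < Dq F (X a q)" "0 < Dq F (X b q)" for F a b
  proof (rule ccontr)
   assume "\<not> ?thesis"
   hence big: "2 * Th < qt.Phi F (X a q) (X b q)" by simp
   have FV': "F : V" "F : Ap" using QV QAp F(1) by auto
   note XqV = XV[OF qV(1)]
   have side: "\<exists>c. 0 < Dq (X c q) F & Dq (X c q) v = Dq (X c q) F + Dq F v" if v: "v : V" "0 < Dq F v" for v
   proof -
    have "qt.Phi F (X a q) (X b q) <= qt.Phi F (X a q) v + qt.Phi F (X b q) v"
     by (metis qt.Phi_tri FV' XqV F v qt.Phi_sym)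
    then consider "Th < qt.Phi F (X a q) v" | "Th < qt.Phi F (X b q) v" using big by linarith
    thus ?thesis
     by cases (use qt.Phi_A1[OF FV'(2) XqV F(2) v] qt.Phi_A1[OF FV'(2) XqV F(3) v] Dq_sym[OF FV'(1) XqV] F in metis)+
   qed
   have i: "Dq F (X c q) <= d0 - 1" for c
   proof (cases "0 < Dq F (X c q)")
    case True
    then obtain e where "0 < Dq (X e q) F" "Dq (X e q) (X c q) = Dq (X e q) F + Dq F (X c q)" using side[OF XqV] by blast
    thus ?thesis using dab[of e c] by linarith
   qed simp
   have "Dq F (X j F) <= d0 - 1" for j
   proof (cases "0 < Dq F (X j F)")
    case True
    then obtain e where e: "Dq (X e q) (X j F) = Dq (X e q) F + Dq F (X j F)" using side XV FV' by blast
    have "Dq (X e q) (X j F) = Dq F (X (e - j) q)"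
     by (metis XD FV' qV Dq_sym XV)
    thus ?thesis using e i[of "e - j"] by linarith
   qed simp
   hence "bd F (d0 - 1)" by (simp add: bd_def)
   thus False using min[OF F(1)] d0 by fastforce
  qed
  \<comment> \<open>\<open>small_N\<close> needs a base point outside \<open>Q\<close>, so
    \<open>q\<close> is replaced by a neighbour on the way to its image.\<close>
  obtain y where y: "y : qt.ES q (X 1 q)" using qt.ES_ne qV XV d0 by blast
  have yn: "y : nb q" "Dq y (X 1 q) + 1 = Dq q (X 1 q)" "y : V" using y nbV'[OF qV(2)] by (auto simp: qt.ES_def)
  note yq = qt.nbD[OF qV(2) yn(1)]
  have gy: "0 < Dq G (act g y)" if "G : Ap" for G g by (rule Dq_nb[OF act_Ap[OF qV(2)] that act_nb[OF qV(2) yn(1)]])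
  have gyQ: "act g y ~: Q" for g using gy[of "act g y" g] QAp Dq_self[OF act_V[OF yn(3)]] by auto
  have gyne: "F ~= act g y" if "F : Q" for F g using gyQ that by blast
  have H1: "\<exists>c. 0 < Dq F (X c q) & qt.Phi F (X i y) (X c q) <= 3 * Th" if F: "F : Q" for F i
  proof -
   have FV': "F : V" "F : Ap" using QV QAp F(1) by auto
   have yi: "0 < Dq F (X i y)" using gy[OF FV'(2)] by (simp add: X_def)
   show ?thesis
   proof (cases "0 < Dq F (X i q)")
    case True
    have "Dq (X i y) (X i q) <= 1" using XD yn qV X0 yq Dq_sym by simp
    hence "qt.Phi F (X i y) (X i q) <= Th" using qt.Phi_adj[OF FV'(2) XV[OF yn(3)] yi XV[OF qV(1)] True] by simp
    thus ?thesis using True by (intro exI[of _ i]) simp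
   next
    \<comment> \<open>Here \<open>F\<close> is itself the orbit point next to \<open>X i y\<close>,
      up to \<open>NN\<close>. A translate of \<open>X i y\<close> is a first step from
      \<open>F\<close> towards the following orbit point, so the angle is measured against that
      one.\<close>
    case False
    then obtain n where n: "n : NN" "F = act n (X i q)" using Dq0 FV' XV qV by blast
    have iq: "X i q : Ap" using XQ[OF q(1)] QAp by auto
    have inb: "X i y : nb (X i q)" using act_nb qV yn by (simp add: X_def)
    define e where "e = act n (X i y)"
    have enb: "e : nb F" unfolding e_def n(2) by (rule act_nb[OF iq inb])
    have 1: "Dq e v = Dq (X i y) v" "Dq F v = Dq (X i q) v" if "v : V" for v
     unfolding e_def n(2) by (rule Dq_n'[OF XV[OF yn(3)] that n(1)], rule Dq_n'[OF XV[OF qV(1)] that n(1)])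
    have e1: "e : qt.ES F (X i y)"
     unfolding qt.ES_def using enb 1[OF XV[OF yn(3)]] XD[OF qV(1) yn(3), of i i] X0[OF yn(3)] yq Dq_self[OF XV[OF yn(3)]] by simp
    have FF: "Dq F (X (i + 1) q) = Dq q (X 1 q)" using 1[OF XV[OF qV(1)]] XD[OF qV(1,1), of i "i + 1"] by simp
    have e2: "e : qt.ES F (X (i + 1) q)"
     unfolding qt.ES_def using enb 1[OF XV[OF qV(1)]] XD[OF yn(3) qV(1), of i "i + 1"] FF yn(2) by simp
    have pos: "0 < Dq F (X (i + 1) q)" using FF d0 by simp
    note qt.Phi_upper[OF FV'(2) XV[OF yn(3)] yi XV[OF qV(1)] pos e1 e2]
    moreover note qt.same_bd[OF FV'(2) XV[OF yn(3)] yi e1 e1]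
    ultimately show ?thesis using pos by auto
   qed
  qed
  have H2: "qt.Phi F (X i y) (X j y) <= 4 * th" if F: "F : Q" for F i j
  proof -
   have FV': "F : V" "F : Ap" using QV QAp F(1) by auto
   note XqV = XV[OF qV(1)] and XyV = XV[OF yn(3)]
   have yi: "0 < Dq F (X i y)" for i using gy[OF FV'(2)] by (simp add: X_def)
   obtain a where a: "0 < Dq F (X a q)" "qt.Phi F (X i y) (X a q) <= 3 * Th" using H1[OF F] by blast
   obtain b where b: "0 < Dq F (X b q)" "qt.Phi F (X j y) (X b q) <= 3 * Th" using H1[OF F] by blast
   have "qt.Phi F (X i y) (X j y) <= qt.Phi F (X i y) (X a q) + (qt.Phi F (X a q) (X b q) + qt.Phi F (X b q) (X j y))"
    using qt.Phi_tri[OF FV'(2) XyV yi XqV a(1) XyV yi, of i j] qt.Phi_tri[OF FV'(2) XqV a(1) XqV b(1) XyV yi, of j] by linarith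
   thus ?thesis using a b claim[OF F a(1) b(1)] qt.Phi_sym[of F "X j y" "X b q"] by (simp add: th_def)
  qed
  have "\<exists>g. \<forall>i. g i * (zpow x i)^- : NN & tight y (act (g i) y)"
  proof (rule choice, rule allI)
   fix i
   obtain n where n: "n : NN" "tight y (act n (X i y))" using tight_ex[OF yn(3) XV[OF yn(3)]] .
   have "act n (X i y) = act (n * zpow x i) y" using act_mult[OF yn(3)] by (simp add: X_def)
   thus "\<exists>g. g * (zpow x i)^- : NN & tight y (act g y)" using n by (intro exI[of _ "n * zpow x i"]) (simp add: mult.assoc)
  qed
  then obtain g where g: "\<And>i. g i * (zpow x i)^- : NN" "\<And>i. tight y (act (g i) y)" by blast
  have gs: "Phi F y (act (g i) y) <= 12 * th" if F: "F : Q" for F i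
  proof -
   have FV': "F : V" "F : Ap" using QV QAp F(1) by auto
   have gx: "act (g i) y = act (g i * (zpow x i)^-) (X i y)"
    using act_mult[OF XV[OF yn(3), of i], symmetric] act_mult[OF yn(3), of "g i * (zpow x i)^-" "zpow x i"] by (simp add: X_def mult.assoc)
   have "Dq (X i y) (act (g i) y) = 0"
    unfolding gx using Dq_n[OF XV[OF yn(3)] g(1)] Dq_self[OF XV[OF yn(3)]] by simp
   hence "qt.Phi F y (act (g i) y) = qt.Phi F y (X i y)"
    by (metis qt.Phi_cong FV' XV yn act_V)
   moreover have "qt.Phi F (X 0 y) (X i y) <= 4 * th" by (rule H2[OF F])
   moreover have "0 < Dq F y" "0 < Dq F (act (g i) y)" using gy[OF FV'(2), of 1] gy[OF FV'(2)] act_one[OF yn(3)] by auto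
   ultimately show ?thesis using tight_bar[OF g(2) F _ _ yn(3) act_V[OF yn(3)], of i] X0[OF yn(3)] by simp
  qed
  \<comment> \<open>The defect lies in \<open>NN\<close> and moves a vertex by at most three angles
    of \<open>12 * th\<close>.\<close>
  have hom: "g i * g j * (g (i + j))^- : N" for i j
  proof -
   let ?n = "g i * g j * (g (i + j))^-" and ?w = "act (g (i + j)) y"
   have nw: "act ?n ?w = act (g i) (act (g j) y)"
    using act_mult[OF yn(3), of ?n "g (i + j)"] act_mult[OF yn(3), of "g i" "g j"] by (simp add: mult.assoc)
   have "?n = (g i * (zpow x i)^-) * (zpow x i * (g j * (zpow x j)^-) * (zpow x i)^-) *
     (g (i + j) * (zpow x (i + j))^-)^-"
    by (simp add: mult.assoc zpow_add)
   also have "... : NN" by (rule NNm[OF NNm[OF g(1) NNc[OF g(1)]] NNi[OF g(1)]])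
   finally have nN: "?n : NN" .
   show ?thesis
   proof (rule small_N[OF act_V[OF yn(3)] gyQ nN])
    fix F assume F: "F : Q"
    have FV': "F : V" "F : Ap" using QV QAp F(1) by auto
    have ne: "act h y ~= F" "y ~= F" for h using gyne[OF F] gyne[OF F, of 1] act_one[OF yn(3)] by auto
    have ne2: "act (g i) (act (g j) y) ~= F" using ne act_mult yn by blast
    have "Phi F (act (g i) y) (act (g i) (act (g j) y)) = Phi (act (g i)^- F) y (act (g j) y)"
     using act_Phi' FV' yn act_V act_inv by simp
    hence 1: "Phi F (act (g i) y) (act (g i) (act (g j) y)) <= 12 * th" using gs[OF act_Q[OF F]] by simp
    have "Phi F ?w (act (g i) (act (g j) y)) <= Phi F ?w y + Phi F y (act (g i) (act (g j) y))"
     using triQ FV' act_V yn ne ne2 by simp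
    moreover have "Phi F y (act (g i) (act (g j) y)) <= Phi F y (act (g i) y) + Phi F (act (g i) y) (act (g i) (act (g j) y))"
     using triQ FV' yn act_V ne ne2 by simp
    ultimately show "Phi F ?w (act ?n ?w) <= 50 * th"
     unfolding nw using 1 gs[OF F, of i] gs[OF F, of "i + j"] Phi_sym[of F ?w y] by linarith
   qed
  qed
  note sN = normal_subD(1)[OF N_normal]
  have pw: "g 1 ^ Suc k * (g (int (Suc k)))^- : N" for k
  proof (induction k)
   case 0 show ?case using subgrpD(1)[OF sN] by simp
  next
   case (Suc k)
   have "g 1 ^ Suc (Suc k) * (g (int (Suc (Suc k))))^- =
    (g 1 * (g 1 ^ Suc k * (g (int (Suc k)))^-) * (g 1)^-) * (g 1 * g (int (Suc k)) * (g (1 + int (Suc k)))^-)"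
    by (simp add: mult.assoc)
   also have "... : N" by (metis subgrpD normal_subD N_normal Suc.IH hom)
   finally show ?case .
  qed
  have gm: "g (int m) : N"
  proof (rule small_N[OF yn(3)])
   show "y ~: Q" by (metis gyQ act_one yn)
   have "zpow x (int m) : NN" using xm by (simp add: zpow_of_nat)
   from NNm[OF g(1)[of "int m"] this] show "g (int m) : NN" by (simp add: mult.assoc)
   show "Phi F y (act (g (int m)) y) <= 50 * th" if "F : Q" for F using gs[OF that, of "int m"] by linarith
  qed
  have "g 1 ^ m : N" using subgrpD(2)[OF sN pw[of "m - 1"] , of "g (int m)"] gm m by (simp add: mult.assoc)
  hence "g 1 : NN" using NN_incl tN m by simp
  from NNm[OF NNi[OF g(1)[of 1]] this] show ?thesis by (simp add: mult.assoc)
 qed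
qed

end

section \<open>Colours of elements that fix an apex\<close>

context rotm begin

text \<open>Induction on the certificate of \<open>n\<close>. A large angle at \<open>q\<close>
  between \<open>G\<close> and its image must be shared by both sides as seen from \<open>H\<close>,
  since otherwise a rotation would shorten a tight pair. Then both geodesics from \<open>H\<close>
  pass through \<open>q\<close>, so \<open>a\<close> fixes \<open>q\<close>, and the claim splits
  there into two shorter distances.\<close>

lemma colour_inner:
 assumes r: "red G n" and GQ: "G : Q"
  and col_K: "\<And>q a b. [|q : Q; act a q = q; act b q = q; a * b^- : Kq q|] ==> col q a = (col q b :: nat)"
  and col_conj: "\<And>q a g. [|q : Q; act a q = q|] ==> col (act g q) (g * a * g^-) = col q a"
  and EE: "\<And>q q' a. [|q : Q; q' : Q; q ~= q'; act a q = q; act a q' = q'|] ==> col q a = col q' a"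
  and IH: "\<And>H G a b. [|Dq H G < d; H : Q; G : Q; act a H = H; act b G = G; a * b^- : NN|] ==> col H a = col G b"
  and "n : NN" "H : Q" "H ~= G" "act a H = H" "act b G = G" "a = n * b" "tight H G" "Dq H G = d" "Phi H G (act a G) <= 2 * th"
 shows "col H a = col G b"
 using r assms(7-)
proof (induction arbitrary: H a b)
 case (red_N n)
 have GV: "G : V" "H : V" using QV GQ red_N by auto
 have aG: "act a G = G" using act_mult GV red_N N_triv by simp
 have "col H a = col G a" using EE red_N GQ aG by blast
 moreover have "a * b^- = n" using red_N by (simp add: mult.assoc)
 hence "col G a = col G b" using col_K[OF GQ aG] red_N Kq_N[OF GQ] by auto
 ultimately show ?case by simp
next
 case (red_base k n)
 note p = red_base.prems
 have GV: "G : V" "H : V" using QV GQ p by auto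
 have kG: "act k G = G" "act k^- G = G" using Kq_fix[OF GQ] red_base(2) stab_inv[OF GV(1)] by auto
 note kN = NN_incl(2)[OF red_base(1,2)]
 have aG: "act (k * a * k^-) G = act k (act a G)"
  using act_mult GV kG by simp
 have "col (act k H) (k * a * k^-) = col G (b * k^-)"
 proof (rule red_base.IH[OF NNm[OF kN p(1)] act_Q[OF p(2)]])
  show "act k H ~= G" by (metis act_eq GV kG p)
  show "act (k * a * k^-) (act k H) = act k H" by (metis act_swap GV p)
  show "act (b * k^-) G = G" using act_mult GV kG p by simp
  show "k * a * k^- = k * n * (b * k^-)" by (simp add: p mult.assoc)
  show "tight (act k H) G" by (metis tight_act p GV kG)
  show "Dq (act k H) G = d" by (metis Dq_act GV kG p)
  have "Phi (act k H) (act k G) (act k (act a G)) = Phi H G (act a G)"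
   using act_Phi GV p QAp act_V by blast
  thus "Phi (act k H) G (act (k * a * k^-) G) <= 2 * th" using aG kG p(9) by simp
 qed
 moreover have "col (act k H) (k * a * k^-) = col H a" by (rule col_conj[OF p(2,4)])
 moreover have "col G b = col G (b * k^-)"
 proof (rule col_K[OF GQ p(5)])
  show "act (b * k^-) G = G" using act_mult GV kG p by simp
  have "b * k * b^- : Kq (act b G)" by (rule Kq_conj[OF GQ red_base(2)])
  thus "b * (b * k^-)^- : Kq G" by (simp add: p mult.assoc)
 qed
 ultimately show ?case by simp
next
 case (red_step q n k)
 note p = red_step.prems
 have GV: "G : V" "H : V" "q : V" "q : Ap" "H : Ap" using QV QAp GQ p(2) red_step(1) by auto
 note kq = Kq_fix[OF red_step(1,4)]
 have aG: "act a G = act n G" using act_mult GV p by simp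
 have aV: "act a v : V" if "v : V" for v by (rule act_V[OF that])
 have big: "BIG - 4 * th < Phi q G (act a G)" using red_step(5) aG by simp
 have sm: "Phi q G (act k (act a G)) <= 4 * th" using red_step act_mult GV by simp
 have ne: "G ~= q" "act a G ~= q" using red_step(2,3) aG by auto
 have Hq: "H ~= q"
 proof
  assume "H = q"
  hence "BIG - 4 * th < 2 * th" using big p(9) by simp
  thus False using th_BIG by linarith
 qed
 have knq: "act k v ~= q" "act k^- v ~= q" if "v : V" "v ~= q" for v
  using act_eq[OF that(1) GV(3), of k] act_eq[OF that(1) GV(3), of "k^-"] kq stab_inv[OF GV(3) kq] that by auto
 note triQ[OF GV(4,1,2) aV[OF GV(1)] ne(1) Hq ne(2)]
 hence sum: "BIG - 4 * th < Phi q H G + Phi q H (act a G)" using big Phi_sym by simp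
 note Ha = p(4)
 have tHa: "tight H (act a G)" by (metis tight_act p GV)
 consider "th < Phi q H G" "th < Phi q H (act a G)" | "Phi q H G <= th" | "Phi q H (act a G) <= th" by linarith
 thus ?case
 proof cases
  case 1
  have d1: "D H G = D H q + D q G" using A1Q[OF GV(4,2,1) Hq ne(1)] 1 th_BIG by linarith
  have d2: "D H (act a G) = D H q + D q (act a G)" using A1Q[OF GV(4,2) aV[OF GV(1)] Hq ne(2)] 1 th_BIG by linarith
  have dH: "D H G = d" using p(7,8) by (simp add: tight_def)
  have pos: "0 < D H q" "0 < D q G" using Dpos GV Hq ne by auto
  show ?thesis
  proof (cases "act a q = q")
   case True
   have "Dq H q < d" using Dq_le1[OF GV(3), of H] d1 dH pos by linarith
   hence "col H a = col q a" using IH[OF _ p(2) red_step(1) Ha True] NN1 by simp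
   moreover have "Dq q G < d" using Dq_le1[OF GV(1), of q] d1 dH pos by linarith
   hence "col q a = col G b" using IH[OF _ red_step(1) GQ True p(5)] p(1,6) by (simp add: mult.assoc)
   ultimately show ?thesis by simp
  next
   \<comment> \<open>The apices \<open>q\<close> and \<open>act a q\<close> are at the same distance
     from \<open>H\<close> and from \<open>act a G\<close>; a large angle at \<open>q\<close>
     towards either end would put one strictly behind the other.\<close>
   case False
   have aqH: "act a q ~= H" using act_eq GV Ha Hq by blast
   have aqG: "act a q ~= act a G" using act_eq GV ne by simp
   have e1: "D H (act a q) = D H q" by (metis act_D GV Ha)
   have e2: "D (act a q) (act a G) = D q G" by (rule act_D[OF GV(3,1)])
   have e3: "D H (act a G) = D H G" by (metis act_D GV Ha)
   have pos2: "0 < D q (act a q)" using Dpos[OF GV(3) aV[OF GV(3)]] False by auto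
   note triQ[OF GV(4,2) aV[OF GV(3)] aV[OF GV(1)] Hq False ne(2)]
   then consider "Th < Phi q H (act a q)" | "Th < Phi q (act a q) (act a G)" using 1 th_def by linarith
   thus ?thesis
   proof cases
    case 1
    note A1Q[OF GV(4,2) aV[OF GV(3)] Hq False 1]
    thus ?thesis using e1 pos2 by simp
   next
    case 2
    note A1Q[OF GV(4) aV[OF GV(3)] aV[OF GV(1)] False ne(2) 2]
    hence "D (act a q) q = 0" using e2 e3 d1 d2 by linarith
    thus ?thesis using pos2 D_sym GV aV by simp
   qed
  qed
 next
  case 2
  note triQ[OF GV(4,2,1) act_V[OF aV[OF GV(1)]] Hq ne(1) knq(1)[OF aV[OF GV(1)] ne(2)]]
  moreover have "Phi q H (act a G) <= Phi q H (act k (act a G)) + 4 * th"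
   using tightD tHa red_step Hq ne by simp
  ultimately show ?thesis using 2 sm sum th_BIG by linarith
 next
  case 3
  have "Phi (act k q) (act k (act a G)) (act k (act k^- G)) = Phi q (act a G) (act k^- G)"
   using act_Phi GV act_V by simp
  hence "Phi q (act a G) (act k^- G) <= 4 * th"
   using kq act_inv GV sm Phi_sym by simp
  moreover note triQ[OF GV(4,2) aV[OF GV(1)] act_V[OF GV(1)] Hq ne(2) knq(2)[OF GV(1) ne(1)]]
  moreover have "Phi q H G <= Phi q H (act k^- G) + 4 * th"
   by (metis tightD red_step subgrpD Kq_sub Hq)
  ultimately show ?thesis using 3 sum th_BIG by linarith
 qed
qed

text \<open>Induction on the distance in the quotient. \<open>G\<close> is replaced by a lift that
  is tight with \<open>H\<close>, and \<open>a\<close> is corrected by a rotation about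
  \<open>H\<close>, which keeps its colour, until \<open>H\<close> sees \<open>G\<close> and its
  image under a small angle; this is the situation of \<open>colour_inner\<close>.\<close>

lemma colour:
 assumes col_K: "\<And>q a b. [|q : Q; act a q = q; act b q = q; a * b^- : Kq q|] ==> col q a = (col q b :: nat)"
  and col_conj: "\<And>q a g. [|q : Q; act a q = q|] ==> col (act g q) (g * a * g^-) = col q a"
  and EE: "\<And>q q' a. [|q : Q; q' : Q; q ~= q'; act a q = q; act a q' = q'|] ==> col q a = col q' a"
 shows "[|H : Q; G : Q; act a H = H; act b G = G; a * b^- : NN|] ==> col H a = col G b"
proof (induction "Dq H G" arbitrary: H G a b rule: less_induct)
 case less
 note p = less.prems
 have V: "H : V" "G : V" "H : Ap" using QV QAp p by auto
 have tr: "col (act n G) (n * b * n^-) = col G b & act (n * b * n^-) (act n G) = act n G & a * (n * b * n^-)^- : NN"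
  if n: "n : NN" for n
 proof (intro conjI)
  show "col (act n G) (n * b * n^-) = col G b" by (rule col_conj[OF p(2,4)])
  show "act (n * b * n^-) (act n G) = act n G" by (metis act_swap V p)
  have "a * (n * b * n^-)^- = (a * b^-) * (b * n * b^-) * n^-" by (simp add: mult.assoc)
  also have "... : NN" using NNm p NNc n NNi by simp
  finally show "a * (n * b * n^-)^- : NN" .
 qed
 show ?case
 proof (cases "Dq H G = 0")
  case True
  then obtain n where n: "n : NN" "H = act n G" using Dq0 V by blast
  note t = tr[OF n(1), folded n(2)]
  have fx: "act (a * (n * b * n^-)^-) H = H"
   by (metis act_mult V stab_inv t p)
  have "col H a = col H (n * b * n^-)"
   using col_K p t stabQ fx by blast
  thus ?thesis using t by simp
 next
  case False
  obtain n where n: "n : NN" "tight H (act n G)" using tight_ex[OF V(1,2)] .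
  define G1 where "G1 = act n G"
  define b1 where "b1 = n * b * n^-"
  note t = tr[OF n(1), folded G1_def b1_def] and tight = n(2)[folded G1_def]
  have G1: "G1 : Q" "G1 : V" using act_Q[OF p(2)] QV by (auto simp: G1_def)
  have dH: "Dq H G1 = Dq H G" using Dq_n V n by (simp add: G1_def)
  have DH: "D H G1 = Dq H G" using tight dH by (simp add: tight_def)
  have HG: "H ~= G1" using dH False Dq_self[OF V(1)] by auto
  define m where "m = a * b1^-"
  have mN: "m : NN" using t by (simp add: m_def)
  have aG: "act a G1 = act m G1"
   using act_mult G1 stab_inv t by (simp add: m_def)
  have aGV: "act a G1 : V" by (rule act_V[OF G1(2)])
  have DaG: "D H (act a G1) = Dq H G" by (metis act_D V G1 p DH)
  have q0: "Dq (act a G1) G1 = 0" using aG Dq_n' G1 mN Dq_self by simp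
  have pos: "0 < D H G1" "0 < D H (act a G1)" "0 < Dq H G1" using DH DaG False dH by auto
  obtain e where e: "e : ES H G1" using ES_ne V G1 pos by blast
  obtain e' where e': "e' : ES H (act a G1)" using ES_ne V aGV pos by blast
  have E: "e : qt.ES H G1" using ESq_I V G1 e DH dH by simp
  have "Dq H (act a G1) = Dq H G1" using aG Dq_n G1 mN by simp
  hence "e' : qt.ES H (act a G1)" using ESq_I V aGV e' DaG dH by simp
  hence E': "e' : qt.ES H G1" using qt.ES_cong V aGV G1 q0 by simp
  note nq = qt.same_bd[OF V(3) G1(2) pos(3) E E']
  obtain k where k: "k : NN" "act k H = H" "nu H e (act k e') = nuq H e e'" by (rule nuq_ex[OF V(3)])
  note kK = stabQ[OF p(1) k(1,2)]
  have kaG: "act (k * a) G1 = act k (act a G1)" by (rule act_mult[OF G1(2)])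
  have ke': "act k e' : ES H (act (k * a) G1)" unfolding kaG using act_ES[OF V(3) aGV, of k] k(2) e' by simp
  have "D H (act (k * a) G1) = D H (act a G1)" unfolding kaG using act_D[OF V(1) aGV, of k] k(2) by simp
  hence ph: "Phi H G1 (act (k * a) G1) <= 2 * th"
   using Phi_upper[OF V(3) G1(2) pos(1) act_V[OF G1(2)] _ e ke'] pos nq k(3) th_BIG by (simp add: th_def)
  have kaH: "act (k * a) H = H" using act_mult[OF V(1), of k a] p(3) k(2) by simp
  have "col H (k * a) = col G1 b1"
  proof (rule colour_inner[OF windmill_all[OF G1(2)] G1(1) col_K col_conj EE, where d = "Dq H G" and n = "k * m"])
   show "k * m : NN" "k * m : NN" by (rule NNm[OF k(1) mN])+
   show "k * a = k * m * b1" by (simp add: m_def mult.assoc)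
   show "col H' a' = col G' b'" if "Dq H' G' < Dq H G" "H' : Q" "G' : Q" "act a' H' = H'" "act b' G' = G'" "a' * b'^- : NN"
    for H' G' a' b' by (rule less.hyps[OF that])
  qed (use p(1) HG kaH t tight dH ph in auto)
  moreover have "col H (k * a) = col H a" by (simp add: col_K p kaH kK mult.assoc)
  ultimately show ?thesis using t by simp
 qed
qed

end

section \<open>Projection systems on cosets and chains of words\<close>

definition lm :: "'g::grp => 'g set => 'g set" where "lm g X = (*) g ` X"

lemma lm_lm [simp]: "lm g (lm h X) = lm (g * h) X" by (simp add: lm_def image_image mult.assoc)
lemma lm_1 [simp]: "lm 1 X = X" by (simp add: lm_def)

lemma lm_inj: "lm g X = lm g Z \<longleftrightarrow> X = Z"
proof
 assume "lm g X = lm g Z"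
 hence "lm g^- (lm g X) = lm g^- (lm g Z)" by (rule arg_cong)
 thus "X = Z" by simp
qed simp

lemma lm_stab: assumes E: "subgrp E" shows "lm e E = E \<longleftrightarrow> e : E"
proof
 assume e: "lm e E = E"
 have "e * 1 : lm e E" by (metis lm_def subgrpD E imageI)
 thus "e : E" unfolding e by simp
next
 assume e: "e : E"
 show "lm e E = E"
 proof
  show "lm e E <= E" using subgrpD E e by (auto simp: lm_def)
  show "E <= lm e E"
  proof
   fix x assume "x : E"
   hence "x = e * (e^- * x)" "e^- * x : E" using subgrpD(2)[OF E subgrpD(3)[OF E e]] by auto
   thus "x : lm e E" unfolding lm_def by blast
  qed
 qed
qed

lemma lm_eq: assumes E: "subgrp E" shows "lm g E = lm h E \<longleftrightarrow> h^- * g : E"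
proof -
 have "lm g E = lm h E \<longleftrightarrow> lm h^- (lm g E) = lm h^- (lm h E)" by (rule lm_inj[symmetric])
 thus ?thesis by (simp add: lm_stab E)
qed

definition Yc :: "'g::grp set => 'g set set" where "Yc E = range (\<lambda>g. lm g E)"

lemma Yc_lm: "y : Yc E ==> lm g y : Yc E" by (auto simp: Yc_def)
lemma Yc_I: "lm g E : Yc E" by (auto simp: Yc_def)
lemma Yc_E: "E : Yc E" using Yc_I[of 1 E] by simp
lemma Yc_D: "y : Yc E ==> \<exists>g. y = lm g E" by (auto simp: Yc_def)

locale gsys = sps "Yc E" ang th for E :: "'g::grp set" and ang th +
 assumes E_sub: "subgrp E"
  and ang_inv: "[|y : Yc E; x : Yc E; z : Yc E|] ==> ang (lm g y) (lm g x) (lm g z) = ang y x z"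
begin

lemma ang_bdd: assumes "x : Yc E" "z : Yc E"
 obtains B where "\<And>y. [|y : Yc E; y ~= x; y ~= z|] ==> ang y x z <= B"
proof -
 let ?S = "{y : Yc E - {x, z}. th < ang y x z}"
 have fin: "finite ((\<lambda>y. ang y x z) ` ?S)" using ang_fin[OF assms] by simp
 have "ang y x z <= max th (Max ((\<lambda>y. ang y x z) ` ?S))" if "y : Yc E" "y ~= x" "y ~= z" for y
 proof (cases "th < ang y x z")
  case True
  hence "ang y x z : (\<lambda>y. ang y x z) ` ?S" using that by blast
  thus ?thesis using Max_ge[OF fin] by fastforce
 qed simp
 thus ?thesis using that by blast
qed

lemma ang_inv': assumes "y : Yc E" "x : Yc E" "z : Yc E"
 shows "ang (lm g y) x z = ang y (lm g^- x) (lm g^- z)"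
proof -
 have "ang (lm g y) (lm g (lm g^- x)) (lm g (lm g^- z)) = ang y (lm g^- x) (lm g^- z)"
  using ang_inv assms Yc_lm by blast
 thus ?thesis by simp
qed

text \<open>If a point saw a large angle between two points of a cyclic orbit, then its own translates would
 be lined up, and only two consecutive steps of the orbit could contribute to that angle.\<close>

lemma cyclic_bdd:
 assumes nofix: "\<And>k y. [|k ~= 0; y : Yc E|] ==> lm (zpow g k) y ~= y"
 obtains B where "\<And>a b y. [|y : Yc E; y ~= lm (zpow g a) E; y ~= lm (zpow g b) E|] ==>
  ang y (lm (zpow g a) E) (lm (zpow g b) E) <= B"
proof -
 define u where "u a = lm (zpow g a) E" for a
 define T where "T a y = lm (zpow g a) y" for a y
 have uY: "u a : Yc E" for a by (simp add: u_def Yc_I)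
 have TY: "T a y : Yc E" if "y : Yc E" for a y using Yc_lm[OF that] by (simp add: T_def)
 have TT: "T a (T b y) = T (a + b) y" for a b y by (simp add: T_def zpow_add)
 have T0: "T 0 y = y" for y by (simp add: T_def)
 have Tu: "T a (u b) = u (a + b)" for a b by (simp add: T_def u_def zpow_add)
 have Tang: "ang (T a y) (T a x) (T a z) = ang y x z" if "y : Yc E" "x : Yc E" "z : Yc E" for a y x z
  using ang_inv[OF that] by (simp add: T_def)
 have Tinj: "T a y = T a x \<longleftrightarrow> y = x" for a y x by (simp add: T_def lm_inj)
 have Tne: "T a y ~= T b y" if "y : Yc E" "a ~= b" for a b y
 proof
  assume "T a y = T b y"
  hence "T (- b) (T a y) = T (- b) (T b y)" by simp
  hence "T (a - b) y = y" by (simp add: TT T0)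
  thus False using nofix[of "a - b" y] that by (simp add: T_def)
 qed
 obtain B0 where B0: "\<And>y. [|y : Yc E; y ~= u 0; y ~= u 1|] ==> ang y (u 0) (u 1) <= B0"
  using ang_bdd[OF uY uY] by blast
 have jump: "ang y (u a) (u (a + 1)) <= B0" if "y : Yc E" "y ~= u a" "y ~= u (a + 1)" for y a
 proof -
  have "ang (T (- a) y) (T (- a) (u a)) (T (- a) (u (a + 1))) <= B0"
   unfolding Tu using B0[OF TY[OF that(1)], of "- a"] Tinj[of "- a" y "u a"] Tinj[of "- a" y "u (a + 1)"] that by (simp add: Tu)
  thus ?thesis using Tang[OF that(1) uY uY] by simp
 qed
 define B1 where "B1 = ang (u 0) (u (- 1)) (u 1)"
 \<comment> \<open>Large enough for all losses below: multiples of \<open>th\<close> keep two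
   translates lined up, \<open>B0\<close> bounds a single step of the orbit, and \<open>B1\<close>
   is the angle at an orbit point between its two neighbours.\<close>
 define M where "M = 5 * B0 + 4 * th + B1"
 have jump': "ang y (u a) (u (a + s)) <= B0" if "y : Yc E" "y ~= u a" "y ~= u (a + s)" "s = 1 \<or> s = - 1" for y a s
  using that(4)
 proof
  assume s: "s = - 1"
  have "ang y (u (a + s)) (u (a + s + 1)) <= B0" by (rule jump) (use that s in auto)
  thus ?thesis using ang_sym[OF that(1) uY uY that(2)[symmetric] that(3)[symmetric]] s by simp
 qed (use jump that in auto)
 \<comment> \<open>Under so large an angle \<open>y\<close> and its translate by one step both
   separate the shifted endpoints and are therefore ordered. Moving this order back by one step
   shows that \<open>y\<close> sees the endpoints where it sees its own two translates, up to
   \<open>B0\<close>.\<close>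
 have line: "ang y (u a) (u b) <= ang y (T (- 1) y) (T 1 y) + B0"
  if y: "y : Yc E" "y ~= u a" "y ~= u b" "y ~= u (a + s)" "y ~= u (b + s)" and s: "s = 1 \<or> s = - 1" and big: "M < ang y (u a) (u b)"
  for y a b s
 proof -
  define y1 where "y1 = T s y"
  have y1: "y1 : Yc E" "y1 ~= y" "y1 ~= u (a + s)" "y1 ~= u (b + s)"
   using TY[OF y(1)] Tne[OF y(1), of s 0] T0[of y] s Tinj[of s y "u a"] Tinj[of s y "u b"] y by (auto simp: y1_def Tu add.commute)
  have e1: "ang y1 (u (a + s)) (u (b + s)) = ang y (u a) (u b)"
   unfolding y1_def using Tang[OF y(1) uY uY, of s a b] by (simp add: Tu add.commute)
  have "ang y (u a) (u b) <= ang y (u a) (u (a + s)) + (ang y (u (a + s)) (u (b + s)) + ang y (u (b + s)) (u b))"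
   using ang_tri[OF y(1) uY[of a] uY[of "a + s"] uY[of b]] ang_tri[OF y(1) uY[of "a + s"] uY[of "b + s"] uY[of b]] y by auto
  moreover have "ang y (u (b + s)) (u b) <= B0"
   using jump'[OF y(1,3,5) s] ang_sym[OF y(1) uY uY y(3)[symmetric] y(5)[symmetric]] by simp
  ultimately have e2: "ang y (u a) (u b) <= ang y (u (a + s)) (u (b + s)) + 2 * B0"
   using jump'[OF y(1,2,4) s] by linarith
  have s1: "y : sep (2 * th) (u (a + s)) (u (b + s))" using y e2 big unfolding sep_def M_def by auto
  have s2: "y1 : sep (2 * th) (u (a + s)) (u (b + s))" using y1 e1 big unfolding sep_def M_def by auto
  have bk: "T (- s) (u (a + s)) = u a" "T (- s) (u (b + s)) = u b" "T (- s) y1 = y" by (simp_all add: Tu y1_def TT T0)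
  have tri: "ang y (u a) (u b) <= ang y (T (- s) y) (T s y) + B0"
  proof -
   from sep_total[OF _ uY uY s1 s2] y1(2) consider
    "y1 : sep (2 * th) y (u (b + s))" "y : sep (2 * th) (u (a + s)) y1" | "y1 : sep (2 * th) (u (a + s)) y" "y : sep (2 * th) y1 (u (b + s))" by auto
   thus ?thesis
   proof cases
    case 1
    have z1: "ang y y1 (u (b + s)) = 0" using sep_zero[OF _ y(1) uY 1(1)] by simp
    have "ang y1 (u (a + s)) y = 0" using sep_zero[OF _ uY y1(1) 1(2)] by simp
    hence "ang (T (- s) y1) (T (- s) (u (a + s))) (T (- s) y) = 0" using Tang[OF y1(1) uY y(1)] by simp
    hence z2: "ang y (u a) (T (- s) y) = 0" unfolding bk .
    have ne: "T (- s) y ~= y" using Tne[OF y(1), of "- s" 0] T0 s by auto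
    have "ang y (u a) (u b) <= ang y (u a) (T (- s) y) + ang y (T (- s) y) (u b)"
     by (rule ang_tri[OF y(1) uY TY[OF y(1)] uY]) (use y ne in auto)
    also have "ang y (T (- s) y) (u b) <= ang y (T (- s) y) y1 + ang y y1 (u b)"
     by (rule ang_tri[OF y(1) TY[OF y(1)] y1(1) uY]) (use y ne y1 in auto)
    also have "ang y y1 (u b) <= ang y y1 (u (b + s)) + ang y (u (b + s)) (u b)"
     by (rule ang_tri[OF y(1) y1(1) uY uY]) (use y y1 in auto)
    finally show ?thesis using z1 z2 \<open>ang y (u (b + s)) (u b) <= B0\<close> unfolding y1_def by linarith
   next
    case 2
    have z1: "ang y (u (a + s)) y1 = 0" using sep_zero[OF _ uY y(1) 2(1)] ang_sym[OF y(1) uY y1(1)] y y1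
     by (metis Tang ang_strong' sepD 2 uY le_add_same_cancel2 mult_2 order_le_less_trans zero_le)
    have "ang y1 y (u (b + s)) = 0" using sep_zero[OF _ y1(1) uY 2(2)] by simp
    hence "ang (T (- s) y1) (T (- s) y) (T (- s) (u (b + s))) = 0" using Tang[OF y1(1) y(1) uY] by simp
    hence z2: "ang y (T (- s) y) (u b) = 0" unfolding bk .
    have ne: "T (- s) y ~= y" using Tne[OF y(1), of "- s" 0] T0 s by auto
    have "ang y (u a) (u b) <= ang y (u a) (u (a + s)) + ang y (u (a + s)) (u b)"
     by (rule ang_tri[OF y(1) uY uY uY]) (use y in auto)
    also have "ang y (u (a + s)) (u b) <= ang y (u (a + s)) y1 + ang y y1 (u b)"
     by (rule ang_tri[OF y(1) uY y1(1) uY]) (use y y1 in auto)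
    also have "ang y y1 (u b) <= ang y y1 (T (- s) y) + ang y (T (- s) y) (u b)"
     by (rule ang_tri[OF y(1) y1(1) TY[OF y(1)] uY]) (use y y1 ne in auto)
    finally show ?thesis using z1 z2 jump'[OF y(1,2,4) s] ang_sym[OF y(1) y1(1) TY[OF y(1), of "- s"]] ne y1 unfolding y1_def by linarith
   qed
  qed
  have "ang y (T (- s) y) (T s y) = ang y (T (- 1) y) (T 1 y)"
   using s ang_sym[OF y(1) TY[OF y(1), of 1] TY[OF y(1), of "- 1"]] Tne[OF y(1), of 1 0] Tne[OF y(1), of "- 1" 0] T0 by auto
  thus ?thesis using tri by simp
 qed
 \<comment> \<open>For an orbit point the shifted endpoints must not hit it; both directions fail
   only if the endpoints are its two neighbours, which \<open>B1\<close> covers.\<close>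
 have special: "ang (u 0) (u a) (u b) <= M" if "u 0 ~= u a" "u 0 ~= u b" for a b
 proof (rule ccontr)
  assume c: "\<not> ?thesis"
  have une: "u 0 ~= u c \<longleftrightarrow> c ~= 0" for c using Tne[OF uY[of 0], of c 0] by (cases "c = 0") (simp_all add: Tu)
  consider s where "s = 1 \<or> s = - 1" "a + s ~= 0" "b + s ~= 0" | "a = - 1" "b = 1" | "a = 1" "b = - 1"
  proof -
   have "(a + 1 ~= 0 & b + 1 ~= 0) \<or> (a + - 1 ~= 0 & b + - 1 ~= 0) \<or> (a = - 1 & b = 1) \<or> (a = 1 & b = - 1)" by presburger
   thus thesis using that by blast
  qed
  thus False
  proof cases
   case 1
   have "ang (u 0) (u a) (u b) <= ang (u 0) (T (- 1) (u 0)) (T 1 (u 0)) + B0"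
    by (rule line[OF uY that _ _ 1(1)]) (use 1 une c in auto)
   thus False using c by (simp add: Tu M_def B1_def)
  next
   case 2 thus ?thesis using c by (simp add: M_def B1_def)
  next
   case 3
   have "u 1 ~= u 0" "u (- 1) ~= u 0" using une[of 1] une[of "- 1"] by auto
   thus ?thesis using 3 c ang_sym[OF uY[of 0] uY[of 1] uY[of "- 1"]] by (simp add: M_def B1_def)
  qed
 qed
 have general: "ang y (u a) (u b) <= M" if y: "y : Yc E" "\<And>c. y ~= u c" and ab: "a <= b" for y a b
 proof (rule ccontr)
  assume c: "\<not> ?thesis"
  hence lam: "M < ang y (T (- 1) y) (T 1 y) + B0"
   using line[OF y(1) y(2) y(2) y(2) y(2), of 1 a b] by simp
  define l where "l = ang y (T (- 1) y) (T 1 y)"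
  have l: "2 * th + 2 * B0 < l" using lam unfolding l_def M_def by linarith
  have TyT: "T i y ~= y" if "i ~= 0" for i using Tne[OF y(1), of i 0] that T0 by auto
  have inl: "ang y (T 1 y) (T (- int (Suc n)) y) = l" for n
  proof (induction n)
   case 0
   show ?case using ang_sym[OF y(1) TY[OF y(1)] TY[OF y(1)], of 1 "- 1"] TyT by (simp add: l_def)
  next
   case (Suc n)
   let ?z = "T (- int (Suc (Suc n))) y"
   have "ang (T (- 1) y) (T (- 1) (T 1 y)) (T (- 1) (T (- int (Suc n)) y)) = l"
    using Tang[OF y(1) TY[OF y(1)] TY[OF y(1)]] Suc.IH by simp
   hence "ang (T (- 1) y) y ?z = l" by (simp add: TT T0)
   hence "ang y ?z (T (- 1) y) = 0"
    using ang_strong'[OF y(1) TY[OF y(1), of "- 1"] TY[OF y(1), of "- int (Suc (Suc n))"]]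
     Tne[OF y(1), of "- int (Suc (Suc n))" "- 1"] TyT[of "- 1"] TyT[of "- int (Suc (Suc n))"] l by auto
   hence "ang y (T 1 y) ?z = ang y (T 1 y) (T (- 1) y)"
    using ang_zero_cong'[OF y(1) TY[OF y(1)] TY[OF y(1)] TY[OF y(1)], of "- int (Suc (Suc n))" "- 1" 1]
     TyT[of "- 1"] TyT[of "- int (Suc (Suc n))"] TyT[of 1] by auto
   thus ?case using ang_sym[OF y(1) TY[OF y(1)] TY[OF y(1)], of 1 "- 1"] TyT by (simp add: l_def)
  qed
  define S where "S = {j. 0 < ang y (u j) (u (j + 1))}"
  \<comment> \<open>In the frame of \<open>z i\<close> the step of index \<open>i\<close> becomes
    the step from \<open>u 0\<close> to \<open>u 1\<close>. For two steps with an index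
    \<open>m\<close> strictly between them, \<open>z m\<close> lies between \<open>z j\<close> and
    \<open>z k\<close> and hides that step from one of them.\<close>
  have two: False if jk: "j : S" "k : S" "j + 2 <= k" for j k
  proof -
   define z where "z i = T (- i) y" for i
   have zY: "z i : Yc E" for i using TY[OF y(1)] by (simp add: z_def)
   have zu: "z i ~= u c" for i c
   proof
    assume "z i = u c"
    hence "T i (z i) = T i (u c)" by simp
    thus False using y(2)[of "i + c"] by (simp add: z_def TT T0 Tu)
   qed
   have za: "ang (z i) (u 0) (u 1) = ang y (u i) (u (i + 1))" for i
    using Tang[OF y(1) uY uY, of "- i" i "i + 1"] by (simp add: Tu z_def)
   have zne: "z i ~= z i'" if "i ~= i'" for i i' using Tne[OF y(1), of "- i" "- i'"] that by (simp add: z_def)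
   define m where "m = j + 1"
   have "ang (T (- m) y) (T (- m) (T 1 y)) (T (- m) (T (- int (Suc (nat (k - m - 1)))) y)) = l"
    unfolding Tang[OF y(1) TY[OF y(1)] TY[OF y(1)]] by (rule inl)
   hence "ang (T (- m) y) (T (- m + 1) y) (T (- m + - int (Suc (nat (k - m - 1)))) y) = l" unfolding TT .
   moreover have "- m + 1 = - j" "- m + - int (Suc (nat (k - m - 1))) = - k" using jk by (auto simp: m_def)
   ultimately have mid: "ang (z m) (z j) (z k) = l" by (simp add: z_def)
   have ne: "z j ~= z m" "z k ~= z m" using zne jk by (auto simp: m_def)
   have B: "ang (z m) (u 0) (u 1) <= B0" by (rule B0[OF zY zu zu])
   have far: False if i: "i : S" "z i ~= z m" and b: "th + B0 < ang (z m) (u 0) (z i)" for i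
   proof -
    have "ang (z m) (u 0) (z i) <= ang (z m) (u 0) (u 1) + ang (z m) (u 1) (z i)"
     by (rule ang_tri[OF zY uY uY zY]) (use zu zu[symmetric] i in auto)
    hence b1: "th < ang (z m) (u 1) (z i)" using b B by linarith
    have b0: "th < ang (z m) (u 0) (z i)" using b by linarith
    have 0: "ang (z i) (u 0) (z m) = 0" by (rule ang_strong[OF uY zY zY _ i(2) _ b0]) (use zu[symmetric] in auto)
    have 1: "ang (z i) (u 1) (z m) = 0" by (rule ang_strong[OF uY zY zY _ i(2) _ b1]) (use zu[symmetric] in auto)
    have "ang (z i) (u 0) (u 1) <= ang (z i) (u 0) (z m) + ang (z i) (z m) (u 1)"
     by (rule ang_tri[OF zY uY zY uY]) (use zu[symmetric] i in auto)
    moreover have "ang (z i) (z m) (u 1) = ang (z i) (u 1) (z m)"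
     by (rule ang_sym[OF zY zY uY]) (use zu[symmetric] i in auto)
    ultimately show False using 0 1 i(1) za[of i] by (simp add: S_def)
   qed
   have "ang (z m) (z j) (z k) <= ang (z m) (z j) (u 0) + ang (z m) (u 0) (z k)"
    using ang_tri zY uY ne zu by blast
   moreover have "ang (z m) (z j) (u 0) = ang (z m) (u 0) (z j)"
    using ang_sym zY uY ne zu by blast
   ultimately show False using far[OF jk(1) ne(1)] far[OF jk(2) ne(2)] mid l by linarith
  qed
  have card: "card (S \<inter> {a..<b}) <= 2" for b
  proof (rule card_le_2)
   fix i j k assume "i : S \<inter> {a..<b}" "j : S \<inter> {a..<b}" "k : S \<inter> {a..<b}" "i ~= j" "j ~= k" "i ~= k"
   thus False using two[of i j] two[of j i] two[of i k] two[of k i] two[of j k] two[of k j] by force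
  qed simp
  have "ang y (u a) (u b) <= B0 * card (S \<inter> {a..<b})"
   using ab
  proof (induction b rule: int_ge_induct)
   case base show ?case using ang_self[OF y(1) uY] y(2)[symmetric] by simp
  next
   case (step i)
   have t: "ang y (u a) (u (i + 1)) <= ang y (u a) (u i) + ang y (u i) (u (i + 1))"
    by (rule ang_tri[OF y(1) uY uY uY]) (use y(2)[symmetric] in auto)
   show ?case
   proof (cases "i : S")
    case True
    hence "S \<inter> {a..<i + 1} = insert i (S \<inter> {a..<i})" using step.hyps by auto
    hence "card (S \<inter> {a..<i + 1}) = Suc (card (S \<inter> {a..<i}))" by simp
    thus ?thesis using t step.IH jump[OF y(1,2,2), of i] by simp
   next
    case False
    hence "S \<inter> {a..<i + 1} = S \<inter> {a..<i}" by (auto simp: less_le)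
    thus ?thesis using t step.IH False by (simp add: S_def)
   qed
  qed
  also have "... <= B0 * 2" using card by simp
  finally show False using c unfolding M_def by linarith
 qed
 have fin: "ang y (u a) (u b) <= M" if y: "y : Yc E" "y ~= u a" "y ~= u b" for y a b
 proof (cases "\<exists>c. y = u c")
  case True
  then obtain c where yc: "y = u c" by blast
  have ne: "u 0 ~= u (a - c)" "u 0 ~= u (b - c)"
   using y Tinj[of c "u 0" "u (a - c)"] Tinj[of c "u 0" "u (b - c)"] by (auto simp: Tu yc)
  have "ang (T c (u 0)) (T c (u (a - c))) (T c (u (b - c))) <= M"
   using special ne Tang uY by simp
  thus ?thesis by (simp add: Tu yc)
 next
  case False
  hence n: "\<And>c. y ~= u c" by blast
  show ?thesis
  proof (cases "a <= b")
   case True thus ?thesis using general[OF y(1) n] by blast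
  next
   case False
   thus ?thesis using general[OF y(1) n, of b a] ang_sym[OF y(1) uY uY, of a b] y by auto
  qed
 qed
 show ?thesis by (rule that[of M, folded u_def]) (rule fin)
qed

end

text \<open>Sequences that turn by a large angle at each of their interior points.\<close>

locale spc = sps Y ang th for Y :: "'y set" and ang th +
 fixes B K kap :: nat
 assumes csts: "B + th <= K" "2 * th <= K" "K + th <= kap" "2 * B <= kap"
begin

definition lgeo :: "(nat => 'y) => nat => bool" where
 "lgeo f n \<longleftrightarrow> (ALL i<=n. f i : Y) &
   (\<forall>i<n. f i ~= f (Suc i) & (ALL w:Y. w ~= f i --> w ~= f (Suc i) --> ang w (f i) (f (Suc i)) <= B)) &
   (\<forall>i. Suc i < n --> kap < ang (f (Suc i)) (f i) (f (Suc (Suc i))))"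

lemma lgeoD: assumes "lgeo f n"
 shows "\<And>i. i <= n ==> f i : Y" "\<And>i. i < n ==> f i ~= f (Suc i)"
  "\<And>i w. i < n ==> w : Y ==> w ~= f i ==> w ~= f (Suc i) ==> ang w (f i) (f (Suc i)) <= B"
  "\<And>i. Suc i < n ==> kap < ang (f (Suc i)) (f i) (f (Suc (Suc i)))"
 using assms by (auto simp: lgeo_def)

lemma lgeo_sub: assumes f: "lgeo f n" and "b <= n" "a <= b" shows "lgeo (\<lambda>i. f (a + i)) (b - a)"
 unfolding lgeo_def using lgeoD[OF f] assms(2,3) by (auto simp: less_diff_conv)

lemma lgeo_rev: assumes f: "lgeo f n" shows "lgeo (\<lambda>i. f (n - i)) n"
 unfolding lgeo_def
proof (intro conjI allI impI ballI)
 fix i assume "i <= n" thus "f (n - i) : Y" using lgeoD(1)[OF f] by simp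
next
 fix i assume i: "i < n"
 hence e: "n - i = Suc (n - Suc i)" by simp
 have l: "n - Suc i < n" using i by simp
 show "f (n - i) ~= f (n - Suc i)" unfolding e using lgeoD(2)[OF f l] by simp
 fix w assume w: "w : Y" "w ~= f (n - i)" "w ~= f (n - Suc i)"
 have "ang w (f (n - Suc i)) (f (Suc (n - Suc i))) <= B" by (rule lgeoD(3)[OF f l]) (use w e in auto)
 moreover have "f (n - Suc i) : Y" "f (n - i) : Y" using lgeoD(1)[OF f] by auto
 ultimately show "ang w (f (n - i)) (f (n - Suc i)) <= B" using ang_sym w e by simp
next
 fix i assume i: "Suc i < n"
 define j where "j = n - Suc (Suc i)"
 have e: "n - i = Suc (Suc j)" "n - Suc i = Suc j" "n - Suc (Suc i) = j" "Suc j < n" using i by (auto simp: j_def)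
 note lgeoD(4)[OF f e(4)]
 moreover have "f j : Y" "f (Suc j) : Y" "f (Suc (Suc j)) : Y" using lgeoD(1)[OF f] e(4) by auto
 moreover have "f j ~= f (Suc j)" "f (Suc j) ~= f (Suc (Suc j))" using lgeoD(2)[OF f] e(4) by auto
 ultimately show "kap < ang (f (n - Suc i)) (f (n - i)) (f (n - Suc (Suc i)))" using e ang_sym by simp
qed

text \<open>By induction the last corner sees the start where it sees its predecessor, so its angle
  is undiminished when measured from the start, and the strong axiom passes this on to the next
  point.\<close>

lemma lgeo_end: "lgeo f (Suc n) ==> f 0 ~= f (Suc n) & ang (f (Suc n)) (f 0) (f n) = 0"
proof (induction n)
 case 0
 have "f 0 : Y" "f (Suc 0) : Y" "f 0 ~= f (Suc 0)" using lgeoD(1,2)[OF 0] by auto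
 thus ?case using ang_self by simp
next
 case (Suc n)
 have "lgeo f (Suc n)" using lgeo_sub[OF Suc.prems, of "Suc n" 0] by simp
 note IH = Suc.IH[OF this]
 have Y: "f 0 : Y" "f n : Y" "f (Suc n) : Y" "f (Suc (Suc n)) : Y" using lgeoD(1)[OF Suc.prems] by auto
 have ne: "f n ~= f (Suc n)" "f (Suc n) ~= f (Suc (Suc n))" using lgeoD(2)[OF Suc.prems] by auto
 have "kap < ang (f (Suc n)) (f n) (f (Suc (Suc n)))" by (rule lgeoD(4)[OF Suc.prems]) simp
 hence big: "kap < ang (f (Suc n)) (f 0) (f (Suc (Suc n)))"
  using ang_zero_cong[OF Y(3,1,2,4)] IH ne by simp
 have ne2: "f 0 ~= f (Suc (Suc n))" using big ang_self[OF Y(3,1)] IH by auto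
 moreover have "ang (f (Suc (Suc n))) (f 0) (f (Suc n)) = 0"
  by (rule ang_strong[OF Y(1,3,4)]) (use IH ne ne2 big csts in auto)
 ultimately show ?case by simp
qed

lemma lgeo_ne: "lgeo f n ==> i < j ==> j <= n ==> f i ~= f j"
 using lgeo_end[of "\<lambda>l. f (i + l)" "j - i - 1"] lgeo_sub[of f n j i] by (simp add: Suc_diff_Suc)

lemma lgeo_before: assumes f: "lgeo f n" and i: "0 < i" "i <= n" shows "ang (f i) (f 0) (f (i - 1)) = 0"
 using lgeo_end[of f "i - 1"] lgeo_sub[OF f i(2), of 0] i by simp

lemma lgeo_after: assumes f: "lgeo f n" and i: "i < n" shows "ang (f i) (f n) (f (Suc i)) = 0"
 using lgeo_before[OF lgeo_rev[OF f], of "n - i"] i by (simp add: Suc_diff_Suc Suc_leI)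

lemma lgeo_ang: assumes f: "lgeo f n" and i: "0 < i" "i < n"
 shows "ang (f i) (f 0) (f n) = ang (f i) (f (i - 1)) (f (Suc i))" "kap < ang (f i) (f 0) (f n)"
proof -
 have Y: "f 0 : Y" "f n : Y" "f i : Y" "f (i - 1) : Y" "f (Suc i) : Y" using lgeoD(1)[OF f] i by auto
 have ne: "f 0 ~= f i" "f n ~= f i" "f (i - 1) ~= f i" "f (Suc i) ~= f i"
  using lgeo_ne[OF f, of 0 i] lgeo_ne[OF f, of i n] lgeo_ne[OF f, of "i - 1" i] lgeo_ne[OF f, of i "Suc i"] i by auto
 have "ang (f i) (f 0) (f n) = ang (f i) (f (i - 1)) (f n)"
  by (rule ang_zero_cong[OF Y(3,1,4,2)]) (use ne lgeo_before[OF f] i in auto)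
 also have "... = ang (f i) (f (i - 1)) (f (Suc i))"
  by (rule ang_zero_cong'[OF Y(3,2,5,4)]) (use ne lgeo_after[OF f] i in auto)
 finally show "ang (f i) (f 0) (f n) = ang (f i) (f (i - 1)) (f (Suc i))" .
 thus "kap < ang (f i) (f 0) (f n)" using lgeoD(4)[OF f, of "i - 1"] i by simp
qed

text \<open>Seen from \<open>w\<close>, the direction changes at one step only: after the last index
  that looks like the start, the next point already looks like the end, by
  \<open>ang_bet\<close>.\<close>

lemma lgeo_off: assumes f: "lgeo f n" and n: "0 < n" and w: "w : Y" "\<And>i. i <= n ==> w ~= f i"
 shows "ang w (f 0) (f n) <= B"
proof -
 note Y = lgeoD(1)[OF f]
 define S where "S = {i. i <= n & ang w (f 0) (f i) = 0}"
 have S: "finite S" "0 : S" using ang_self[OF w(1) Y[of 0]] w(2)[of 0] by (auto simp: S_def)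
 define i where "i = Max S"
 have iS: "i : S" using Max_in S by (auto simp: i_def)
 hence i: "i <= n" "ang w (f 0) (f i) = 0" by (auto simp: S_def)
 show ?thesis
 proof (cases "i = n")
  case False
  hence lt: "i < n" using i by simp
  have nS: "Suc i ~: S" using Max_ge[OF S(1), of "Suc i"] by (auto simp: i_def)
  hence nz: "ang w (f 0) (f (Suc i)) ~= 0" using lt by (auto simp: S_def)
  have wne: "f j ~= w" if "j <= n" for j using w(2)[OF that] by auto
  have z: "ang w (f (Suc i)) (f n) = 0"
  proof (cases "Suc i = n")
   case True thus ?thesis using ang_self w Y wne by simp
  next
   case False
   hence l: "0 < Suc i" "Suc i < n" using lt by auto
   have "ang w (f 0) (f (Suc i)) = 0 \<or> ang w (f (Suc i)) (f n) = 0"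
    by (rule ang_bet) (use Y lt w lgeo_ang(2)[OF f l] csts lgeo_ne[OF f, of 0 "Suc i"] lgeo_ne[OF f l(2)] in auto)
   thus ?thesis using nz by simp
  qed
  have "ang w (f 0) (f n) <= ang w (f 0) (f i) + ang w (f i) (f n)"
   by (rule ang_tri[OF w(1) Y Y Y]) (use wne i in auto)
  also have "ang w (f i) (f n) <= ang w (f i) (f (Suc i)) + ang w (f (Suc i)) (f n)"
   using ang_tri w Y wne lt by simp
  also have "ang w (f i) (f (Suc i)) <= B" by (rule lgeoD(3)[OF f lt w(1)]) (use w(2) lt in auto)
  finally show ?thesis using i z by simp
 qed (use i in simp)
qed

lemma lgeo_sep: assumes f: "lgeo f n" and n: "0 < n" and K': "B <= K'" "K' <= kap"
 shows "sep K' (f 0) (f n) = f ` {1..<n}"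
proof
 show "sep K' (f 0) (f n) <= f ` {1..<n}"
 proof
  fix w assume "w : sep K' (f 0) (f n)"
  hence w: "w : Y" "w ~= f 0" "w ~= f n" "K' < ang w (f 0) (f n)" by (auto simp: sep_def)
  then obtain i where i: "i <= n" "w = f i" using lgeo_off[OF f n w(1)] K' by fastforce
  have "i ~= 0" "i ~= n" using w(2,3) unfolding i(2) by metis+
  thus "w : f ` {1..<n}" using i by auto
 qed
 show "f ` {1..<n} <= sep K' (f 0) (f n)"
 proof
  fix w assume "w : f ` {1..<n}"
  then obtain i where "i : {1..<n}" "w = f i" by blast
  hence i: "0 < i" "i < n" "w = f i" by auto
  have "f i ~= f 0" using lgeo_ne[OF f, of 0 i] i by simp
  moreover have "f i ~= f n" using lgeo_ne[OF f i(2)] by simp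
  moreover have "K' < ang (f i) (f 0) (f n)" using lgeo_ang(2)[OF f i(1,2)] K' by linarith
  ultimately show "w : sep K' (f 0) (f n)" unfolding sep_def i(3) using lgeoD(1)[OF f, of i] i by simp
 qed
qed

lemma lgeo_card: assumes f: "lgeo f n" and n: "0 < n" and K': "B <= K'" "K' <= kap"
 shows "Suc (card (sep K' (f 0) (f n))) = n"
proof -
 have "inj_on f {1..<n}"
 proof (rule inj_onI)
  fix i j assume ij: "i : {1..<n}" "j : {1..<n}" "f i = f j"
  show "i = j" using lgeo_ne[OF f, of i j] lgeo_ne[OF f, of j i] ij by (cases i j rule: linorder_cases) auto
 qed
 hence "card (f ` {1..<n}) = n - 1" by (simp add: card_image)
 thus ?thesis using lgeo_sep[OF assms] n by simp
qed

text \<open>The interior points are the separators of the ends, which fixes their number; the first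
  of them is the one that no other separates from the start.\<close>

lemma lgeo_unique: "[|lgeo f n; lgeo h m; f 0 = h 0; f n = h m; i <= n|] ==> n = m & f i = h i"
proof (induction n arbitrary: f h m i)
 case 0
 have "m = 0" using lgeo_ne[OF 0(2), of 0 m] 0 by (cases "m = 0") auto
 thus ?case using 0 by simp
next
 case (Suc n)
 have m0: "m ~= 0" using lgeo_ne[OF Suc.prems(1), of 0 "Suc n"] Suc.prems by (cases "m = 0") auto
 have KK: "B <= kap" using csts by auto
 have nm: "Suc n = m" using lgeo_card[OF Suc.prems(1) _ KK] lgeo_card[OF Suc.prems(2) _ KK] m0 Suc.prems(3,4) by simp
 have f1: "f 1 = h 1"
 proof (cases "n = 0")
  case True thus ?thesis using Suc.prems nm by simp
 next
  case False
  hence "f 1 : f ` {1..<Suc n}" by auto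
  hence "f 1 : h ` {1..<m}" using lgeo_sep[OF Suc.prems(1) _ KK] lgeo_sep[OF Suc.prems(2) _ KK] m0 Suc.prems(3,4) by simp
  then obtain j where j: "1 <= j" "j < m" "f 1 = h j" by auto
  have "j = 1"
  proof (rule ccontr)
   assume "j ~= 1"
   hence "h 1 : h ` {1..<j}" using j by auto
   moreover have "lgeo h j" using lgeo_sub[OF Suc.prems(2), of j 0] j by simp
   hence "sep kap (h 0) (h j) = h ` {1..<j}" using lgeo_sep[OF _ _ KK] j by simp
   moreover have "lgeo f 1" using lgeo_sub[OF Suc.prems(1), of 1 0] by simp
   hence "sep kap (f 0) (f 1) = {}" using lgeo_sep KK by simp
   ultimately show False using j Suc.prems(3) by simp
  qed
  thus ?thesis using j by simp
 qed
 have lf: "lgeo (\<lambda>i. f (1 + i)) n" using lgeo_sub[OF Suc.prems(1), of "Suc n" 1] by simp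
 have lh: "lgeo (\<lambda>i. h (1 + i)) n" using lgeo_sub[OF Suc.prems(2), of m 1] nm by auto
 have "f (1 + j) = h (1 + j)" if "j <= n" for j
  using Suc.IH[OF lf lh _ _ that] f1 Suc.prems(4) nm by auto
 hence "f i = h i" using Suc.prems(3,5) by (cases i) auto
 thus ?case using nm by simp
qed

end

definition pwr :: "'g::grp => 'g set => 'g set" where
 "pwr r N = {x. \<exists>i. (zpow r i)^- * x : N}"

lemma pwr_I: "subgrp N ==> zpow r i : pwr r N"
proof -
 assume "subgrp N"
 hence "(zpow r i)^- * zpow r i : N" using subgrpD(1) by simp
 thus ?thesis unfolding pwr_def by blast
qed

lemma pwr_N: "x : N ==> x : pwr r N"
proof -
 assume "x : N"
 hence "(zpow r 0)^- * x : N" by simp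
 thus ?thesis unfolding pwr_def by blast
qed

lemma pwr_sub: assumes N: "normal_sub N" shows "subgrp (pwr r N)"
proof -
 note sg = normal_subD(1)[OF N]
 show ?thesis unfolding subgrp_def
 proof (intro conjI ballI)
  show "1 : pwr r N" by (rule pwr_N[OF subgrpD(1)[OF sg]])
  fix x assume "x : pwr r N"
  then obtain i where i: "(zpow r i)^- * x : N" by (auto simp: pwr_def)
  have "((zpow r i)^- * x)^- : N" by (rule subgrpD(3)[OF sg i])
  hence "zpow r i * ((zpow r i)^- * x)^- * (zpow r i)^- : N" by (rule normal_subD(2)[OF N])
  hence "(zpow r (- i))^- * x^- : N" by (simp add: zpow_minus mult.assoc)
  thus "x^- : pwr r N" by (auto simp: pwr_def)
  fix y assume "y : pwr r N"
  then obtain j where j: "(zpow r j)^- * y : N" by (auto simp: pwr_def)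
  have "(zpow r j)^- * ((zpow r i)^- * x) * (zpow r j)^-^- : N" by (rule normal_subD(2)[OF N i])
  hence "(zpow r j)^- * ((zpow r i)^- * x) * zpow r j * ((zpow r j)^- * y) : N"
   using subgrpD(2)[OF sg _ j] by simp
  hence "(zpow r (i + j))^- * (x * y) : N" by (simp add: zpow_add mult.assoc)
  thus "x * y : pwr r N" by (auto simp: pwr_def)
 qed
qed

section \<open>Chains of words: steps, corners and rotation numbers\<close>

locale wds = gsys E ang th for E :: "'g::grp set" and ang th +
 fixes P N0 N :: "'g set" and r t g p0 :: 'g and k :: nat
 assumes P_sub: "subgrp P" and N_normal: "normal_sub N" and PN: "P \<inter> N = N0"
  and E_eq: "E = pwr r N"
  and rot: "\<exists>m0. \<forall>m. int m0 <= \<bar>m\<bar> --> (ALL x:Yc E. x ~= E --> (M::nat) < ang E x (lm (zpow r m) x))"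
  and BP: "\<exists>B. ALL p:P - N0. lm p E ~= E & (ALL y:Yc E. y ~= E --> y ~= lm p E --> ang y E (lm p E) <= B)"
  and tE: "t ~: E"
  and gfix: "[|j ~= 0; y : Yc E|] ==> lm (zpow g j) y ~= y"
  and p0: "p0 : P" "p0 ~: N0"
  and kbig: "120001 <= k"
begin

lemmas sN = normal_subD(1)[OF N_normal]

lemma N0: "x : N0 \<longleftrightarrow> x : P & x : N" using PN by blast

lemma N0_sub: "subgrp N0"
 using N0 P_sub sN by (simp add: subgrp_def)

lemma Nc: "x : N ==> y * x * y^- : N" by (rule normal_subD(2)[OF N_normal])
lemma Nc': "x : N ==> y^- * x * y : N" using Nc[of x "y^-"] by simp
lemma Nm: "x : N ==> y : N ==> x * y : N" by (rule subgrpD(2)[OF sN])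
lemma Ni: "x : N ==> x^- : N" by (rule subgrpD(3)[OF sN])

lemma rE: "zpow r i : E" by (simp add: E_eq pwr_I sN)
lemma NE: "x : N ==> x : E" unfolding E_eq by (rule pwr_N)

lemma lm_E: "e : E ==> lm (x * e) E = lm x E"
 by (metis lm_lm lm_stab E_sub)

lemma lm_r: "lm (x * zpow r i) E = lm x E" by (rule lm_E[OF rE])

lemma lm_N: "n : N ==> lm (x * n * y) E = lm (x * y) E"
 using lm_E[OF NE[OF Nc'[of n y]], of "x * y"] by (simp add: mult.assoc)

text \<open>The steps between consecutive cosets: \<open>t\<close> and its inverse along a chain,
  \<open>P\<close> at its left end, powers of \<open>g\<close> at its right end.\<close>

definition Sg :: "'g set" where
 "Sg = {t, t^-} \<union> (P - N0) \<union> {zpow g j |j. j ~= 0}"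

lemma Sg_cases: "s : Sg ==> s = t \<or> s = t^- \<or> s : P - N0 \<or> (\<exists>j. j ~= 0 & s = zpow g j)"
 unfolding Sg_def by blast

lemma Sg_inv: "s : Sg ==> s^- : Sg"
proof -
 assume s: "s : Sg"
 consider "s = t" | "s = t^-" | "s : P - N0" | j where "j ~= 0" "s = zpow g j" using Sg_cases[OF s] by blast
 thus ?thesis
 proof cases
  case 3
  thus ?thesis by (simp add: subgrp_inv_iff P_sub N0_sub Sg_def)
 next
  case 4
  hence "- j ~= 0" "s^- = zpow g (- j)" by (simp_all add: zpow_minus)
  thus ?thesis unfolding Sg_def by blast
 qed (simp_all add: Sg_def)
qed

lemma Sg_ne: "s : Sg ==> lm s E ~= E"
proof -
 assume "s : Sg"
 then consider "s = t" | "s = t^-" | "s : P - N0" | j where "j ~= 0" "s = zpow g j" using Sg_cases by blast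
 thus ?thesis
 proof cases
  case 1 thus ?thesis using tE lm_stab[OF E_sub] by simp
 next
  case 2 thus ?thesis by (simp add: tE lm_stab E_sub subgrp_inv_iff)
 next
  case 3 thus ?thesis using BP by metis
 next
  case 4 thus ?thesis using gfix[OF _ Yc_E] by simp
 qed
qed

lemma Sg_pair_un:
 assumes "\<exists>D. ALL s:A. ALL s':A. ang E (lm s E) (lm s' E) <= D" "\<exists>D. ALL s:B. ALL s':B. ang E (lm s E) (lm s' E) <= (D::nat)"
  and sub: "A <= Sg" "B <= Sg"
 shows "\<exists>D. ALL s:A \<union> B. ALL s':A \<union> B. ang E (lm s E) (lm s' E) <= D"
proof (cases "A = {} \<or> B = {}")
 case True thus ?thesis using assms(1,2) by (cases "A = {}") simp_all
next
 case False
 then obtain a b where ab: "a : A" "b : B" by blast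
 obtain D1 where D1: "\<And>s s'. s : A ==> s' : A ==> ang E (lm s E) (lm s' E) <= D1" using assms(1) by blast
 obtain D2 where D2: "\<And>s s'. s : B ==> s' : B ==> ang E (lm s E) (lm s' E) <= D2" using assms(2) by blast
 define c where "c = ang E (lm a E) (lm b E)"
 have AB: "ang E (lm s E) (lm s' E) <= D1 + c + D2 & ang E (lm s' E) (lm s E) <= D1 + c + D2" if s: "s : A" "s' : B" for s s'
 proof -
  have ne: "lm s E ~= E" "lm s' E ~= E" "lm a E ~= E" "lm b E ~= E"
   using Sg_ne[of s] Sg_ne[of s'] Sg_ne[of a] Sg_ne[of b] s ab sub by (simp_all add: subset_iff)
  have "ang E (lm s E) (lm s' E) <= ang E (lm s E) (lm a E) + ang E (lm a E) (lm s' E)"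
   by (simp add: ang_tri Yc_E Yc_I ne)
  also have "ang E (lm a E) (lm s' E) <= c + ang E (lm b E) (lm s' E)"
   by (simp add: c_def ang_tri Yc_E Yc_I ne)
  finally have "ang E (lm s E) (lm s' E) <= D1 + c + D2" using D1[OF s(1) ab(1)] D2[OF ab(2) s(2)] by linarith
  thus ?thesis by (simp add: ang_sym Yc_E Yc_I ne)
 qed
 have "ang E (lm s E) (lm s' E) <= D1 + c + D2" if m: "s : A \<union> B" "s' : A \<union> B" for s s'
 proof -
  consider "s : A" "s' : A" | "s : A" "s' : B" | "s : B" "s' : A" | "s : B" "s' : B" using m by blast
  thus ?thesis
  proof cases
   case 1 thus ?thesis using D1[OF 1] by linarith
  next
   case 2 thus ?thesis using AB[OF 2] by linarith
  next
   case 3 thus ?thesis using AB[OF 3(2,1)] by linarith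
  next
   case 4 thus ?thesis using D2[OF 4] by linarith
  qed
 qed
 thus ?thesis by blast
qed

text \<open>For \<open>P\<close> the bound is \<open>BP\<close>, for powers of \<open>g\<close> it
  is \<open>cyclic_bdd\<close>. The angle at \<open>E\<close> between two translates by
  \<open>P\<close> is moved to the coset of \<open>p^-\<close>, where \<open>BP\<close> applies
  again; the kinds of steps are compared through one fixed pair.\<close>

lemma Sg_bdd: "\<exists>B. (ALL s:Sg. ALL y:Yc E. y ~= E --> y ~= lm s E --> ang y E (lm s E) <= B) &
  (ALL s:Sg. ALL s':Sg. ang E (lm s E) (lm s' E) <= B)"
proof -
 obtain B1 where B1: "\<And>y. [|y : Yc E; y ~= E; y ~= lm t E|] ==> ang y E (lm t E) <= B1" using ang_bdd[OF Yc_E Yc_I] by blast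
 obtain B2 where B2: "\<And>y. [|y : Yc E; y ~= E; y ~= lm t^- E|] ==> ang y E (lm t^- E) <= B2"
  using ang_bdd[OF Yc_E Yc_I] by blast
 obtain B3 where B3: "\<And>p y. [|p : P - N0; y : Yc E; y ~= E; y ~= lm p E|] ==> ang y E (lm p E) <= B3" using BP by metis
 obtain B4 where B4: "\<And>a b y. [|y : Yc E; y ~= lm (zpow g a) E; y ~= lm (zpow g b) E|] ==>
  ang y (lm (zpow g a) E) (lm (zpow g b) E) <= B4" by (rule cyclic_bdd[OF gfix]) blast+
 have 1: "ang y E (lm s E) <= B1 + B2 + B3 + B4" if s: "s : Sg" and y: "y : Yc E" "y ~= E" "y ~= lm s E" for s y
 proof -
  consider "s = t" | "s = t^-" | "s : P - N0" | j where "j ~= 0" "s = zpow g j" using Sg_cases[OF s] by blast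
  thus ?thesis
  proof cases
   case 1 thus ?thesis using B1[OF y(1,2) y(3)[unfolded 1]] unfolding 1 by linarith
  next
   case 2 thus ?thesis using B2[OF y(1,2) y(3)[unfolded 2]] unfolding 2 by linarith
  next
   case 3 thus ?thesis using B3[OF 3 y] by linarith
  next
   case (4 j)
   have "ang y (lm (zpow g 0) E) (lm (zpow g j) E) <= B4" by (rule B4[OF y(1)]) (use y 4 in simp_all)
   thus ?thesis unfolding 4(2) by simp
  qed
 qed
 have pT: "\<exists>D. ALL s:{t, t^-}. ALL s':{t, t^-}. ang E (lm s E) (lm s' E) <= D"
  by (rule exI[of _ "ang E (lm t E) (lm t E) + ang E (lm t E) (lm t^- E) + ang E (lm t^- E) (lm t E) + ang E (lm t^- E) (lm t^- E)"]) auto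
 have "ang E (lm p E) (lm p' E) <= B3" if p: "p : P - N0" "p' : P - N0" for p p'
 proof (cases "p^- * p' : N0")
  case True
  hence "lm p' E = lm p E" using lm_E[OF NE, of "p^- * p'" p] N0 by simp
  thus ?thesis using ang_self[OF Yc_E Yc_I] Sg_ne[of p] p by (simp add: Sg_def)
 next
  case False
  hence pp: "p^- * p' : P - N0" using subgrpD P_sub p by blast
  have ip: "p^- : Sg" "p' : Sg" "p : Sg" using p Sg_inv by (auto simp: Sg_def)
  have ne: "lm p^- E ~= lm (p^- * p') E" using Sg_ne[OF ip(2)] lm_inj[of "p^-" E "lm p' E"] by simp
  have "ang (lm p^- E) E (lm (p^- * p') E) <= B3" by (metis B3 pp Yc_I Sg_ne ip ne)
  thus ?thesis by (simp add: ang_inv' Yc_E Yc_I)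
 qed
 hence pP: "\<exists>D. ALL s:P - N0. ALL s':P - N0. ang E (lm s E) (lm s' E) <= D" by blast
 have pG: "\<exists>D. ALL s:{zpow g j |j. j ~= 0}. ALL s':{zpow g j |j. j ~= 0}. ang E (lm s E) (lm s' E) <= D"
 proof (rule exI[of _ B4], intro ballI)
  fix s s' assume "s : {zpow g j |j. j ~= 0}" "s' : {zpow g j |j. j ~= 0}"
  then obtain i j where ij: "i ~= 0" "j ~= 0" "s = zpow g i" "s' = zpow g j" by blast
  show "ang E (lm s E) (lm s' E) <= B4" by (metis ij B4 Yc_E gfix)
 qed
 have "\<exists>D. ALL s:Sg. ALL s':Sg. ang E (lm s E) (lm s' E) <= D"
  unfolding Sg_def by (rule Sg_pair_un[OF Sg_pair_un[OF pT pP] pG]) (auto simp: Sg_def)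
 then obtain D where D: "\<And>s s'. s : Sg ==> s' : Sg ==> ang E (lm s E) (lm s' E) <= D" by blast
 show ?thesis
 proof (rule exI[of _ "B1 + B2 + B3 + B4 + D"], intro conjI ballI impI)
  fix s y assume "s : Sg" "y : Yc E" "y ~= E" "y ~= lm s E"
  thus "ang y E (lm s E) <= B1 + B2 + B3 + B4 + D" using 1[of s y] by linarith
 next
  fix s s' assume "s : Sg" "s' : Sg"
  thus "ang E (lm s E) (lm s' E) <= B1 + B2 + B3 + B4 + D" using D[of s s'] by linarith
 qed
qed

definition BB :: nat where
 "BB = (SOME B. (ALL s:Sg. ALL y:Yc E. y ~= E --> y ~= lm s E --> ang y E (lm s E) <= B) &
  (ALL s:Sg. ALL s':Sg. ang E (lm s E) (lm s' E) <= B))"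

lemma BB: "[|s : Sg; y : Yc E; y ~= E; y ~= lm s E|] ==> ang y E (lm s E) <= BB"
 "[|s : Sg; s' : Sg|] ==> ang E (lm s E) (lm s' E) <= BB"
 using someI_ex[OF Sg_bdd] unfolding BB_def[symmetric] by blast+

definition KK :: nat where "KK = BB + 2 * th"
definition kap :: nat where "kap = 2 * BB + 3 * th"

sublocale spc "Yc E" ang th BB KK kap
 by unfold_locales (simp_all add: KK_def kap_def)

definition m0 :: nat where
 "m0 = (SOME m0. \<forall>m. int m0 <= \<bar>m\<bar> --> (ALL x:Yc E. x ~= E --> kap + 2 * BB < ang E x (lm (zpow r m) x)))"

lemma m0: "[|int m0 <= \<bar>m\<bar>; x : Yc E; x ~= E|] ==> kap + 2 * BB < ang E x (lm (zpow r m) x)"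
 using someI_ex[OF rot[of "kap + 2 * BB"]] unfolding m0_def[symmetric] by blast

lemma t_Sg: "t : Sg" "t^- : Sg" by (auto simp: Sg_def)

lemma lm_rne: "lm (zpow r j * s) E ~= E" if "s : Sg"
 using Sg_ne[OF that] lm_inj[of "zpow r j" "lm s E" E] lm_r[of 1 j] by simp

lemma m0_pos: "0 < m0"
proof (rule ccontr)
 assume "\<not> 0 < m0"
 hence "kap + 2 * BB < ang E (lm t E) (lm (zpow r 0) (lm t E))"
  by (intro m0 Yc_I Sg_ne t_Sg) simp
 thus False by (simp add: ang_self Yc_E Yc_I Sg_ne t_Sg)
qed

text \<open>The power of \<open>r\<close> sweeps more than \<open>kap + 2 * BB\<close>, while two
  steps that are not rotated differ by at most \<open>BB\<close>.\<close>

lemma corner: assumes s: "s : Sg" "s' : Sg" and j: "int m0 <= \<bar>j\<bar>"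
 shows "kap < ang E (lm s E) (lm (zpow r j * s') E)"
proof -
 have "kap + 2 * BB < ang E (lm s' E) (lm (zpow r j) (lm s' E))" by (rule m0[OF j Yc_I Sg_ne[OF s(2)]])
 also have "... <= ang E (lm s' E) (lm s E) + ang E (lm s E) (lm (zpow r j * s') E)"
  by (simp add: ang_tri Yc_E Yc_I Sg_ne s lm_rne)
 finally show ?thesis using BB(2)[OF s(2,1)] by linarith
qed

lemma corner0: assumes "s : Sg" "s' : Sg" "lm s E = lm (zpow r j * s') E" shows "\<bar>j\<bar> < int m0"
proof (rule ccontr)
 assume "\<not> ?thesis"
 hence "kap < ang E (lm s E) (lm s E)" using corner assms by fastforce
 thus False using ang_self[OF Yc_E Yc_I Sg_ne[OF assms(1)]] by simp
qed

text \<open>All multiples of \<open>j\<close> would fix the coset too, and the multiple by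
  \<open>m0\<close> contradicts \<open>corner0\<close>.\<close>

lemma rot_fix: assumes s: "s : Sg" and e: "lm s E = lm (zpow r j * s) E" shows "j = 0"
proof (rule ccontr)
 assume j: "j ~= 0"
 have "lm (zpow r (j * int n)) (lm s E) = lm s E" for n
 proof (induction n)
  case (Suc n)
  have "j * int (Suc n) = j + j * int n" by (simp add: algebra_simps)
  hence "lm (zpow r (j * int (Suc n))) (lm s E) = lm (zpow r j) (lm (zpow r (j * int n)) (lm s E))"
   by (simp add: zpow_add mult.assoc)
  hence "lm (zpow r (j * int (Suc n))) (lm s E) = lm (zpow r j) (lm s E)" unfolding Suc.IH .
  also have "... = lm s E" using lm_lm e by blast
  finally show ?case .
 qed simp
 from this[of m0] have "lm s E = lm (zpow r (j * int m0) * s) E" by simp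
 hence "\<bar>j * int m0\<bar> < int m0" by (rule corner0[OF s s])
 thus False using j m0_pos by (simp add: abs_mult)
qed

text \<open>Comparing two corners determines a rotation number only up to an error below
  \<open>m0\<close> at either side, so the spacing must be at least \<open>2 * m0\<close>; distance
  from zero also rules out that a corner is matched with a reversed one.\<close>

definition mx :: "nat => int" where "mx i = 3 * int m0 * (int i + 1)"

text \<open>The steps by which a chain can be left at index \<open>i\<close>: at its two ends the
  choice in \<open>P\<close>, and in \<open>Rt\<close> among the powers of \<open>g\<close>,
  replaces the letter \<open>t\<close>.\<close>

definition Lf :: "nat => 'g set" where "Lf i = (if i = 0 then P - N0 else {t^-})"
definition Rt :: "nat => 'g set" where "Rt i = (if i = k - 1 then {zpow g j |j. j ~= 0} else {t})"

lemma Lf_Sg: "a : Lf i ==> a : Sg" by (auto simp: Lf_def Sg_def split: if_splits)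
lemma Rt_Sg: "b : Rt i ==> b : Sg" by (auto simp: Rt_def Sg_def split: if_splits)

lemma mx_ge: "3 * int m0 <= mx i" using m0_pos by (simp add: mx_def)

lemma mx_close: assumes "\<bar>mx i - mx j\<bar> < 2 * int m0" shows "i = j"
proof (rule ccontr)
 assume "i ~= j"
 hence "1 <= \<bar>int i - int j\<bar>" by linarith
 hence "3 * int m0 * 1 <= 3 * int m0 * \<bar>int i - int j\<bar>" by (intro mult_left_mono) auto
 also have "mx i - mx j = 3 * int m0 * (int i - int j)" by (simp add: mx_def algebra_simps)
 hence "3 * int m0 * \<bar>int i - int j\<bar> = \<bar>mx i - mx j\<bar>" by (simp add: abs_mult)
 finally show False using assms m0_pos by linarith
qed

text \<open>The rotation numbers at a corner determine its index; the rigid side of the corner then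
 determines the frame.\<close>

lemma shared_corner:
 assumes a: "a : Lf i" "b : Rt i" and a': "a' : Lf i'" "b' : Rt i'"
  and y: "lm y E = lm y' E"
  and sh: "(lm (y * a) E = lm (y' * a') E & lm (y * zpow r (mx i) * b) E = lm (y' * zpow r (mx i') * b') E) \<or>
   (lm (y * a) E = lm (y' * zpow r (mx i') * b') E & lm (y * zpow r (mx i) * b) E = lm (y' * a') E)"
 shows "i = i' & y^- * y' : N"
proof -
 note S = Lf_Sg[OF a(1)] Rt_Sg[OF a(2)] Lf_Sg[OF a'(1)] Rt_Sg[OF a'(2)]
 have "y^- * y' : E" using y lm_eq[OF E_sub, of y' y] by simp
 then obtain s where s: "(zpow r s)^- * (y^- * y') : N" unfolding E_eq pwr_def by blast
 define n where "n = (zpow r s)^- * (y^- * y')"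
 have n: "n : N" "y' = y * zpow r s * n" using s by (simp_all add: n_def mult.assoc)
 have tr: "lm (y' * c) E = lm (y * (zpow r s * c)) E" for c
  by (metis n lm_N mult.assoc)
 have cancel: "lm (y * c) E = lm (y * d) E \<longleftrightarrow> lm c E = lm d E" for c d
  using lm_inj[of y "lm c E" "lm d E"] by simp
 have rc: "lm (zpow r u * c) E = lm (zpow r v * d) E \<longleftrightarrow> lm c E = lm (zpow r (v - u) * d) E" for u v c d
  using lm_inj[of "zpow r (- u)" "lm (zpow r u * c) E" "lm (zpow r v * d) E"]
  by (simp add: mult.assoc[symmetric] zpow_add[symmetric])
 from sh show ?thesis
 proof
  assume "lm (y * a) E = lm (y' * a') E & lm (y * zpow r (mx i) * b) E = lm (y' * zpow r (mx i') * b') E"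
  hence "lm (y * a) E = lm (y' * a') E" "lm (y * (zpow r (mx i) * b)) E = lm (y' * (zpow r (mx i') * b')) E"
   by (simp_all add: mult.assoc)
  hence 1: "lm a E = lm (zpow r s * a') E" and "lm (zpow r (mx i) * b) E = lm (zpow r s * (zpow r (mx i') * b')) E"
   unfolding tr cancel by auto
  hence "lm (zpow r (mx i) * b) E = lm (zpow r (s + mx i') * b') E" by (simp add: zpow_add mult.assoc)
  hence 2: "lm b E = lm (zpow r (s + mx i' - mx i) * b') E" unfolding rc .
  have "\<bar>s\<bar> < int m0" "\<bar>s + mx i' - mx i\<bar> < int m0" using corner0[OF S(1,3) 1] corner0[OF S(2,4) 2] by auto
  hence ii: "i = i'" by (intro mx_close) linarith
  have "s = 0"
  proof (cases "i = 0")
   case True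
   hence "i ~= k - 1" using kbig by simp
   hence "b = t" "b' = t" using a(2) a'(2) ii by (auto simp: Rt_def)
   thus ?thesis using rot_fix[OF t_Sg(1), of s] 2 ii by simp
  next
   case False
   hence "a = t^-" "a' = t^-" using a(1) a'(1) ii by (auto simp: Lf_def)
   thus ?thesis using rot_fix[OF t_Sg(2), of s] 1 by simp
  qed
  thus ?thesis using ii s by simp
 next
  assume "lm (y * a) E = lm (y' * zpow r (mx i') * b') E & lm (y * zpow r (mx i) * b) E = lm (y' * a') E"
  hence "lm (y * a) E = lm (y' * (zpow r (mx i') * b')) E" "lm (y * (zpow r (mx i) * b)) E = lm (y' * a') E"
   by (simp_all add: mult.assoc)
  hence "lm a E = lm (zpow r s * (zpow r (mx i') * b')) E" and 2: "lm (zpow r (mx i) * b) E = lm (zpow r s * a') E"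
   unfolding tr cancel by auto
  hence 1: "lm a E = lm (zpow r (s + mx i') * b') E" by (simp add: zpow_add mult.assoc)
  have 3: "lm b E = lm (zpow r (s - mx i) * a') E" using 2 unfolding rc .
  have "\<bar>s + mx i'\<bar> < int m0" "\<bar>s - mx i\<bar> < int m0" using corner0[OF S(1,4) 1] corner0[OF S(2,3) 3] by auto
  thus ?thesis using mx_ge[of i] mx_ge[of i'] by linarith
 qed
qed

end

section \<open>Reduced walks along the chain and the subgroup they describe\<close>

context wds begin

primrec w :: "nat => 'g" where
 "w 0 = 1"
| "w (Suc i) = w i * zpow r (mx i) * t"

text \<open>This is \<open>Y * g * Y^-\<close> for the long word
  \<open>Y = w (k - 1) * zpow r (mx (k - 1))\<close>, bracketed so that a power of \<open>z\<close>
  is one move at the last index.\<close>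

definition z :: 'g where
 "z = w (k - 1) * (zpow r (mx (k - 1)) * g * (zpow r (mx (k - 1)))^-) * (w (k - 1))^-"

lemma z_pow: "zpow z j = w (k - 1) * (zpow r (mx (k - 1)) * zpow g j * (zpow r (mx (k - 1)))^-) * (w (k - 1))^-"
 unfolding z_def zpow_conj ..

text \<open>The graph of the homomorphism that is the identity on \<open>P\<close> and sends \<open>z\<close> to \<open>p0\<close>, modulo \<open>N\<close>.\<close>

inductive_set Gam :: "('g \<times> 'g) set" where
 Gam_1: "(1, 1) : Gam"
| Gam_P: "(x, q) : Gam ==> p : P ==> (x * p, q * p) : Gam"
| Gam_z: "(x, q) : Gam ==> (x * zpow z j, q * zpow p0 j) : Gam"
| Gam_N: "(x, q) : Gam ==> n : N ==> (x * n, q) : Gam"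

lemma Gam_mult: assumes "(x, q) : Gam" shows "(y, q') : Gam ==> (x * y, q * q') : Gam"
proof (induction rule: Gam.induct)
 case Gam_1 thus ?case using assms by simp
next
 case (Gam_P y q' p) thus ?case using Gam.Gam_P[OF Gam_P.IH, of p] by (simp add: mult.assoc)
next
 case (Gam_z y q' j) thus ?case using Gam.Gam_z[OF Gam_z.IH, of j] by (simp add: mult.assoc)
next
 case (Gam_N y q' n) thus ?case by (metis Gam.Gam_N mult.assoc)
qed

lemma Gam_of_P: "p : P ==> (p, p) : Gam" using Gam_P[OF Gam_1] by simp
lemma Gam_of_z: "(zpow z j, zpow p0 j) : Gam" using Gam_z[OF Gam_1] by simp
lemma Gam_of_N: "n : N ==> (n, 1) : Gam" using Gam_N[OF Gam_1] by simp

lemma Gam_inv: "(x, q) : Gam ==> (x^-, q^-) : Gam"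
proof (induction rule: Gam.induct)
 case Gam_1 thus ?case using Gam.Gam_1 by simp
next
 case (Gam_P y q' p) thus ?case by (simp add: Gam_mult Gam_of_P subgrpD P_sub)
next
 case (Gam_z y q' j) thus ?case using Gam_mult[OF Gam_of_z[of "- j"] Gam_z.IH] by (simp add: zpow_minus)
next
 case (Gam_N y q' n) thus ?case using Gam_mult[OF Gam_of_N[OF subgrpD(3)[OF sN Gam_N.hyps(2)]] Gam_N.IH] by simp
qed

lemma Gam_range: "(x, q) : Gam ==> q : P"
proof (induction rule: Gam.induct)
 case (Gam_P y q' p) thus ?case using subgrpD(2)[OF P_sub] by blast
next
 case (Gam_z y q' j) thus ?case by (simp add: subgrpD P_sub subgrp_zpow p0)
qed (use subgrpD(1)[OF P_sub] in simp_all)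

definition QN :: "'g set" where "QN = Domain Gam"

lemma QN_I: "(x, q) : Gam ==> x : QN" by (auto simp: QN_def)
lemma QN_D: "x : QN ==> \<exists>q. (x, q) : Gam" by (auto simp: QN_def)

lemma QN_sub: "subgrp QN"
 unfolding subgrp_def
proof (intro conjI ballI)
 show "1 : QN" by (rule QN_I[OF Gam_1])
 fix x assume "x : QN"
 then obtain q where q: "(x, q) : Gam" using QN_D by blast
 show "x^- : QN" by (rule QN_I[OF Gam_inv[OF q]])
 fix y assume "y : QN"
 then obtain q' where q': "(y, q') : Gam" using QN_D by blast
 show "x * y : QN" by (rule QN_I[OF Gam_mult[OF q q']])
qed

lemma QN_N: "n : N ==> n : QN" by (rule QN_I[OF Gam_of_N])

lemma N0_conj: assumes "n : N0" "p : P" shows "p * n * p^- : N0" "p^- * n * p : N0"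
proof -
 have "n : P" "n : N" using assms N0 by auto
 thus "p * n * p^- : N0" "p^- * n * p : N0"
  using subgrpD(2)[OF P_sub subgrpD(2)[OF P_sub assms(2) \<open>n : P\<close>] subgrpD(3)[OF P_sub assms(2)]]
   subgrpD(2)[OF P_sub subgrpD(2)[OF P_sub subgrpD(3)[OF P_sub assms(2)] \<open>n : P\<close>] assms(2)] Nc Nc' by (simp_all add: N0)
qed

text \<open>States: a frame, the image of its group element in \<open>P\<close>, and an index. Moves leave through the left
 or the right side (\<open>True\<close> is left) and arrive through the left or the right side.\<close>

type_synonym 'a wstate = "'a \<times> 'a \<times> nat"

inductive mv :: "'g wstate => 'g wstate => bool => bool => bool" where
 up: "Suc i < k ==> mv (y, q, i) (y * zpow r (mx i) * t, q, Suc i) False True"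
| dn: "Suc i < k ==> mv (y, q, Suc i) (y * t^- * (zpow r (mx i))^-, q, i) True False"
| mp: "p : P - N0 ==> mv (y, q, 0) (y * p, q * p, 0) True True"
| mg: "j ~= 0 ==> mv (y, q, k - 1) (y * (zpow r (mx (k - 1)) * zpow g j * (zpow r (mx (k - 1)))^-), q * zpow p0 j, k - 1) False False"

definition pt :: "'g wstate => 'g set" where "pt s = lm (fst s) E"

definition eqv :: "'g wstate => 'g wstate => bool" where
 "eqv s s' \<longleftrightarrow> (fst s)^- * fst s' : N & (fst (snd s))^- * fst (snd s') : N0 & snd (snd s) = snd (snd s')"

definition ok :: "'g wstate => bool" where
 "ok s \<longleftrightarrow> (fst s * (w (snd (snd s)))^-, fst (snd s)) : Gam & snd (snd s) < k"

lemma ok_mv: "mv s s' a b ==> ok s ==> ok s'"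
proof (induction rule: mv.induct)
 case (up i y q) thus ?case by (simp add: ok_def mult.assoc)
next
 case (dn i y q) thus ?case by (simp add: ok_def mult.assoc)
next
 case (mp p y q) thus ?case using Gam_P by (simp add: ok_def)
next
 case (mg j y q)
 hence "(y * (w (k - 1))^-, q) : Gam" by (simp add: ok_def)
 from Gam_z[OF this, of j] show ?case using kbig by (simp add: ok_def z_pow mult.assoc)
qed

definition side :: "bool => nat => 'g => 'g set => bool" where
 "side b i y u \<longleftrightarrow> (if b then EX a:Lf i. u = lm (y * a) E else EX c:Rt i. u = lm (y * zpow r (mx i) * c) E)"

lemma mv_sides: assumes "mv s s' a b"
 shows "side a (snd (snd s)) (fst s) (pt s')" "side b (snd (snd s')) (fst s') (pt s)"
proof -
 have "side a (snd (snd s)) (fst s) (pt s') & side b (snd (snd s')) (fst s') (pt s)"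
  using assms
 proof (induction rule: mv.induct)
  case (up i y q)
  have "lm (y * zpow r (mx i) * t * t^-) E = lm y E" using lm_r by (simp add: mult.assoc)
  thus ?case using up kbig by (auto simp: side_def pt_def Lf_def Rt_def)
 next
  case (dn i y q)
  have "lm (y * t^- * (zpow r (mx i))^-) E = lm (y * t^-) E" by (metis lm_r zpow_minus)
  moreover have "y * t^- * (zpow r (mx i))^- * zpow r (mx i) * t = y" by (simp add: mult.assoc)
  ultimately show ?case using dn kbig by (auto simp: side_def pt_def Lf_def Rt_def)
 next
  case (mp p y q)
  hence "p^- : P - N0" by (simp add: subgrp_inv_iff P_sub N0_sub)
  moreover have "lm y E = lm (y * p * p^-) E" by (simp add: mult.assoc)
  ultimately show ?case using mp unfolding side_def pt_def Lf_def by fastforce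
 next
  case (mg j y q)
  let ?R = "zpow r (mx (k - 1))"
  have 1: "lm (y * (?R * zpow g j * inverse ?R)) E = lm (y * ?R * zpow g j) E"
   by (metis lm_r zpow_minus mult.assoc)
  have "y * (?R * zpow g j * inverse ?R) * ?R * zpow g (- j) = y * ?R" by (simp add: mult.assoc zpow_minus)
  hence 2: "lm y E = lm (y * (?R * zpow g j * inverse ?R) * ?R * zpow g (- j)) E" using lm_r by simp
  have 3: "zpow g j : Rt (k - 1)" "zpow g (- j) : Rt (k - 1)" using mg by (auto simp: Rt_def)
  show ?case unfolding side_def pt_def using 1 2 3 by auto
 qed
 thus "side a (snd (snd s)) (fst s) (pt s')" "side b (snd (snd s')) (fst s') (pt s)" by auto
qed

lemma eqv_refl: "eqv s s" by (simp add: subgrpD sN N0_sub eqv_def)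

lemma eqv_sym: assumes "eqv s s'" shows "eqv s' s"
proof -
 have "((fst s)^- * fst s')^- : N" by (metis assms subgrpD sN eqv_def)
 moreover have "((fst (snd s))^- * fst (snd s'))^- : N0" by (metis assms subgrpD N0_sub eqv_def)
 ultimately show ?thesis using assms by (simp add: eqv_def)
qed

lemma eqv_trans: assumes "eqv s s'" "eqv s' s''" shows "eqv s s''"
proof -
 have "((fst s)^- * fst s') * ((fst s')^- * fst s'') : N" using assms Nm unfolding eqv_def by blast
 moreover have "((fst (snd s))^- * fst (snd s')) * ((fst (snd s'))^- * fst (snd s'')) : N0"
  by (metis assms subgrpD N0_sub eqv_def)
 ultimately show ?thesis using assms by (simp add: eqv_def mult.assoc)
qed

lemma eqv_pt: "eqv s s' ==> pt s = pt s'"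
 by (metis pt_def lm_eq E_sub NE eqv_def)

lemma eqv_rm: assumes "y^- * y' : N" shows "(y * c)^- * (y' * c) : N"
 using Nc'[OF assms, of c] by (simp add: mult.assoc)

lemma eqv_rm0: assumes "y^- * y' : N0" "c : P" shows "(y * c)^- * (y' * c) : N0"
 using N0_conj(2)[OF assms] by (simp add: mult.assoc)

lemma eqv_mv: assumes m: "mv s s1 a b" and e: "eqv s s'" shows "\<exists>s1'. mv s' s1' a b & eqv s1 s1'"
 using m e
proof (induction rule: mv.induct)
 case (up i y q)
 obtain y' q' where s': "s' = (y', q', i)" using up by (cases s') (auto simp: eqv_def)
 have "eqv (y * zpow r (mx i) * t, q, Suc i) (y' * zpow r (mx i) * t, q', Suc i)"
  using up s' eqv_rm[of y y' "zpow r (mx i) * t"] by (simp add: eqv_def mult.assoc)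
 thus ?case using mv.up[OF up(1)] s' by blast
next
 case (dn i y q)
 obtain y' q' where s': "s' = (y', q', Suc i)" using dn by (cases s') (auto simp: eqv_def)
 have "eqv (y * t^- * (zpow r (mx i))^-, q, i) (y' * t^- * (zpow r (mx i))^-, q', i)"
  using dn s' eqv_rm[of y y' "t^- * (zpow r (mx i))^-"] by (simp add: eqv_def mult.assoc)
 thus ?case using mv.dn[OF dn(1)] s' by blast
next
 case (mp p y q)
 obtain y' q' where s': "s' = (y', q', 0)" using mp by (cases s') (auto simp: eqv_def)
 have "eqv (y * p, q * p, 0) (y' * p, q' * p, 0)"
  using mp s' eqv_rm eqv_rm0 by (simp add: eqv_def)
 thus ?case using mv.mp[OF mp(1)] s' by blast
next
 case (mg j y q)
 let ?c = "zpow r (mx (k - 1)) * zpow g j * (zpow r (mx (k - 1)))^-"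
 obtain y' q' where s': "s' = (y', q', k - 1)" using mg by (cases s') (auto simp: eqv_def)
 have e: "y^- * y' : N" "q^- * q' : N0" using mg s' by (auto simp: eqv_def)
 have "eqv (y * ?c, q * zpow p0 j, k - 1) (y' * ?c, q' * zpow p0 j, k - 1)"
  unfolding eqv_def using eqv_rm[OF e(1), of ?c] eqv_rm0[OF e(2) subgrp_zpow[OF P_sub p0(1)], of j] by simp
 thus ?case using mv.mg[OF mg(1)] s' by blast
qed

inductive rp :: "'g wstate => nat => (nat => 'g set) => 'g wstate => bool option => bool" for s0 where
 rp_0: "rp s0 0 (\<lambda>_. pt s0) s0 None"
| rp_S: "rp s0 n f s tg ==> mv s s' a b ==> tg ~= Some a ==> rp s0 (Suc n) (f(Suc n := pt s')) s' (Some b)"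

definition Reach :: "'g wstate => 'g wstate => bool" where
 "Reach s0 s \<longleftrightarrow> (\<exists>n f s' tg. rp s0 n f s' tg & eqv s' s)"

lemma Reach_0: "Reach s s" by (metis Reach_def rp_0 eqv_refl)

lemma Reach_eqv: "Reach s0 s ==> eqv s s' ==> Reach s0 s'" by (metis Reach_def eqv_trans)

text \<open>Turning back through the side of arrival retraces a letter \<open>t\<close> or, at an
  end of the chain, merges two elements of \<open>P\<close> or two powers of \<open>g\<close> into
  one.\<close>

lemma undo:
 assumes m1: "mv s s1 a b" and m2: "mv s1 s2 b c"
 shows "eqv s s2 \<or> (\<exists>s2'. mv s s2' a c & eqv s2' s2)"
 using m1
proof (cases rule: mv.cases)
 case (up i y q)
 note o = up
 from m2 show ?thesis
 proof (cases rule: mv.cases)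
  case (dn i' y' q')
  have "s2 = s" using dn o by (auto simp: mult.assoc)
  thus ?thesis using eqv_refl by simp
 qed (use o in auto)
next
 case (dn i y q)
 note o = dn
 from m2 show ?thesis
 proof (cases rule: mv.cases)
  case (up i' y' q')
  have "s2 = s" using up o by (auto simp: mult.assoc)
  thus ?thesis using eqv_refl by simp
 next
  case (mg j y' q')
  thus ?thesis using o by auto
 qed (use o in auto)
next
 case (mp p y q)
 note o = mp
 from m2 show ?thesis
 proof (cases rule: mv.cases)
  case (mp p' y' q')
  have s2: "s2 = (y * (p * p'), q * (p * p'), 0)" using mp o by (auto simp: mult.assoc)
  have pp: "p * p' : P" using subgrpD P_sub o mp by blast
  show ?thesis
  proof (cases "p * p' : N0")
   case True
   thus ?thesis using s2 o by (simp add: eqv_def N0)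
  next
   case False
   hence "mv s s2 a c" using mv.mp pp s2 o mp by simp
   thus ?thesis using eqv_refl by blast
  qed
 qed (use o kbig in auto)
next
 case (mg j y q)
 note o = mg
 from m2 show ?thesis
 proof (cases rule: mv.cases)
  case (up i y' q')
  thus ?thesis using o by auto
 next
  case (mg j' y' q')
  let ?c = "\<lambda>j. zpow r (mx (k - 1)) * zpow g j * (zpow r (mx (k - 1)))^-"
  have cc: "?c j * ?c j' = ?c (j + j')" by (simp add: zpow_add mult.assoc)
  have "s2 = (y * ?c j * ?c j', q * zpow p0 j * zpow p0 j', k - 1)" using mg o by auto
  hence s2: "s2 = (y * ?c (j + j'), q * zpow p0 (j + j'), k - 1)"
   by (simp add: zpow_add mult.assoc)
  show ?thesis
  proof (cases "j + j' = 0")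
   case True
   thus ?thesis using s2 o eqv_refl by simp
  next
   case False
   hence "mv s s2 a c" using mv.mg s2 o mg by simp
   thus ?thesis using eqv_refl by blast
  qed
 qed (use o kbig in auto)
qed

text \<open>If the new move leaves through the side of arrival, \<open>undo\<close> drops or
  replaces the last step, so the walk stays reduced.\<close>

lemma Reach_mv: assumes R: "Reach s0 s" and m: "mv s s1 a b" shows "Reach s0 s1"
proof -
 obtain n f s' tg where rp: "rp s0 n f s' tg" "eqv s' s" by (metis R Reach_def)
 obtain s1' where s1': "mv s' s1' a b" "eqv s1 s1'" using eqv_mv m eqv_sym rp by blast
 show ?thesis
 proof (cases "tg = Some a")
  case False
  show ?thesis unfolding Reach_def using rp_S[OF rp(1) s1'(1) False] eqv_sym[OF s1'(2)] by blast
 next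
  case True
  from rp(1) True obtain n0 f0 s'' tg0 a0 where l: "rp s0 n0 f0 s'' tg0" "mv s'' s' a0 a" "tg0 ~= Some a0"
   by (cases rule: rp.cases) auto
  from undo[OF l(2) s1'(1)] show ?thesis
  proof
   assume "eqv s'' s1'"
   note eqv_trans[OF _ eqv_sym[OF s1'(2)], OF this]
   thus ?thesis by (metis Reach_def l)
  next
   assume "\<exists>s2'. mv s'' s2' a0 b & eqv s2' s1'"
   then obtain s2' where s2': "mv s'' s2' a0 b" "eqv s2' s1'" by blast
   note eqv_trans[OF s2'(2) eqv_sym[OF s1'(2)]]
   thus ?thesis by (metis Reach_def rp_S l s2')
  qed
 qed
qed

lemma Reach_move_idx: assumes R: "Reach s0 (x * w i, q, i)" and "i < k" "j < k" shows "Reach s0 (x * w j, q, j)"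
proof -
 have up: "Reach s0 (x * w (i + d), q, i + d)" if "Reach s0 (x * w i, q, i)" "i + d < k" for i d
  using that(2)
 proof (induction d)
  case (Suc d)
  hence "Reach s0 (x * w (i + d), q, i + d)" by simp
  from Reach_mv[OF this mv.up] Suc.prems show ?case by (simp add: mult.assoc)
 qed (use that in simp)
 have dn: "Reach s0 (x * w i, q, i)" if "Reach s0 (x * w (i + d), q, i + d)" "i + d < k" for i d
  using that
 proof (induction d)
  case (Suc d)
  have "Reach s0 (x * w (Suc (i + d)), q, Suc (i + d))" using Suc.prems by simp
  from Reach_mv[OF this mv.dn] Suc.prems have "Reach s0 (x * w (i + d), q, i + d)" by (simp add: mult.assoc)
  thus ?case using Suc by simp
 qed simp
 show ?thesis
 proof (cases "i <= j")
  case True thus ?thesis using up[OF R, of "j - i"] assms by simp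
 next
  case False thus ?thesis using dn[of j "i - j"] R assms by simp
 qed
qed

text \<open>Each generator of \<open>Gam\<close> is read at the end where it is a move:
  \<open>P\<close> at index 0, powers of \<open>z\<close> at index \<open>k - 1\<close>.\<close>

lemma Reach_all: assumes i0: "i0 < k" shows "(x, q) : Gam ==> i < k ==> Reach (w i0, 1, i0) (x * w i, q, i)"
proof (induction arbitrary: i rule: Gam.induct)
 case Gam_1
 show ?case using Reach_move_idx[of "(w i0, 1, i0)" 1 i0 1 i] Reach_0 i0 Gam_1 by simp
next
 case (Gam_P x q p)
 have k0: "0 < k" using kbig by simp
 note 0 = Gam_P.IH[OF k0]
 have "Reach (w i0, 1, i0) (x * p * w 0, q * p, 0)"
 proof (cases "p : N0")
  case True
  thus ?thesis using Reach_eqv[OF 0] by (simp add: eqv_def N0)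
 next
  case False
  thus ?thesis using Reach_mv[OF 0 mv.mp] Gam_P by simp
 qed
 thus ?case by (rule Reach_move_idx[OF _ k0 Gam_P.prems])
next
 case (Gam_z x q j)
 have k0: "k - 1 < k" using kbig by simp
 note 0 = Gam_z.IH[OF k0]
 have "Reach (w i0, 1, i0) (x * zpow z j * w (k - 1), q * zpow p0 j, k - 1)"
 proof (cases "j = 0")
  case True thus ?thesis using 0 by simp
 next
  case False
  thus ?thesis using Reach_mv[OF 0 mv.mg[OF False]] by (simp add: z_pow mult.assoc)
 qed
 thus ?case by (rule Reach_move_idx[OF _ k0 Gam_z.prems])
next
 case (Gam_N x q n)
 have "eqv (x * w i, q, i) (x * n * w i, q, i)"
  using Nc'[OF Gam_N.hyps(2), of "w i"] subgrpD(1)[OF N0_sub] by (simp add: eqv_def mult.assoc)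
 thus ?case by (rule Reach_eqv[OF Gam_N.IH[OF Gam_N.prems]])
qed

text \<open>A reduced path that has turned at both ends of the chain has passed all \<open>k\<close> indices.\<close>

lemma rp_trichotomy:
 assumes "rp (w i0, 1, i0) n f s tg" and i0: "i0 < k"
 shows "s = (w (snd (snd s)), 1, snd (snd s)) & (snd (snd s) = i0 & n = 0 \<or> 0 < n) \<or>
  (EX p:P - N0. s = (p * w (snd (snd s)), p, snd (snd s)) & tg = Some True & snd (snd s) < n) \<or>
  (\<exists>j. j ~= 0 & s = (zpow z j * w (snd (snd s)), zpow p0 j, snd (snd s)) & tg = Some False & k <= n + snd (snd s)) \<or> k < n"
 using assms(1)
proof (induction rule: rp.induct)
 case rp_0 show ?case by simp
next
 case (rp_S n f s tg s' a b)
 consider (A) "s = (w (snd (snd s)), 1, snd (snd s))"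
  | (P) p where "p : P - N0" "s = (p * w (snd (snd s)), p, snd (snd s))" "tg = Some True" "snd (snd s) < n"
  | (G) j where "j ~= 0" "s = (zpow z j * w (snd (snd s)), zpow p0 j, snd (snd s))" "tg = Some False" "k <= n + snd (snd s)"
  | (C) "k < n" using rp_S.IH by blast
 thus ?case
 proof cases
  case A
  from rp_S.hyps(2) show ?thesis
  proof (cases rule: mv.cases)
   case (up i y q) thus ?thesis using A by simp
  next
   case (dn i y q) thus ?thesis using A by (simp add: mult.assoc)
  next
   case (mp p y q) thus ?thesis using A by simp
  next
   case (mg j y q) thus ?thesis using A kbig by (auto simp: z_pow mult.assoc)
  qed
 next
  case (P p)
  from rp_S.hyps(2) show ?thesis
  proof (cases rule: mv.cases)
   case (up i y q) thus ?thesis using P by (auto simp: mult.assoc)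
  next
   case (dn i y q) thus ?thesis using P rp_S.hyps(3) by simp
  next
   case (mp p y q) thus ?thesis using P rp_S.hyps(3) by simp
  next
   case (mg j y q) thus ?thesis using P by auto
  qed
 next
  case (G j)
  from rp_S.hyps(2) show ?thesis
  proof (cases rule: mv.cases)
   case (up i y q) thus ?thesis using G rp_S.hyps(3) by simp
  next
   case (dn i y q) thus ?thesis using G by (auto simp: mult.assoc)
  next
   case (mp p y q) thus ?thesis using G by auto
  next
   case (mg j y q) thus ?thesis using G rp_S.hyps(3) by simp
  qed
 qed simp
qed

end

section \<open>Translates of the chain orbit and of two axes as families\<close>

context wds begin

text \<open>For \<open>c = 1\<close> and \<open>c = 2\<close> the rotation number occurs at no
  corner of the chain, so corners of the three families cannot be confused.\<close>

definition R :: "nat => 'g" where "R c = zpow r (mx (k + c)) * t"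

definition EE :: "nat => 'g set" where "EE c = (if c = 0 then QN else pwr (R c) N)"

text \<open>Frames together with the index that determines the rotation at their corner; along the
  axis of \<open>R c\<close> this index is constant.\<close>

definition FRM :: "nat => ('g \<times> nat) set" where
 "FRM c = (if c = 0 then {(x * w i, i) |x i. x : QN & i < k} else {(x, k + c) |x. x : pwr (R c) N})"

definition XX :: "nat => 'g set set" where "XX c = {lm y E |y i. (y, i) : FRM c}"

definition st :: "'g set => 'g set => bool" where
 "st u v \<longleftrightarrow> (\<exists>x s. s : Sg & u = lm x E & v = lm (x * s) E)"

definition cn :: "'g => nat => 'g set => 'g set => 'g set => bool" where
 "cn h c u v x \<longleftrightarrow> (\<exists>y i a b. (y, i) : FRM c & a : Lf i & b : Rt i & v = lm (h * y) E &
   (u = lm (h * y * a) E & x = lm (h * y * zpow r (mx i) * b) E \<or>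
   x = lm (h * y * a) E & u = lm (h * y * zpow r (mx i) * b) E))"

definition pth :: "'g => nat => (nat => 'g set) => nat => bool" where
 "pth h c f n \<longleftrightarrow> (ALL i<=n. f i : lm h ` XX c) & (\<forall>i<n. st (f i) (f (Suc i))) &
   (\<forall>i. Suc i < n --> cn h c (f i) (f (Suc i)) (f (Suc (Suc i))))"

lemma pthD: assumes "pth h c f n"
 shows "\<And>i. i <= n ==> f i : lm h ` XX c" "\<And>i. i < n ==> st (f i) (f (Suc i))"
  "\<And>i. Suc i < n ==> cn h c (f i) (f (Suc i)) (f (Suc (Suc i)))"
 using assms by (simp_all add: pth_def)

lemma EE_sub: "subgrp (EE c)" by (simp add: QN_sub pwr_sub N_normal EE_def)
lemma EE_N: "n : N ==> n : EE c" by (simp add: QN_N pwr_N EE_def)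

lemma XXY: "u : XX c ==> u : Yc E" unfolding XX_def using Yc_I by blast

lemma XXhY: "u : lm h ` XX c ==> u : Yc E"
proof -
 assume "u : lm h ` XX c"
 then obtain v where "v : XX c" "u = lm h v" by blast
 thus ?thesis using Yc_lm[OF XXY] by simp
qed

lemma FRM_EE: "(y, i) : FRM c ==> x : EE c ==> (x * y, i) : FRM c"
proof (cases "c = 0")
 case True
 assume a: "(y, i) : FRM c" "x : EE c"
 then obtain x' where x': "y = x' * w i" "x' : QN" "i < k" using True by (auto simp: FRM_def)
 have "x * x' : QN" using subgrpD(2)[OF QN_sub] a True x' by (simp add: EE_def)
 hence "(x * x' * w i, i) : FRM c" using True x' unfolding FRM_def by auto
 thus ?thesis using x' by (simp add: mult.assoc)
next
 case False
 assume a: "(y, i) : FRM c" "x : EE c"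
 thus ?thesis using subgrpD(2)[OF EE_sub[of c], of x y] False by (auto simp: FRM_def EE_def)
qed

lemma FRM_diff: assumes "(y, i) : FRM c" "(y', i) : FRM c'" "c <= 2" "c' <= 2"
 shows "c = c' & (\<forall>h h'. (h * y)^- * (h' * y') : N --> h^- * h' : EE c)"
proof -
 have cc: "c = c'" using assms by (auto simp: FRM_def split: if_splits)
 obtain v e e' where v: "y = e * v" "y' = e' * v" "e : EE c" "e' : EE c"
 proof (cases "c = 0")
  case True
  thus ?thesis using that[of _ "w i"] assms cc by (auto simp: FRM_def EE_def)
 next
  case False
  thus ?thesis using that[of _ 1] assms cc by (auto simp: FRM_def EE_def)
 qed
 have "h^- * h' : EE c" if n: "(h * y)^- * (h' * y') : N" for h h'
 proof -
  have "v * ((h * y)^- * (h' * y')) * v^- : N" by (rule Nc[OF n])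
  hence "e^- * (h^- * h') * e' : EE c" by (simp add: EE_N v mult.assoc)
  hence "e * (e^- * (h^- * h') * e') * e'^- : EE c"
   by (simp add: subgrpD EE_sub v)
  thus ?thesis by (simp add: mult.assoc)
 qed
 thus ?thesis using cc by blast
qed

lemma cn_ang: "cn h c u v x ==> kap < ang v u x"
proof -
 assume "cn h c u v x"
 then obtain y i a b where c: "a : Lf i" "b : Rt i" "v = lm (h * y) E"
   "u = lm (h * y * a) E & x = lm (h * y * zpow r (mx i) * b) E \<or>
   x = lm (h * y * a) E & u = lm (h * y * zpow r (mx i) * b) E" unfolding cn_def by blast
 note S = Lf_Sg[OF c(1)] Rt_Sg[OF c(2)]
 have k: "kap < ang E (lm a E) (lm (zpow r (mx i) * b) E)"
  by (rule corner[OF S]) (use mx_ge[of i] m0_pos in linarith)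
 have t: "ang (lm (h * y) E) (lm (h * y * a) E) (lm (h * y * zpow r (mx i) * b) E) = ang E (lm a E) (lm (zpow r (mx i) * b) E)"
  using ang_inv[OF Yc_E Yc_I Yc_I, of "h * y" a "zpow r (mx i) * b"] by (simp add: mult.assoc)
 have s: "ang E (lm (zpow r (mx i) * b) E) (lm a E) = ang E (lm a E) (lm (zpow r (mx i) * b) E)"
  by (simp add: ang_sym Yc_E Yc_I lm_rne S Sg_ne)
 have t': "ang (lm (h * y) E) (lm (h * y * zpow r (mx i) * b) E) (lm (h * y * a) E) = ang E (lm (zpow r (mx i) * b) E) (lm a E)"
  using ang_inv[OF Yc_E Yc_I Yc_I, of "h * y" "zpow r (mx i) * b" a] by (simp add: mult.assoc)
 show ?thesis using c(3,4) k t t' s by auto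
qed

lemma st_bd: assumes "st u v" shows "u ~= v" "[|y : Yc E; y ~= u; y ~= v|] ==> ang y u v <= BB"
proof -
 obtain x s where x: "s : Sg" "u = lm x E" "v = lm (x * s) E" by (metis assms st_def)
 show "u ~= v" using Sg_ne[OF x(1)] lm_inj[of x E "lm s E"] x by simp
 assume y: "y : Yc E" "y ~= u" "y ~= v"
 define y' where "y' = lm x^- y"
 have y': "y = lm x y'" "y' : Yc E" using Yc_lm[OF y(1)] by (simp_all add: y'_def)
 have ne: "y' ~= E" "y' ~= lm s E" using y x y' by auto
 have "ang (lm x y') (lm x E) (lm x (lm s E)) = ang y' E (lm s E)" by (rule ang_inv[OF y'(2) Yc_E Yc_I])
 thus "ang y u v <= BB" using BB(1)[OF x(1) y'(2) ne] x y' by simp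
qed

lemma pth_lgeo: assumes p: "pth h c f n" shows "lgeo f n"
 unfolding lgeo_def
proof (intro conjI allI impI ballI)
 fix i assume "i <= n"
 from pthD(1)[OF p this] show "f i : Yc E" by (rule XXhY)
next
 fix i assume i: "i < n"
 show "f i ~= f (Suc i)" by (rule st_bd(1)[OF pthD(2)[OF p i]])
 show "\<And>w. w : Yc E ==> w ~= f i ==> w ~= f (Suc i) ==> ang w (f i) (f (Suc i)) <= BB" by (rule st_bd(2)[OF pthD(2)[OF p i]])
next
 fix i assume i: "Suc i < n"
 show "kap < ang (f (Suc i)) (f i) (f (Suc (Suc i)))" by (rule cn_ang[OF pthD(3)[OF p i]])
qed

lemma mv_st: "mv s s' a b ==> st (pt s) (pt s')"
proof (induction rule: mv.induct)
 case (up i y q)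
 have "pt (y, q, i) = lm (y * zpow r (mx i)) E" using lm_r by (simp add: pt_def)
 thus ?case by (metis t_Sg st_def pt_def fst_conv)
next
 case (dn i y q)
 have "lm (y * t^- * (zpow r (mx i))^-) E = lm (y * t^-) E" by (metis lm_r zpow_minus)
 thus ?case by (metis t_Sg st_def pt_def fst_conv)
next
 case (mp p y q)
 hence "p : Sg" by (simp add: Sg_def)
 thus ?case by (metis st_def pt_def fst_conv)
next
 case (mg j y q)
 let ?Q = "zpow r (mx (k - 1))"
 have "zpow g j : Sg" using mg by (auto simp: Sg_def)
 moreover have "lm (y * (?Q * zpow g j * inverse ?Q)) E = lm (y * ?Q * zpow g j) E"
  by (metis lm_r zpow_minus mult.assoc)
 moreover have "lm y E = lm (y * ?Q) E" using lm_r by simp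
 ultimately show ?case by (metis st_def pt_def fst_conv)
qed

lemma ok_FRM: "ok s ==> (fst s, snd (snd s)) : FRM 0"
 unfolding ok_def FRM_def using QN_I[of "fst s * (w (snd (snd s)))^-" "fst (snd s)"]
 by (auto simp: mult.assoc intro!: exI[of _ "fst s * (w (snd (snd s)))^-"])

lemma FRM_XX: "(y, i) : FRM c ==> lm y E : XX c" unfolding XX_def by blast

lemma rp_path:
 assumes "rp s0 n f s tg" "ok s0"
 shows "ok s & f 0 = pt s0 & f n = pt s & pth 1 0 f n & (0 < n --> (\<exists>b. tg = Some b & side b (snd (snd s)) (fst s) (f (n - 1))))"
 using assms
proof (induction rule: rp.induct)
 case rp_0
 thus ?case using FRM_XX ok_FRM by (fastforce simp: pth_def pt_def)
next
 case (rp_S n f s tg s' a b)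
 have IH: "ok s" "f 0 = pt s0" "f n = pt s" "pth 1 0 f n" "0 < n ==> \<exists>b. tg = Some b & side b (snd (snd s)) (fst s) (f (n - 1))"
  using rp_S.IH[OF rp_S.prems] by auto
 note ok' = ok_mv[OF rp_S.hyps(2) IH(1)]
 let ?f = "f(Suc n := pt s')"
 have X: "pt s' : lm 1 ` XX 0" using FRM_XX ok_FRM ok' by (fastforce simp: pt_def)
 have "cn 1 0 (f (n - 1)) (f n) (pt s')" if n: "0 < n"
 proof -
  obtain b0 where b0: "tg = Some b0" "side b0 (snd (snd s)) (fst s) (f (n - 1))" using IH(5)[OF n] by blast
  note a = mv_sides(1)[OF rp_S.hyps(2)]
  have ab: "a = (\<not> b0)" using rp_S.hyps(3) b0(1) by auto
  let ?y = "fst s" and ?i = "snd (snd s)"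
  have "\<exists>a b. a : Lf ?i & b : Rt ?i & (f (n - 1) = lm (?y * a) E & pt s' = lm (?y * zpow r (mx ?i) * b) E \<or>
   pt s' = lm (?y * a) E & f (n - 1) = lm (?y * zpow r (mx ?i) * b) E)"
   using a b0(2) ab unfolding side_def by (cases b0) auto
  thus ?thesis unfolding cn_def IH(3) using ok_FRM[OF IH(1)] by (auto simp: pt_def)
 qed
 hence c: "cn 1 0 (f i) (f n) (pt s')" if "n = Suc i" for i using that by simp
 define F where "F = f(Suc n := pt s')"
 have F: "F i = f i" if "i <= n" for i using that by (simp add: F_def)
 have Fn: "F (Suc n) = pt s'" by (simp add: F_def)
 have "pth 1 0 F (Suc n)" unfolding pth_def
 proof (intro conjI allI impI)
  fix i assume "i <= Suc n"
  then consider "i <= n" | "i = Suc n" by linarith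
  thus "F i : lm 1 ` XX 0" by cases (use F Fn X pthD(1)[OF IH(4)] in simp_all)
 next
  fix i assume "i < Suc n"
  then consider "i < n" | "i = n" by linarith
  thus "st (F i) (F (Suc i))" by cases (use F Fn mv_st[OF rp_S.hyps(2)] IH(3) pthD(2)[OF IH(4)] in simp_all)
 next
  fix i assume "Suc i < Suc n"
  then consider "Suc i < n" | "n = Suc i" by linarith
  thus "cn 1 0 (F i) (F (Suc i)) (F (Suc (Suc i)))"
  proof cases
   case 1 thus ?thesis using F pthD(3)[OF IH(4)] by simp
  next
   case 2 thus ?thesis using F Fn c by simp
  qed
 qed
 thus ?case unfolding F_def[symmetric] using F[of 0] F[of n] Fn IH ok' mv_sides(2)[OF rp_S.hyps(2)] by simp
qed

lemma ok_start: "i < k ==> ok (w i, 1, i)" using Gam_1 by (simp add: ok_def)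

lemma path_w:
 assumes i: "i < k" "j < k" and x: "(x, q) : Gam"
 obtains f n s tg where "rp (w i, 1, i) n f s tg" "eqv s (x * w j, q, j)" "f 0 = lm (w i) E" "f n = lm (x * w j) E" "pth 1 0 f n"
proof -
 obtain n f s tg where rp: "rp (w i, 1, i) n f s tg" "eqv s (x * w j, q, j)"
  using Reach_all[OF i(1) x i(2)] unfolding Reach_def by blast
 have "pt s = lm (x * w j) E" using eqv_pt[OF rp(2)] by (simp add: pt_def)
 thus ?thesis using that[OF rp] rp_path[OF rp(1) ok_start[OF i(1)]] by (simp add: pt_def)
qed

lemma eqv_w: assumes "eqv (y * w i, q, i) (x * w i, q', i)" shows "y^- * x : N" "q^- * q' : N0"
proof -
 have "(y * w i)^- * (x * w i) : N" using assms by (simp add: eqv_def)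
 from Nc[OF this, of "w i"] show "y^- * x : N" by (simp add: mult.assoc)
qed (use assms in \<open>simp add: eqv_def\<close>)

text \<open>\<open>rp_trichotomy\<close> in geometric form: a reduced walk is a local geodesic, so
  length above \<open>k\<close> means at least \<open>k\<close> separators.\<close>

lemma Gam_move:
 assumes i: "i < k" and x: "(x, q) : Gam"
 obtains "x : N" "q : N0"
 | p where "p : P - N0" "p^- * x : N" "p^- * q : N0"
 | j where "j ~= 0" "(zpow z j)^- * x : N" "(zpow p0 j)^- * q : N0"
 | "lm (w i) E ~= lm (x * w i) E" "k <= card (sep KK (lm (w i) E) (lm (x * w i) E))"
proof -
 obtain f n s tg where p: "rp (w i, 1, i) n f s tg" "eqv s (x * w i, q, i)" "f 0 = lm (w i) E" "f n = lm (x * w i) E" "pth 1 0 f n"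
  using path_w[OF i i x] .
 have si: "snd (snd s) = i" using p(2) by (simp add: eqv_def)
 note tri = rp_trichotomy[OF p(1) i, unfolded si]
 have eA: "x : N & q : N0" if "s = (w i, 1, i)" using eqv_w[of 1 i 1 x q] p(2) that by simp
 have eP: "p'^- * x : N & p'^- * q : N0" if "s = (p' * w i, p', i)" for p' using eqv_w[of p' i p' x q] p(2) that by simp
 have eG: "(zpow z j)^- * x : N & (zpow p0 j)^- * q : N0" if "s = (zpow z j * w i, zpow p0 j, i)" for j
  using eqv_w[of "zpow z j" i "zpow p0 j" x q] p(2) that by simp
 have eC: "lm (w i) E ~= lm (x * w i) E & k <= card (sep KK (lm (w i) E) (lm (x * w i) E))" if n: "k < n"
 proof
  note l = pth_lgeo[OF p(5)]
  show "lm (w i) E ~= lm (x * w i) E" using lgeo_ne[OF l, of 0 n] n p by simp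
  have "Suc (card (sep KK (f 0) (f n))) = n" using lgeo_card l n csts by simp
  thus "k <= card (sep KK (lm (w i) E) (lm (x * w i) E))" using n p by simp
 qed
 show ?thesis using tri eA eP eG eC that by metis
qed

lemma Gam_fix:
 assumes i: "i < k" and x: "(x, q) : Gam" and e: "lm (x * w i) E = lm (w i) E"
 shows "x : N & q : N0"
proof -
 obtain f n s tg where p: "rp (w i, 1, i) n f s tg" "eqv s (x * w i, q, i)" "f 0 = lm (w i) E" "f n = lm (x * w i) E" "pth 1 0 f n"
  using path_w[OF i i x] .
 have n: "n = 0" using lgeo_ne[OF pth_lgeo[OF p(5)], of 0 n] p e by (cases "n = 0") auto
 have si: "snd (snd s) = i" using p(2) by (simp add: eqv_def)
 have "s = (w i, 1, i)" using rp_trichotomy[OF p(1) i, unfolded si] n i by auto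
 thus ?thesis using eqv_w[of 1 i 1 x q] p(2) by simp
qed

text \<open>The quotient of the two pairs lies over 1, which fixes the base coset, so
  \<open>Gam_fix\<close> applies. Thus \<open>Gam\<close> is the graph of a homomorphism modulo
  \<open>N0\<close>.\<close>

lemma Gam_unique: assumes "(x, q) : Gam" "(x, q') : Gam" shows "q^- * q' : N0"
proof -
 note Gam_mult[OF Gam_inv[OF assms(1)] assms(2)]
 thus ?thesis using Gam_fix kbig by fastforce
qed

lemma pth_lm: assumes p: "pth 1 c f n" and x: "x : EE c" shows "pth h c (\<lambda>i. lm (h * x) (f i)) n"
proof -
 have XE: "lm x u : XX c" if uX: "u : XX c" for u
 proof -
  obtain y i where "u = lm y E" "(y, i) : FRM c" using uX unfolding XX_def by blast
  thus ?thesis using FRM_XX[OF FRM_EE[OF _ x]] by simp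
 qed
 show ?thesis unfolding pth_def
 proof (intro conjI allI impI)
  fix i assume "i <= n"
  hence "f i : XX c" using pthD p by fastforce
  hence "lm h (lm x (f i)) : lm h ` XX c" by (intro imageI XE)
  thus "lm (h * x) (f i) : lm h ` XX c" by simp
 next
  fix i assume "i < n"
  then obtain y s where "s : Sg" "f i = lm y E" "f (Suc i) = lm (y * s) E" by (metis pthD p st_def)
  hence "s : Sg" "lm (h * x) (f i) = lm (h * x * y) E" "lm (h * x) (f (Suc i)) = lm (h * x * y * s) E"
   by (simp_all add: mult.assoc)
  thus "st (lm (h * x) (f i)) (lm (h * x) (f (Suc i)))" unfolding st_def by blast
 next
  fix i assume "Suc i < n"
  then obtain y l a b where c: "(y, l) : FRM c" "a : Lf l" "b : Rt l" "f (Suc i) = lm y E"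
   "f i = lm (y * a) E & f (Suc (Suc i)) = lm (y * zpow r (mx l) * b) E \<or>
   f (Suc (Suc i)) = lm (y * a) E & f i = lm (y * zpow r (mx l) * b) E" using pthD(3)[OF p] unfolding cn_def by fastforce
  show "cn h c (lm (h * x) (f i)) (lm (h * x) (f (Suc i))) (lm (h * x) (f (Suc (Suc i))))"
   unfolding cn_def
   by (rule exI[of _ "x * y"], rule exI[of _ l], rule exI[of _ a], rule exI[of _ b])
    (use c FRM_EE[OF c(1) x] in \<open>auto simp: mult.assoc\<close>)
 qed
qed

lemma axis_pth:
 assumes c: "c = 1 \<or> c = 2" and e: "e = 1 \<or> e = - 1"
 shows "pth 1 c (\<lambda>i. lm (zpow (R c) (a + e * int i)) E) n"
proof -
 have F: "(zpow (R c) j, k + c) : FRM c" for j using c pwr_I[OF sN] by (auto simp: FRM_def)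
 have up: "lm (zpow (R c) (j + 1)) E = lm (zpow (R c) j * zpow r (mx (k + c)) * t) E" for j
  by (simp add: zpow_add R_def mult.assoc)
 have dn: "lm (zpow (R c) (j - 1)) E = lm (zpow (R c) j * t^-) E" for j
 proof -
  have "zpow (R c) (j - 1) = zpow (R c) j * t^- * zpow r (- mx (k + c))"
   using zpow_add[of "R c" j "- 1"] by (simp add: R_def mult.assoc zpow_minus)
  thus ?thesis using lm_r by simp
 qed
 have up': "st (lm (zpow (R c) j) E) (lm (zpow (R c) (j + 1)) E)" for j
  by (metis st_def up t_Sg lm_r)
 have dn': "st (lm (zpow (R c) j) E) (lm (zpow (R c) (j - 1)) E)" for j
  by (metis st_def dn t_Sg)
 have LR: "t^- : Lf (k + c)" "t : Rt (k + c)" using c kbig by (auto simp: Lf_def Rt_def)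
 have c1: "cn 1 c (lm (zpow (R c) (j - 1)) E) (lm (zpow (R c) j) E) (lm (zpow (R c) (j + 1)) E)"
  and c2: "cn 1 c (lm (zpow (R c) (j + 1)) E) (lm (zpow (R c) j) E) (lm (zpow (R c) (j - 1)) E)" for j
  unfolding cn_def up dn using F[of j] LR by (metis mult_1_left)+
 show ?thesis
  using e
 proof
  assume e: "e = 1"
  have n: "a + e * int (Suc i) = (a + e * int i) + 1" "a + e * int (Suc (Suc i)) = (a + e * int (Suc i)) + 1"
   "a + e * int i = (a + e * int (Suc i)) - 1" for i by (auto simp: e)
  show ?thesis unfolding pth_def
  proof (intro conjI allI impI)
   fix i show "lm (zpow (R c) (a + e * int i)) E : lm 1 ` XX c" using FRM_XX F by auto
   show "st (lm (zpow (R c) (a + e * int i)) E) (lm (zpow (R c) (a + e * int (Suc i))) E)" by (metis n up')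
   show "cn 1 c (lm (zpow (R c) (a + e * int i)) E) (lm (zpow (R c) (a + e * int (Suc i))) E) (lm (zpow (R c) (a + e * int (Suc (Suc i)))) E)"
    by (metis n c1)
  qed
 next
  assume e: "e = - 1"
  have n: "a + e * int (Suc i) = (a + e * int i) - 1" "a + e * int (Suc (Suc i)) = (a + e * int (Suc i)) - 1"
   "a + e * int i = (a + e * int (Suc i)) + 1" for i by (auto simp: e)
  show ?thesis unfolding pth_def
  proof (intro conjI allI impI)
   fix i show "lm (zpow (R c) (a + e * int i)) E : lm 1 ` XX c" using FRM_XX F by auto
   show "st (lm (zpow (R c) (a + e * int i)) E) (lm (zpow (R c) (a + e * int (Suc i))) E)" by (metis n dn')
   show "cn 1 c (lm (zpow (R c) (a + e * int i)) E) (lm (zpow (R c) (a + e * int (Suc i))) E) (lm (zpow (R c) (a + e * int (Suc (Suc i)))) E)"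
    by (metis n c2)
  qed
 qed
qed

lemma axis_path:
 assumes c: "c = 1 \<or> c = 2" and ab: "a ~= b"
 obtains f where "f 0 = lm (zpow (R c) a) E" "f (nat \<bar>b - a\<bar>) = lm (zpow (R c) b) E" "pth 1 c f (nat \<bar>b - a\<bar>)"
proof -
 define e :: int where "e = (if a < b then 1 else - 1)"
 have e: "e = 1 \<or> e = - 1" "a + e * int (nat \<bar>b - a\<bar>) = b" using ab by (auto simp: e_def)
 show ?thesis using that[of "\<lambda>i. lm (zpow (R c) (a + e * int i)) E"] axis_pth[OF c e(1)] e(2) by simp
qed

lemma axis_card:
 assumes c: "c = 1 \<or> c = 2" and ab: "a ~= b"
 shows "lm (zpow (R c) a) E ~= lm (zpow (R c) b) E & Suc (card (sep KK (lm (zpow (R c) a) E) (lm (zpow (R c) b) E))) = nat \<bar>b - a\<bar>"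
proof -
 obtain f where f: "f 0 = lm (zpow (R c) a) E" "f (nat \<bar>b - a\<bar>) = lm (zpow (R c) b) E" "pth 1 c f (nat \<bar>b - a\<bar>)"
  using axis_path[OF assms] .
 note l = pth_lgeo[OF f(3)]
 have n: "0 < nat \<bar>b - a\<bar>" using ab by simp
 have "f 0 ~= f (nat \<bar>b - a\<bar>)" using lgeo_ne[OF l n] by simp
 moreover have "Suc (card (sep KK (f 0) (f (nat \<bar>b - a\<bar>)))) = nat \<bar>b - a\<bar>" using lgeo_card l n csts by simp
 ultimately show ?thesis using f by simp
qed

lemma XX_paths:
 assumes c: "c <= 2" and u: "u : lm h ` XX c" and v: "v : lm h ` XX c" and ne: "u ~= v"
 obtains f n where "0 < n" "f 0 = u" "f n = v" "pth h c f n"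
proof (cases "c = 0")
 case True
 obtain y i y' j where uv: "u = lm h (lm y E)" "(y, i) : FRM c" "v = lm h (lm y' E)" "(y', j) : FRM c"
  using u v unfolding XX_def by blast
 obtain x x' where x: "y = x * w i" "x : QN" "i < k" "y' = x' * w j" "x' : QN" "j < k"
  using uv True by (auto simp: FRM_def)
 note subgrpD(2)[OF QN_sub subgrpD(3)[OF QN_sub x(2)] x(5)]
 then obtain q where q: "(x^- * x', q) : Gam" using QN_D by blast
 obtain f n s tg where f: "f 0 = lm (w i) E" "f n = lm (x^- * x' * w j) E" "pth 1 0 f n"
  using path_w[OF x(3,6) q] by metis
 have p: "pth h c (\<lambda>i. lm (h * x) (f i)) n" using pth_lm[OF f(3)] x True by (simp add: EE_def)
 have e: "lm (h * x) (f 0) = u" "lm (h * x) (f n) = v" using f uv x by (simp_all add: mult.assoc)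
 have "0 < n" using e ne by (cases "n = 0") auto
 thus ?thesis using that[OF _ e p] by simp
next
 case False
 hence c': "c = 1 \<or> c = 2" using c by auto
 have *: "\<exists>a. u' = lm h (lm (zpow (R c) a) E)" if u': "u' : lm h ` XX c" for u'
 proof -
  obtain y i where "u' = lm h (lm y E)" "(y, i) : FRM c" using u' unfolding XX_def by blast
  hence y: "u' = lm h (lm y E)" "y : pwr (R c) N" using False by (auto simp: FRM_def)
  then obtain a where a: "(zpow (R c) a)^- * y : N" unfolding pwr_def by blast
  have "lm y E = lm (zpow (R c) a) E" using lm_E[OF NE[OF a], of "zpow (R c) a"] by simp
  thus ?thesis using y(1) by (intro exI[of _ a]) simp
 qed
 obtain a b where ab: "u = lm h (lm (zpow (R c) a) E)" "v = lm h (lm (zpow (R c) b) E)" using *[OF u] *[OF v] by blast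
 have "a ~= b" using ab ne by auto
 then obtain f where f: "f 0 = lm (zpow (R c) a) E" "f (nat \<bar>b - a\<bar>) = lm (zpow (R c) b) E" "pth 1 c f (nat \<bar>b - a\<bar>)"
  using axis_path[OF c'] by blast
 have p: "pth h c (\<lambda>i. lm (h * 1) (f i)) (nat \<bar>b - a\<bar>)" by (rule pth_lm[OF f(3) subgrpD(1)[OF EE_sub]])
 show ?thesis by (rule that[OF _ _ _ p]) (use f ab \<open>a ~= b\<close> in auto)
qed

text \<open>Local geodesics between \<open>u\<close> and \<open>v\<close> are unique, so the two
  translates have a corner in common, and \<open>shared_corner\<close> recovers index and frame from
  it.\<close>

lemma same_fam:
 assumes c: "c <= 2" "c' <= 2" and m: "u : lm h ` XX c" "v : lm h ` XX c" "u : lm h' ` XX c'" "v : lm h' ` XX c'"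
  and s: "x : sep kap u v"
 shows "c = c' & h^- * h' : EE c"
proof -
 have uv: "u : Yc E" "v : Yc E" using XXhY[OF m(1)] XXhY[OF m(2)] .
 note ne = sep_ne[OF s uv]
 have BK: "BB <= kap" using csts by simp
 obtain f n where f: "0 < n" "f 0 = u" "f n = v" "pth h c f n" using XX_paths[OF c(1) m(1,2) ne] .
 obtain f' n' where f': "0 < n'" "f' 0 = u" "f' n' = v" "pth h' c' f' n'" using XX_paths[OF c(2) m(3,4) ne] .
 note l = pth_lgeo[OF f(4)] and l' = pth_lgeo[OF f'(4)]
 have eq: "n = n' & f i = f' i" if "i <= n" for i using lgeo_unique[OF l l' _ _ that] f f' by simp
 have "x : f ` {1..<n}" using lgeo_sep[OF l f(1) BK] s f by simp
 then obtain j where "j : {1..<n}" "x = f j" by blast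
 then obtain i where i: "Suc i < n" by (cases j) auto
 have e: "f i = f' i" "f (Suc i) = f' (Suc i)" "f (Suc (Suc i)) = f' (Suc (Suc i))" "Suc i < n'" using eq i by auto
 obtain y l a b where C: "(y, l) : FRM c" "a : Lf l" "b : Rt l" "f (Suc i) = lm (h * y) E"
   "f i = lm (h * y * a) E & f (Suc (Suc i)) = lm (h * y * zpow r (mx l) * b) E \<or>
   f (Suc (Suc i)) = lm (h * y * a) E & f i = lm (h * y * zpow r (mx l) * b) E"
  using pthD(3)[OF f(4) i] unfolding cn_def by blast
 obtain y' l' a' b' where C': "(y', l') : FRM c'" "a' : Lf l'" "b' : Rt l'" "f (Suc i) = lm (h' * y') E"
   "f i = lm (h' * y' * a') E & f (Suc (Suc i)) = lm (h' * y' * zpow r (mx l') * b') E \<or>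
   f (Suc (Suc i)) = lm (h' * y' * a') E & f i = lm (h' * y' * zpow r (mx l') * b') E"
  using pthD(3)[OF f'(4) e(4)] unfolding cn_def e(1-3)[symmetric] by blast
 have "l = l' & (h * y)^- * (h' * y') : N"
 proof (rule shared_corner[OF C(2,3) C'(2,3)])
  show "lm (h * y) E = lm (h' * y') E" using C(4) C'(4) by simp
 qed (use C(5) C'(5) in metis)
 thus ?thesis using FRM_diff C c C' by simp
qed

text \<open>Supplies the data for \<open>same_fam\<close>, which then yields stabilizers and tells
  the three families apart.\<close>

lemma XX_line:
 assumes c: "c <= 2" obtains u v x where "u : XX c" "v : XX c" "x : sep kap u v"
proof (cases "c = 0")
 case True
 have k: "0 < k" "1 < k" using kbig by auto
 have mk: "(x * w i, i) : FRM c" if "x : QN" "i < k" for x i unfolding FRM_def using True that by auto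
 note o1 = subgrpD(1)[OF QN_sub]
 have F: "(p0, 0) : FRM c" "(zpow r (mx 0) * t, 1) : FRM c" "(1, 0) : FRM c"
  using mk[OF QN_I[OF Gam_of_P[OF p0(1)]] k(1)] mk[OF o1 k(2)] mk[OF o1 k(1)] by simp_all
 have pL: "p0 : Lf 0" "t : Rt 0" using p0 kbig by (auto simp: Lf_def Rt_def)
 have "cn 1 c (lm p0 E) E (lm (zpow r (mx 0) * t) E)"
  using F pL by (fastforce simp: cn_def)
 note big = cn_ang[OF this]
 note ne = not_sym[OF Sg_ne[OF Lf_Sg[OF pL(1)]]]
 have ne2: "E ~= lm (zpow r (mx 0) * t) E" by (rule not_sym[OF lm_rne[OF t_Sg(1)]])
 have "E : sep kap (lm p0 E) (lm (zpow r (mx 0) * t) E)" by (simp add: sep_def big ne ne2 Yc_E)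
 thus ?thesis by (rule that[OF FRM_XX[OF F(1)] FRM_XX[OF F(2)]])
next
 case False
 hence c': "c = 1 \<or> c = 2" using c by auto
 have p: "pth 1 c (\<lambda>i. lm (zpow (R c) (0 + 1 * int i)) E) 2" by (rule axis_pth[OF c']) simp
 note l = pth_lgeo[OF p]
 have s: "sep kap (lm (zpow (R c) (0 + 1 * int 0)) E) (lm (zpow (R c) (0 + 1 * int 2)) E) = (\<lambda>i. lm (zpow (R c) (0 + 1 * int i)) E) ` {1..<2}"
  using lgeo_sep l csts by fastforce
 have X: "lm (zpow (R c) (0 + 1 * int i)) E : XX c" if "i <= 2" for i using pthD(1)[OF p that] by (simp add: image_def)
 have "1 : {1..<2::nat}" by simp
 hence "lm (zpow (R c) (0 + 1 * int 1)) E : sep kap (lm (zpow (R c) (0 + 1 * int 0)) E) (lm (zpow (R c) (0 + 1 * int 2)) E)"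
  using s by blast
 moreover have "(0::nat) <= 2" "(2::nat) <= 2" by simp_all
 ultimately show ?thesis using that[OF X[of 0] X[of 2]] by blast
qed

lemma XX_stab: assumes c: "c <= 2" shows "lm h ` XX c = XX c \<longleftrightarrow> h : EE c"
proof
 have i1: "lm 1 ` XX c = XX c" by (simp add: image_def)
 obtain u v x where u: "u : XX c" "v : XX c" "x : sep kap u v" using XX_line[OF c] .
 {
  assume e: "lm h ` XX c = XX c"
  have "inverse 1 * h : EE c" by (metis same_fam c u i1 e)
  thus "h : EE c" by simp
 }
 have *: "lm h ` XX c <= XX c" if h: "h : EE c" for h
 proof
  fix u assume "u : lm h ` XX c"
  then obtain y i where "u = lm h (lm y E)" "(y, i) : FRM c" unfolding XX_def by blast
  thus "u : XX c" using FRM_XX[OF FRM_EE[OF _ h]] by simp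
 qed
 assume h: "h : EE c"
 have "lm h ` lm h^- ` XX c <= lm h ` XX c" using *[OF subgrpD(3)[OF EE_sub h]] by blast
 hence "XX c <= lm h ` XX c" by (simp add: image_image)
 thus "lm h ` XX c = XX c" using *[OF h] by blast
qed

lemma XX_eq: assumes "c <= 2" shows "lm h ` XX c = lm h' ` XX c \<longleftrightarrow> h'^- * h : EE c"
proof -
 have "lm h ` XX c = lm h' ` XX c \<longleftrightarrow> lm h'^- ` lm h ` XX c = lm h'^- ` lm h' ` XX c"
  by (metis inj_image_eq_iff lm_inj injI)
 thus ?thesis by (simp add: XX_stab assms image_image)
qed

lemma XX_ne: assumes "c <= 2" "c' <= 2" "lm h ` XX c = lm h' ` XX c'" shows "c = c'"
proof -
 obtain u v x where u: "u : XX c" "v : XX c" "x : sep kap u v" using XX_line[OF assms(1)] .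
 have Y: "u : Yc E" "v : Yc E" "x : Yc E" using u XXY by (auto simp: sep_def)
 have "ang (lm h x) (lm h u) (lm h v) = ang x u v" by (rule ang_inv[OF Y(3,1,2)])
 hence "lm h x : sep kap (lm h u) (lm h v)" using u(3) Yc_lm[OF Y(3)] by (simp add: sep_def lm_inj)
 thus ?thesis using same_fam[OF assms(1,2), of "lm h u" h "lm h v" h' "lm h x"] u assms(3) by blast
qed

definition FF :: "'g set set set" where "FF = {lm h ` XX c |h c. c <= 2}"

text \<open>\<open>F1\<close> holds because points outside the local geodesic joining two points of
  a translate see its ends within \<open>BB\<close>, and its interior points see them beyond
  \<open>kap\<close>; \<open>F2\<close> is \<open>same_fam\<close>.\<close>

sublocale fm: fam "Yc E" ang th FF BB KK kap
proof (unfold_locales, goal_cases)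
 case 1 show ?case using csts by simp
next
 case 2 show ?case using csts by simp
next
 case 3 show ?case using csts by simp
next
 case 4 show ?case using csts by simp
next
 case (5 F)
 then obtain h c where F: "F = lm h ` XX c" "c <= 2" unfolding FF_def by blast
 obtain u where u: "u : XX c" using XX_line[OF F(2)] by blast
 have "F <= Yc E" using F XXhY by blast
 moreover have "F ~= {}" using F u by blast
 ultimately show ?case by blast
next
 case (6 F f f' x)
 then obtain h c where F: "F = lm h ` XX c" "c <= 2" unfolding FF_def by blast
 have f: "f : lm h ` XX c" "f' : lm h ` XX c" using 6(2,3) unfolding F(1) .
 have ne: "f ~= f'" using ang_self[OF 6(4) XXhY[OF f(1)] 6(5)[symmetric]] 6(7) by auto
 obtain f1 n where p: "0 < n" "f1 0 = f" "f1 n = f'" "pth h c f1 n" using XX_paths[OF F(2) f ne] .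
 note l = pth_lgeo[OF p(4)]
 have "EX i<=n. x = f1 i"
 proof (rule ccontr)
  assume "\<not> ?thesis"
  hence "ang x (f1 0) (f1 n) <= BB" by (intro lgeo_off[OF l p(1) 6(4)]) blast
  thus False using 6(7) p by simp
 qed
 then obtain i where i: "i <= n" "x = f1 i" by blast
 have "i ~= 0" "i ~= n" using i(2) p(2,3) 6(5,6) by metis+
 hence "kap < ang (f1 i) (f1 0) (f1 n)" using lgeo_ang(2)[OF l, of i] i(1) by simp
 moreover have "f1 i : F" unfolding F(1) by (rule pthD(1)[OF p(4) i(1)])
 ultimately show ?case unfolding i(2) p(2,3) by simp
next
 case (7 F G a b c)
 obtain h d where F: "F = lm h ` XX d" "d <= 2" using 7(1) unfolding FF_def by blast
 obtain h' d' where G: "G = lm h' ` XX d'" "d' <= 2" using 7(2) unfolding FF_def by blast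
 have ac: "a : lm h ` XX d" "c : lm h ` XX d" "a : lm h' ` XX d'" "c : lm h' ` XX d'"
  using 7(4,6) unfolding F(1) G(1) by blast+
 note s = same_fam[OF F(2) G(2) ac 7(7)]
 hence "lm h' ` XX d = lm h ` XX d" using XX_eq F by blast
 thus ?case using 7(3) F(1) G(1) s by simp
qed

end

primrec act :: "'g::grp => 'g set + 'g set set => 'g set + 'g set set" where
 "act g (Inl y) = Inl (lm g y)"
| "act g (Inr F) = Inr (lm g ` F)"

lemma act_1: "act 1 v = v" by (cases v) (simp_all add: image_def)
lemma act_act: "act (g * h) v = act g (act h v)" by (cases v) (simp_all add: image_image)
lemma act_inv_act: "act g^- (act g v) = v" "act g (act g^- v) = v"
 by (simp_all add: act_act[symmetric] act_1)

section \<open>One step of the construction\<close>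

locale stp = wds E ang th P N0 N r t g p0 k for E :: "'g::grp set" and ang th P N0 N r t g p0 k +
 fixes c :: "'g => nat"
 assumes tfN: "[|0 < m; x ^ m : N|] ==> x : N"
  and c_conj: "[|x : P; y : P|] ==> c (y * x * y^-) = c x"
  and c_N0: "[|x : P; n : N0|] ==> c (x * n) = c x"
  and c_pow: "[|x : P; j ~= 0|] ==> c (zpow x j) = c x"
  and colN: "[|x : P; x' : P; h * x * h^- * x'^- : N|] ==> c x = c x'"
  and compat: "[|j ~= 0; x : P; h * zpow g j * h^- * x^- : N|] ==> c x = c p0"
begin

lemma tfz: assumes "j ~= 0" "zpow x j : N" shows "x : N"
proof -
 have "x ^ nat \<bar>j\<bar> : N"
 proof (cases "0 <= j")
  case True thus ?thesis using assms by (simp add: zpow_def)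
 next
  case False
  hence "(zpow x j)^- = x ^ nat \<bar>j\<bar>" by (simp add: zpow_def inv_power)
  thus ?thesis by (metis Ni assms)
 qed
 thus ?thesis using tfN[of "nat \<bar>j\<bar>" x] assms by simp
qed

lemma lmY: "y : Yc E ==> lm n y = y" if "n : N" for n
proof -
 assume "y : Yc E"
 then obtain h where "y = lm h E" using Yc_D by blast
 thus ?thesis using lm_N[OF that, of 1 h] by simp
qed

lemma sep_lm: assumes "x : Yc E" "x' : Yc E" shows "sep K' (lm h x) (lm h x') = lm h ` sep K' x x'"
proof -
 have *: "lm h ` sep K' x x' <= sep K' (lm h x) (lm h x')" if xz: "x : Yc E" "x' : Yc E" for h x x'
 proof
  fix u assume "u : lm h ` sep K' x x'"
  then obtain y where "y : sep K' x x'" and u: "u = lm h y" by blast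
  hence y: "y : Yc E" "y ~= x" "y ~= x'" "K' < ang y x x'" by (simp_all add: sep_def)
  thus "u : sep K' (lm h x) (lm h x')" by (simp add: u sep_def ang_inv xz Yc_lm lm_inj)
 qed
 have "lm h^- ` sep K' (lm h x) (lm h x') <= sep K' x x'"
  using *[OF Yc_lm[OF assms(1)] Yc_lm[OF assms(2)], of "h^-" h h] by simp
 hence "lm h ` lm h^- ` sep K' (lm h x) (lm h x') <= lm h ` sep K' x x'" by (rule image_mono)
 hence "sep K' (lm h x) (lm h x') <= lm h ` sep K' x x'" by (simp add: image_image)
 thus ?thesis by (rule subset_antisym[OF _ *[OF assms]])
qed

lemma inj_lm: "inj_on (lm h) A" by (metis inj_onI lm_inj)

lemma card_sep_lm: assumes "x : Yc E" "x' : Yc E" shows "card (sep K' (lm h x) (lm h x')) = card (sep K' x x')"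
 by (simp add: sep_lm assms card_image inj_lm)

lemma FF_lm: "F : FF ==> lm h ` F : FF"
proof -
 assume "F : FF"
 then obtain h' d where "F = lm h' ` XX d" "d <= 2" unfolding FF_def by blast
 hence "lm h ` F = lm (h * h') ` XX d" "d <= 2" by (simp_all add: image_image)
 thus ?thesis unfolding FF_def by blast
qed

lemma act_V: "v : fm.V ==> act h v : fm.V"
proof (cases v)
 case (Inl y)
 assume "v : fm.V"
 thus ?thesis by (simp add: Inl fm.VI Yc_lm fm.VD)
next
 case (Inr F)
 assume "v : fm.V"
 thus ?thesis using Inr fm.VI FF_lm fm.VD by simp
qed

lemma act_adj: assumes "fm.adj u v" shows "fm.adj (act h u) (act h v)"
proof (cases u)
 case (Inl x)
 note x = Inl
 show ?thesis
 proof (cases v)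
  case (Inl y)
  thus ?thesis using assms x sep_lm[of x y KK h] by (simp add: lm_inj Yc_lm)
 next
  case (Inr F)
  thus ?thesis using assms x FF_lm by simp
 qed
next
 case (Inr F)
 thus ?thesis using assms FF_lm by (cases v) simp_all
qed

lemma act_gd_le: assumes "u : fm.V" "v : fm.V" shows "fm.gd (act h u) (act h v) <= fm.gd u v"
proof -
 have "(fm.adj ^^ n) u v ==> (fm.adj ^^ n) (act h u) (act h v)" for n v
 proof (induction n arbitrary: v)
  case (Suc n)
  then obtain y where "(fm.adj ^^ n) u y" "fm.adj y v" by (meson relpowp_Suc_E)
  thus ?case using Suc.IH act_adj by fastforce
 qed simp
 thus ?thesis using fm.gd_walk[OF assms] fm.gd_le by blast
qed

lemma act_gd: assumes "u : fm.V" "v : fm.V" shows "fm.gd (act h u) (act h v) = fm.gd u v"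
 using act_gd_le[OF assms, of h] act_gd_le[OF act_V[OF assms(1), of h] act_V[OF assms(2), of h], of "h^-"]
 by (simp add: act_inv_act)

definition QQ :: "('g set + 'g set set) set" where "QQ = {Inr (lm h ` XX 0) |h. True}"

text \<open>The kernel of the homomorphism from \<open>QN\<close> to \<open>P / N0\<close>. Its
  conjugates are the rotation groups, so that dividing by them identifies \<open>z\<close> with
  \<open>p0\<close>.\<close>

definition KH :: "'g set" where "KH = {x. EX q:N0. (x, q) : Gam}"

definition KQ :: "'g set + 'g set set => 'g set" where
 "KQ v = {h * x * h^- |h x. v = Inr (lm h ` XX 0) & x : KH}"

lemma QQ_I: "Inr (lm h ` XX 0) : QQ" by (auto simp: QQ_def)
lemma QQ_D: "v : QQ ==> \<exists>h. v = Inr (lm h ` XX 0)" by (auto simp: QQ_def)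

lemma X0_eq: "lm h ` XX 0 = lm h' ` XX 0 \<longleftrightarrow> h'^- * h : QN"
 using XX_eq by (simp add: EE_def)

lemma N0_1: "1 : N0" by (rule subgrpD(1)[OF N0_sub])

lemma KH_sub: "subgrp KH" unfolding subgrp_def
proof (intro conjI ballI)
 show "1 : KH" unfolding KH_def using Gam_1 N0_1 by blast
 fix x assume "x : KH"
 then obtain q where q: "q : N0" "(x, q) : Gam" unfolding KH_def by blast
 show "x^- : KH" using Gam_inv q subgrpD N0_sub by (fastforce simp: KH_def)
 fix y assume "y : KH"
 then obtain q' where q': "q' : N0" "(y, q') : Gam" unfolding KH_def by blast
 show "x * y : KH" using Gam_mult q q' subgrpD N0_sub by (fastforce simp: KH_def)
qed

lemma KH_QN: "x : KH ==> x : QN" unfolding KH_def using QN_I by blast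

lemma KH_conj: assumes x: "x : KH" and e: "e : QN" shows "e * x * e^- : KH"
proof -
 obtain q where q: "q : N0" "(x, q) : Gam" using x unfolding KH_def by blast
 obtain d where d: "(e, d) : Gam" using QN_D[OF e] by blast
 note Gam_mult[OF Gam_mult[OF d q(2)] Gam_inv[OF d]]
 thus ?thesis using N0_conj q Gam_range d by (auto simp: KH_def)
qed

lemma KQ_iff: "a : KQ (Inr (lm h ` XX 0)) \<longleftrightarrow> h^- * a * h : KH"
proof
 assume "a : KQ (Inr (lm h ` XX 0))"
 then obtain h' x where h: "a = h' * x * h'^-" "lm h ` XX 0 = lm h' ` XX 0" "x : KH" unfolding KQ_def by blast
 have "h^- * h' : QN" by (metis h X0_eq)
 from KH_conj[OF h(3) this] show "h^- * a * h : KH" by (simp add: h(1) mult.assoc)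
next
 assume a: "h^- * a * h : KH"
 have "a = h * (h^- * a * h) * h^-" by (simp add: mult.assoc)
 thus "a : KQ (Inr (lm h ` XX 0))" unfolding KQ_def using a by blast
qed

lemma act_H: "act a (Inr (lm h ` XX d)) = Inr (lm (a * h) ` XX d)" by (simp add: image_image)

lemma stab_H: "act a (Inr (lm h ` XX 0)) = Inr (lm h ` XX 0) \<longleftrightarrow> h^- * a * h : QN"
 unfolding act_H using X0_eq[of "a * h" h] by (simp add: mult.assoc)

text \<open>All separators are counted, not only those of one family, so that one measure serves the
  rotations about every apex.\<close>

definition ms :: "'g set + 'g set set => 'g set + 'g set set => nat" where
 "ms u v = (LEAST m. EX x:fm.pts u. EX z:fm.pts v. card (sep KK x z) = m)"

lemma pts_act: "fm.pts (act h v) = lm h ` fm.pts v" by (cases v) simp_all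

lemma fm_pts: "v : fm.V ==> x : fm.pts v ==> x : Yc E" using fm.ptsY by blast

lemma nuf_act: assumes "F : Inr ` FF" "e : fm.nbf F" "e' : fm.nbf F"
 shows "fm.nuf (act h F) (act h e) (act h e') = fm.nuf F e e'"
proof -
 obtain G x where G: "e = Inl x" "x : Yc E" using fm.nbfE assms by blast
 obtain G' x' where G': "e' = Inl x'" "x' : Yc E" using fm.nbfE assms by blast
 show ?thesis using G G' card_sep_lm by (simp add: fm.nuf_def)
qed

lemma nbf_act: assumes "F : Inr ` FF" "e : fm.nbf F" shows "act h e : fm.nbf (act h F)"
proof -
 obtain G x where "F = Inr G" "e = Inl x" "x : G" using fm.nbfE[OF assms] by metis
 thus ?thesis by (simp add: fm.nbf_def)
qed

lemma ES_act: assumes F: "F : Inr ` FF" and v: "v : fm.V" and e: "e : fm.ag.ES F v"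
 shows "act h e : fm.ag.ES (act h F) (act h v)"
proof -
 have e': "e : fm.nbf F" "fm.gd e v + 1 = fm.gd F v" using e by (auto simp: fm.ag.ES_def)
 have V: "e : fm.V" "F : fm.V" using fm.ag.ES_V[OF F e] fm.ag.FV[OF F] .
 show ?thesis using nbf_act F e' act_gd V v by (simp add: fm.ag.ES_def)
qed

lemma QQ_Ap: "QQ <= Inr ` FF" unfolding QQ_def FF_def by auto

text \<open>An element of the stabiliser of an apex that moves a neighbour by less than a full chain is, up to
 conjugation, in \<open>P\<close> or a power of \<open>z\<close>.\<close>

lemma small_move:
 assumes a: "h^- * a * h = b" "(b, q) : Gam" and u: "u : lm h ` XX 0"
 obtains "a : N" "q : N0"
 | p s where "p : P - N0" "s * p * s^- * a^- : N" "c p = c q" "q ~: N0"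
 | j s where "j ~= 0" "s * zpow z j * s^- * a^- : N" "c p0 = c q" "q ~: N0"
 | "k <= card (sep KK u (lm a u))"
proof -
 obtain y i where "u = lm h (lm y E)" "(y, i) : FRM 0" using u unfolding XX_def by blast
 then obtain x where x: "u = lm (h * x * w i) E" "x : QN" "i < k" by (auto simp: FRM_def mult.assoc)
 obtain d where d: "(x, d) : Gam" using QN_D[OF x(2)] by blast
 have dP: "d : P" and qP: "q : P" using Gam_range[OF d] Gam_range[OF a(2)] .
 define b' where "b' = x^- * b * x"
 define q' where "q' = d^- * q * d"
 have B: "(b', q') : Gam" using Gam_mult Gam_inv d a by (simp add: b'_def q'_def)
 have ab: "a = (h * x) * b' * (h * x)^-" unfolding b'_def a(1)[symmetric] by (simp add: mult.assoc)
 have qq: "q = d * q' * d^-" by (simp add: q'_def mult.assoc)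
 note q'P = Gam_range[OF B]
 have cq: "c q = c q'" using qq c_conj q'P dP by simp
 have qN: "q : N0 \<longleftrightarrow> q' : N0"
 proof
  assume "q : N0" thus "q' : N0" unfolding q'_def by (rule N0_conj(2)[OF _ dP])
 next
  assume "q' : N0" thus "q : N0" using qq N0_conj dP by simp
 qed
 have cc: "c p = c q & q ~: N0" if p: "p : P" "p ~: N0" "p^- * q' : N0" for p
 proof
  have e: "p * (p^- * q') = q'" by simp
  show "c p = c q" by (metis c_N0 p cq e)
  show "q ~: N0"
  proof
   assume "q : N0"
   hence "q' * (p^- * q')^- : N0" using qN subgrpD N0_sub p by blast
   thus False using p(2) by simp
  qed
 qed
 have conj: "(h * x) * s * (h * x)^- * a^- : N" if "s^- * b' : N" for s
 proof -
  have "(h * x * s) * (s^- * b')^- * (h * x * s)^- : N" by (rule Nc[OF Ni[OF that]])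
  thus ?thesis by (simp add: ab mult.assoc)
 qed
 from x(3) B show ?thesis
 proof (cases rule: Gam_move)
  case 1
  have "a : N" unfolding ab by (rule Nc[OF 1(1)])
  thus ?thesis using that(1) 1(2) qN by simp
 next
  case (2 p)
  show ?thesis by (rule that(2)[OF 2(1) conj[OF 2(2)]]) (use cc[of p] 2 in auto)
 next
  case (3 j)
  have nP: "zpow p0 j : P" by (rule subgrp_zpow[OF P_sub p0(1)])
  have "zpow p0 j ~: N0" using tfz[OF 3(1), of p0] p0 by (auto simp: N0)
  hence "c (zpow p0 j) = c q & q ~: N0" using cc[OF nP _ 3(3)] by simp
  thus ?thesis using that(3)[OF 3(1) conj[OF 3(2)]] c_pow[OF p0(1) 3(1)] by simp
 next
  case 4
  have "card (sep KK (lm (h * x) (lm (w i) E)) (lm (h * x) (lm (b' * w i) E))) = card (sep KK (lm (w i) E) (lm (b' * w i) E))"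
   by (rule card_sep_lm[OF Yc_I Yc_I])
  moreover have "lm (h * x) (lm (w i) E) = u" "lm (h * x) (lm (b' * w i) E) = lm a u"
   unfolding x(1) ab by (simp_all add: mult.assoc)
  ultimately show ?thesis using that(4) 4(2) by simp
 qed
qed

text \<open>For \<open>deep\<close>, an element of \<open>KH\<close> has image in \<open>N0\<close>,
  so outside \<open>N\<close> \<open>small_move\<close> leaves only the case of at least
  \<open>k\<close> separators, and \<open>k\<close> exceeds 120000. For \<open>ms_shrink\<close>,
  \<open>Phi_count\<close> feeds \<open>shrink\<close>, as \<open>6 * 120\<close> exceeds
  \<open>330 + 200 + 20\<close>.\<close>

sublocale rm: rotm fm.V fm.gd "Inr ` FF" fm.nbf fm.nuf 120 act N QQ KQ 120000 ms
proof (unfold_locales, goal_cases)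
 case (1 x y) thus ?case using fm.gd_eq_0 by blast
next
 case (2 x) show ?case by (rule act_1)
next
 case (3 x g h) show ?case by (rule act_act)
next
 case (4 x g) thus ?case by (rule act_V)
next
 case (5 x y g) thus ?case by (rule act_gd)
next
 case (6 F g) thus ?case using FF_lm by auto
next
 case (7 F e g) thus ?case by (rule nbf_act)
next
 case (8 F e e' g) thus ?case by (rule nuf_act)
next
 case 9 show ?case by (rule N_normal)
next
 case (10 n x)
 thus ?case
 proof (cases x)
  case (Inl y)
  thus ?thesis using 10 lmY fm.VD(1)[of y] by simp
 next
  case (Inr F)
  hence "F <= Yc E" using 10 fm.FFY fm.VD(2)[of F] by blast
  hence "lm n y = y" if "y : F" for y using lmY[OF 10(1)] that by blast
  hence "lm n ` F = F" by force
  thus ?thesis using Inr by simp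
 qed
next
 case 11 show ?case by (rule QQ_Ap)
next
 case (12 q g)
 then obtain h where "q = Inr (lm h ` XX 0)" using QQ_D by blast
 thus ?case unfolding QQ_def using act_H by blast
next
 case (13 q)
 then obtain h where q: "q = Inr (lm h ` XX 0)" using QQ_D by blast
 show ?case unfolding subgrp_def
 proof (intro conjI ballI)
  show "1 : KQ q" by (simp add: q KQ_iff subgrpD KH_sub)
  fix x assume "x : KQ q"
  hence x: "h^- * x * h : KH" unfolding q KQ_iff .
  show "x^- : KQ q" unfolding q KQ_iff using subgrpD(3)[OF KH_sub x] by (simp add: mult.assoc)
  fix y assume "y : KQ q"
  hence y: "h^- * y * h : KH" unfolding q KQ_iff .
  show "x * y : KQ q" unfolding q KQ_iff using subgrpD(2)[OF KH_sub x y] by (simp add: mult.assoc)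
 qed
next
 case (14 q)
 then obtain h where q: "q = Inr (lm h ` XX 0)" using QQ_D by blast
 show ?case
 proof
  fix n assume n: "n : N"
  have "(h^- * n * h, 1) : Gam" by (rule Gam_of_N[OF Nc'[OF n]])
  thus "n : KQ q" unfolding q KQ_iff KH_def using N0_1 by blast
 qed
next
 case (15 q k)
 then obtain h where q: "q = Inr (lm h ` XX 0)" using QQ_D by blast
 thus ?case using 15(2) KQ_iff KH_QN stab_H by blast
next
 case (16 q k g)
 then obtain h where q: "q = Inr (lm h ` XX 0)" using QQ_D by blast
 have "h^- * k * h : KH" using 16(2) unfolding q KQ_iff .
 thus ?case unfolding q act_H KQ_iff by (simp add: mult.assoc)
next
 case (17 q a v)
 then obtain h where q: "q = Inr (lm h ` XX 0)" using QQ_D by blast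
 have FA: "q : Inr ` FF" using 17(1) QQ_Ap by blast
 note qV = fm.ag.FV[OF FA]
 have aK: "h^- * a * h : KH" using 17(2) unfolding q KQ_iff .
 then obtain n where n: "n : N0" "(h^- * a * h, n) : Gam" unfolding KH_def by blast
 have aq: "act a q = q" using q stab_H KH_QN aK by simp
 have avq: "act a v ~= q" using act_inv_act(1)[of a v] act_inv_act(1)[of a q] aq 17(5) by metis
 have pos: "0 < fm.gd q v" "0 < fm.gd q (act a v)" using fm.gd_eq_0[OF qV 17(4)] fm.gd_eq_0[OF qV act_V[OF 17(4)], of a] 17(5) avq by auto
 obtain e where e: "e : fm.ag.ES q v" using fm.ag.ES_ne[OF FA 17(4) pos(1)] by blast
 have e2: "act a e : fm.ag.ES q (act a v)" using ES_act[OF FA 17(4) e, of a] aq by simp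
 obtain G u where u: "q = Inr G" "e = Inl u" "u : G" by (metis fm.nbfE FA fm.ag.ES_nb e)
 have uX: "u : lm h ` XX 0" using u q by simp
 have "k <= card (sep KK u (lm a u))"
  using refl n(2) uX by (cases rule: small_move) (use n(1) 17(3) in auto)
 hence nu: "120000 < fm.nuf q e (act a e)" using kbig u by (simp add: fm.nuf_def)
 also have "... <= fm.ag.Phi q v (act a v)"
  by (rule fm.ag.Phi_lower'[OF FA 17(4) pos(1) act_V[OF 17(4)] pos(2) e e2]) (use nu in simp)
 finally show ?case .
next
 case 18 show ?case by simp
next
 case 19 show ?case by simp
next
 case (20 q a u v)
 then obtain h where q: "q = Inr (lm h ` XX 0)" using QQ_D by blast
 define F where "F = lm h ` XX 0"
 have F: "F : FF" "q = Inr F" unfolding F_def q FF_def by auto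
 have aF: "lm a ` F = F"
 proof -
  have "h^- * a * h : QN" using 20(2) KH_QN unfolding q KQ_iff by blast
  hence "act a q = q" unfolding q stab_H .
  thus ?thesis by (simp add: F(2))
 qed
 have "\<exists>m. EX x:fm.pts u. EX z:fm.pts v. card (sep KK x z) = m" using fm.ptsY[OF 20(3)] fm.ptsY[OF 20(4)] by blast
 from LeastI_ex[OF this] obtain x z where xz: "x : fm.pts u" "z : fm.pts v" "card (sep KK x z) = ms u v"
  unfolding ms_def by blast
 have Y: "x : Yc E" "z : Yc E" using fm_pts xz 20(3,4) by auto
 have az: "lm a z : fm.pts (act a v)" using xz pts_act by simp
 have avq: "act a v ~= Inr F"
 proof
  assume "act a v = Inr F"
  hence "act a v = act a (Inr F)" using aF by simp
  hence "v = Inr F" using act_inv_act(1) by metis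
  thus False using 20(6) F by simp
 qed
 have uF: "u ~= Inr F" "v ~= Inr F" using 20 F by auto
 have c1: "fm.ag.Phi q u v <= card (sep kap x z \<inter> F) + 330"
  unfolding F(2) by (rule fm.Phi_count(1)[OF F(1) 20(3) uF(1) 20(4) uF(2) xz(1,2)])
 have c2: "card (sep kap x (lm a z) \<inter> F) <= fm.ag.Phi q u (act a v) + 200"
  unfolding F(2) by (rule fm.Phi_count(2)[OF F(1) 20(3) uF(1) act_V[OF 20(4)] avq xz(1) az])
 have "card (sep KK x (lm a z)) < card (sep KK x z)"
 proof (rule fm.shrink[OF F(1) Y])
  show "lm a y : Yc E" if "y : Yc E" for y by (rule Yc_lm[OF that])
  show "lm a y : F" if "y : F" for y using that aF by blast
  show "card (sep KK (lm a y) (lm a y')) = card (sep KK y y')" if "y : Yc E" "y' : Yc E" for y y' by (rule card_sep_lm[OF that])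
  show "card (sep kap (lm a y) (lm a y') \<inter> F) = card (sep kap y y' \<inter> F)" if "y : Yc E" "y' : Yc E" for y y'
  proof -
   have "sep kap (lm a y) (lm a y') \<inter> F = lm a ` (sep kap y y' \<inter> F)"
    unfolding sep_lm[OF that] using aF image_Int[OF inj_lm, of a "sep kap y y'" F] by (metis injI lm_inj image_Int)
   thus ?thesis by (simp add: card_image[OF inj_lm])
  qed
  show "card (sep kap x (lm a z) \<inter> F) + 20 < card (sep kap x z \<inter> F)" using c1 c2 20(7) by linarith
 qed
 moreover have "ms u (act a v) <= card (sep KK x (lm a z))" unfolding ms_def by (rule Least_le) (use xz(1) az in blast)
 ultimately show ?case using xz(3) by simp
qed

end

section \<open>Transport of angles to the quotient\<close>

context apexg
begin

text \<open>The large angle at \<open>F\<close> would put a different \<open>G\<close> strictly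
  before or behind it on the way from \<open>x\<close> to \<open>z\<close>. Distances from
  \<open>x\<close> thus distinguish the apices with large angle, which makes their number
  finite.\<close>

lemma Phi_same_dist:
 assumes F: "F : Ap" "G : Ap" and x: "x : V" "z : V" and pos: "0 < D F x" "0 < D F z" "0 < D G x" "0 < D G z"
  and big: "2 * Th < Phi F x z" "2 * Th < Phi G x z" and eq: "D x F = D x G"
 shows "D F G = 0"
proof (rule ccontr)
 assume "D F G ~= 0"
 hence FG: "0 < D F G" by simp
 note V = FV[OF F(1)] FV[OF F(2)]
 note GF = D_sym[OF V(2,1)]
 note Phi_tri[OF F(1) x(1) pos(1) V(2) FG x(2) pos(2)]
 then consider "Th < Phi F x G" | "Th < Phi F G z" using big(1) by linarith
 thus False
 proof cases
  case 1
  thus ?thesis using Phi_A1[OF F(1) x(1) pos(1) V(2) FG] eq FG by simp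
 next
  case 2
  note Phi_A1[OF F(1) V(2) FG x(2) pos(2) 2]
  moreover have "D x z = D x F + D F z" by (rule Phi_A1[OF F(1) x(1) pos(1) x(2) pos(2)]) (use big in simp)
  moreover have "D x z = D x G + D G z" by (rule Phi_A1[OF F(2) x(1) pos(3) x(2) pos(4)]) (use big in simp)
  ultimately show ?thesis using eq FG GF by simp
 qed
qed

end

context rot
begin

lemma qt_ES_act: assumes F: "F : Ap" and x: "x : V" shows "qt.ES (act g F) (act g x) = act g ` qt.ES F x"
proof -
 have *: "act g e : qt.ES (act g F) (act g x)" if "F : Ap" "x : V" "e : qt.ES F x" for g F x e
 proof -
  have e: "e : nb F" "Dq e x + 1 = Dq F x" "e : V" using that qt.ES_V by (auto simp: qt.ES_def)
  show ?thesis unfolding qt.ES_def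
   using act_nb[OF that(1) e(1)] Dq_act[OF e(3) that(2)] Dq_act[OF FV[OF that(1)] that(2)] e by simp
 qed
 show ?thesis
 proof
  show "qt.ES (act g F) (act g x) <= act g ` qt.ES F x"
  proof
   fix e assume e: "e : qt.ES (act g F) (act g x)"
   have "act g^- e : qt.ES (act g^- (act g F)) (act g^- (act g x))"
    by (rule *[OF act_Ap[OF F] act_V[OF x] e])
   hence "act g^- e : qt.ES F x" by (simp only: act_inv[OF x] act_inv[OF FV[OF F]])
   moreover have "act g (act g^- e) = e" using act_inv qt.ES_V act_Ap F e by blast
   ultimately show "e : act g ` qt.ES F x" by (metis imageI)
  qed
 qed (use *[OF F x] in blast)
qed

lemma qt_Phi_act: assumes F: "F : Ap" and x: "x : V" "z : V" shows "qt.Phi (act g F) (act g x) (act g z) = qt.Phi F x z"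
proof -
 have inj: "inj_on (act g) V" using act_eq by (auto simp: inj_on_def)
 have sub: "qt.ES F x <= V" "qt.ES F z <= V" using qt.ES_V[OF F] by auto
 have eq: "qt.ES (act g F) (act g x) = qt.ES (act g F) (act g z) \<longleftrightarrow> qt.ES F x = qt.ES F z"
  unfolding qt_ES_act[OF F x(1)] qt_ES_act[OF F x(2)] using inj_on_image_eq_iff[OF inj sub] .
 let ?U = "qt.ES F x \<union> qt.ES F z"
 have nu: "nuq (act g F) (act g e) (act g e') = nuq F e e'" if "e : ?U" "e' : ?U" for e e'
  using that nuq_act[OF F] qt.ES_nb by blast
 have "{nuq (act g F) e e' |e e'. e : act g ` qt.ES F x \<union> act g ` qt.ES F z & e' : act g ` qt.ES F x \<union> act g ` qt.ES F z}
   = {nuq F e e' |e e'. e : ?U & e' : ?U}" (is "?A = ?B")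
 proof
  show "?A <= ?B"
  proof
   fix t assume "t : ?A"
   hence "\<exists>e e'. t = nuq (act g F) (act g e) (act g e') & e : ?U & e' : ?U" by blast
   then obtain e e' where t: "t = nuq (act g F) (act g e) (act g e')" "e : ?U" "e' : ?U" by blast
   show "t : ?B" using t nu by blast
  qed
  show "?B <= ?A"
  proof
   fix t assume "t : ?B"
   hence "\<exists>e e'. t = nuq F e e' & e : ?U & e' : ?U" by blast
   then obtain e e' where t: "t = nuq F e e'" "e : ?U" "e' : ?U" by blast
   have "t = nuq (act g F) (act g e) (act g e')" using t nu by simp
   moreover have "act g e : act g ` qt.ES F x \<union> act g ` qt.ES F z" "act g e' : act g ` qt.ES F x \<union> act g ` qt.ES F z" using t by blast+
   ultimately show "t : ?A" by blast
  qed
 qed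
 thus ?thesis unfolding qt.Phi_def eq unfolding qt_ES_act[OF F x(1)] qt_ES_act[OF F x(2)] by (rule arg_cong)
qed

lemma qt_Phi_F: assumes F: "F : Ap" "F' : Ap" "Dq F F' = 0" and x: "x : V" "z : V" shows "qt.Phi F x z = qt.Phi F' x z"
proof -
 obtain n where n: "n : NN" "F = act n F'" using Dq0 FV F by blast
 have z: "Dq (act n v) v = 0" if "v : V" for v using Dq_n'[OF that that n(1)] Dq_self[OF that] by simp
 have "qt.Phi F' x z = qt.Phi F (act n x) (act n z)" unfolding n(2) by (rule qt_Phi_act[OF F(2) x, symmetric])
 also have "... = qt.Phi F x (act n z)" by (rule qt.Phi_cong(1)[OF F(1) act_V[OF x(1)] x(1) z[OF x(1)]])
 also have "... = qt.Phi F x z" by (rule qt.Phi_cong(2)[OF F(1) act_V[OF x(2)] x(2) z[OF x(2)]])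
 finally show ?thesis by simp
qed

end

context rotm
begin

text \<open>Outside \<open>Q\<close> the stabilizer of \<open>F\<close> in \<open>NN\<close> lies in
  \<open>N\<close>, which acts trivially; so the minimum in \<open>nuq\<close> loses nothing and
  rotations about \<open>F\<close> survive in the quotient.\<close>

lemma rot_lower:
 assumes F: "F : Ap" "F ~: Q" and g: "act g F = F" and v: "v : V" "0 < Dq F v"
 obtains e where "e : nb F" "nu F e (act g e) <= Th + qt.Phi F v (act g v)"
proof -
 note FVx = FV[OF F(1)]
 obtain e where e: "e : qt.ES F v" using qt.ES_ne[OF F(1) v] by blast
 note enb = qt.ES_nb[OF e]
 have ge: "act g e : qt.ES F (act g v)" using qt_ES_act[OF F(1) v(1), of g] g e by auto
 have gv: "0 < Dq F (act g v)" using Dq_act[OF FVx v(1), of g] g v(2) by simp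
 obtain k where k: "k : NN" "act k F = F" "nu F e (act k (act g e)) = nuq F e (act g e)" by (rule nuq_ex[OF F(1)])
 note stabV[OF FVx F(2) k(1,2)]
 hence "act k (act g e) = act g e" using N_triv act_V nbV' F enb by simp
 hence "nu F e (act g e) = nuq F e (act g e)" using k(3) by simp
 hence "nu F e (act g e) <= Th + qt.Phi F v (act g v)"
  using qt.Phi_lower'[OF F(1) v act_V[OF v(1)] gv e ge] by linarith
 thus ?thesis by (rule that[OF enb])
qed

end

text \<open>The angles at the base coset that are swept by powers of \<open>r\<close> tend to infinity, while those
between the base coset and its translates under \<open>P\<close> are bounded.\<close>

definition gsystem :: "'g::grp set => 'g set => 'g set => 'g => bool" where
 "gsystem P N0 N r \<longleftrightarrow> (\<exists>ang th. gsys (pwr r N) ang th &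
   (\<forall>M::nat. \<exists>m0. \<forall>m. int m0 <= \<bar>m\<bar> --> (ALL x:Yc (pwr r N). x ~= pwr r N --> M < ang (pwr r N) x (lm (zpow r m) x))) &
   (\<exists>B. ALL p:P - N0. lm p (pwr r N) ~= pwr r N &
    (ALL y:Yc (pwr r N). y ~= pwr r N --> y ~= lm p (pwr r N) --> ang y (pwr r N) (lm p (pwr r N)) <= B)))"

section \<open>The new kernel: intersection with \<open>P\<close>, roots and colours\<close>

context stp
begin

lemma z_p0: "z * p0^- : rm.NN"
proof -
 have "(zpow z 1 * p0^-, zpow p0 1 * p0^-) : Gam"
  using Gam_mult Gam_of_z Gam_inv Gam_of_P p0 by blast
 hence "z * p0^- : KH" unfolding KH_def using N0_1 by force
 hence "z * p0^- : KQ (Inr (lm 1 ` XX 0))" unfolding KQ_iff by simp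
 thus ?thesis by (rule rm.NN_incl(2)[OF QQ_I])
qed

lemma QN_P: "p : P ==> p : QN" by (rule QN_I[OF Gam_of_P])

lemma Gam_N0: assumes "(x, q) : Gam" "x : KH" shows "q : N0"
proof -
 obtain q' where q': "q' : N0" "(x, q') : Gam" using assms(2) unfolding KH_def by blast
 note subgrpD(2)[OF N0_sub q'(1) Gam_unique[OF q'(2) assms(1)]]
 thus ?thesis by simp
qed

text \<open>\<open>P\<close> fixes the apex of the chain orbit, and an element of \<open>NN\<close>
  fixing an apex belongs to its rotation group; there \<open>Gam\<close> decides membership in
  \<open>N0\<close>.\<close>

lemma P_NN: "P \<inter> rm.NN = N0"
proof
 show "N0 <= P \<inter> rm.NN" using N0 rm.NN_incl(1) by blast
 show "P \<inter> rm.NN <= N0"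
 proof
  fix p assume "p : P \<inter> rm.NN"
  hence p: "p : P" "p : rm.NN" by auto
  have "act p (Inr (lm 1 ` XX 0)) = Inr (lm 1 ` XX 0)" unfolding stab_H using QN_P[OF p(1)] by simp
  from rm.stabQ[OF QQ_I p(2) this] have "p : KH" unfolding KQ_iff by simp
  thus "p : N0" by (rule Gam_N0[OF Gam_of_P[OF p(1)]])
 qed
qed

lemma Gam_pow: "(x, q) : Gam ==> (x ^ n, q ^ n) : Gam"
 by (induction n) (auto intro: Gam_1 Gam_mult)

lemma tf_NN: assumes m: "0 < m" "x ^ m : rm.NN" shows "x : rm.NN"
proof (rule rm.torsion[OF QQ_I _ _ m])
 show "y : N" if "0 < n" "y ^ n : N" for y n by (rule tfN[OF that])
 \<comment> \<open>For roots modulo a rotation group the homomorphism from \<open>QN\<close> to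
   \<open>P / N0\<close> carries the question to \<open>P\<close>, where \<open>tfN\<close> answers
   it.\<close>
 fix q y n assume q: "q : QQ" "act y q = q" "0 < n" "y ^ n : KQ q"
 obtain h where h: "q = Inr (lm h ` XX 0)" using QQ_D[OF q(1)] by blast
 define y1 where "y1 = h^- * y * h"
 have "y1 : QN" using q(2) unfolding h stab_H y1_def .
 then obtain d where d: "(y1, d) : Gam" using QN_D by blast
 have "y1 ^ n = h^- * y ^ n * h" using conj_power[of "h^-" y n] by (simp add: y1_def)
 hence "y1 ^ n : KH" using q h KQ_iff by simp
 note Gam_N0[OF Gam_pow[OF d], OF this]
 hence "d : N" using tfN[OF q(3)] N0 by blast
 hence "d : N0" using Gam_range[OF d] N0 by blast
 thus "y : KQ q" using h KQ_iff d by (auto simp: KH_def y1_def)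
qed

text \<open>On \<open>\<int>\<^sup>2\<close> the colour depends on the direction only; elsewhere it is the index of a set \<open>X m\<close> that meets
the commensurability class of the \<open>G\<close>-component, with \<open>1\<close> as default.\<close>

definition col :: "'g set + 'g set set => 'g => nat" where
 "col q a = c (SOME d. \<exists>h. q = Inr (lm h ` XX 0) & (h^- * a * h, d) : Gam)"

lemma c_eq: assumes "d : P" "d^- * d' : N0" shows "c d' = c d"
proof -
 note c_N0[OF assms]
 thus ?thesis by simp
qed

text \<open>Two frames of one apex differ by an element of \<open>QN\<close>, which conjugates the
  image in \<open>P\<close>, and this image is unique modulo \<open>N0\<close>; \<open>c\<close> is
  insensitive to both changes.\<close>

lemma col_eq: assumes d: "(h^- * a * h, d) : Gam" shows "col (Inr (lm h ` XX 0)) a = c d"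
proof -
 define q :: "'g set + 'g set set" where "q = Inr (lm h ` XX 0)"
 define d' where "d' = (SOME d. \<exists>h. q = Inr (lm h ` XX 0) & (h^- * a * h, d) : Gam)"
 have "\<exists>d. \<exists>h. q = Inr (lm h ` XX 0) & (h^- * a * h, d) : Gam" using d q_def by blast
 from someI_ex[OF this] obtain h' where h': "q = Inr (lm h' ` XX 0)" "(h'^- * a * h', d') : Gam" unfolding d'_def by blast
 have "h^- * h' : QN" using h'(1) X0_eq[of h' h] by (simp add: q_def)
 then obtain b where b: "(h^- * h', b) : Gam" using QN_D by blast
 note Gam_mult[OF Gam_mult[OF Gam_inv[OF b] d] b]
 hence "(h'^- * a * h', b^- * d * b) : Gam" by (simp add: mult.assoc)
 note Gam_unique[OF _ h'(2), OF this]
 moreover have "b^- * d * b : P" by (metis Gam_range d b subgrpD P_sub)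
 ultimately have "c d' = c (b^- * d * b)" by (intro c_eq)
 also have "... = c d" using c_conj[OF Gam_range[OF d] subgrpD(3)[OF P_sub Gam_range[OF b]]] by simp
 finally show ?thesis unfolding col_def q_def[symmetric] d'_def[symmetric] .
qed

lemma conj_eq: "u * x * u^- * a^- : N ==> u' * x' * u'^- * a^- : N ==>
  (u'^- * u) * x * (u'^- * u)^- * x'^- : N"
proof -
 assume a: "u * x * u^- * a^- : N" "u' * x' * u'^- * a^- : N"
 note Nm[OF a(1) Ni[OF a(2)]]
 from Nc'[OF this, of u'] show ?thesis by (simp add: mult.assoc)
qed

lemma zg: "zpow z j = (w (k - 1) * zpow r (mx (k - 1))) * zpow g j * (w (k - 1) * zpow r (mx (k - 1)))^-"
 by (simp add: z_pow mult.assoc)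

text \<open>Fixing a second apex, \<open>a\<close> permutes the first steps towards it and so moves
  them by at most 120; \<open>small_move\<close> then leaves only \<open>N\<close> and conjugates of
  elements of \<open>P\<close> or of powers of \<open>g\<close>.\<close>

lemma elliptic_colours:
 assumes q: "q : QQ" "q' : QQ" "q ~= q'" and a: "act a q = q" "act a q' = q'"
 shows "(a : N & col q a = c 1) \<or> (a ~: N & (\<exists>p s. p : P - N0 & s * p * s^- * a^- : N & c p = col q a)) \<or>
  (a ~: N & (\<exists>j s. j ~= 0 & s * zpow g j * s^- * a^- : N & c p0 = col q a))"
proof -
 obtain h where h: "q = Inr (lm h ` XX 0)" using QQ_D[OF q(1)] by blast
 have FA: "q : Inr ` FF" "q' : Inr ` FF" using q QQ_Ap by auto
 have V: "q : fm.V" "q' : fm.V" using fm.ag.FV FA by auto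
 have "h^- * a * h : QN" using a(1) unfolding h stab_H .
 then obtain d where d: "(h^- * a * h, d) : Gam" using QN_D by blast
 have cd: "col q a = c d" using h col_eq d by simp
 have pos: "0 < fm.gd q q'" using fm.gd_eq_0[OF V] q(3) by simp
 obtain e where e: "e : fm.ag.ES q q'" using fm.ag.ES_ne FA V pos by blast
 have e2: "act a e : fm.ag.ES q q'" by (metis ES_act FA V e a)
 note nu = fm.ag.same_bd[OF FA(1) V(2) pos e e2]
 obtain G u where u: "q = Inr G" "e = Inl u" "u : G" by (metis fm.nbfE FA fm.ag.ES_nb e)
 have uX: "u : lm h ` XX 0" using u h by simp
 have small: "\<not> k <= card (sep KK u (lm a u))" using nu kbig u by (simp add: fm.nuf_def)
 have notN: "a ~: N" if "d ~: N0"
 proof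
  assume "a : N"
  hence "h^- * a * h : KH" using Gam_of_N Nc' N0_1 by (auto simp: KH_def)
  thus False using Gam_N0[OF d] that by simp
 qed
 from refl d uX show ?thesis
 proof (cases rule: small_move)
  case 1
  hence "c d = c 1" using c_N0 subgrpD P_sub by fastforce
  thus ?thesis using 1 cd by simp
 next
  case (2 p s)
  note notN[OF 2(4)]
  thus ?thesis unfolding cd using 2(1-3) by blast
 next
  case (3 j s)
  let ?Y = "w (k - 1) * zpow r (mx (k - 1))"
  have "(s * ?Y) * zpow g j * (s * ?Y)^- * a^- : N" using 3(2) unfolding zg by (simp add: mult.assoc)
  moreover note notN[OF 3(4)]
  ultimately show ?thesis unfolding cd using 3(1,3) by blast
 qed (use small in simp)
qed

text \<open>The descriptions of \<open>a\<close> at the two apices are compared by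
  \<open>colN\<close> if both lie in \<open>P\<close>, and by \<open>compat\<close> if one is a
  power of \<open>g\<close>; two powers of \<open>g\<close> both give the colour of
  \<open>p0\<close>.\<close>

lemma EEcol:
 assumes q: "q : QQ" "q' : QQ" "q ~= q'" and a: "act a q = q" "act a q' = q'"
 shows "col q a = col q' a"
proof -
 note A = elliptic_colours[OF q a] and B = elliptic_colours[OF q(2,1) q(3)[symmetric] a(2,1)]
 show ?thesis
 proof (cases "a : N")
  case True thus ?thesis using A B by simp
 next
  case False
  have A': "(\<exists>p s. p : P - N0 & s * p * s^- * a^- : N & c p = col q a) \<or>
    (\<exists>j s. j ~= 0 & s * zpow g j * s^- * a^- : N & c p0 = col q a)" using A False by simp
  have B': "(\<exists>p s. p : P - N0 & s * p * s^- * a^- : N & c p = col q' a) \<or>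
    (\<exists>j s. j ~= 0 & s * zpow g j * s^- * a^- : N & c p0 = col q' a)" using B False by simp
  from A' B' consider
    "(\<exists>p s. p : P - N0 & s * p * s^- * a^- : N & c p = col q a)" "(\<exists>p s. p : P - N0 & s * p * s^- * a^- : N & c p = col q' a)"
   | "(\<exists>p s. p : P - N0 & s * p * s^- * a^- : N & c p = col q a)" "(\<exists>j s. j ~= 0 & s * zpow g j * s^- * a^- : N & c p0 = col q' a)"
   | "(\<exists>j s. j ~= 0 & s * zpow g j * s^- * a^- : N & c p0 = col q a)" "(\<exists>p s. p : P - N0 & s * p * s^- * a^- : N & c p = col q' a)"
   | "c p0 = col q a" "c p0 = col q' a" by blast
  thus ?thesis
  proof cases
   case 1
   obtain p s where p: "p : P - N0" "s * p * s^- * a^- : N" "c p = col q a" using 1(1) by blast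
   obtain p' s' where p': "p' : P - N0" "s' * p' * s'^- * a^- : N" "c p' = col q' a" using 1(2) by blast
   have "c p = c p'" using colN conj_eq p p' by blast
   thus ?thesis using p p' by simp
  next
   case 2
   obtain p s where p: "p : P - N0" "s * p * s^- * a^- : N" "c p = col q a" using 2(1) by blast
   obtain j s' where p': "j ~= 0" "s' * zpow g j * s'^- * a^- : N" "c p0 = col q' a" using 2(2) by blast
   have "c p = c p0" using compat p' conj_eq p by blast
   thus ?thesis using p p' by simp
  next
   case 3
   obtain j s where p: "j ~= 0" "s * zpow g j * s^- * a^- : N" "c p0 = col q a" using 3(1) by blast
   obtain p' s' where p': "p' : P - N0" "s' * p' * s'^- * a^- : N" "c p' = col q' a" using 3(2) by blast
   have "c p' = c p0" using compat p conj_eq p' by blast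
   thus ?thesis using p p' by simp
  qed simp
 qed
qed

lemma col_NN:
 assumes x: "x : P" "x' : P" and n: "h * x * h^- * x'^- : rm.NN"
 shows "c x = c x'"
proof -
 have d: "(h^- * (h * x * h^-) * h, x) : Gam" "(inverse 1 * x' * 1, x') : Gam"
  using Gam_of_P[OF x(1)] Gam_of_P[OF x(2)] by (simp_all add: mult.assoc)
 have f: "act (h * x * h^-) (Inr (lm h ` XX 0)) = Inr (lm h ` XX 0)"
  unfolding stab_H using QN_P[OF x(1)] by (simp add: mult.assoc)
 have f': "act x' (Inr (lm 1 ` XX 0)) = Inr (lm 1 ` XX 0)" unfolding stab_H using QN_P[OF x(2)] by simp
 have "col (Inr (lm h ` XX 0)) (h * x * h^-) = col (Inr (lm 1 ` XX 0)) x'"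
 proof (rule rm.colour[OF _ _ EEcol QQ_I QQ_I f f' n])
  fix q a b assume q: "q : QQ" "act a q = q" "act b q = q" "a * b^- : KQ q"
  obtain h where h: "q = Inr (lm h ` XX 0)" using QQ_D[OF q(1)] by blast
  obtain d where d: "(h^- * a * h, d) : Gam" using q QN_D h stab_H by blast
  obtain d' where d': "(h^- * b * h, d') : Gam" using q QN_D h stab_H by blast
  have "(h^- * (a * b^-) * h, d * d'^-) : Gam"
   using Gam_mult[OF d Gam_inv[OF d']] by (simp add: mult.assoc)
  hence dd: "d * d'^- : N0" using q Gam_N0 h KQ_iff by simp
  note N0_conj(2)[OF subgrpD(3)[OF N0_sub dd] Gam_range[OF d]]
  hence "c d' = c d" by (intro c_eq Gam_range[OF d]) (simp add: mult.assoc)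
  thus "col q a = col q b" using h col_eq d d' by simp
 next
  fix q a g assume q: "q : QQ" "act a q = q"
  obtain h where h: "q = Inr (lm h ` XX 0)" using QQ_D[OF q(1)] by blast
  obtain d where d: "(h^- * a * h, d) : Gam" using q QN_D h stab_H by blast
  have d': "((g * h)^- * (g * a * g^-) * (g * h), d) : Gam" using d by (simp add: mult.assoc)
  show "col (act g q) (g * a * g^-) = col q a" using h act_H col_eq d d' by simp
 qed
 thus ?thesis unfolding col_eq[OF d(1)] col_eq[OF d(2)] .
qed

end

lemma normal_power_quot: assumes N: "normal_sub N" and ab: "a * b^- : (N::'g::grp set)" shows "a ^ m * (b ^ m)^- : N"
proof (induction m)
 case 0 show ?case by (simp add: subgrpD normal_subD N)
next
 case (Suc m)
 have "a * (a ^ m * (b ^ m)^-) * a^- * (a * b^-) : N"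
  by (simp add: subgrpD normal_subD N Suc.IH ab)
 thus ?case by (simp add: mult.assoc)
qed

lemma zpow_nat_mult: "zpow x i ^ m = zpow x (i * int m)"
 by (simp add: zpow_mult zpow_of_nat)

lemma normal_zpow_quot: assumes N: "normal_sub N" and ab: "a * b^- : (N::'g::grp set)" shows "zpow a j * (zpow b j)^- : N"
proof (cases "0 <= j")
 case True
 thus ?thesis by (simp add: normal_power_quot N ab zpow_def)
next
 case False
 have "b^- * (a * b^-)^- * b^-^- : N"
  using normal_subD N subgrpD ab by blast
 hence "a^- * b^-^- : N" by (simp add: mult.assoc)
 from normal_power_quot[OF N this] show ?thesis using False by (simp add: zpow_def)
qed

section \<open>Projection systems on the two axes in the quotient\<close>

context stp
begin

abbreviation "NN \<equiv> rm.NN"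

definition AV :: "nat => 'g => 'g set + 'g set set" where "AV d h = Inr (lm h ` XX d)"

lemma act_AV: "act a (AV d h) = AV d (a * h)" unfolding AV_def by (rule act_H)

lemma AV_Ap: "d = 1 \<or> d = 2 ==> AV d h : Inr ` FF"
proof -
 assume "d = 1 \<or> d = 2"
 hence "d <= 2" by auto
 hence "lm h ` XX d : FF" unfolding FF_def by blast
 thus ?thesis by (simp add: AV_def)
qed

lemma AV_V: "d = 1 \<or> d = 2 ==> AV d h : fm.V" by (rule fm.ag.FV[OF AV_Ap])

lemma AV_Q: "d = 1 \<or> d = 2 ==> AV d h ~: QQ"
proof
 assume d: "d = 1 \<or> d = 2" "AV d h : QQ"
 then obtain h' where "lm h ` XX d = lm h' ` XX 0" using QQ_D[OF d(2)] unfolding AV_def by blast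
 hence "d = 0" using XX_ne[of d 0 h h'] d(1) by auto
 thus False using d(1) by simp
qed

lemma AV_eq: "d = 1 \<or> d = 2 ==> AV d h = AV d h' \<longleftrightarrow> h'^- * h : pwr (R d) N"
proof -
 assume "d = 1 \<or> d = 2"
 hence "d <= 2" "d ~= 0" by auto
 thus ?thesis using XX_eq by (simp add: AV_def EE_def)
qed

abbreviation "E' d \<equiv> pwr (R d) NN"

lemma E'_sub: "subgrp (E' d)" by (rule pwr_sub[OF rm.NN_normal])

text \<open>Matches axis apices modulo \<open>NN\<close> with cosets, so that angles of the quotient
  graph become a projection system of the kind needed for the next step.\<close>

lemma AV_Dq: assumes d: "d = 1 \<or> d = 2" shows "rm.Dq (AV d h) (AV d h') = 0 \<longleftrightarrow> h'^- * h : E' d"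
proof
 assume "rm.Dq (AV d h) (AV d h') = 0"
 then obtain n where n: "n : NN" "AV d h = AV d (n * h')" by (metis rm.Dq0 AV_V d act_AV)
 then obtain i where i: "(zpow (R d) i)^- * ((n * h')^- * h) : N" using AV_eq[OF d] unfolding pwr_def by blast
 have "((zpow (R d) i)^- * ((n * h')^- * h)) * (h^- * n * h) : NN"
  by (rule rm.NNm[OF rm.NN_incl(1)[OF i] rm.NNc'[OF n(1)]])
 hence "(zpow (R d) i)^- * (h'^- * h) : NN" by (simp add: mult.assoc)
 thus "h'^- * h : E' d" unfolding pwr_def by blast
next
 assume "h'^- * h : E' d"
 then obtain i where i: "(zpow (R d) i)^- * (h'^- * h) : NN" unfolding pwr_def by blast
 define u where "u = h' * zpow (R d) i"
 define n where "n = u * ((zpow (R d) i)^- * (h'^- * h)) * u^-"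
 have n: "n : NN" unfolding n_def by (rule rm.NNc[OF i])
 have h: "h = n * u" by (simp add: n_def u_def mult.assoc)
 have "AV d u = AV d h'" using AV_eq d pwr_I sN by (fastforce simp: u_def)
 hence "AV d h = act n (AV d h')" by (metis h act_AV)
 thus "rm.Dq (AV d h) (AV d h') = 0" using rm.Dq_n' AV_V d n rm.Dq_self by simp
qed

definition vx :: "nat => 'g set => 'g set + 'g set set" where
 "vx d y = AV d (SOME h. y = lm h (E' d))"

lemma vx_Ap: "d = 1 \<or> d = 2 ==> vx d y : Inr ` FF" unfolding vx_def by (rule AV_Ap)
lemma vx_V: "d = 1 \<or> d = 2 ==> vx d y : fm.V" unfolding vx_def by (rule AV_V)

lemma Dq0_trans: "[|x : fm.V; y : fm.V; x' : fm.V; rm.Dq x y = 0; rm.Dq y x' = 0|] ==> rm.Dq x x' = 0"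
 using rm.Dq_tri[of x y x'] by simp

lemma vx_lm: assumes d: "d = 1 \<or> d = 2" shows "rm.Dq (vx d (lm h (E' d))) (AV d h) = 0"
proof -
 define h' where "h' = (SOME h'. lm h (E' d) = lm h' (E' d))"
 have "lm h (E' d) = lm h' (E' d)" unfolding h'_def by (rule someI) (rule refl)
 hence "h^- * h' : E' d" using lm_eq E'_sub by blast
 thus ?thesis using AV_Dq d by (simp add: vx_def h'_def)
qed

lemma vx_eq: assumes d: "d = 1 \<or> d = 2" and y: "y : Yc (E' d)" "x : Yc (E' d)"
 shows "rm.Dq (vx d y) (vx d x) = 0 \<longleftrightarrow> y = x"
proof -
 obtain h h' where h: "y = lm h (E' d)" "x = lm h' (E' d)" using Yc_D y by metis
 note V = vx_V[OF d] AV_V[OF d]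
 have "rm.Dq (vx d y) (vx d x) = rm.Dq (AV d h) (vx d x)" by (metis h rm.qt.D0_cong V vx_lm d)
 also have "... = rm.Dq (AV d h) (AV d h')" by (metis h rm.qt.D0_cong V vx_lm d)
 finally show ?thesis by (metis AV_Dq d h lm_eq E'_sub)
qed

lemma vx_act: assumes d: "d = 1 \<or> d = 2" and y: "y : Yc (E' d)" shows "rm.Dq (vx d (lm a y)) (act a (vx d y)) = 0"
proof -
 obtain h where h: "y = lm h (E' d)" using Yc_D[OF y] by blast
 note V = vx_V[OF d] AV_V[OF d]
 have 1: "rm.Dq (vx d (lm a y)) (AV d (a * h)) = 0" using h vx_lm d by simp
 have "rm.Dq (act a (vx d y)) (act a (AV d h)) = rm.Dq (vx d y) (AV d h)" by (rule rm.Dq_act[OF V])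
 also have "... = 0" using h vx_lm d by simp
 finally have "rm.Dq (AV d (a * h)) (act a (vx d y)) = 0"
  using act_AV rm.Dq_sym act_V V by simp
 thus ?thesis by (rule Dq0_trans[OF V(1) V(2) act_V[OF V(1)] 1])
qed

definition ang' :: "nat => 'g set => 'g set => 'g set => nat" where
 "ang' d y x x' = rm.qt.Phi (vx d y) (vx d x) (vx d x')"

text \<open>The axioms are properties of \<open>Phi\<close> in the quotient, with
  \<open>240 = 2 * 120\<close>. Apices with a large angle lie at different, bounded distances from
  \<open>x\<close>, hence finiteness.\<close>

lemma gsys': assumes d: "d = 1 \<or> d = 2" shows "gsys (E' d) (ang' d) 240"
proof -
 note V = vx_V[OF d] and Ap = vx_Ap[OF d]
 have pos: "0 < rm.Dq (vx d y) (vx d x)" if "y : Yc (E' d)" "x : Yc (E' d)" "x ~= y" for x y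
  using vx_eq[OF d that(1,2)] that(3) by auto
 show ?thesis
 proof (unfold_locales, goal_cases)
  case (1 y x) show ?case by (simp add: ang'_def)
 next
  case (2 y x z) show ?case unfolding ang'_def by (rule rm.qt.Phi_sym)
 next
  case (3 y x v z)
  show ?case unfolding ang'_def
   by (rule rm.qt.Phi_tri[OF Ap V pos[OF 3(1,2,5)] V pos[OF 3(1,3,6)] V pos[OF 3(1,4,7)]])
 next
  case (4 x y z)
  show ?case unfolding ang'_def
   by (rule rm.qt.Phi_strong(2)[OF Ap Ap V pos[OF 4(2,1,4)] pos[OF 4(3,1,6)] pos[OF 4(2,3,5)]])
    (use 4(7) in \<open>simp add: ang'_def\<close>)
 next
  case (5 x z)
  let ?S = "{y : Yc (E' d) - {x, z}. 240 < ang' d y x z}"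
  have y: "y : Yc (E' d)" "0 < rm.Dq (vx d y) (vx d x)" "0 < rm.Dq (vx d y) (vx d z)" "2 * 120 < rm.qt.Phi (vx d y) (vx d x) (vx d z)"
   if yS: "y : ?S" for y
  proof -
   have *: "y : Yc (E' d)" "y ~= x" "y ~= z" "240 < ang' d y x z" using yS by blast+
   show "y : Yc (E' d)" by (rule *(1))
   show "0 < rm.Dq (vx d y) (vx d x)" by (rule pos[OF *(1) 5(1) not_sym[OF *(2)]])
   show "0 < rm.Dq (vx d y) (vx d z)" by (rule pos[OF *(1) 5(2) not_sym[OF *(3)]])
   show "2 * 120 < rm.qt.Phi (vx d y) (vx d x) (vx d z)" using *(4) by (simp add: ang'_def)
  qed
  have inj: "inj_on (\<lambda>y. rm.Dq (vx d x) (vx d y)) ?S"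
  proof (rule inj_onI)
   fix u v assume uv: "u : ?S" "v : ?S" "rm.Dq (vx d x) (vx d u) = rm.Dq (vx d x) (vx d v)"
   have "rm.Dq (vx d u) (vx d v) = 0"
    by (rule rm.qt.Phi_same_dist[OF Ap Ap V V y(2)[OF uv(1)] y(3)[OF uv(1)] y(2)[OF uv(2)] y(3)[OF uv(2)] y(4)[OF uv(1)] y(4)[OF uv(2)] uv(3)])
   thus "u = v" using vx_eq d uv by simp
  qed
  have sub: "(\<lambda>y. rm.Dq (vx d x) (vx d y)) ` ?S <= {..rm.Dq (vx d x) (vx d z)}"
  proof
   fix m assume "m : (\<lambda>y. rm.Dq (vx d x) (vx d y)) ` ?S"
   then obtain u where u: "u : ?S" "m = rm.Dq (vx d x) (vx d u)" by blast
   have "rm.Dq (vx d x) (vx d z) = rm.Dq (vx d x) (vx d u) + rm.Dq (vx d u) (vx d z)"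
    by (rule rm.qt.Phi_A1[OF Ap V y(2)[OF u(1)] V y(3)[OF u(1)]]) (use y(4)[OF u(1)] in simp)
   thus "m : {..rm.Dq (vx d x) (vx d z)}" using u(2) by simp
  qed
  show ?case using inj_on_finite inj sub by blast
 next
  case 6 show ?case by (rule E'_sub)
 next
  case (7 y x z a)
  have "rm.qt.Phi (vx d (lm a y)) (vx d (lm a x)) (vx d (lm a z)) = rm.qt.Phi (act a (vx d y)) (vx d (lm a x)) (vx d (lm a z))"
   by (rule rm.qt_Phi_F[OF Ap rm.act_Ap[OF Ap] vx_act[OF d 7(1)] V V])
  also have "... = rm.qt.Phi (act a (vx d y)) (act a (vx d x)) (vx d (lm a z))"
   by (rule rm.qt.Phi_cong(1)[OF rm.act_Ap[OF Ap] V act_V[OF V] vx_act[OF d 7(2)]])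
  also have "... = rm.qt.Phi (act a (vx d y)) (act a (vx d x)) (act a (vx d z))"
   by (rule rm.qt.Phi_cong(2)[OF rm.act_Ap[OF Ap] V act_V[OF V] vx_act[OF d 7(3)]])
  also have "... = rm.qt.Phi (vx d y) (vx d x) (vx d z)" by (rule rm.qt_Phi_act[OF Ap V V])
  finally show ?case by (simp add: ang'_def)
 qed
qed

lemma XX_axis: assumes d: "d = 1 \<or> d = 2" and u: "u : XX d" obtains a where "u = lm (zpow (R d) a) E"
proof -
 obtain y i where "u = lm y E" "(y, i) : FRM d" using u unfolding XX_def by blast
 hence y: "u = lm y E" "y : pwr (R d) N" using d by (auto simp: FRM_def)
 then obtain a where a: "(zpow (R d) a)^- * y : N" unfolding pwr_def by blast
 have "lm y E = lm (zpow (R d) a) E" using lm_E[OF NE[OF a], of "zpow (R d) a"] by simp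
 thus ?thesis using y that by blast
qed

lemma R_fix: "d = 1 \<or> d = 2 ==> act (zpow (R d) m) (AV d 1) = AV d 1"
 by (simp add: act_AV AV_eq pwr_I sN)

text \<open>The power of \<open>R d\<close> translates its own axis, where a shift by
  \<open>m\<close> has absolute value of \<open>m\<close> minus one separators; by
  \<open>rot_lower\<close> this angle persists in the quotient up to 120.\<close>

lemma R_rot: assumes d: "d = 1 \<or> d = 2" and m: "m ~= 0" and v: "v : fm.V" "0 < rm.Dq (AV d 1) v"
 shows "nat \<bar>m\<bar> <= 120 + rm.qt.Phi (AV d 1) v (act (zpow (R d) m) v)"
proof -
 obtain e where e: "e : fm.nbf (AV d 1)"
   "fm.nuf (AV d 1) e (act (zpow (R d) m) e) <= 120 + rm.qt.Phi (AV d 1) v (act (zpow (R d) m) v)"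
  using rm.rot_lower[OF AV_Ap[OF d] AV_Q[OF d] R_fix[OF d] v] .
 obtain u where u: "e = Inl u" "u : XX d" using e(1) by (auto simp: fm.nbf_def AV_def)
 obtain a where a: "u = lm (zpow (R d) a) E" using XX_axis[OF d u(2)] .
 have "lm (zpow (R d) m) u = lm (zpow (R d) (m + a)) E" by (simp add: a zpow_add)
 moreover have "Suc (card (sep KK (lm (zpow (R d) a) E) (lm (zpow (R d) (m + a)) E))) = nat \<bar>m\<bar>"
  using axis_card d m by simp
 ultimately have "fm.nuf (AV d 1) e (act (zpow (R d) m) e) = nat \<bar>m\<bar>" by (simp add: fm.nuf_def u(1) a)
 thus ?thesis using e(2) by simp
qed

lemma rot': assumes d: "d = 1 \<or> d = 2"
 shows "\<exists>m0. \<forall>m. int m0 <= \<bar>m\<bar> --> (ALL x:Yc (E' d). x ~= E' d --> (M::nat) < ang' d (E' d) x (lm (zpow (R d) m) x))"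
proof (rule exI[of _ "M + 200"], intro allI impI ballI)
 fix m x assume m: "int (M + 200) <= \<bar>m\<bar>" and x: "x : Yc (E' d)" "x ~= E' d"
 note V = vx_V[OF d] and Ap = vx_Ap[OF d]
 have b: "rm.Dq (vx d (E' d)) (AV d 1) = 0" using vx_lm[OF d, of 1] by simp
 have "0 < rm.Dq (vx d (E' d)) (vx d x)" using vx_eq[OF d Yc_E x(1)] x(2) by auto
 hence pos: "0 < rm.Dq (AV d 1) (vx d x)" by (metis rm.qt.D0_cong V AV_V d b)
 have m0: "m ~= 0" using m by auto
 have l: "nat \<bar>m\<bar> <= 120 + rm.qt.Phi (AV d 1) (vx d x) (act (zpow (R d) m) (vx d x))"
  by (rule R_rot[OF d m0 V pos])
 have "ang' d (E' d) x (lm (zpow (R d) m) x) = rm.qt.Phi (AV d 1) (vx d x) (vx d (lm (zpow (R d) m) x))"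
  using rm.qt_Phi_F Ap AV_Ap d b V by (simp add: ang'_def)
 also have "... = rm.qt.Phi (AV d 1) (vx d x) (act (zpow (R d) m) (vx d x))"
  by (rule rm.qt.Phi_cong(2)[OF AV_Ap[OF d] V act_V[OF V] vx_act[OF d x(1)]])
 finally show "M < ang' d (E' d) x (lm (zpow (R d) m) x)" using l m by linarith
qed

lemma E_V: "Inl (lm h E) : fm.V" by (rule fm.VI(1)[OF Yc_I])

lemma P_adj: assumes p: "p : P - N0" shows "fm.gd (Inl E) (Inl (lm p E)) <= 1"
proof -
 have pS: "p : Sg" using p by (simp add: Sg_def)
 have "sep KK E (lm p E) = {}"
 proof (rule ccontr)
  assume "sep KK E (lm p E) ~= {}"
  then obtain y where "y : sep KK E (lm p E)" by blast
  hence y: "y : Yc E" "y ~= E" "y ~= lm p E" "KK < ang y E (lm p E)" by (simp_all add: sep_def)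
  thus False using BB(1)[OF pS y(1-3)] csts by linarith
 qed
 thus ?thesis using fm.gd_adj[of "Inl E" "Inl (lm p E)"] Yc_E Yc_I Sg_ne[OF pS] by force
qed

lemma AV_adj: assumes d: "d = 1 \<or> d = 2" shows "fm.gd (AV d h) (Inl (lm h E)) = 1" "Inl (lm h E) : fm.nbf (AV d h)"
proof -
 have "(1, k + d) : FRM d" using d pwr_I[OF sN, of "R d" 0] by (auto simp: FRM_def)
 hence "E : XX d" using FRM_XX by fastforce
 thus nb: "Inl (lm h E) : fm.nbf (AV d h)" by (auto simp: fm.nbf_def AV_def)
 thus "fm.gd (AV d h) (Inl (lm h E)) = 1" by (rule fm.ag.nbD[OF AV_Ap[OF d]])
qed

text \<open>Three short steps, from the apex to \<open>E\<close>, to the coset of \<open>p\<close>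
  and to its apex, contribute at most 120 each.\<close>

lemma P_chain_up:
 assumes d: "d = 1 \<or> d = 2" and p: "p : P - N0" and q: "q : Inr ` FF" "q ~= AV d 1" "q ~= AV d p"
 shows "fm.ag.Phi q (AV d 1) (AV d p) <= 360"
proof -
 have qV: "q : fm.V" by (rule fm.ag.FV[OF q(1)])
 note A = AV_V[OF d] and E1 = E_V[of 1] and Ep = E_V[of p]
 have pos: "0 < fm.gd q (AV d 1)" "0 < fm.gd q (AV d p)" using fm.gd_eq_0[OF qV A] q by auto
 have posE: "0 < fm.gd q (Inl (lm h E))" for h by (metis fm.ag.nbA AV_Ap q AV_adj)
 have 1: "fm.ag.Phi q (AV d 1) (Inl (lm 1 E)) <= 120"
  by (rule fm.ag.Phi_adj[OF q(1) A pos(1) E_V posE]) (use AV_adj(1)[OF d, of 1] in simp)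
 have 2: "fm.ag.Phi q (Inl (lm 1 E)) (Inl (lm p E)) <= 120"
  by (rule fm.ag.Phi_adj[OF q(1) E_V posE E_V posE]) (use P_adj[OF p] in simp)
 have 3: "fm.ag.Phi q (Inl (lm p E)) (AV d p) <= 120"
  using fm.ag.Phi_adj q E_V posE A pos AV_adj d fm.gd_sym by fastforce
 show ?thesis
  using fm.ag.Phi_tri[OF q(1) A pos(1) E_V posE A pos(2), of 1] fm.ag.Phi_tri[OF q(1) E_V posE E_V posE A pos(2), of 1 p] 1 2 3 by linarith
qed

lemma P_chain_bar:
 assumes d: "d = 1 \<or> d = 2" and p: "p : P - N0" and q: "q : Inr ` FF" "0 < rm.Dq q (AV d 1)" "0 < rm.Dq q (AV d p)"
 shows "rm.qt.Phi q (AV d 1) (AV d p) <= 360"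
proof -
 note A = AV_V[OF d] and pos = q(2,3)
 have posE: "0 < rm.Dq q (Inl (lm h E))" for h by (metis rm.qt.nbA AV_Ap q AV_adj)
 have D1: "rm.Dq (AV d h) (Inl (lm h E)) <= 1" for h by (metis rm.Dq_le1 E_V AV_adj d)
 have 1: "rm.qt.Phi q (AV d 1) (Inl (lm 1 E)) <= 120" using rm.qt.Phi_adj q A E_V posE D1 by blast
 have "rm.Dq (Inl (lm 1 E)) (Inl (lm p E)) <= 1" using rm.Dq_le1[OF E_V, of "Inl (lm 1 E)" p] P_adj[OF p] by simp
 hence 2: "rm.qt.Phi q (Inl (lm 1 E)) (Inl (lm p E)) <= 120" using rm.qt.Phi_adj q E_V posE by blast
 have 3: "rm.qt.Phi q (Inl (lm p E)) (AV d p) <= 120"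
  using rm.qt.Phi_adj q E_V posE A D1 rm.Dq_sym by simp
 show ?thesis
  using rm.qt.Phi_tri[OF q(1) A pos(1) E_V posE A pos(2), of 1] rm.qt.Phi_tri[OF q(1) E_V posE E_V posE A pos(2), of 1 p] 1 2 3 by linarith
qed

text \<open>Otherwise an element of \<open>NN\<close> moves the axis apex as \<open>p\<close> does,
  hence little, and lies in \<open>N\<close>; so \<open>p\<close> is a power of \<open>R d\<close>
  modulo \<open>N\<close>. Its square has an even nonzero exponent, for which the axis has a
  separator between \<open>E\<close> and its image, while a step in \<open>P\<close> has
  none.\<close>

lemma P_moves: assumes d: "d = 1 \<or> d = 2" and p: "p : P - N0" shows "p ~: E' d"
proof
 assume "p : E' d"
 hence "rm.Dq (AV d p) (AV d 1) = 0" using AV_Dq d by simp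
 then obtain n where n: "n : NN" "AV d p = act n (AV d 1)" using rm.Dq0 AV_V d by blast
 have "n : N"
 proof (rule rm.small_N[OF AV_V[OF d] AV_Q[OF d] n(1)])
  fix q assume q: "q : QQ" "q ~= AV d 1" "q ~= act n (AV d 1)"
  have "fm.ag.Phi q (AV d 1) (AV d p) <= 360" by (rule P_chain_up[OF d p]) (use q QQ_Ap n in auto)
  thus "fm.ag.Phi q (AV d 1) (act n (AV d 1)) <= 50 * rm.th" using n(2) by (simp add: rm.th_def)
 qed
 hence "AV d p = AV d 1" using n(2) rm.N_triv AV_V[OF d] by simp
 hence "p : pwr (R d) N" using AV_eq d by simp
 then obtain i where i: "(zpow (R d) i)^- * p : N" unfolding pwr_def by blast
 have pi: "lm p E = lm (zpow (R d) i) E" using lm_E[OF NE[OF i], of "zpow (R d) i"] by simp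
 have i0: "i ~= 0"
 proof
  assume "i = 0"
  thus False using i p by (simp add: N0)
 qed
 have "zpow (R d) i * (zpow (R d) i)^- * p * (zpow (R d) i)^- : N"
  using Nc[OF i, of "zpow (R d) i"] by (simp add: mult.assoc)
 hence "p * (zpow (R d) i)^- : N" by simp
 from normal_power_quot[OF N_normal this, of 2] have "p ^ 2 * (zpow (R d) (i * 2))^- : N"
  by (simp add: zpow_nat_mult)
 from Nc'[OF Ni[OF this], of "p ^ 2"] have "(p ^ 2)^- * zpow (R d) (i * 2) : N" by (simp add: mult.assoc)
 hence e2: "lm (p ^ 2) E = lm (zpow (R d) (i * 2)) E" using lm_E[OF NE, of _ "p ^ 2"] by fastforce
 have p2: "p ^ 2 : P - N0" using p tfN[of 2 p] subgrpD(2)[OF P_sub, of p p] by (auto simp: N0 power2_eq_square)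
 have "fm.gd (Inl E) (Inl (lm (p ^ 2) E)) <= 1" by (rule P_adj[OF p2])
 have pS: "p ^ 2 : Sg" using p2 by (simp add: Sg_def)
 have "lm (zpow (R d) 0) E ~= lm (zpow (R d) (i * 2)) E & Suc (card (sep KK (lm (zpow (R d) 0) E) (lm (zpow (R d) (i * 2)) E))) = nat \<bar>i * 2 - 0\<bar>"
  by (rule axis_card[OF d]) (use i0 in simp)
 moreover have "2 <= nat \<bar>i * 2 - 0\<bar>" using i0 by (cases "i < 0") auto
 ultimately have "card (sep KK (lm (zpow (R d) 0) E) (lm (zpow (R d) (i * 2)) E)) ~= 0" by linarith
 hence "card (sep KK E (lm (p ^ 2) E)) ~= 0" unfolding e2 by simp
 then obtain y where "y : sep KK E (lm (p ^ 2) E)" by fastforce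
 hence y: "y : Yc E" "y ~= E" "y ~= lm (p ^ 2) E" "KK < ang y E (lm (p ^ 2) E)" by (simp_all add: sep_def)
 thus False using BB(1)[OF pS y(1-3)] csts by linarith
qed

lemma gsystem': assumes d: "d = 1 \<or> d = 2" shows "gsystem P N0 NN (R d)"
 unfolding gsystem_def
proof (intro exI conjI)
 show "gsys (E' d) (ang' d) 240" by (rule gsys'[OF d])
 show "\<forall>M::nat. \<exists>m0. \<forall>m. int m0 <= \<bar>m\<bar> --> (ALL x:Yc (E' d). x ~= E' d --> M < ang' d (E' d) x (lm (zpow (R d) m) x))"
  using rot'[OF d] by blast
 show "ALL p:P - N0. lm p (E' d) ~= E' d &
    (ALL y:Yc (E' d). y ~= E' d --> y ~= lm p (E' d) --> ang' d y (E' d) (lm p (E' d)) <= 360)"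
 proof (intro ballI conjI impI)
  fix p assume p: "p : P - N0"
  show "lm p (E' d) ~= E' d" using P_moves d p lm_stab E'_sub by blast
  fix y assume y: "y : Yc (E' d)" "y ~= E' d" "y ~= lm p (E' d)"
  note V = vx_V[OF d] and Ap = vx_Ap[OF d] and A = AV_V[OF d]
  have c1: "rm.Dq (vx d (E' d)) (AV d 1) = 0" using vx_lm[OF d, of 1] by simp
  have c2: "rm.Dq (vx d (lm p (E' d))) (AV d p) = 0" by (rule vx_lm[OF d])
  have "0 < rm.Dq (vx d y) (AV d 1)" using vx_eq[OF d y(1) Yc_E] y(2) rm.qt.D0_cong(2)[OF V A V c1] by (metis gr0I)
  moreover have "0 < rm.Dq (vx d y) (AV d p)" using vx_eq[OF d y(1) Yc_I] y(3) rm.qt.D0_cong(2)[OF V A V c2] by (metis gr0I)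
  ultimately have "rm.qt.Phi (vx d y) (AV d 1) (AV d p) <= 360" by (rule P_chain_bar[OF d p Ap])
  moreover have "ang' d y (E' d) (lm p (E' d)) = rm.qt.Phi (vx d y) (AV d 1) (AV d p)"
   by (metis ang'_def rm.qt.Phi_cong Ap V A c1 c2)
  ultimately show "ang' d y (E' d) (lm p (E' d)) <= 360" by simp
 qed
qed

text \<open>A conjugate of a power of \<open>R d'\<close> fixes an apex of the other axis. So the
  121st power of \<open>zpow (R d) i\<close> would fix it in the quotient, although it rotates by at
  least 121, beyond the slack 120 of \<open>R_rot\<close>.\<close>

lemma nonconj': assumes d: "d = 1 \<or> d = 2" "d' = 1 \<or> d' = 2" "d ~= d'" and i: "i ~= 0"
 shows "h * zpow (R d) i * h^- * (zpow (R d') j)^- ~: NN"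
proof
 assume n: "h * zpow (R d) i * h^- * (zpow (R d') j)^- : NN"
 define x where "x = zpow (R d) i"
 define y where "y = h^- * zpow (R d') j * h"
 define v where "v = AV d' h^-"
 have vV: "v : fm.V" unfolding v_def by (rule AV_V[OF d(2)])
 have "x * y^- : NN" using rm.NNc'[OF n, of h] by (simp add: x_def y_def mult.assoc)
 hence xy: "x ^ 121 * (y ^ 121)^- : NN" by (rule normal_power_quot[OF rm.NN_normal])
 have "zpow (h^- * zpow (R d') j * h^-^-) 121 = h^- * zpow (zpow (R d') j) 121 * h^-^-"
  by (rule zpow_conj)
 moreover have "y ^ 121 = zpow y 121" using zpow_of_nat[of y 121] by simp
 ultimately have y121: "y ^ 121 = h^- * zpow (R d') (j * 121) * h" by (simp add: y_def zpow_mult)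
 have yv: "act (y ^ 121) v = v"
 proof -
  have "act (y ^ 121) v = act (h^- * zpow (R d') (j * 121)) (AV d' 1)"
   by (simp add: v_def act_AV y121 mult.assoc)
  also have "... = act h^- (act (zpow (R d') (j * 121)) (AV d' 1))" by (rule act_act)
  also have "... = act h^- (AV d' 1)" using R_fix d by simp
  also have "... = v" by (simp add: v_def act_AV)
  finally show ?thesis .
 qed
 have "act (x ^ 121) v = act (x ^ 121 * (y ^ 121)^-) (act (y ^ 121) v)"
  unfolding act_act[symmetric] by (simp add: mult.assoc)
 hence xv: "act (x ^ 121) v = act (x ^ 121 * (y ^ 121)^-) v" unfolding yv .
 have D0: "rm.Dq (act (x ^ 121) v) v = 0" using xv rm.Dq_n' vV xy rm.Dq_self by simp
 have x121: "x ^ 121 = zpow (R d) (i * 121)" by (simp add: zpow_nat_mult x_def)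
 have pos: "0 < rm.Dq (AV d 1) v"
 proof (rule ccontr)
  assume "\<not> ?thesis"
  then obtain n where "AV d 1 = act n v" using rm.Dq0 AV_V d vV by blast
  hence "lm 1 ` XX d = lm (n * h^-) ` XX d'" unfolding v_def act_AV by (simp add: AV_def)
  moreover have "d <= 2" "d' <= 2" using d by auto
  ultimately have "d = d'" by (intro XX_ne)
  thus False using d(3) by simp
 qed
 have "nat \<bar>i * 121\<bar> <= 120 + rm.qt.Phi (AV d 1) v (act (zpow (R d) (i * 121)) v)"
  by (rule R_rot[OF d(1) _ vV pos]) (use i in simp)
 also have "rm.qt.Phi (AV d 1) v (act (zpow (R d) (i * 121)) v) = rm.qt.Phi (AV d 1) v v"
  using rm.qt.Phi_cong(2)[OF AV_Ap[OF d(1)] act_V[OF vV] vV D0] unfolding x121 .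
 finally show False using i by simp
qed

end

section \<open>Invariants of the chain of kernels, and the step\<close>

locale amb =
 fixes P N0 S :: "'g::grp set" and c :: "'g => nat"
 assumes P_sub: "subgrp P" and S_sub: "subgrp S"
  and c_conj: "[|x : P; y : P|] ==> c (y * x * y^-) = c x"
  and c_N0: "[|x : P; n : N0|] ==> c (x * n) = c x"
  and c_pow: "[|x : P; j ~= 0|] ==> c (zpow x j) = c x"
begin

text \<open>The last clause says that \<open>r1\<close> and \<open>r2\<close> have infinite order
  and are incommensurable modulo \<open>N\<close>; this is what offers a choice in
  \<open>step\<close>.\<close>

definition state :: "'g set => bool" where
 "state N \<longleftrightarrow> normal_sub N & P \<inter> N = N0 & (\<forall>x. \<forall>m>0. x ^ m : N --> x : N) &
   (ALL x:P. ALL x':P. \<forall>h. h * x * h^- * x'^- : N --> c x = c x') &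
   (EX r1:S. EX r2:S. gsystem P N0 N r1 & gsystem P N0 N r2 &
    (\<forall>h i j. i ~= 0 \<or> j ~= 0 --> h * zpow r1 i * h^- * (zpow r2 j)^- ~: N))"

lemma step_aux:
 assumes N: "normal_sub N" "P \<inter> N = N0" "\<And>x m. [|0 < m; x ^ m : N|] ==> x : N"
  "\<And>x x' h. [|x : P; x' : P; h * x * h^- * x'^- : N|] ==> c x = c x'"
  and rt: "r : S" "t : S" "gsystem P N0 N r" "t ~: pwr r N"
  and g: "\<And>j y. [|j ~= 0; y : Yc (pwr r N)|] ==> lm (zpow g j) y ~= y"
  and p0: "p0 : P" "p0 ~: N0"
  and compat: "\<And>h j x. [|j ~= 0; x : P; h * zpow g j * h^- * x^- : N|] ==> c x = c p0"
 shows "\<exists>N'. state N' & N <= N' & (EX Y:S. Y * g * Y^- * p0^- : N')"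
proof -
 from rt(3) obtain ang th where sys0: "gsys (pwr r N) ang th &
   (\<forall>M::nat. \<exists>m0. \<forall>m. int m0 <= \<bar>m\<bar> --> (ALL x:Yc (pwr r N). x ~= pwr r N --> M < ang (pwr r N) x (lm (zpow r m) x))) &
   (\<exists>B. ALL p:P - N0. lm p (pwr r N) ~= pwr r N &
    (ALL y:Yc (pwr r N). y ~= pwr r N --> y ~= lm p (pwr r N) --> ang y (pwr r N) (lm p (pwr r N)) <= B))"
  by (metis gsystem_def exE)
 note sys = conjunct1[OF sys0] conjunct1[OF conjunct2[OF sys0], rule_format] conjunct2[OF conjunct2[OF sys0]]
 interpret G: gsys "pwr r N" ang th by (rule sys(1))
 interpret s: stp "pwr r N" ang th P N0 N r t g p0 120001 c
 proof (unfold_locales, goal_cases)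
  case 1 show ?case by (rule P_sub)
 next
  case 2 show ?case by (rule N(1))
 next
  case 3 show ?case by (rule N(2))
 next
  case 4 show ?case by (rule refl)
 next
  case (5 M) show ?case using sys0 by simp
 next
  case 6 show ?case by (rule sys(3))
 next
  case 7 show ?case by (rule rt(4))
 next
  case 8 thus ?case by (rule g)
 next
  case 9 show ?case by (rule p0(1))
 next
  case 10 show ?case by (rule p0(2))
 next
  case 11 show ?case by (rule order_refl)
 next
  case 12 thus ?case by (rule N(3))
 next
  case 13 thus ?case by (rule c_conj)
 next
  case 14 thus ?case by (rule c_N0)
 next
  case 15 thus ?case by (rule c_pow)
 next
  case 16 thus ?case by (rule N(4))
 next
  case 17 thus ?case by (rule compat)
 qed
 have Sm: "x * y : S" if "x : S" "y : S" for x y by (rule subgrpD(2)[OF S_sub that])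
 have rS: "zpow r i : S" for i by (rule subgrp_zpow[OF S_sub rt(1)])
 have RS: "s.R d : S" for d unfolding s.R_def by (rule Sm[OF rS rt(2)])
 have wS: "s.w i : S" for i by (induction i) (simp_all add: Sm rS rt(2) subgrpD(1)[OF S_sub])
 have "state s.NN" unfolding state_def
 proof (intro conjI)
  show "normal_sub s.NN" by (rule s.rm.NN_normal)
  show "P \<inter> s.NN = N0" by (rule s.P_NN)
  show "\<forall>x. \<forall>m>0. x ^ m : s.NN --> x : s.NN"
  proof (intro allI impI)
   fix x m assume "0 < m" "x ^ m : s.NN"
   thus "x : s.NN" by (rule s.tf_NN)
  qed
  show "ALL x:P. ALL x':P. \<forall>h. h * x * h^- * x'^- : s.NN --> c x = c x'"
  proof (intro ballI allI impI)
   fix x x' h assume "x : P" "x' : P" "h * x * h^- * x'^- : s.NN"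
   thus "c x = c x'" by (rule s.col_NN)
  qed
  have nc: "h * zpow (s.R 1) i * h^- * (zpow (s.R 2) j)^- ~: s.NN" if ij: "i ~= 0 \<or> j ~= 0" for h i j
  proof (cases "i = 0")
   case False
   show ?thesis by (rule s.nonconj'[OF _ _ _ False]) simp_all
  next
   case True
   hence "h^- * zpow (s.R 2) j * h^-^- * (zpow (s.R 1) 0)^- ~: s.NN"
    by (intro s.nonconj') (use ij in simp_all)
   hence a: "h^- * zpow (s.R 2) j * h ~: s.NN" by simp
   show ?thesis
   proof
    assume "h * zpow (s.R 1) i * h^- * (zpow (s.R 2) j)^- : s.NN"
    hence "(zpow (s.R 2) j)^- : s.NN" using True by simp
    hence "zpow (s.R 2) j : s.NN" using subgrp_inv_iff[OF s.rm.NN_sub] by simp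
    hence "h^- * zpow (s.R 2) j * h : s.NN" by (rule s.rm.NNc')
    thus False using a by simp
   qed
  qed
  show "EX r1:S. EX r2:S. gsystem P N0 s.NN r1 & gsystem P N0 s.NN r2 &
    (\<forall>h i j. i ~= 0 \<or> j ~= 0 --> h * zpow r1 i * h^- * (zpow r2 j)^- ~: s.NN)"
  proof (rule bexI[OF _ RS[of 1]], rule bexI[OF _ RS[of 2]], intro conjI allI impI)
   show "gsystem P N0 s.NN (s.R 1)" by (rule s.gsystem') simp
   show "gsystem P N0 s.NN (s.R 2)" by (rule s.gsystem') simp
   fix h and i j :: int assume "i ~= 0 \<or> j ~= 0"
   thus "h * zpow (s.R 1) i * h^- * (zpow (s.R 2) j)^- ~: s.NN" by (rule nc)
  qed
 qed
 moreover have "N <= s.NN" using s.rm.NN_incl(1) by blast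
 moreover define Y where "Y = s.w (120001 - 1) * zpow r (s.mx (120001 - 1))"
 have "s.z = Y * g * Y^-" using s.zg[of 1] unfolding Y_def[symmetric] zpow_1 .
 hence "Y * g * Y^- * p0^- : s.NN" using s.z_p0 by simp
 moreover have "Y : S" unfolding Y_def by (rule Sm[OF wS rS])
 ultimately show ?thesis by blast
qed

lemma pwr_fix: assumes N: "normal_sub N" and y: "y : Yc (pwr r N)" and f: "lm x y = y"
 shows "\<exists>h i. x * (h * zpow r i * h^-)^- : N"
proof -
 obtain h where h: "y = lm h (pwr r N)" using Yc_D[OF y] by blast
 have "h^- * (x * h) : pwr r N" using f lm_eq[OF pwr_sub[OF N, of r], of "x * h" h] unfolding h by simp
 then obtain i where i: "(zpow r i)^- * (h^- * (x * h)) : N" unfolding pwr_def by blast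
 have "(h * zpow r i) * ((zpow r i)^- * (h^- * (x * h))) * (h * zpow r i)^- : N" by (rule normal_subD(2)[OF N i])
 hence "x * (h * zpow r i * h^-)^- : N" by (simp add: mult.assoc)
 thus ?thesis by blast
qed

text \<open>If nonzero powers of \<open>g\<close> fixed cosets in both systems, a common power would
  be conjugate to powers of \<open>r1\<close> and of \<open>r2\<close>. So one of the two carries
  the chain, and the other serves as its letter \<open>t\<close>.\<close>

theorem step:
 assumes st: "state N" and g: "g ~: N" and p0: "p0 : P" "p0 ~: N0"
  and compat: "\<And>h j x. [|j ~= 0; x : P; h * zpow g j * h^- * x^- : N|] ==> c x = c p0"
 shows "\<exists>N'. state N' & N <= N' & (EX Y:S. Y * g * Y^- * p0^- : N')"
proof -
 have N: "normal_sub N" "P \<inter> N = N0" "\<And>x m. [|0 < m; x ^ m : N|] ==> x : N"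
  "\<And>x x' h. [|x : P; x' : P; h * x * h^- * x'^- : N|] ==> c x = c x'"
  using st unfolding state_def by blast+
 obtain r1 r2 where r: "r1 : S" "r2 : S" "gsystem P N0 N r1" "gsystem P N0 N r2"
  "\<And>h i j. i ~= 0 \<or> j ~= 0 ==> h * zpow r1 i * h^- * (zpow r2 j)^- ~: N"
  by (metis st state_def)
 note sN = normal_subD(1)[OF N(1)]
 have tfz: "x : N" if "j ~= 0" "zpow x j : N" for x j
 proof (cases "0 <= j")
  case True thus ?thesis using N(3)[of "nat j" x] that by (simp add: zpow_def)
 next
  case False
  hence "x^- ^ nat (- j) : N" using that by (simp add: zpow_def)
  hence "x^- : N" using N(3)[of "nat (- j)" "x^-"] False by simp
  thus ?thesis using subgrp_inv_iff[OF sN] by blast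
 qed
 have t1: "r2 ~: pwr r1 N"
 proof
  assume "r2 : pwr r1 N"
  then obtain i where "(zpow r1 i)^- * r2 : N" unfolding pwr_def by blast
  hence "((zpow r1 i)^- * r2)^- : N" by (rule subgrpD(3)[OF sN])
  hence "zpow r1 i * ((zpow r1 i)^- * r2)^- * (zpow r1 i)^- : N" by (rule normal_subD(2)[OF N(1)])
  hence "1 * zpow r1 i * inverse 1 * (zpow r2 1)^- : N"
   by (simp add: mult.assoc)
  thus False using r(5)[of i 1 1] by simp
 qed
 have t2: "r1 ~: pwr r2 N"
 proof
  assume "r1 : pwr r2 N"
  then obtain j where j: "(zpow r2 j)^- * r1 : N" unfolding pwr_def by blast
  have "zpow r2 j * ((zpow r2 j)^- * r1) * (zpow r2 j)^- : N" by (rule normal_subD(2)[OF N(1) j])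
  hence "1 * zpow r1 1 * inverse 1 * (zpow r2 j)^- : N" by (simp add: mult.assoc)
  thus False using r(5)[of 1 j 1] by simp
 qed
 show ?thesis
 proof (cases "\<forall>j y. j ~= 0 --> y : Yc (pwr r1 N) --> lm (zpow g j) y ~= y")
  case True
  hence g': "\<And>j y. [|j ~= 0; y : Yc (pwr r1 N)|] ==> lm (zpow g j) y ~= y" by simp
  show ?thesis by (rule step_aux[OF N r(1,2,3) t1 g' p0 compat])
 next
  case False
  then obtain j1 y1 where f1: "j1 ~= 0" "y1 : Yc (pwr r1 N)" "lm (zpow g j1) y1 = y1" by blast
  obtain h1 i1 where h1: "zpow g j1 * (h1 * zpow r1 i1 * h1^-)^- : N" using pwr_fix N f1 by blast
  have g': "lm (zpow g j2) y2 ~= y2" if f2: "j2 ~= 0" "y2 : Yc (pwr r2 N)" for j2 y2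
  proof
   assume "lm (zpow g j2) y2 = y2"
   then obtain h2 i2 where h2: "zpow g j2 * (h2 * zpow r2 i2 * h2^-)^- : N" using pwr_fix N f2 by blast
   have "zpow (zpow g j1) j2 * (zpow (h1 * zpow r1 i1 * h1^-) j2)^- : N" by (rule normal_zpow_quot[OF N(1) h1])
   hence a: "zpow g (j1 * j2) * (h1 * zpow r1 (i1 * j2) * h1^-)^- : N" unfolding zpow_conj zpow_mult .
   have "zpow (zpow g j2) j1 * (zpow (h2 * zpow r2 i2 * h2^-) j1)^- : N" by (rule normal_zpow_quot[OF N(1) h2])
   hence "zpow g (j2 * j1) * (h2 * zpow r2 (i2 * j1) * h2^-)^- : N" unfolding zpow_conj zpow_mult .
   hence b: "zpow g (j1 * j2) * (h2 * zpow r2 (i2 * j1) * h2^-)^- : N" by (simp add: mult.commute)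
   have "i1 ~= 0"
   proof
    assume "i1 = 0"
    hence "zpow g j1 : N" using h1 by simp
    thus False using tfz[OF f1(1)] g by blast
   qed
   hence ij: "i1 * j2 ~= 0" using f2 by simp
   have "(zpow g (j1 * j2) * (h1 * zpow r1 (i1 * j2) * h1^-)^-)^- * (zpow g (j1 * j2) * (h2 * zpow r2 (i2 * j1) * h2^-)^-) : N"
    using subgrpD sN a b by blast
   from normal_subD(2)[OF N(1) this, of "h2^-"]
   have "(h2^- * h1) * zpow r1 (i1 * j2) * (h2^- * h1)^- * (zpow r2 (i2 * j1))^- : N"
    by (simp add: mult.assoc)
   thus False using r(5) ij by blast
  qed
  show ?thesis by (rule step_aux[OF N r(2,1,4) t2 g' p0 compat])
 qed
qed

end

section \<open>Free groups, free products and the initial state\<close>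

text \<open>Permutation groups bring groups given by carriers into the type class: the free product
  acting on its normal forms, and \<open>G\<close> times \<open>Z^2\<close> acting by
  translations.\<close>

typedef 'a bperm = "{f :: 'a => 'a. bij f}" morphisms papp Bperm
 by (rule exI[of _ id]) simp

setup_lifting type_definition_bperm

instantiation bperm :: (type) grp
begin

lift_definition one_bperm :: "'a bperm" is id by simp
lift_definition times_bperm :: "'a bperm => 'a bperm => 'a bperm" is "(\<circ>)" by (rule bij_comp)
lift_definition inverse_bperm :: "'a bperm => 'a bperm" is "inv_into UNIV" by (rule bij_imp_bij_inv)
instance
proof
 fix x y z :: "'a bperm"
 show "x * y * z = x * (y * z)" by transfer (simp add: comp_assoc)
 show "1 * x = x" by transfer simp
 show "x * 1 = x" by transfer simp
 show "x^- * x = 1" by transfer (auto simp: bij_is_inj)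
qed

end

lemma papp_mult [simp]: "papp (x * y) a = papp x (papp y a)" by transfer simp
lemma papp_1 [simp]: "papp 1 a = a" by transfer simp
lemma bperm_eqI: "(\<And>a. papp x a = papp y a) ==> x = y" by transfer auto

section \<open>The free group on countably many generators\<close>

definition red1 :: "(nat \<times> bool) list => (nat \<times> bool) list => bool" where
 "red1 w w' \<longleftrightarrow> (\<exists>u n b v. w = u @ [(n, b), (n, \<not> b)] @ v & w' = u @ v)"

lemma red1_append: "red1 w w' ==> red1 (x @ w @ y) (x @ w' @ y)"
 unfolding red1_def by (metis append_assoc)

definition winv :: "(nat \<times> bool) list => (nat \<times> bool) list" where
 "winv w = rev (map (\<lambda>(n, b). (n, \<not> b)) w)"

lemma winv_Cons: "winv (x # w) = winv w @ [(fst x, \<not> snd x)]"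
 by (simp add: winv_def split: prod.split)

lemma red1_winv: "red1 w w' ==> red1 (winv w) (winv w')"
proof -
 assume "red1 w w'"
 then obtain u n b v where "w = u @ [(n, b), (n, \<not> b)] @ v" "w' = u @ v" unfolding red1_def by blast
 hence "winv w = winv v @ [(n, b), (n, \<not> b)] @ winv u" "winv w' = winv v @ winv u"
  by (simp_all add: winv_def)
 thus ?thesis unfolding red1_def by blast
qed

abbreviation "fgeq \<equiv> equivclp red1"

lemma fgeq_map: assumes "\<And>w w'. red1 w w' ==> red1 (f w) (f w')" and "fgeq w w'" shows "fgeq (f w) (f w')"
 using assms(2)
proof (induction rule: equivclp_induct)
 case base show ?case by (rule equivclp_refl)
next
 case (step y z)
 hence "fgeq (f y) (f z)"
  using assms(1) r_into_equivclp[of red1] equivclp_sym[of red1] by blast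
 thus ?case using step.IH equivclp_trans[of red1] by blast
qed

lemma fgeq_invariant: assumes "\<And>w w'. red1 w w' ==> f w = f w'" and "fgeq w w'" shows "f w = f w'"
 using assms(2) by (induction rule: equivclp_induct) (use assms(1) in auto)

lemma fgeq_append: assumes "fgeq u u'" "fgeq v v'" shows "fgeq (u @ v) (u' @ v')"
proof -
 have "fgeq (u @ v) (u' @ v)" using fgeq_map[of "\<lambda>w. w @ v", OF _ assms(1)] red1_append[of _ _ "[]" v] by simp
 moreover have "fgeq (u' @ v) (u' @ v')" using fgeq_map[of "\<lambda>w. u' @ w", OF _ assms(2)] red1_append[of _ _ u' "[]"] by simp
 ultimately show ?thesis by (rule equivclp_trans)
qed

lemma fgeq_winv: "fgeq (winv w @ w) []"
proof (induction w)
 case Nil show ?case by (simp add: winv_def equivclp_refl)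
next
 case (Cons x w)
 have "red1 (winv (x # w) @ x # w) (winv w @ w)"
  unfolding red1_def winv_Cons by (rule exI[of _ "winv w"], rule exI[of _ "fst x"], rule exI[of _ "\<not> snd x"], rule exI[of _ w]) simp
 thus ?case using Cons.IH r_into_equivclp[of red1] equivclp_trans[of red1] by blast
qed

quotient_type fg = "(nat \<times> bool) list" / fgeq
 by (rule equivpI) (auto intro!: reflpI sympI transpI intro: equivclp_sym equivclp_trans)

instantiation fg :: grp
begin

lift_definition one_fg :: fg is "[]" .
lift_definition times_fg :: "fg => fg => fg" is "(@)" by (rule fgeq_append)
lift_definition inverse_fg :: "fg => fg" is winv by (rule fgeq_map[OF red1_winv])
instance
proof
 fix x y z :: fg
 show "x * y * z = x * (y * z)" by transfer (simp add: equivclp_refl)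
 show "1 * x = x" by transfer (simp add: equivclp_refl)
 show "x * 1 = x" by transfer (simp add: equivclp_refl)
 show "x^- * x = 1" by transfer (rule fgeq_winv)
qed

end

lift_definition fgen :: "nat => fg" is "\<lambda>n. [(n, True)]" .

lift_definition flift :: "(nat => 'b::grp) => fg => 'b"
 is "\<lambda>f w. prod_list (map (\<lambda>(n, b). if b then f n else (f n)^-) w)"
 by (rule fgeq_invariant) (auto simp: red1_def mult.assoc)

lemma flift_mult: "flift f (x * y) = flift f x * flift f y" by transfer simp
lemma flift_1: "flift f 1 = 1" by transfer simp
lemma flift_gen: "flift f (fgen n) = f n" by transfer simp

lemma flift_inverse: "flift f x^- = (flift f x)^-"
 by (rule inv_unique[symmetric]) (simp add: flift_mult[symmetric] flift_1)

lemma flift_zpow: "flift f (zpow x k) = zpow (flift f x) k"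
proof -
 have "flift f (x ^ n) = flift f x ^ n" for x n by (induction n) (simp_all add: flift_1 flift_mult)
 thus ?thesis by (simp add: zpow_def flift_inverse)
qed

lemma gen_fgen: "gen (range fgen) = UNIV"
proof -
 have "abs_fg w : gen (range fgen)" for w
 proof (induction w)
  case Nil
  have "abs_fg [] = 1" by (simp add: one_fg_def)
  thus ?case by (simp add: gen_one)
 next
  case (Cons x w)
  obtain n b where x: "x = (n, b)" by (cases x)
  have e: "abs_fg (x # w) = abs_fg [x] * abs_fg w" by (simp add: times_fg.abs_eq)
  have T: "abs_fg [(n, True)] = fgen n" by (simp add: fgen_def)
  have "(fgen n)^- = abs_fg [(n, False)]" unfolding T[symmetric] inverse_fg.abs_eq by (simp add: winv_def)
  hence "abs_fg [x] : range fgen \<or> (abs_fg [x])^- : range fgen"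
   unfolding x using T by (cases b) (simp_all, metis inv_inv rangeI)
  thus ?case unfolding e by (rule gen_mult[OF _ Cons.IH])
 qed
 moreover have "\<exists>w. x = abs_fg w" for x by (metis Quotient_abs_rep Quotient_fg)
 ultimately show ?thesis by (metis UNIV_eq_I)
qed

lemma countable_fg: "countable (UNIV :: fg set)"
proof -
 have "(UNIV :: fg set) = abs_fg ` UNIV" by (metis Quotient_abs_rep Quotient_fg surjI)
 thus ?thesis by (metis countable_image countableI_type)
qed

text \<open>The free product of \<open>P\<close> and two copies of the infinite cyclic subgroup generated by \<open>u\<close>, acting on its
 normal forms; a letter carries its factor \<open>0\<close>, \<open>1\<close> or \<open>2\<close>.\<close>

locale fprod =
 fixes P :: "'q::grp set" and u :: 'q
 assumes P_sub: "subgrp P" and u: "u : P" and u_inf: "zpow u i = 1 ==> i = 0"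
  and P_tf: "[|x : P; 0 < m; x ^ m = 1|] ==> x = 1"
begin

text \<open>The two cyclic factors are represented inside \<open>P\<close> so that all letters have
  one type; the index keeps the factors apart.\<close>

definition Pk :: "nat => 'q set" where "Pk k = (if k = 0 then P else range (zpow u))"

lemma Pk_P: "x : Pk k ==> x : P"
 using subgrp_zpow[OF P_sub u] by (auto simp: Pk_def split: if_splits)

lemma Pk_sub: "subgrp (Pk k)"
proof (cases "k = 0")
 case True thus ?thesis using P_sub by (simp add: Pk_def)
next
 case False
 have "subgrp (range (zpow u))" unfolding subgrp_def
 proof (intro conjI ballI)
  show "1 : range (zpow u)" using zpow_0[of u] by (metis rangeI)
  fix x assume "x : range (zpow u)"
  then obtain i where i: "x = zpow u i" by blast
  show "x^- : range (zpow u)" unfolding i zpow_minus[symmetric] by (rule rangeI)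
  fix y assume "y : range (zpow u)"
  then obtain j where j: "y = zpow u j" by blast
  show "x * y : range (zpow u)" unfolding i j zpow_add[symmetric] by (rule rangeI)
 qed
 thus ?thesis using False by (simp add: Pk_def)
qed

lemma Pk1: "1 : Pk k" by (rule subgrpD(1)[OF Pk_sub])
lemma Pkm: "x : Pk k ==> y : Pk k ==> x * y : Pk k" by (rule subgrpD(2)[OF Pk_sub])
lemma Pki: "x : Pk k ==> x^- : Pk k" by (rule subgrpD(3)[OF Pk_sub])

fun rw :: "(nat \<times> 'q) list => bool" where
 "rw [] = True"
| "rw (l # w) = (fst l <= 2 & snd l : Pk (fst l) & snd l ~= 1 & rw w & (w = [] \<or> fst (hd w) ~= fst l))"

definition lact :: "nat => 'q => (nat \<times> 'q) list => (nat \<times> 'q) list" where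
 "lact k x w = (if x = 1 then w else if w = [] then [(k, x)] else
   if fst (hd w) = k then (if x * snd (hd w) = 1 then tl w else (k, x * snd (hd w)) # tl w) else (k, x) # w)"

lemma lact_1: "lact k 1 w = w" by (simp add: lact_def)

lemma rw_lact: assumes "k <= 2" "x : Pk k" "rw w" shows "rw (lact k x w)"
 using assms by (cases w) (auto simp: lact_def intro: Pkm)

lemma lact_lact: assumes "k <= 2" "x : Pk k" "y : Pk k" "rw w" shows "lact k x (lact k y w) = lact k (x * y) w"
proof (cases "x = 1 \<or> y = 1")
 case True thus ?thesis by (auto simp: lact_1)
next
 case False
 hence xy: "x ~= 1" "y ~= 1" by auto
 show ?thesis
 proof (cases "w ~= [] & fst (hd w) = k")
  case nh: False
  thus ?thesis using xy by (cases w) (auto simp: lact_def)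
 next
  case True
  then obtain v w' where w: "w = (k, v) # w'" by (cases w) auto
  have w': "v ~= 1" "w' = [] \<or> fst (hd w') ~= k" using assms(4) w by auto
  show ?thesis
  proof (cases "y * v = 1")
   case True
   hence "x * y * v = x" by (simp add: mult.assoc)
   moreover have "x * y ~= 1 \<or> v = x" using \<open>x * y * v = x\<close> by auto
   ultimately show ?thesis using True xy w w' by (cases w') (auto simp: lact_def)
  next
   case yv: False
   thus ?thesis using xy w w' by (auto simp: lact_def mult.assoc) (metis mult.assoc mult_1_left)+
  qed
 qed
qed

text \<open>The van der Waerden construction of a free product; being the identity off the normal
  forms makes each letter act as a permutation of all words.\<close>

definition pact :: "nat => 'q => (nat \<times> 'q) list => (nat \<times> 'q) list" where
 "pact k x w = (if rw w then lact k x w else w)"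

lemma pact_pact: "[|k <= 2; x : Pk k; y : Pk k|] ==> pact k x (pact k y w) = pact k (x * y) w"
 using rw_lact lact_lact by (simp add: pact_def)

lemma pact_1: "pact k 1 w = w" by (simp add: pact_def lact_1)

lemma pact_bij: assumes "k <= 2" "x : Pk k" shows "bij (pact k x)"
 by (rule o_bij[of "pact k x^-"]) (use pact_pact[OF assms(1)] Pki assms in \<open>auto simp: fun_eq_iff pact_1\<close>)

definition La :: "nat => 'q => (nat \<times> 'q) list bperm" where "La k x = Bperm (pact k x)"

lemma papp_La: "[|k <= 2; x : Pk k|] ==> papp (La k x) w = pact k x w"
 unfolding La_def by (subst Bperm_inverse) (auto intro: pact_bij)

lemma La_mult: assumes "k <= 2" "x : Pk k" "y : Pk k" shows "La k x * La k y = La k (x * y)"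
 by (rule bperm_eqI) (simp add: papp_La assms Pkm pact_pact)

lemma La_1: "k <= 2 ==> La k 1 = 1"
 by (rule bperm_eqI) (simp add: papp_La Pk1 pact_1)

lemma La_inv: assumes "k <= 2" "x : Pk k" shows "(La k x)^- = La k x^-"
 by (rule inv_unique) (simp add: La_mult assms Pki La_1)

lemma La_zpow: assumes "k <= 2" "x : Pk k" shows "zpow (La k x) i = La k (zpow x i)"
proof -
 have "La k y ^ n = La k (y ^ n) & y ^ n : Pk k" if "y : Pk k" for y n
  using that by (induction n) (simp_all add: La_1 assms La_mult Pk1 Pkm)
 thus ?thesis using La_inv[OF assms] Pki[OF assms(2)] assms by (simp add: zpow_def)
qed

definition ev :: "(nat \<times> 'q) list => (nat \<times> 'q) list bperm" where "ev w = prod_list (map (\<lambda>l. La (fst l) (snd l)) w)"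

lemma ev_simps: "ev [] = 1" "ev (l # w) = La (fst l) (snd l) * ev w" "ev (v @ w) = ev v * ev w"
 by (simp_all add: ev_def)

lemma nf_ev: "rw w ==> papp (ev w) [] = w"
proof (induction w)
 case (Cons l w)
 hence "papp (ev (l # w)) [] = pact (fst l) (snd l) w" by (simp add: ev_simps papp_La)
 thus ?case using Cons.prems by (cases w) (auto simp: pact_def lact_def)
qed (simp add: ev_simps)

lemma La_ev: assumes "k <= 2" "x : Pk k" "rw w" shows "La k x * ev w = ev (lact k x w)"
proof (cases "x = 1")
 case True thus ?thesis using assms by (simp add: La_1 lact_1)
next
 case False
 show ?thesis
 proof (cases "w ~= [] & fst (hd w) = k")
  case nh: False
  thus ?thesis using False by (cases w) (auto simp: lact_def ev_simps)
 next
  case True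
  then obtain v w' where w: "w = (k, v) # w'" by (cases w) auto
  have v: "v : Pk k" using assms(3) w by simp
  have "La k x * ev w = La k (x * v) * ev w'" using La_mult[OF assms(1,2) v] w by (simp add: ev_simps mult.assoc[symmetric])
  thus ?thesis using False w assms(1) by (simp add: lact_def ev_simps La_1)
 qed
qed

definition FG :: "(nat \<times> 'q) list bperm set" where "FG = {ev w |w. rw w}"

definition nf :: "(nat \<times> 'q) list bperm => (nat \<times> 'q) list" where "nf g = papp g []"

lemma nf: "rw w ==> nf (ev w) = w" by (simp add: nf_def nf_ev)

lemma FG_nf: "g : FG ==> rw (nf g) & ev (nf g) = g" by (auto simp: FG_def nf)
lemma FG_I: "rw w ==> ev w : FG" by (auto simp: FG_def)

lemma nf_eq: "[|g : FG; h : FG; nf g = nf h|] ==> g = h" using FG_nf by metis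

lemma nf_I: "rw w ==> g = ev w ==> nf g = w" by (simp add: nf)

lemma FG_La: assumes "k <= 2" "x : Pk k" "g : FG" shows "La k x * g : FG" "nf (La k x * g) = lact k x (nf g)"
proof -
 have r: "rw (nf g)" "ev (nf g) = g" using FG_nf assms(3) by auto
 have "La k x * g = ev (lact k x (nf g))" using La_ev[OF assms(1,2) r(1)] r(2) by simp
 thus "La k x * g : FG" "nf (La k x * g) = lact k x (nf g)" using rw_lact[OF assms(1,2) r(1)] FG_I nf by auto
qed

lemma FG_1: "1 : FG" using FG_I[of "[]"] by (simp add: ev_simps)

lemma FG_La1: "k <= 2 ==> x : Pk k ==> La k x : FG" using FG_La(1)[OF _ _ FG_1] by simp

lemma ev_FG: "(\<And>l. l : set v ==> fst l <= 2 & snd l : Pk (fst l)) ==> g : FG ==> ev v * g : FG"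
 by (induction v) (auto simp: ev_simps mult.assoc intro: FG_La)

lemma rw_set: "rw w ==> l : set w ==> fst l <= 2 & snd l : Pk (fst l) & snd l ~= 1"
 by (induction w) auto

definition vinv :: "(nat \<times> 'q) list => (nat \<times> 'q) list" where "vinv w = rev (map (\<lambda>l. (fst l, (snd l)^-)) w)"

lemma rw_append: "rw (v @ w) \<longleftrightarrow> rw v & rw w & (v = [] \<or> w = [] \<or> fst (last v) ~= fst (hd w))"
proof (induction v)
 case (Cons l v)
 thus ?case by (cases v) auto
qed simp

lemma vinv_Cons: "vinv (l # w) = vinv w @ [(fst l, (snd l)^-)]" by (simp add: vinv_def)

lemma vinv_last: "w ~= [] ==> vinv w ~= [] & fst (last (vinv w)) = fst (hd w) & fst (hd (vinv w)) = fst (last w)"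
 by (simp add: vinv_def last_rev hd_rev hd_map last_map)

lemma rw_vinv: "rw w ==> rw (vinv w)"
proof (induction w)
 case (Cons l w)
 thus ?case using vinv_last[of w] by (cases "w = []") (auto simp: vinv_Cons rw_append Pki, simp_all add: vinv_def)
qed (simp add: vinv_def)

lemma ev_vinv: "rw w ==> ev (vinv w) = (ev w)^-"
 by (induction w) (auto simp: vinv_Cons ev_simps La_inv vinv_def)

lemma FG_sub: "subgrp FG" unfolding subgrp_def
proof (intro conjI ballI)
 show "1 : FG" by (rule FG_1)
 fix x assume x: "x : FG"
 hence r: "rw (nf x)" "ev (nf x) = x" using FG_nf by auto
 show "x^- : FG" using FG_I[OF rw_vinv[OF r(1)]] ev_vinv[OF r(1)] r(2) by simp
 fix y assume y: "y : FG"
 have "ev (nf x) * y : FG" by (rule ev_FG[OF _ y]) (use rw_set[OF r(1)] in blast)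
 thus "x * y : FG" using r(2) by simp
qed

lemma FGm: "x : FG ==> y : FG ==> x * y : FG" by (rule subgrpD(2)[OF FG_sub])
lemma FGi: "x : FG ==> x^- : FG" by (rule subgrpD(3)[OF FG_sub])

lemma nf_inv: "g : FG ==> nf g^- = vinv (nf g)"
 using FG_nf ev_vinv rw_vinv nf by metis

lemma nf_app: "[|g : FG; h : FG; nf g = [] \<or> nf h = [] \<or> fst (last (nf g)) ~= fst (hd (nf h))|] ==> nf (g * h) = nf g @ nf h"
 by (rule nf_I) (use FG_nf in \<open>auto simp: rw_append ev_simps\<close>)

lemma nf_La: "[|k <= 2; x : Pk k; x ~= 1|] ==> nf (La k x) = [(k, x)]"
 by (rule nf_I) (simp_all add: ev_simps)

lemma nf_1: "nf 1 = []" by (rule nf_I) (simp_all add: ev_simps)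

lemma nf_Nil: "g : FG ==> nf g = [] \<longleftrightarrow> g = 1" using nf_eq[OF _ FG_1] nf_1 by auto

lemma La_inj: "[|k <= 2; x : Pk k; y : Pk k; La k x = La k y|] ==> x = y"
 using nf_La[of k x] nf_La[of k y] La_1[of k] nf_1 by (metis list.distinct(1) list.inject prod.inject)

lemma nf_snoc: assumes g: "g : FG" "nf g = v @ [l]" shows "g = ev v * La (fst l) (snd l)" "rw v" "fst l <= 2" "snd l : Pk (fst l)"
  "snd l ~= 1" "v = [] \<or> fst (last v) ~= fst l"
 using FG_nf[OF g(1)] g(2) by (auto simp: ev_simps rw_append)

lemma strip_right: assumes k: "k <= 2" and g: "g : FG"
 obtains g' x where "g' : FG" "x : Pk k" "g = g' * La k x" "nf g' = [] \<or> fst (last (nf g')) ~= k"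
proof (cases "nf g = [] \<or> fst (last (nf g)) ~= k")
 case True
 thus ?thesis using that[OF g Pk1] La_1[OF k] by simp
next
 case False
 then obtain v l where v: "nf g = v @ [l]" "fst l = k" by (cases "nf g" rule: rev_cases) auto
 note s = nf_snoc[OF g v(1)]
 show ?thesis by (rule that[OF FG_I[OF s(2)], of "snd l"]) (use s v nf[OF s(2)] in auto)
qed

lemma strip_left: assumes k: "k <= 2" and g: "g : FG"
 obtains g' x where "g' : FG" "x : Pk k" "g = La k x * g'" "nf g' = [] \<or> fst (hd (nf g')) ~= k"
proof -
 obtain h x where h: "h : FG" "x : Pk k" "g^- = h * La k x" "nf h = [] \<or> fst (last (nf h)) ~= k"
  using strip_right[OF k FGi[OF g]] .
 have "g^-^- = (h * La k x)^-" using h(3) by (rule arg_cong)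
 hence "g = La k x^- * h^-" using La_inv[OF k h(2)] by simp
 moreover have "nf h^- = [] \<or> fst (hd (nf h^-)) ~= k"
  using h(4) nf_inv[OF h(1)] vinv_last[of "nf h"] by (cases "nf h = []") (auto simp: vinv_def)
 ultimately show ?thesis by (rule that[OF FGi[OF h(1)] Pki[OF h(2)]])
qed

text \<open>In a conjugate of least length the first and the last letter lie in different factors,
  as otherwise moving the first to the end would merge them.\<close>

lemma cyc_red: assumes g: "g : FG"
 obtains h where "h : FG" "length (nf (h^- * g * h)) <= 1 \<or>
  fst (hd (nf (h^- * g * h))) ~= fst (last (nf (h^- * g * h)))"
proof -
 define m where "m = (LEAST m. EX h:FG. length (nf (h^- * g * h)) = m)"
 have "\<exists>m. EX h:FG. length (nf (h^- * g * h)) = m" using FG_1 by blast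
 from LeastI_ex[OF this] obtain h where h: "h : FG" "length (nf (h^- * g * h)) = m" unfolding m_def by blast
 have min: "m <= length (nf (h^- * g * h))" if "h : FG" for h unfolding m_def by (rule Least_le) (use that in blast)
 define g' where "g' = h^- * g * h"
 have g': "g' : FG" unfolding g'_def using FGm FGi g h by blast
 have "length (nf g') <= 1 \<or> fst (hd (nf g')) ~= fst (last (nf g'))"
 proof (rule ccontr)
  assume c: "\<not> ?thesis"
  then obtain l v l' where v: "nf g' = l # v @ [l']" by (cases "nf g'"; cases "tl (nf g')" rule: rev_cases) auto
  have k: "fst l' = fst l" using c v by simp
  have r: "rw (l # v @ [l'])" "ev (l # v @ [l']) = g'" using FG_nf[OF g'] v by auto
  have l: "fst l <= 2" "snd l : Pk (fst l)" "snd l' : Pk (fst l)" using r(1) k by (auto simp: rw_append)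
  define h' where "h' = h * La (fst l) (snd l)"
  have h': "h' : FG" unfolding h'_def by (rule FGm[OF h(1) FG_La1[OF l(1,2)]])
  have "h'^- * g * h' = (La (fst l) (snd l))^- * g' * La (fst l) (snd l)" by (simp add: h'_def g'_def mult.assoc)
  also have "... = ev v * (La (fst l') (snd l') * La (fst l) (snd l))" unfolding r(2)[symmetric] by (simp add: ev_simps mult.assoc)
  also have "... = ev v * La (fst l) (snd l' * snd l)" using La_mult[OF l(1,3,2)] k by simp
  finally have e: "h'^- * g * h' = ev v * La (fst l) (snd l' * snd l)" .
  have rv: "rw v" "v = [] \<or> fst (last v) ~= fst l" using r(1) k by (auto simp: rw_append)
  have "length (nf (h'^- * g * h')) <= Suc (length v)"
  proof (cases "snd l' * snd l = 1")
   case True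
   hence "nf (h'^- * g * h') = v" unfolding e using La_1[OF l(1)] nf[OF rv(1)] by simp
   thus ?thesis by simp
  next
   case False
   have "nf (h'^- * g * h') = v @ [(fst l, snd l' * snd l)]"
    by (rule nf_I) (use False rv l Pkm in \<open>auto simp: e ev_simps rw_append\<close>)
   thus ?thesis by simp
  qed
  thus False using min[OF h'] h(2) v unfolding g'_def[symmetric] by simp
 qed
 thus ?thesis using that[OF h(1)] unfolding g'_def by blast
qed

text \<open>Powers of a cyclically reduced element of length at least 2 involve no cancellation, and
  for a single letter \<open>P_tf\<close> applies.\<close>

lemma FG_tf: assumes g: "g : FG" "0 < m" "g ^ m = 1" shows "g = 1"
proof -
 obtain h where h: "h : FG" "length (nf (h^- * g * h)) <= 1 \<or>
  fst (hd (nf (h^- * g * h))) ~= fst (last (nf (h^- * g * h)))" using cyc_red[OF g(1)] .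
 define g' where "g' = h^- * g * h"
 have g': "g' : FG" unfolding g'_def using FGm FGi g h by blast
 have "g' ^ m = h^- * g ^ m * h" using conj_power[of "h^-" g m] by (simp add: g'_def)
 hence p: "g' ^ m = 1" using g(3) by simp
 have "nf g' = []"
 proof (rule ccontr)
  assume ne: "nf g' ~= []"
  show False
  proof (cases "length (nf g') <= 1")
   case True
   then obtain l where l: "nf g' = [l]" using ne by (cases "nf g'") auto
   hence "g' = La (fst l) (snd l)" "fst l <= 2" "snd l : Pk (fst l)" "snd l ~= 1" using FG_nf[OF g'] by (auto simp: ev_simps)
   moreover have "zpow (La (fst l) (snd l)) (int m) = La (fst l) (zpow (snd l) (int m))" by (rule La_zpow) (use calculation in auto)
   ultimately have "La (fst l) (snd l ^ m) = La (fst l) 1" using p La_1 by (simp add: zpow_of_nat)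
   moreover have "snd l ^ m : Pk (fst l)" using subgrp_zpow[OF Pk_sub, of "snd l" "fst l" "int m"] \<open>snd l : Pk (fst l)\<close> by (simp add: zpow_of_nat)
   ultimately have "snd l ^ m = 1" using La_inj \<open>fst l <= 2\<close> Pk1 by blast
   thus False using P_tf[OF Pk_P g(2)] \<open>snd l : Pk (fst l)\<close> \<open>snd l ~= 1\<close> by blast
  next
   case False
   hence k: "fst (hd (nf g')) ~= fst (last (nf g'))" using h(2) unfolding g'_def by blast
   have "g' ^ Suc n : FG & nf (g' ^ Suc n) ~= [] & fst (hd (nf (g' ^ Suc n))) = fst (hd (nf g'))" for n
   proof (induction n)
    case 0 thus ?case using g' ne by simp
   next
    case (Suc n)
    have "nf (g' * g' ^ Suc n) = nf g' @ nf (g' ^ Suc n)" by (rule nf_app) (use Suc g' k in auto)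
    thus ?case using ne FGm[OF g', of "g' ^ Suc n"] Suc by simp
   qed
   from this[of "m - 1"] have "nf (g' ^ m) ~= []" using g(2) by simp
   thus False using p nf_1 by simp
  qed
 qed
 hence "g' = 1" using nf_Nil[OF g'] by simp
 hence "h * g' * h^- = 1" by simp
 thus ?thesis by (simp add: g'_def mult.assoc)
qed

text \<open>With the last letter in factor \<open>k\<close> stripped from \<open>h\<close>, nothing
  cancels on the left side of the equation, and comparing normal forms leaves nothing of
  \<open>h\<close>.\<close>

lemma letters_conj:
 assumes k: "k <= 2" "k' <= 2" and x: "x : Pk k" "x' : Pk k'" "x ~= 1" "x' ~= 1"
  and h: "h : FG" and e: "h * La k x = La k' x' * h"
 shows "k = k' & (EX y:Pk k. x' = y * x * y^-)"
proof -
 obtain h0 y where h0: "h0 : FG" "y : Pk k" "h = h0 * La k y" "nf h0 = [] \<or> fst (last (nf h0)) ~= k" using strip_right[OF k(1) h] .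
 define x1 where "x1 = y * x * y^-"
 have x1: "x1 : Pk k" "x1 ~= 1"
 proof -
  show "x1 : Pk k" unfolding x1_def using Pkm Pki h0 x by blast
  have "x = y^- * x1 * y" by (simp add: x1_def mult.assoc)
  thus "x1 ~= 1" using x(3) by auto
 qed
 have "La k x1 = La k y * La k x * (La k y)^-" unfolding x1_def La_inv[OF k(1) h0(2)] using La_mult[OF k(1)] Pkm Pki h0 x by simp
 hence "h0 * La k x1 = h0 * La k y * La k x * (La k y)^-" by (simp add: mult.assoc)
 also have "... = La k' x' * h0" using e unfolding h0(3) by (simp add: mult.assoc)
 finally have e0: "h0 * La k x1 = La k' x' * h0" .
 have "nf (h0 * La k x1) = nf h0 @ nf (La k x1)" by (rule nf_app[OF h0(1) FG_La1[OF k(1) x1(1)]]) (use h0(4) nf_La[OF k(1) x1] in auto)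
 hence a: "nf h0 @ [(k, x1)] = lact k' x' (nf h0)" using nf_La[OF k(1) x1] FG_La(2)[OF k(2) x(2) h0(1)] e0 by simp
 have "nf h0 = []"
 proof (rule ccontr)
  assume ne: "nf h0 ~= []"
  show False
  proof (cases "fst (hd (nf h0)) = k'")
   case True
   hence "length (lact k' x' (nf h0)) <= length (nf h0)" using x(4) ne by (simp add: lact_def)
   thus False using a[symmetric] by simp
  next
   case False
   hence "nf h0 @ [(k, x1)] = (k', x') # nf h0" using a x(4) ne by (simp add: lact_def)
   hence "hd (nf h0) = (k', x')" using ne by (metis hd_append2 list.sel(1))
   thus False using False by simp
  qed
 qed
 hence "(k, x1) = (k', x')" using a x(4) by (simp add: lact_def)
 thus ?thesis using h0(2) x1_def by auto
qed

end

section \<open>Exponents of leading letters\<close>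

context fprod
begin

definition lg :: "'q => int" where "lg x = (THE i. x = zpow u i)"

lemma zpow_u_inj: "zpow u i = zpow u j ==> i = j"
proof -
 assume "zpow u i = zpow u j"
 hence "zpow u (i - j) = 1" using zpow_add[of u i "- j"] zpow_minus[of u j] by simp
 thus "i = j" using u_inf by fastforce
qed

lemma lg: "lg (zpow u i) = i"
 by (simp add: lg_def the_equality zpow_u_inj)

definition ex :: "nat => (nat \<times> 'q) list bperm => int" where
 "ex k g = (if nf g ~= [] & fst (hd (nf g)) = k then lg (snd (hd (nf g))) else 0)"

definition AA :: "nat => (nat \<times> 'q) list bperm set" where "AA k = La k ` Pk k"

lemma nf_nAA: "[|g : FG; k <= 2; g ~: AA k|] ==> nf g ~= []"
 by (metis nf_Nil La_1 Pk1 AA_def imageI)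

lemma Pk_zpow: "0 < k ==> x : Pk k ==> \<exists>i. x = zpow u i" by (auto simp: Pk_def)
lemma zpow_Pk: "0 < k ==> zpow u i : Pk k" by (auto simp: Pk_def)

lemma ex_left: assumes k: "0 < k" "k <= 2" and g: "g : FG" shows "ex k (La k (zpow u i) * g) = i + ex k g"
proof -
 have e: "nf (La k (zpow u i) * g) = lact k (zpow u i) (nf g)" by (rule FG_La(2)[OF k(2) zpow_Pk[OF k(1)] g])
 show ?thesis
 proof (cases "i = 0")
  case True thus ?thesis using La_1[OF k(2)] by simp
 next
  case False
  hence ne: "zpow u i ~= 1" using u_inf by blast
  have rw: "rw (nf g)" using FG_nf[OF g] by simp
  show ?thesis
  proof (cases "nf g ~= [] & fst (hd (nf g)) = k")
   case nh: False
   hence "lact k (zpow u i) (nf g) = (k, zpow u i) # nf g" by (metis ne lact_def)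
   thus ?thesis by (simp add: nh lg ex_def e)
  next
   case True
   then obtain v w where w: "nf g = (k, v) # w" by (cases "nf g") auto
   obtain j where j: "v = zpow u j" using Pk_zpow[OF k(1)] rw w by auto
   have p: "zpow u i * v = zpow u (i + j)" by (simp add: j zpow_add)
   have x: "ex k g = j" using w j lg by (simp add: ex_def)
   show ?thesis
   proof (cases "zpow u i * v = 1")
    case True
    hence "i + j = 0" using u_inf p by simp
    moreover have "lact k (zpow u i) (nf g) = w" using ne w True by (simp add: lact_def)
    moreover have "w = [] \<or> fst (hd w) ~= k" using rw w by simp
    ultimately show ?thesis using x unfolding ex_def e by auto
   next
    case False
    hence "lact k (zpow u i) (nf g) = (k, zpow u (i + j)) # w" using ne w p by (simp add: lact_def)
    thus ?thesis using x lg unfolding ex_def e by simp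
   qed
  qed
 qed
qed

lemma ex_right: assumes k: "k <= 2" "k' <= 2" and g: "g : FG" "g ~: AA k'" and x: "x : Pk k'"
 shows "ex k (g * La k' x) = ex k g"
proof -
 obtain g' y where g': "g' : FG" "y : Pk k'" "g = g' * La k' y" "nf g' = [] \<or> fst (last (nf g')) ~= k'" using strip_right[OF k(2) g(1)] .
 have ne: "nf g' ~= []"
 proof
  assume "nf g' = []"
  hence "g' = 1" using nf_Nil[OF g'(1)] by simp
  thus False using g' g(2) unfolding AA_def by simp
 qed
 have *: "ex k (g' * La k' z) = ex k g'" if z: "z : Pk k'" for z
 proof (cases "z = 1")
  case True thus ?thesis using La_1[OF k(2)] by simp
 next
  case False
  have "nf (g' * La k' z) = nf g' @ nf (La k' z)" by (rule nf_app[OF g'(1) FG_La1[OF k(2) z]]) (use g'(4) nf_La[OF k(2) z False] in auto)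
  thus ?thesis using ne by (simp add: ex_def)
 qed
 have "g * La k' x = g' * La k' (y * x)" unfolding g'(3) using La_mult[OF k(2) g'(2) x] by (simp add: mult.assoc)
 thus ?thesis using *[OF Pkm[OF g'(2) x]] *[OF g'(2)] g'(3) by simp
qed

lemma ex_right0: assumes k: "0 < k" "k <= 2" and g: "g : FG" and x: "x : P" shows "ex k (g * La 0 x) = ex k g"
proof (cases "g : AA 0")
 case False
 thus ?thesis using ex_right[OF k(2) _ g False] x by (simp add: Pk_def)
next
 case True
 have *: "ex k (La 0 y) = 0" if "y : P" for y
  using nf_La[of 0 y] La_1[of 0] nf_1 that k(1) by (cases "y = 1") (auto simp: ex_def Pk_def)
 from True obtain y where y: "y : P" "g = La 0 y" by (auto simp: AA_def Pk_def)
 hence "g * La 0 x = La 0 (y * x)" using La_mult[of 0 y x] x by (simp add: Pk_def)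
 thus ?thesis using *[OF y(1)] *[OF subgrpD(2)[OF P_sub y(1) x]] y(2) by simp
qed

text \<open>As the leading exponents differ, a nontrivial letter of factor \<open>k\<close> remains
  in the middle of \<open>q^- * p\<close> and everything to its left is as in \<open>q^-\<close>.
  This is the strong axiom with threshold 0.\<close>

lemma ex_strong: assumes k: "0 < k" "k <= 2" and p: "p : FG" "p ~: AA k" and q: "q : FG" "q ~: AA k" and ne: "ex k p ~= ex k q"
 shows "ex k (q^- * p) = ex k q^-"
proof -
 obtain p' x where p': "p' : FG" "x : Pk k" "p = La k x * p'" "nf p' = [] \<or> fst (hd (nf p')) ~= k" using strip_left[OF k(2) p(1)] .
 obtain q' y where q': "q' : FG" "y : Pk k" "q = La k y * q'" "nf q' = [] \<or> fst (hd (nf q')) ~= k" using strip_left[OF k(2) q(1)] .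
 have nq: "q' ~: AA k"
 proof
  assume "q' : AA k"
  then obtain z where "z : Pk k" "q' = La k z" by (auto simp: AA_def)
  hence "q = La k (y * z)" "y * z : Pk k" using q'(2,3) La_mult[OF k(2)] Pkm by auto
  thus False using q(2) by (simp add: AA_def)
 qed
 have "ex k p' = 0" "ex k q' = 0" using p'(4) q'(4) by (auto simp: ex_def)
 hence xy: "x ~= y" using ne p' q' ex_left[OF k] Pk_zpow[OF k(1)] by metis
 define v where "v = y^- * x"
 have v: "v : Pk k" "v ~= 1"
 proof -
  show "v : Pk k" using Pkm Pki q' p' by (simp add: v_def)
  have "y * v = x" by (simp add: v_def)
  thus "v ~= 1" using xy by auto
 qed
 have i: "q^- = q'^- * La k y^-" using q'(3) La_inv[OF k(2) q'(2)] by simp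
 have e: "q^- * p = q'^- * (La k v * p')" unfolding i p'(3) v_def
  using La_mult[OF k(2) Pki[OF q'(2)] p'(2)] by (simp add: mult.assoc[symmetric]) (simp add: mult.assoc)
 note nq' = nf_nAA[OF q'(1) k(2) nq]
 hence l: "nf q'^- ~= []" "fst (last (nf q'^-)) ~= k"
  using vinv_last[of "nf q'"] q'(4) nf_inv[OF q'(1)] by auto
 have h: "La k v * p' : FG" "nf (La k v * p') = (k, v) # nf p'"
  using FG_La[OF k(2) v(1) p'(1)] v(2) p'(4) by (auto simp: lact_def)
 have "nf (q^- * p) = nf q'^- @ nf (La k v * p')" using e nf_app FGi q' h l by simp
 hence "ex k (q^- * p) = ex k q'^-" using l by (simp add: ex_def)
 moreover have "q'^- ~: AA k"
 proof
  assume "q'^- : AA k"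
  then obtain z where "z : Pk k" "q'^- = La k z" by (auto simp: AA_def)
  hence "q' = La k z^-" "z^- : Pk k" using La_inv[OF k(2)] Pki inv_inv[of q'] by auto
  thus False using nq by (simp add: AA_def)
 qed
 hence "ex k q^- = ex k q'^-" unfolding i by (rule ex_right[OF k(2) k(2) FGi[OF q'(1)] _ Pki[OF q'(2)]])
 ultimately show ?thesis by simp
qed

text \<open>Peel the letters of \<open>w\<close> off \<open>g\<close>: at the first one that
  \<open>g\<close> does not share, cancellation stops for good and the remaining inverse letters
  pile up in front.\<close>

lemma prefix_or_head: "[|rw w; w ~= []; g : FG|] ==>
 (\<exists>v. nf g = w @ v) \<or> nf ((ev w)^- * g) ~= [] & fst (hd (nf ((ev w)^- * g))) = fst (last w)"
proof (induction w arbitrary: g)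
 case (Cons l w)
 have l: "fst l <= 2" "snd l : Pk (fst l)" "snd l ~= 1" "rw w" "w = [] \<or> fst (hd w) ~= fst l" using Cons.prems(1) by auto
 define g1 where "g1 = La (fst l) (snd l)^- * g"
 note li = Pki[OF l(2)]
 have g1: "g1 : FG" "nf g1 = lact (fst l) (snd l)^- (nf g)" unfolding g1_def by (rule FG_La[OF l(1) li Cons.prems(3)])+
 have e: "(ev (l # w))^- * g = (ev w)^- * g1" by (simp add: La_inv l ev_simps g1_def mult.assoc)
 have ne: "(snd l)^- ~= 1" using l(3) by simp
 show ?case
 proof (cases "\<exists>v. nf g = l # v")
  case True
  then obtain v where v: "nf g = l # v" by blast
  hence n: "nf g1 = v" using g1(2) ne by (simp add: lact_def)
  show ?thesis
  proof (cases "w = []")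
   case True thus ?thesis using v by simp
  next
   case False
   from Cons.IH[OF l(4) False g1(1)] show ?thesis using e n v by simp
  qed
 next
  case nl: False
  have h: "nf g1 ~= [] & fst (hd (nf g1)) = fst l"
  proof (cases "nf g ~= [] & fst (hd (nf g)) = fst l")
   case False
   thus ?thesis using ne g1 by (auto simp: lact_def)
  next
   case True
   then obtain l' v where v: "nf g = l' # v" "fst l' = fst l" by (cases "nf g") auto
   have "(snd l)^- * snd l' ~= 1"
   proof
    assume "(snd l)^- * snd l' = 1"
    hence "snd l * ((snd l)^- * snd l') = snd l" by simp
    hence "l' = l" by (simp add: v prod_eq_iff)
    thus False using nl v by simp
   qed
   thus ?thesis using v g1 by (simp add: lact_def)
  qed
  show ?thesis
  proof (cases "w = []")
   case True
   thus ?thesis using e h ev_simps by simp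
  next
   case False
   have iv: "nf (ev w)^- = vinv w" using nf_inv FG_I l nf by simp
   have "nf ((ev w)^- * g1) = nf (ev w)^- @ nf g1"
    by (rule nf_app[OF FGi[OF FG_I[OF l(4)]] g1(1)]) (use vinv_last[OF False] l(5) False h iv in simp)
   thus ?thesis unfolding e iv using vinv_last[OF False] False by simp
  qed
 qed
qed simp

end

text \<open>The initial quotient: \<open>h\<close> maps onto the free product, and the generators of the two free
 cyclic factors act on their cosets as on a Bass-Serre tree.\<close>

locale inst = fprod P u for P :: "'q::grp set" and u +
 fixes h :: "'g::grp => (nat \<times> 'q) list bperm" and aa :: "nat => 'g"
 assumes h_mult: "h (x * y) = h x * h y" and h_range: "range h = FG"
  and h_aa: "k = 1 \<or> k = 2 ==> h (aa k) = La k u"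
begin

lemma h_FG: "h x : FG" using h_range by blast

lemma h_1: "h 1 = 1"
proof -
 have "h 1 * h 1 = h 1 * 1" using h_mult[of 1 1] by simp
 thus ?thesis by (simp only: grp_left_cancel)
qed

lemma h_inv: "h x^- = (h x)^-"
 by (rule inv_unique[symmetric]) (simp add: h_mult[symmetric] h_1)

lemma h_power: "h (x ^ n) = h x ^ n" by (induction n) (simp_all add: h_1 h_mult)

lemma h_zpow: "h (zpow x i) = zpow (h x) i" by (simp add: zpow_def h_power h_inv)

definition NI :: "'g set" where "NI = {x. h x = 1}"
definition PI :: "'g set" where "PI = {x. EX y:P. h x = La 0 y}"

lemma NI_normal: "normal_sub NI"
 by (auto simp: normal_sub_def subgrp_def NI_def h_1 h_mult h_inv)

lemma La0: "y : P ==> y' : P ==> La 0 y * La 0 y' = La 0 (y * y')" using La_mult[of 0] by (simp add: Pk_def)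
lemma La0_inv: "y : P ==> (La 0 y)^- = La 0 y^-" using La_inv[of 0] by (simp add: Pk_def)
lemma La0_inj: "y : P ==> y' : P ==> La 0 y = La 0 y' ==> y = y'" using La_inj[of 0] by (simp add: Pk_def)
lemma La0_1: "La 0 1 = 1" using La_1[of 0] by simp

lemma PI_sub: "subgrp PI" unfolding subgrp_def
proof (intro conjI ballI)
 show "1 : PI" using h_1 La0_1 subgrpD P_sub by (auto simp: PI_def)
 fix x assume "x : PI"
 then obtain y where y: "y : P" "h x = La 0 y" by (auto simp: PI_def)
 thus "x^- : PI" by (auto simp: PI_def h_inv La0_inv subgrpD P_sub)
 fix x' assume "x' : PI"
 then obtain y' where y': "y' : P" "h x' = La 0 y'" by (auto simp: PI_def)
 thus "x * x' : PI" unfolding PI_def using y h_mult[of x x'] La0 subgrpD(2)[OF P_sub] by auto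
qed

lemma NI_tf: "[|0 < m; x ^ m : NI|] ==> x : NI"
 using FG_tf[OF h_FG] h_power by (simp add: NI_def)

lemma pwr_AA: assumes k: "k = 1 \<or> k = 2" shows "x : pwr (aa k) NI \<longleftrightarrow> h x : AA k"
proof -
 have k2: "k <= 2" "0 < k" using k by auto
 have z: "h (zpow (aa k) i) = La k (zpow u i)" for i
  using h_zpow h_aa[OF k] La_zpow[OF k2(1), of u] zpow_Pk[OF k2(2), of 1] by simp
 have "(zpow (aa k) i)^- * x : NI \<longleftrightarrow> h x = La k (zpow u i)" for i
 proof -
  have "h ((zpow (aa k) i)^- * x) = (La k (zpow u i))^- * h x" by (simp add: h_mult h_inv z)
  thus ?thesis unfolding NI_def using grp_left_cancel[of "(La k (zpow u i))^-" "h x" "La k (zpow u i)"] by simp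
 qed
 thus ?thesis using k2 by (auto simp: pwr_def AA_def Pk_def)
qed

text \<open>The coset \<open>y\<close> is a copy of the integers; the leading exponent is the place
  where the path to another coset leaves it, and the angle is the distance of two such places.
  Another representative of \<open>y\<close> shifts all places alike.\<close>

definition angI :: "nat => 'g set => 'g set => 'g set => nat" where
 "angI k y x z = (if x = y \<or> z = y then 0 else
   let r = (\<lambda>y. SOME g. y = lm g (pwr (aa k) NI)) in
   nat \<bar>ex k (h ((r y)^- * r x)) - ex k (h ((r y)^- * r z))\<bar>)"

context
 fixes k :: nat
 assumes k: "k = 1 \<or> k = 2"
begin

abbreviation "E \<equiv> pwr (aa k) NI"

lemma k2: "k <= 2" "0 < k" using k by auto

lemma E_s: "subgrp E" by (rule pwr_sub[OF NI_normal])

lemma E_ex: assumes "g^- * g' : E" "g1^- * g1' : E" "g^- * g1 ~: E"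
 shows "\<exists>i. ex k (h (g'^- * g1')) = i + ex k (h (g^- * g1)) & (\<forall>g2 g2'. g2^- * g2' : E --> g^- * g2 ~: E -->
  ex k (h (g'^- * g2')) = i + ex k (h (g^- * g2)))"
proof -
 note subgrpD(3)[OF E_s assms(1)]
 hence "h (g'^- * g) : AA k" using pwr_AA[OF k] by simp
 then obtain i where i: "h (g'^- * g) = La k (zpow u i)" using Pk_zpow[OF k2(2)] by (auto simp: AA_def)
 have "ex k (h (g'^- * g2')) = i + ex k (h (g^- * g2))" if g2: "g2^- * g2' : E" "g^- * g2 ~: E" for g2 g2'
 proof -
  obtain x where x: "x : Pk k" "h (g2^- * g2') = La k x" using g2(1) pwr_AA[OF k] by (auto simp: AA_def)
  have n: "h (g^- * g2) ~: AA k" using g2(2) pwr_AA[OF k] by simp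
  have "g'^- * g2' = g'^- * g * (g^- * g2 * (g2^- * g2'))" by (simp add: mult.assoc)
  hence "h (g'^- * g2') = La k (zpow u i) * (h (g^- * g2) * La k x)" by (simp only: h_mult[of "g'^- * g"] h_mult[of "g^- * g2"] i x(2))
  moreover have "ex k (La k (zpow u i) * (h (g^- * g2) * La k x)) = i + ex k (h (g^- * g2) * La k x)"
   by (rule ex_left[OF k2(2,1)]) (rule FGm[OF h_FG FG_La1[OF k2(1) x(1)]])
  moreover note ex_right[OF k2(1) k2(1) h_FG n x(1)]
  ultimately show ?thesis by simp
 qed
 thus ?thesis using assms(2,3) by blast
qed

lemma angI_lm: "angI k (lm g E) (lm g1 E) (lm g2 E) = (if g^- * g1 : E \<or> g^- * g2 : E then 0
  else nat \<bar>ex k (h (g^- * g1)) - ex k (h (g^- * g2))\<bar>)"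
proof -
 define r where "r = (\<lambda>y. SOME g. y = lm g E)"
 have r: "x^- * r (lm x E) : E" for x
 proof -
  have "lm x E = lm (r (lm x E)) E" unfolding r_def by (rule someI[of "\<lambda>g. lm x E = lm g E" x]) (rule refl)
  thus ?thesis using lm_eq E_s by blast
 qed
 have eq: "lm g1 E = lm g E \<longleftrightarrow> g^- * g1 : E" for g1 by (rule lm_eq[OF E_s])
 show ?thesis
 proof (cases "g^- * g1 : E \<or> g^- * g2 : E")
  case True
  thus ?thesis unfolding angI_def eq by simp
 next
  case False
  obtain i where "ex k (h ((r (lm g E))^- * r (lm g1 E))) = i + ex k (h (g^- * g1))"
   "ex k (h ((r (lm g E))^- * r (lm g2 E))) = i + ex k (h (g^- * g2))"
   using E_ex[OF r[of g] r[of g1]] r[of g2] False by blast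
  thus ?thesis using eq by (simp add: angI_def r_def)
 qed
qed

lemma E_iff: "x : E \<longleftrightarrow> h x : AA k" by (rule pwr_AA[OF k])

text \<open>A coset that sees different places is passed by the normal form between the two points,
  hence comes from one of its finitely many prefixes.\<close>

lemma angI_fin: "finite {y : Yc E - {lm g1 E, lm g2 E}. 0 < angI k y (lm g1 E) (lm g2 E)}"
proof -
 define w0 where "w0 = nf (h (g1^- * g2))"
 define s where "s w = (SOME y. h y = ev w)" for w
 have "y : (\<lambda>n. lm (g1 * s (take n w0)) E) ` {..length w0}"
  if y: "y : Yc E" "y ~= lm g1 E" "y ~= lm g2 E" "0 < angI k y (lm g1 E) (lm g2 E)" for y
 proof -
  obtain g where g: "y = lm g E" using Yc_D[OF y(1)] by blast
  obtain w x where w: "w : FG" "x : Pk k" "h (g1^- * g) = w * La k x" "nf w = [] \<or> fst (last (nf w)) ~= k"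
   using strip_right[OF k2(1) h_FG] .
  have rw: "rw (nf w)" "ev (nf w) = w" using FG_nf[OF w(1)] by auto
  have sw: "h (s (nf w)) = w"
  proof -
   obtain y0 where "h y0 = ev (nf w)" by (metis w h_range rw imageE)
   hence "h (s (nf w)) = ev (nf w)" unfolding s_def by (rule someI)
   thus ?thesis using rw by simp
  qed
  have yw: "y = lm (g1 * s (nf w)) E"
  proof -
   have "(g1 * s (nf w))^- * g = (s (nf w))^- * (g1^- * g)" by (simp add: mult.assoc)
   hence "h ((g1 * s (nf w))^- * g) = La k x" using h_mult w sw h_inv by simp
   hence "h ((g1 * s (nf w))^- * g) : AA k" using w by (simp add: AA_def)
   thus ?thesis unfolding g lm_eq[OF E_s] E_iff .
  qed
  have ne: "nf w ~= []"
  proof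
   assume "nf w = []"
   hence "h (s (nf w)) = 1" using sw nf_Nil[OF w(1)] by simp
   hence "s (nf w) : E" by (metis E_iff AA_def La_1 k2 Pk1 imageI)
   hence "y = lm g1 E" by (simp add: yw lm_eq E_s)
   thus False using y(2) by simp
  qed
  have i1: "(g1 * s (nf w))^- * g1 = (s (nf w))^-" by (simp add: mult.assoc)
  have i2: "(g1 * s (nf w))^- * g2 = (s (nf w))^- * (g1^- * g2)" by (simp add: mult.assoc)
  have d: "ex k w^- ~= ex k (w^- * h (g1^- * g2))"
   using y(4) unfolding yw angI_lm i1 i2 h_mult[of _ "g1^- * g2"] h_inv sw by (auto split: if_splits)
  have "fst (hd (nf w^-)) ~= k" using nf_inv w vinv_last ne by simp
  hence "ex k w^- = 0" by (simp add: ex_def)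
  hence "nf (w^- * h (g1^- * g2)) ~= []" "fst (hd (nf (w^- * h (g1^- * g2)))) = k"
   using d by (auto simp: ex_def split: if_splits)
  then obtain v where "w0 = nf w @ v" by (metis prefix_or_head rw ne h_FG w w0_def)
  hence t: "take (length (nf w)) w0 = nf w" "length (nf w) <= length w0" by simp_all
  show ?thesis by (rule image_eqI[of _ _ "length (nf w)"]) (simp_all add: t yw)
 qed
 hence "{y : Yc E - {lm g1 E, lm g2 E}. 0 < angI k y (lm g1 E) (lm g2 E)} <= (\<lambda>n. lm (g1 * s (take n w0)) E) ` {..length w0}" by blast
 thus ?thesis by (rule finite_subset) simp
qed

lemma nat_abs_tri: "nat \<bar>i - j\<bar> <= nat \<bar>i - l\<bar> + nat \<bar>l - j\<bar>" by linarith

lemma gsys_I: "gsys E (angI k) 0"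
proof
 fix x y w z g assume "y : Yc E" "x : Yc E" "z : Yc E"
 then obtain gy gx gz where yxz: "y = lm gy E" "x = lm gx E" "z = lm gz E" using Yc_D by metis
 show "angI k y x x = 0" unfolding yxz angI_lm by simp
 show "angI k y x z = angI k y z x" by (simp add: yxz angI_lm abs_minus_commute)
 show "angI k (lm g y) (lm g x) (lm g z) = angI k y x z" by (simp add: yxz angI_lm mult.assoc)
 { assume n: "x ~= y" "z ~= y" "x ~= z" "0 < angI k y x z"
  have E: "gy^- * gx ~: E" "gy^- * gz ~: E" using n unfolding yxz lm_eq[OF E_s] by auto
  hence "ex k (h (gy^- * gx)) ~= ex k (h (gy^- * gz))" using n yxz angI_lm by simp
  from ex_strong[OF k2(2,1) h_FG E(1)[unfolded E_iff] h_FG E(2)[unfolded E_iff] this]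
  have "ex k (h (gz^- * gx)) = ex k (h (gz^- * gy))" by (simp add: h_inv h_mult mult.assoc)
  thus "angI k z x y = 0" using yxz angI_lm by simp }
 { assume w: "w : Yc E" and n: "x ~= y" "w ~= y" "z ~= y"
  obtain gw where gw: "w = lm gw E" using Yc_D[OF w] by blast
  show "angI k y x z <= angI k y x w + angI k y w z" using n nat_abs_tri unfolding yxz gw lm_eq[OF E_s] angI_lm by simp }
 show "finite {y : Yc E - {x, z}. 0 < angI k y x z}" unfolding yxz by (rule angI_fin)
next
 show "subgrp E" by (rule E_s)
qed

text \<open>The power \<open>m\<close> of \<open>aa k\<close> shifts leading exponents by
  \<open>m\<close>, and an element of \<open>P\<close> multiplied on the right does not change them,
  so the angles spanned by \<open>P\<close> vanish.\<close>

lemma gsystem_I: "gsystem PI NI NI (aa k)"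
 unfolding gsystem_def
proof (intro exI conjI)
 show "gsys E (angI k) 0" by (rule gsys_I)
 show "\<forall>M::nat. \<exists>m0. \<forall>m. int m0 <= \<bar>m\<bar> --> (ALL x:Yc E. x ~= E --> M < angI k E x (lm (zpow (aa k) m) x))"
 proof (intro allI)
  fix M :: nat
  have "M < angI k E x (lm (zpow (aa k) m) x)" if m: "int (Suc M) <= \<bar>m\<bar>" and x: "x : Yc E" "x ~= E" for m x
  proof -
   obtain g where g: "x = lm g E" using Yc_D[OF x(1)] by blast
   have n: "g ~: E" using x(2) lm_stab[OF E_s] unfolding g by blast
   have r: "zpow (aa k) m : E" by (rule pwr_I[OF normal_subD(1)[OF NI_normal]])
   have n2: "zpow (aa k) m * g ~: E"
   proof
    assume "zpow (aa k) m * g : E"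
    from subgrpD(2)[OF E_s subgrpD(3)[OF E_s r] this] show False using n by simp
   qed
   have "h (zpow (aa k) m * g) = La k (zpow u m) * h g"
    using h_mult h_zpow h_aa[OF k] La_zpow[OF k2(1), of u] zpow_Pk[OF k2(2), of 1] by simp
   hence "ex k (h (zpow (aa k) m * g)) = m + ex k (h g)" using ex_left k2 h_FG by simp
   hence "angI k (lm 1 E) (lm g E) (lm (zpow (aa k) m * g) E) = nat \<bar>m\<bar>" unfolding angI_lm using n n2 by simp
   thus ?thesis using m unfolding g by simp
  qed
  thus "\<exists>m0. \<forall>m. int m0 <= \<bar>m\<bar> --> (ALL x:Yc E. x ~= E --> M < angI k E x (lm (zpow (aa k) m) x))" by blast
 qed
 show "ALL p:PI - NI. lm p E ~= E & (ALL y:Yc E. y ~= E --> y ~= lm p E --> angI k y E (lm p E) <= 0)"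
 proof (intro ballI conjI impI)
  fix p assume "p : PI - NI"
  then obtain x where x: "x : P" "h p = La 0 x" and np: "h p ~= 1" unfolding PI_def NI_def by auto
  have x1: "x ~= 1" using np x(2) La0_1 by auto
  have "La 0 x ~: AA k"
  proof
   assume "La 0 x : AA k"
   then obtain y where y: "y : Pk k" "La 0 x = La k y" by (auto simp: AA_def)
   have "nf (La 0 x) = [(0, x)]" using nf_La[of 0 x] x x1 by (simp add: Pk_def)
   moreover have "nf (La k y) = [] \<or> nf (La k y) = [(k, y)]" using nf_La[OF k2(1) y(1)] La_1[OF k2(1)] nf_1 by metis
   ultimately show False using y(2) k2 by auto
  qed
  thus pE: "lm p E ~= E" using lm_stab[OF E_s, of p] E_iff[of p] x(2) by simp
  fix y assume y: "y : Yc E"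
  then obtain g where g: "y = lm g E" using Yc_D by blast
  have "ex k (h (g^- * p)) = ex k (h g^-)" unfolding h_mult x(2) by (rule ex_right0[OF k2(2,1) h_FG x(1)])
  hence "angI k (lm g E) (lm 1 E) (lm p E) = 0" unfolding angI_lm by simp
  thus "angI k y E (lm p E) <= 0" unfolding g by simp
 qed
qed

end

definition cI :: "('q => nat) => 'g => nat" where "cI c x = c (SOME y. y : P & h x = La 0 y)"

lemma cI: assumes "y : P" "h x = La 0 y" shows "cI c x = c y"
proof -
 have "(SOME y. y : P & h x = La 0 y) = y" using assms La0_inj by auto
 thus ?thesis by (simp add: cI_def)
qed

lemma init:
 assumes c: "\<And>x y. [|x : P; y : P|] ==> c (y * x * y^-) = c x" "\<And>x j. [|x : P; j ~= 0|] ==> c (zpow x j) = c x"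
  and S: "subgrp S" "aa 1 : S" "aa 2 : S"
 shows "amb PI NI S (cI c)" "amb.state PI NI S (cI c) NI"
proof -
 have PID: "EX y:P. h x = La 0 y" if "x : PI" for x using that by (simp add: PI_def)
 show a: "amb PI NI S (cI c)"
 proof (unfold_locales)
  show "subgrp PI" by (rule PI_sub)
  show "subgrp S" by (rule S(1))
 next
  fix x y n and j :: int assume x: "x : PI"
  then obtain x' where x': "x' : P" "h x = La 0 x'" using PID by blast
  note cx = cI[OF x', of c]
  { assume "y : PI"
   then obtain y' where y': "y' : P" "h y = La 0 y'" using PID by blast
   have m: "y' * x' : P" "y' * x' * y'^- : P" using subgrpD[OF P_sub] x'(1) y'(1) by auto
   have "h (y * x * y^-) = La 0 (y' * x' * y'^-)"
    by (simp add: h_mult h_inv x' y' La0_inv La0 subgrpD P_sub)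
   thus "cI c (y * x * y^-) = cI c x" using cI m c x' y' by simp }
  { assume "n : NI"
   hence "h (x * n) = La 0 x'" using x'(2) by (simp add: NI_def h_mult)
   thus "cI c (x * n) = cI c x" using cI x' by simp }
  { assume j: "j ~= 0"
   have "h (zpow x j) = La 0 (zpow x' j)" using h_zpow x' La_zpow by (simp add: Pk_def)
   thus "cI c (zpow x j) = cI c x" using cI[OF subgrp_zpow[OF P_sub x'(1)]] c(2)[OF x'(1) j] cx by simp }
 qed
 show "amb.state PI NI S (cI c) NI"
  unfolding amb.state_def[OF a]
 proof (intro conjI allI ballI impI, goal_cases)
  case 5
  show ?case
  proof (rule bexI[OF bexI[OF _ S(3)] S(2)], intro conjI allI impI)
   show "gsystem PI NI NI (aa 1)" "gsystem PI NI NI (aa 2)" by (rule gsystem_I, simp)+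
  next
   fix g and i j :: int assume ij: "i ~= 0 \<or> j ~= 0"
   have z: "h (zpow (aa k) i) = La k (zpow u i)" if "k = 1 \<or> k = 2" for k i
    using h_zpow h_aa[OF that] La_zpow[of k u i] that zpow_Pk[of k 1] by auto
   show "g * zpow (aa 1) i * g^- * (zpow (aa 2) j)^- ~: NI"
   proof
    assume "g * zpow (aa 1) i * g^- * (zpow (aa 2) j)^- : NI"
    hence n: "h g * La 1 (zpow u i) * (h g)^- * (La 2 (zpow u j))^- = 1" unfolding NI_def by (simp add: h_mult h_inv z)
    hence "h g * La 1 (zpow u i) * (h g)^- * (La 2 (zpow u j))^- * La 2 (zpow u j) * h g = La 2 (zpow u j) * h g" by simp
    hence e: "h g * La 1 (zpow u i) = La 2 (zpow u j) * h g" by (simp add: mult.assoc)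
    show False
    proof (cases "i = 0 \<or> j = 0")
     case False
     hence "zpow u i ~= 1" "zpow u j ~= 1" using u_inf by blast+
     thus False using letters_conj[of 1 2 "zpow u i" "zpow u j" "h g"] zpow_Pk h_FG e by auto
    next
     case True
     have p: "zpow u i : Pk 1" "zpow u j : Pk 2" by (simp_all add: zpow_Pk)
     have "La 1 (zpow u i) = 1 \<longleftrightarrow> La 2 (zpow u j) = 1"
     proof
      assume "La 1 (zpow u i) = 1"
      hence "1 * h g = La 2 (zpow u j) * h g" using e by simp
      thus "La 2 (zpow u j) = 1" by (simp only: grp_right_cancel)
     next
      assume "La 2 (zpow u j) = 1"
      hence "h g * La 1 (zpow u i) = h g * 1" using e by simp
      thus "La 1 (zpow u i) = 1" by (simp only: grp_left_cancel)
     qed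
     hence "La 1 (zpow u i) = 1" "La 2 (zpow u j) = 1" using True La_1[of 1] La_1[of 2] by auto
     hence "zpow u i = 1" "zpow u j = 1" using La_inj[OF _ p(1) Pk1] La_inj[OF _ p(2) Pk1] La_1[of 1] La_1[of 2] by auto
     thus False using u_inf ij by blast
    qed
   qed
  qed
 next
  case 1 show ?case by (rule NI_normal)
 next
  case 2 show ?case using La0_1 subgrpD(1)[OF P_sub] by (auto simp: PI_def NI_def)
 next
  case 3 thus ?case by (rule NI_tf)
 next
  case (4 x x' g)
  hence x: "x : PI" "x' : PI" and n: "g * x * g^- * x'^- : NI" .
  obtain y y' where y: "y : P" "h x = La 0 y" "y' : P" "h x' = La 0 y'" using PID[OF x(1)] PID[OF x(2)] by blast
  have "h g * La 0 y * (h g)^- * (La 0 y')^- = 1" using n y unfolding NI_def by (simp add: h_mult h_inv)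
  hence "h g * La 0 y * (h g)^- * (La 0 y')^- * La 0 y' * h g = La 0 y' * h g" by simp
  hence e: "h g * La 0 y = La 0 y' * h g" by (simp add: mult.assoc)
  have "c y = c y'"
  proof (cases "y = 1 \<or> y' = 1")
   case True
   have "La 0 y = 1 \<longleftrightarrow> La 0 y' = 1"
   proof
    assume "La 0 y = 1"
    hence "1 * h g = La 0 y' * h g" using e by simp
    thus "La 0 y' = 1" by (simp only: grp_right_cancel)
   next
    assume "La 0 y' = 1"
    hence "h g * La 0 y = h g * 1" using e by simp
    thus "La 0 y = 1" by (simp only: grp_left_cancel)
   qed
   hence "y = 1 & y' = 1" using True La0_1 La0_inj[OF y(1)] La0_inj[OF y(3)] subgrpD(1)[OF P_sub] by auto
   thus ?thesis by simp
  next
   case False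
   then obtain z where "z : P" "y' = z * y * z^-"
    using letters_conj[of 0 0 y y' "h g"] y h_FG e by (auto simp: Pk_def)
   thus ?thesis using c(1)[OF y(1)] by simp
  qed
  thus ?case using cI y by simp
 qed
qed

end

section \<open>The limit group\<close>

context amb
begin

text \<open>Conjugators are restricted to \<open>S\<close> with a view to two-generation.\<close>

definition eqc :: "'g set => 'g => 'g => bool" where
 "eqc N g p \<longleftrightarrow> (EX Y:S. Y * g * Y^- * p^- : N)"

lemma eqc_mono: "eqc N g p ==> N <= N' ==> eqc N' g p" by (auto simp: eqc_def)

lemma stateD: assumes "state N"
 shows "normal_sub N" "P \<inter> N = N0" "[|0 < m; x ^ m : N|] ==> x : N"
  "[|x : P; x' : P; h * x * h^- * x'^- : N|] ==> c x = c x'"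
 using assms unfolding state_def by blast+

text \<open>A target in \<open>P\<close> for \<open>g\<close>: if some power of \<open>g\<close> is already conjugate into \<open>P\<close> then the
 colour of that element is determined by \<open>g\<close>, and otherwise there is no constraint.\<close>

lemma target:
 assumes st: "state N" and g: "g ~: N" and q: "q : P" "q ~: N0"
 obtains p where "p : P" "p ~: N0" "\<And>h j x. [|j ~= 0; x : P; h * zpow g j * h^- * x^- : N|] ==> c x = c p"
proof (cases "\<exists>h j x. j ~= 0 & x : P & h * zpow g j * h^- * x^- : N")
 case False
 thus ?thesis using that[OF q] by blast
next
 case True
 note N = stateD[OF st]
 note sN = normal_subD(1)[OF N(1)]
 have pow: "h * zpow g (j * i) * h^- * (zpow x i)^- : N" if "h * zpow g j * h^- * x^- : N" for h j x i
 proof -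
  have "zpow (h * zpow g j * h^-) i * (zpow x i)^- : N" by (rule normal_zpow_quot[OF N(1) that])
  thus ?thesis by (simp add: zpow_conj zpow_mult)
 qed
 from True obtain h0 j0 x0 where 0: "j0 ~= 0" "x0 : P" "h0 * zpow g j0 * h0^- * x0^- : N" by blast
 have "x0 ~: N0"
 proof
  assume "x0 : N0"
  hence "x0 : N" using N(2) by blast
  from subgrpD(2)[OF sN 0(3) this] have "h0 * zpow g j0 * h0^- : N" by (simp add: mult.assoc)
  from normal_subD(2)[OF N(1) this, of "h0^-"] have z: "zpow g j0 : N" by (simp add: mult.assoc)
  have "g ^ nat \<bar>j0\<bar> : N"
  proof (cases "0 <= j0")
   case True thus ?thesis using z by (simp add: zpow_def)
  next
   case False
   hence "(g ^ nat \<bar>j0\<bar>)^- : N" using z by (simp add: zpow_def inv_power)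
   thus ?thesis using subgrp_inv_iff[OF sN] by blast
  qed
  thus False using N(3)[of "nat \<bar>j0\<bar>" g] 0(1) g by simp
 qed
 moreover have "c x = c x0" if j: "j ~= 0" and x: "x : P" and e: "h * zpow g j * h^- * x^- : N" for h j x
 proof -
  have a: "h * zpow g (j * j0) * h^- * (zpow x j0)^- : N" by (rule pow[OF e])
  have b: "h0 * zpow g (j0 * j) * h0^- * (zpow x0 j)^- : N" by (rule pow[OF 0(3)])
  define k where "k = h0 * h^-"
  have "(k * (h * zpow g (j * j0) * h^- * (zpow x j0)^-) * k^-)^- : N"
   by (metis subgrpD normal_subD N a)
  from subgrpD(2)[OF sN this b] have "k * zpow x j0 * k^- * (zpow x0 j)^- : N"
   by (simp add: k_def mult.assoc mult.commute)
  note N(4)[OF subgrp_zpow[OF P_sub x] subgrp_zpow[OF P_sub 0(2)], OF this]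
  thus ?thesis using c_pow[OF x 0(1)] c_pow[OF 0(2) j] by simp
 qed
 ultimately show ?thesis using that[OF 0(2)] by blast
qed

lemma conj_any: assumes st: "state N" and q: "q : P" "q ~: N0"
 shows "\<exists>N'. state N' & N <= N' & (g : N \<or> (EX p:P - N0. eqc N' g p))"
proof (cases "g : N")
 case False
 obtain p where p: "p : P" "p ~: N0" "\<And>h j x. [|j ~= 0; x : P; h * zpow g j * h^- * x^- : N|] ==> c x = c p"
  using target[OF st False q] by blast
 have "\<exists>N'. state N' & N <= N' & eqc N' g p" unfolding eqc_def by (rule step[OF st False p(1,2)]) (rule p(3))
 thus ?thesis using p(1,2) by blast
qed (use st in blast)

lemma conj_colour: assumes st: "state N" and p: "p : P" "p ~: N0" "p' : P" "p' ~: N0" "c p = c p'"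
 shows "\<exists>N'. state N' & N <= N' & eqc N' p p'"
 unfolding eqc_def
proof (rule step[OF st _ p(3,4)])
 show "p ~: N" using stateD(2)[OF st] p by blast
 fix h x and j :: int assume x: "j ~= 0" "x : P" "h * zpow p j * h^- * x^- : N"
 have "c (zpow p j) = c x" by (rule stateD(4)[OF st subgrp_zpow[OF P_sub p(1)] x(2,3)])
 thus "c x = c p'" using c_pow[OF p(1) x(1)] p(5) by simp
qed

lemma task: assumes st: "state N" and q: "q : P" "q ~: N0"
 shows "\<exists>N'. state N' & N <= N' & (g : N' \<or> (EX p:P - N0. eqc N' g p)) &
  (g : P - N0 --> p' : P - N0 --> c g = c p' --> eqc N' g p')"
proof -
 obtain N1 where N1: "state N1" "N <= N1" "g : N \<or> (EX p:P - N0. eqc N1 g p)" using conj_any[OF st q] by blast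
 show ?thesis
 proof (cases "g : P - N0 & p' : P - N0 & c g = c p'")
  case False
  thus ?thesis using N1 by blast
 next
  case True
  then obtain N2 where "state N2" "N1 <= N2" "eqc N2 g p'" using conj_colour N1 by blast
  thus ?thesis using True N1(2) by blast
 qed
qed

text \<open>All pairs of elements are enumerated and each pair is treated once; what is achieved
  persists because \<open>eqc\<close> is monotone, and the invariants pass to the union of a chain
  because each involves only finitely many members of the kernel.\<close>

theorem limit:
 assumes st: "state N" and q: "q : P" "q ~: N0" and cnt: "countable (UNIV :: 'g set)" and a: "a ~: N"
 obtains N' where "normal_sub N'" "P \<inter> N' = N0" "\<And>x m. [|0 < m; x ^ m : N'|] ==> x : N'" "a ~: N'"
  "\<And>x x' h. [|x : P; x' : P; h * x * h^- * x'^- : N'|] ==> c x = c x'"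
  "\<And>g. g ~: N' ==> EX p:P - N0. eqc N' g p"
  "\<And>p p'. [|p : P - N0; p' : P - N0; c p = c p'|] ==> eqc N' p p'"
proof -
 \<comment> \<open>Conjugating \<open>a\<close> to an element of \<open>P - N0\<close> at the outset
   keeps it nontrivial in the limit, since every later kernel meets \<open>P\<close> in
   \<open>N0\<close>.\<close>
 obtain N1 p1 where N1: "state N1" "N <= N1" "p1 : P - N0" "eqc N1 a p1" using conj_any st q a by blast
 define tk where "tk = from_nat_into (UNIV :: ('g \<times> 'g) set)"
 have "countable (UNIV \<times> UNIV :: ('g \<times> 'g) set)" using cnt by blast
 hence "range tk = (UNIV :: ('g \<times> 'g) set)" by (simp add: tk_def)
 hence tk: "\<exists>n. tk n = t" for t by (metis UNIV_I imageE)
 define R where "R n y \<longleftrightarrow> (fst (tk n) : y \<or> (EX p:P - N0. eqc y (fst (tk n)) p)) &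
  (fst (tk n) : P - N0 --> snd (tk n) : P - N0 --> c (fst (tk n)) = c (snd (tk n)) --> eqc y (fst (tk n)) (snd (tk n)))" for n y
 have "\<exists>f. \<forall>n. (state (f n) & N1 <= f n) & (f n <= f (Suc n) & R n (f (Suc n)))"
 proof (rule dependent_nat_choice)
  show "\<exists>x. state x & N1 <= x" using N1 by blast
  fix x n assume x: "state x & N1 <= x"
  from task[OF conjunct1[OF x] q, of "fst (tk n)" "snd (tk n)"] obtain y where "state y" "x <= y" "R n y"
   by (metis R_def)
  thus "\<exists>y. (state y & N1 <= y) & x <= y & R n y" using x by (intro exI[of _ y]) auto
 qed
 then obtain f where "\<forall>n. (state (f n) & N1 <= f n) & (f n <= f (Suc n) & R n (f (Suc n)))" by (rule exE)
 note f0 = spec[OF this]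
 have f: "\<And>n. state (f n)" "\<And>n. N1 <= f n" "\<And>n. f n <= f (Suc n)" using f0 by simp_all
 have R: "R n (f (Suc n))" for n using f0 by simp
 have mono: "f m <= f n" if "m <= n" for m n by (rule lift_Suc_mono_le[of f, OF f(3) that])
 define N' where "N' = (\<Union>n. f n)"
 have fN: "f n <= N'" for n by (auto simp: N'_def)
 have ch: "\<exists>n. x : f n & y : f n" if xy: "x : N'" "y : N'" for x y
 proof -
  obtain m n where "x : f m" "y : f n" using xy by (auto simp: N'_def)
  hence "x : f (max m n)" "y : f (max m n)" using mono[of m "max m n"] mono[of n "max m n"] by auto
  thus ?thesis by blast
 qed
 note nf = stateD(1)[OF f(1)]
 note sf = normal_subD(1)[OF nf]
 have nN: "normal_sub N'"
  unfolding normal_sub_def subgrp_def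
 proof (intro conjI ballI allI)
  show "1 : N'" using subgrpD sf fN by fastforce
  fix x assume x: "x : N'"
  then obtain n where n: "x : f n" by (auto simp: N'_def)
  show "x^- : N'" using subgrpD(3)[OF sf n] fN by blast
  show "g * x * g^- : N'" for g using normal_subD nf n fN by blast
  fix y assume "y : N'"
  then obtain m where "x : f m" "y : f m" using ch[OF x] by blast
  thus "x * y : N'" using subgrpD(2)[OF sf] fN by blast
 qed
 have PN: "P \<inter> N' = N0" using stateD(2)[OF f(1)] by (auto simp: N'_def)
 have aN: "a ~: N'"
 proof
  assume aN: "a : N'"
  have "eqc N' a p1" using eqc_mono[OF N1(4) f(2)[of 0]] eqc_mono fN by blast
  then obtain Y where Y: "Y * a * Y^- * p1^- : N'" by (auto simp: eqc_def)
  have "(Y * a * Y^-)^- * (Y * a * Y^- * p1^-) : N'"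
   by (metis subgrpD normal_subD nN aN Y)
  hence "p1^- : N'" by (simp only: inv_cancel_left)
  hence "p1 : N'" by (simp add: subgrp_inv_iff normal_subD nN)
  thus False using PN N1(3) by blast
 qed
 show ?thesis
 proof (rule that[OF nN PN _ aN])
  show "x : N'" if "0 < m" "x ^ m : N'" for x m using that stateD(3)[OF f(1)] by (auto simp: N'_def)
  show "c x = c x'" if "x : P" "x' : P" "h * x * h^- * x'^- : N'" for x x' h
   using that stateD(4)[OF f(1) that(1,2)] by (auto simp: N'_def)
  show "EX p:P - N0. eqc N' g p" if "g ~: N'" for g
  proof -
   obtain n where n: "tk n = (g, g)" using tk by blast
   hence "g : f (Suc n) \<or> (EX p:P - N0. eqc (f (Suc n)) g p)" by (metis R R_def fst_conv)
   hence "EX p:P - N0. eqc (f (Suc n)) g p" using fN that by blast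
   thus ?thesis using eqc_mono fN by blast
  qed
  show "eqc N' p p'" if "p : P - N0" "p' : P - N0" "c p = c p'" for p p'
  proof -
   obtain n where n: "tk n = (p, p')" using tk by blast
   hence "eqc (f (Suc n)) p p'" using R[of n] that unfolding R_def n fst_conv snd_conv by simp
   thus ?thesis using eqc_mono fN by blast
  qed
 qed
qed

end

section \<open>The quotient group on natural numbers\<close>

locale qmon =
 fixes N :: "'g::grp set"
 assumes N: "normal_sub N" and cnt: "countable (UNIV :: 'g set)"
begin

text \<open>There are countably many cosets, so numbers can code them; this gives \<open>M\<close>
  the type that the theorem asks for.\<close>

definition q :: "'g => nat" where "q x = to_nat_on (Yc N) (lm x N)"

definition M :: "nat monoid" where
 "M = \<lparr>carrier = range q, monoid.mult = (\<lambda>i j. q (inv_into UNIV q i * inv_into UNIV q j)), one = q 1\<rparr>"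

lemma sN: "subgrp N" by (rule normal_subD(1)[OF N])

lemma N_rot: "x * y : N ==> y * x : N"
 using normal_subD(2)[OF N, of "x * y" y] by (simp add: mult.assoc)

lemma q_eq: "q x = q y \<longleftrightarrow> x * y^- : N"
by (metis Yc_def cnt countable_image q_def to_nat_on_inj Yc_I lm_eq sN N_rot)

lemma q_cong: assumes "q x = q x'" "q y = q y'" shows "q (x * y) = q (x' * y')"
proof -
 have a: "x * x'^- : N" "y * y'^- : N" using assms q_eq by auto
 have "x * (y * y'^-) * x^- * (x * x'^-) : N"
  by (simp add: subgrpD normal_subD N a)
 thus ?thesis by (simp add: q_eq mult.assoc)
qed

lemma q_carrier [simp]: "q x : carrier M" by (simp add: M_def)
lemma M_carrier: "carrier M = range q" by (simp add: M_def)
lemma M_one: "\<one>\<^bsub>M\<^esub> = q 1" by (simp add: M_def)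

lemma M_mult: "q x \<otimes>\<^bsub>M\<^esub> q y = q (x * y)"
proof -
 have "q (inv_into UNIV q (q z)) = q z" for z by (rule f_inv_into_f) simp
 from q_cong[OF this this] show ?thesis by (simp add: M_def)
qed

lemma M_group: "group M"
proof (rule groupI)
 fix x assume "x : carrier M"
 then obtain x' where x: "x = q x'" by (auto simp: M_carrier)
 show "\<one>\<^bsub>M\<^esub> \<otimes>\<^bsub>M\<^esub> x = x" by (simp add: x M_one M_mult)
 show "EX y:carrier M. y \<otimes>\<^bsub>M\<^esub> x = \<one>\<^bsub>M\<^esub>" by (rule bexI[of _ "q x'^-"]) (simp_all add: x M_one M_mult)
qed (auto simp: M_carrier M_one M_mult mult.assoc)

lemma M_inv: "inv\<^bsub>M\<^esub> (q x) = q x^-"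
 by (simp add: group.inv_equality M_group M_mult M_one)

lemma M_pow: "q x [^]\<^bsub>M\<^esub> (n::nat) = q (x ^ n)"
proof (induction n)
 case (Suc n)
 thus ?case by (simp add: M_mult power_commutes)
qed (simp add: M_one)

lemma M_zpow: "q x [^]\<^bsub>M\<^esub> (k::int) = q (zpow x k)"
 by (simp add: int_pow_def2 M_pow M_inv zpow_def inv_power)

definition cj :: "'g => 'g => bool" where "cj x y \<longleftrightarrow> (\<exists>g. q (g * x * g^-) = q y)"

lemma M_conj: "conjugate M (q x) (q y) \<longleftrightarrow> cj x y"
by (simp add: conjugate_def M_carrier M_inv M_mult cj_def eq_commute)

lemma cj_sym: "cj x y ==> cj y x"
proof -
 assume "cj x y"
 then obtain g where "q (g * x * g^-) = q y" unfolding cj_def by blast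
 hence "q y = q (g * x * g^-)" by (rule sym)
 from q_cong[OF q_cong[OF refl[of "q g^-"] this] refl[of "q g"]]
 have "q (g^- * y * g^-^-) = q x" by (simp add: mult.assoc)
 thus ?thesis unfolding cj_def by blast
qed

lemma cj_trans: "cj x y ==> cj y z ==> cj x z"
proof -
 assume "cj x y" "cj y z"
 then obtain g h where g: "q (g * x * g^-) = q y" and h: "q (h * y * h^-) = q z" by (auto simp: cj_def)
 have "q (h * (g * x * g^-) * h^-) = q z" using q_cong[OF q_cong[OF refl g] refl] h by simp
 hence "q ((h * g) * x * (h * g)^-) = q z" by (simp add: mult.assoc)
 thus ?thesis unfolding cj_def by blast
qed

lemma M_nCC:
 assumes C: "\<And>x y. cj x y \<longleftrightarrow> C x = C y" "range C = {..<n}"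
 shows "has_nCC M n"
proof -
 have "{y. conjugate M (q x) y} = q ` {y. C y = C x}" for x
 proof -
  have "conjugate M (q x) y ==> y : range q" for y by (auto simp: conjugate_def M_carrier M_inv M_mult)
  moreover have "conjugate M (q x) (q y) \<longleftrightarrow> C y = C x" for y by (metis C M_conj)
  ultimately show ?thesis by blast
 qed
 hence "conjugacy_classes M = (\<lambda>i. q ` {y. C y = i}) ` range C"
  by (simp add: conjugacy_classes_conjugate M_carrier image_image)
 moreover have "inj_on (\<lambda>i. q ` {y. C y = i}) (range C)"
 proof (rule inj_onI)
  fix i j assume i: "i : range C" and e: "q ` {y. C y = i} = q ` {y. C y = j}"
  obtain x where x: "C x = i" using i by blast
  then obtain y where y: "C y = j" "q x = q y" using e by blast
  have "q (1 * x * inverse 1) = q y" using y by simp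
  hence "cj x y" unfolding cj_def by blast
  thus "i = j" using C(1) x y by simp
 qed
 ultimately show ?thesis by (simp add: has_nCC_def C card_image)
qed

end

section \<open>Conjugacy classes, generation and bounded simplicity of the limit\<close>

locale fin = qmon N + amb P N0 S c for N P N0 S :: "'g::grp set" and c +
 fixes a b :: 'g and n :: nat
 assumes S: "S = gen {a, b}" and L: "gen (P \<union> {a, b}) = UNIV" and P_N: "P \<inter> N = N0"
  and N_tf: "[|0 < m; x ^ m : N|] ==> x : N" and a: "a ~: N"
  and c_N: "[|x : P; x' : P; h * x * h^- * x'^- : N|] ==> c x = c x'"
  and any: "g ~: N ==> EX p:P - N0. eqc N g p"
  and colour: "[|p : P - N0; p' : P - N0; c p = c p'|] ==> eqc N p p'"
  and n: "2 <= n" and c_rng: "p : P - N0 ==> c p : {1..n - 1}"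
  and c_sum: "[|i : {1..n - 1}; j : {1..n - 1}|] ==>
   EX y:P - N0. EX y':P - N0. y * y' : P - N0 & c y = j & c y' = j & c (y * y') = i"
begin

lemma eqc_cj: "eqc N x y ==> cj x y" unfolding eqc_def cj_def q_eq by blast

lemma M_tf: "torsion_free M"
 using N_tf by (auto simp: torsion_free_def M_carrier M_pow M_one q_eq)

text \<open>Nontrivial elements are conjugate into \<open>P\<close>, where only the colour counts,
  and the colour of \<open>x\<close> contains a product of two elements with the colour of
  \<open>y\<close>.\<close>

lemma M_bs: "boundedly_simple 2 M"
 unfolding boundedly_simple_def
proof (intro ballI)
 fix x y assume "x : carrier M - {\<one>\<^bsub>M\<^esub>}" "y : carrier M - {\<one>\<^bsub>M\<^esub>}"
 then obtain x' y' where x: "x = q x'" "q x' ~= q 1" and y: "y = q y'" "q y' ~= q 1" by (auto simp: M_carrier M_one)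
 have nN: "x' ~: N" "y' ~: N" using x(2) y(2) by (simp_all add: q_eq)
 obtain p where p: "p : P - N0" "cj x' p" using any[OF nN(1)] eqc_cj by blast
 obtain p' where p': "p' : P - N0" "cj y' p'" using any[OF nN(2)] eqc_cj by blast
 obtain y1 y2 where 12: "y1 : P - N0" "y2 : P - N0" "y1 * y2 : P - N0" "c y1 = c p'" "c y2 = c p'" "c (y1 * y2) = c p"
  using c_sum c_rng p p' by blast
 have "cj y' y1" by (rule cj_trans[OF p'(2) eqc_cj[OF colour[OF p'(1) 12(1) 12(4)[symmetric]]]])
 then obtain g1 where g1: "q (g1 * y' * g1^-) = q y1" by (auto simp: cj_def)
 have "cj y' y2" by (rule cj_trans[OF p'(2) eqc_cj[OF colour[OF p'(1) 12(2) 12(5)[symmetric]]]])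
 then obtain g2 where g2: "q (g2 * y' * g2^-) = q y2" by (auto simp: cj_def)
 have "cj (y1 * y2) x'" by (rule cj_trans[OF eqc_cj[OF colour[OF 12(3) p(1) 12(6)]] cj_sym[OF p(2)]])
 then obtain k where k: "q (k * (y1 * y2) * k^-) = q x'" by (auto simp: cj_def)
 have "q (k * (g1 * y' * g1^- * (g2 * y' * g2^-)) * k^-) = q x'"
  using q_cong[OF q_cong[OF refl q_cong[OF g1 g2]] refl] k by simp
 hence "x = q ((k * g1) * y' * (k * g1)^- * ((k * g2) * y' * (k * g2)^-))" by (simp add: x mult.assoc)
 hence "x = foldr (\<otimes>\<^bsub>M\<^esub>) (map (\<lambda>g. g \<otimes>\<^bsub>M\<^esub> y \<otimes>\<^bsub>M\<^esub> inv\<^bsub>M\<^esub> g) [q (k * g1), q (k * g2)]) \<one>\<^bsub>M\<^esub>"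
  by (simp only: y list.map foldr.simps comp_apply id_apply M_inv M_one M_mult mult_1_right)
 thus "\<exists>gs. length gs <= 2 & set gs <= carrier M & x = foldr (\<otimes>\<^bsub>M\<^esub>) (map (\<lambda>g. g \<otimes>\<^bsub>M\<^esub> y \<otimes>\<^bsub>M\<^esub> inv\<^bsub>M\<^esub> g) gs) \<one>\<^bsub>M\<^esub>"
  by (intro exI[of _ "[q (k * g1), q (k * g2)]"]) simp
qed

definition SN :: "'g set" where "SN = {x. EX s:S. q s = q x}"

lemma SN_mult: "x : SN ==> y : SN ==> x * y : SN"
 unfolding SN_def using q_cong subgrpD(2)[OF S_sub] by blast

lemma q_inverse: "q x = q y ==> q x^- = q y^-" by (metis M_inv)

lemma SN_inv: "x : SN ==> x^- : SN"
 unfolding SN_def using q_inverse subgrpD(3)[OF S_sub] by blast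

lemma SN_S: "s : S ==> s : SN" by (auto simp: SN_def)

lemma SN_eqc: assumes "x : SN" "eqc N x y" shows "y : SN"
proof -
 obtain Y where Y: "Y : S" "q (Y * x * Y^-) = q y" by (metis assms eqc_def q_eq)
 have "Y * x * Y^- : SN" using SN_mult SN_inv SN_S Y(1) assms(1) by simp
 thus ?thesis using Y(2) by (simp add: SN_def)
qed

text \<open>One nontrivial element of \<open>P\<close> in the image of \<open>S\<close> brings in its whole colour class, hence by
 the sums of colours every class.\<close>

lemma P_SN: assumes x: "x : P" shows "x : SN"
proof (cases "x : N0")
 case True
 hence "q 1 = q x" using P_N q_eq subgrp_inv_iff sN by auto
 thus ?thesis using subgrpD S_sub by (auto simp: SN_def)
next
 case False
 hence xP: "x : P - N0" using x by blast
 obtain p where p: "p : P - N0" "p : SN" using S gen_incl any a SN_eqc SN_S by blast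
 obtain y1 y2 where 12: "y1 : P - N0" "y2 : P - N0" "y1 * y2 : P - N0" "c y1 = c p" "c y2 = c p" "c (y1 * y2) = c x"
  using c_sum c_rng xP p by blast
 have "y1 : SN" by (rule SN_eqc[OF p(2) colour[OF p(1) 12(1) 12(4)[symmetric]]])
 moreover have "y2 : SN" by (rule SN_eqc[OF p(2) colour[OF p(1) 12(2) 12(5)[symmetric]]])
 ultimately have "y1 * y2 : SN" by (rule SN_mult)
 thus ?thesis by (rule SN_eqc[OF _ colour[OF 12(3) xP 12(6)]])
qed

lemma M_2gen: "two_generated M"
 unfolding two_generated_def
proof (intro bexI)
 interpret M: group M by (rule M_group)
 have sub: "q s : generate M {q a, q b}" if "s : gen {a, b}" for s
  using that
 proof (induction rule: gen.induct)
  case gen_one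
  show ?case by (metis M_one generate.one)
 next
  case (gen_mult s x)
  have "q s : generate M {q a, q b}"
  proof (cases "s : {a, b}")
   case True thus ?thesis by (auto intro: generate.incl)
  next
   case False
   hence "inv\<^bsub>M\<^esub> (q s^-) : generate M {q a, q b}" using gen_mult by (auto intro: generate.inv)
   thus ?thesis by (simp add: M_inv)
  qed
  from generate.eng[OF this gen_mult.IH] show ?case by (simp add: M_mult)
 qed
 have "subgrp SN" using SN_mult SN_inv SN_S S_sub by (simp add: subgrp_def)
 moreover have "P \<union> {a, b} <= SN" using P_SN SN_S gen_incl S by blast
 ultimately have "x : SN" for x using gen_least L by blast
 hence "EX s:S. q s = q x" for x unfolding SN_def by blast
 hence "EX s:gen {a, b}. q s = q x" for x unfolding S .
 hence "q x : generate M {q a, q b}" for x using sub by metis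
 moreover have "generate M {q a, q b} <= carrier M" by (rule M.generate_incl) simp
 ultimately show "generate M {q a, q b} = carrier M" by (auto simp: M_carrier)
qed simp_all

lemma M_n: "has_nCC M n"
proof (rule M_nCC)
 \<comment> \<open>Colours start at 1, so 0 is free for the class of the identity; together these
   are \<open>n\<close> values.\<close>
 define C where "C x = (if x : N then 0 else c (SOME p. p : P - N0 & cj x p))" for x
 have C: "EX p:P - N0. cj x p & C x = c p" if x: "x ~: N" for x
 proof -
  have "\<exists>p. p : P - N0 & cj x p" using any[OF x] eqc_cj by blast
  from someI_ex[OF this] show ?thesis using x unfolding C_def by auto
 qed
 have cjc: "c p = c p'" if "cj p p'" "p : P - N0" "p' : P - N0" for p p'
  using that c_N unfolding cj_def q_eq by blast
 have N_cj: "y : N" if xy: "cj x y" "x : N" for x y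
 proof -
  obtain g where "q (g * x * g^-) = q y" by (metis xy cj_def)
  moreover have "q (g * x * g^-) = q 1" by (simp add: normal_subD N xy q_eq)
  ultimately show ?thesis using q_eq[of y 1] by simp
 qed
 have C0: "C x = 0 \<longleftrightarrow> x : N" for x
 by (metis C c_rng atLeastAtMost_iff not_one_le_zero C_def)
 have cjN: "cj x y" if "x : N" "y : N" for x y
 proof -
  have "q (1 * x * inverse 1) = q y" using subgrpD(2)[OF sN that(1) subgrpD(3)[OF sN that(2)]] by (simp add: q_eq)
  thus ?thesis unfolding cj_def by blast
 qed
 show "cj x y \<longleftrightarrow> C x = C y" for x y
 proof (cases "x : N \<or> y : N")
  case True
  thus ?thesis using C0 cjN N_cj cj_sym by metis
 next
  case False
  then obtain p p' where p: "p : P - N0" "cj x p" "C x = c p" "p' : P - N0" "cj y p'" "C y = c p'" using C by metis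
  have "cj x y \<longleftrightarrow> cj p p'" using p(2,5) cj_sym cj_trans by blast
  also have "... \<longleftrightarrow> c p = c p'" using cjc p(1,4) colour eqc_cj by blast
  finally show ?thesis using p by simp
 qed
 show "range C = {..<n}"
 proof
  have "C x < n" for x
  using n C c_rng by (fastforce simp: C_def)
  thus "range C <= {..<n}" by blast
  have "\<exists>x. C x = i" if i: "i < n" for i
  proof (cases "i = 0")
   case True
   thus ?thesis using C0 subgrpD sN by blast
  next
   case False
   hence "i : {1..n - 1}" using i by auto
   then obtain x where x: "x : P - N0" "c x = i" using c_sum by blast
   hence "x ~: N" using P_N by blast
   from C[OF this] obtain p where "p : P - N0" "cj x p" "C x = c p" by blast
   hence "C x = i" using cjc x by metis
   thus ?thesis by blast
  qed
  thus "{..<n} <= range C" by (metis lessThan_iff rangeI subsetI)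
 qed
qed

lemma M_indep: assumes x: "x : P" "x' : P" and cm: "commensurable M (q x) (q x')" shows "c x = c x'"
proof -
 obtain k l :: int where kl: "k ~= 0" "l ~= 0" "cj (zpow x k) (zpow x' l)" by (metis cm commensurable_def M_zpow M_conj)
 then obtain h where "h * zpow x k * h^- * (zpow x' l)^- : N" by (auto simp: cj_def q_eq)
 from c_N[OF subgrp_zpow[OF P_sub x(1)] subgrp_zpow[OF P_sub x(2)] this]
 show ?thesis using c_pow[OF x(1) kl(1)] c_pow[OF x(2) kl(2)] by simp
qed

end

section \<open>Commensurability and the colours of slopes\<close>

definition cq :: "'g::grp set => 'g => 'g => bool" where
 "cq A a b \<longleftrightarrow> (\<exists>k l. k ~= 0 & l ~= 0 & (EX h:A. zpow b l = h * zpow a k * h^-))"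

lemma cq_conj: assumes A: "subgrp A" "y : A" shows "cq A (y * a * y^-) b \<longleftrightarrow> cq A a b"
proof -
 have *: "cq A a b" if A: "y : A" and c: "cq A (y * a * y^-) b" for y a
 proof -
  obtain k l h where kl: "k ~= 0" "l ~= 0" "h : A" "zpow b l = h * zpow (y * a * y^-) k * h^-" by (metis c cq_def)
  hence "zpow b l = (h * y) * zpow a k * (h * y)^-" unfolding zpow_conj by (simp add: mult.assoc)
  thus ?thesis by (metis cq_def kl subgrpD assms A)
 qed
 have "y^- * (y * a * y^-) * y^-^- = a" by (simp add: mult.assoc)
 thus ?thesis using *[OF A(2)] *[OF subgrpD(3)[OF A], of "y * a * y^-"] by auto
qed

lemma cq_pow: assumes j: "j ~= 0" shows "cq A (zpow a j) b \<longleftrightarrow> cq A a b"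
proof
 assume "cq A (zpow a j) b"
 then obtain k l h where kl: "k ~= 0" "l ~= 0" "h : A" "zpow b l = h * zpow a (j * k) * h^-" unfolding cq_def zpow_mult by blast
 thus "cq A a b" unfolding cq_def using j by (metis mult_eq_0_iff)
next
 assume "cq A a b"
 then obtain k l h where kl: "k ~= 0" "l ~= 0" "h : A" "zpow b l = h * zpow a k * h^-" unfolding cq_def by blast
 have "zpow b (l * j) = h * zpow (zpow a j) k * h^-"
  by (metis zpow_mult kl zpow_conj mult.commute)
 thus "cq A (zpow a j) b" unfolding cq_def using j kl(1-3) by (metis mult_eq_0_iff)
qed

text \<open>To base \<open>N\<close>, the slope \<open>4 * m + 1\<close> reads the digit
  \<open>m div N\<close> and the slopes \<open>4 * m\<close>, \<open>4 * m + 2\<close> read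
  \<open>m mod N\<close>. The vectors \<open>(1, 4 * m)\<close> and \<open>(1, 4 * m + 2)\<close>
  have a sum of slope \<open>4 * m + 1\<close>, so the colours of summands and sum are
  independent.\<close>

definition slope :: "nat => int => nat" where
 "slope N z = 1 + nat ((if z mod 4 = 1 then z div 4 div int N else z div 4) mod int N)"

text \<open>Only integral slopes matter; all other directions and the zero vector get the default
  colour 1.\<close>

definition dirc :: "nat => int => int => nat" where
 "dirc N i j = (if i ~= 0 & i dvd j then slope N (j div i) else 1)"

lemma dirc_range: "1 <= N ==> dirc N i j : {1..N}"
proof -
 assume N: "1 <= N"
 have "nat (x mod int N) < N" for x using N by (simp add: nat_less_iff)
 hence "1 + nat (x mod int N) : {1..N}" for x by (auto simp: Suc_le_eq)
 thus ?thesis using N unfolding dirc_def slope_def by auto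
qed

lemma dirc_scale: "k ~= 0 ==> dirc N (k * i) (k * j) = dirc N i j"
 by (simp add: dirc_def)

text \<open>The slopes \<open>4 m\<close>, \<open>4 m + 1\<close>, \<open>4 m + 2\<close> with \<open>m = N (i - 1) + (j - 1)\<close>.\<close>

lemma dirc_sum: assumes "i : {1..N}" "j : {1..N}"
 obtains m where "dirc N 1 (4 * m) = j" "dirc N 1 (4 * m + 2) = j" "dirc N 2 (8 * m + 2) = i"
proof -
 define m where "m = int N * int (i - 1) + int (j - 1)"
 have j: "int (j - 1) < int N" "0 <= int (j - 1)" using assms by auto
 have i: "int (i - 1) < int N" "0 <= int (i - 1)" using assms by auto
 have md: "m mod int N = int (j - 1)" "m div int N = int (i - 1)" unfolding m_def using j by simp_all
 have 4: "(4 * m) mod 4 = 0" "(4 * m + 2) mod 4 = 2" "(4 * m + 1) mod 4 = 1" "4 * m div 4 = m" "(4 * m + 2) div 4 = m" "(4 * m + 1) div 4 = m"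
  by presburger+
 have a: "dirc N 1 (4 * m) = j" "dirc N 1 (4 * m + 2) = j"
  using assms(2) by (simp_all add: dirc_def slope_def md 4 del: mult_numeral_left of_nat_diff)
 have "(8 * m + 2) div 2 = 4 * m + 1" "2 dvd 8 * m + 2" by presburger+
 hence "dirc N 2 (8 * m + 2) = slope N (4 * m + 1)" by (simp add: dirc_def)
 also have "... = i" using assms md by (auto simp: slope_def)
 finally show ?thesis by (rule that[OF a])
qed

section \<open>Assembling the embedding\<close>

context fprod
begin

text \<open>Generators 0 and 1 go to the cyclic factors and all others enumerate \<open>P\<close>,
  so the preimage of \<open>P\<close> together with these two generators generates the free
  group.\<close>

lemma fg_cover: assumes cnt: "countable P"
 obtains h :: "fg => (nat \<times> 'q) list bperm" where "\<And>x y. h (x * y) = h x * h y" "range h = FG"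
  "h (fgen 0) = La 1 u" "h (fgen 1) = La 2 u" "\<And>m. EX y:P. h (fgen (m + 2)) = La 0 y"
proof -
 define f where "f = from_nat_into P"
 have f: "range f = P" unfolding f_def by (rule range_from_nat_into) (use u cnt in auto)
 define F where "F m = (if m = 0 then La 1 u else if m = 1 then La 2 u else La 0 (f (m - 2)))" for m :: nat
 define h where "h = flift F"
 have h: "h (x * y) = h x * h y" "h 1 = 1" "h x^- = (h x)^-" "h (zpow x i) = zpow (h x) i" for x y i
  unfolding h_def by (rule flift_mult flift_1 flift_inverse flift_zpow)+
 have hg: "h (fgen m) = F m" for m unfolding h_def by (rule flift_gen)
 have uk: "u : Pk k" for k using u by (auto simp: Pk_def intro: range_eqI[of _ _ 1])
 have "F m : FG" for m
 proof -
  have "f (m - 2) : Pk 0" using f by (auto simp: Pk_def)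
  thus ?thesis using FG_La1 uk by (simp add: F_def)
 qed
 moreover have "subgrp {x. h x : FG}" using FG_1 FGm FGi by (auto simp: subgrp_def h)
 ultimately have "gen (range fgen) <= {x. h x : FG}" by (intro gen_least) (auto simp: hg)
 hence sub: "range h <= FG" unfolding gen_fgen by blast
 have La: "La k x : range h" if k: "k <= 2" and x: "x : Pk k" for k x
 proof (cases "k = 0")
  case True
  then obtain m where "x = f m" using x f by (auto simp: Pk_def)
  hence "h (fgen (m + 2)) = La k x" unfolding hg F_def using True by simp
  thus ?thesis by (metis rangeI)
 next
  case False
  then obtain i where i: "x = zpow u i" using x by (auto simp: Pk_def)
  have "k = 1 \<or> k = 2" using False k by linarith
  hence "h (fgen (k - 1)) = La k u" unfolding hg F_def by auto
  hence "h (zpow (fgen (k - 1)) i) = La k x" unfolding h(4) i using La_zpow[OF k uk] by simp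
  thus ?thesis by (metis rangeI)
 qed
 have "ev w : range h" if "rw w" for w
  using that
 proof (induction w)
  case Nil
  show ?case using ev_simps h by simp
 next
  case (Cons l w)
  then obtain x y where "La (fst l) (snd l) = h x" "ev w = h y" using La by fastforce
  thus ?case unfolding ev_simps by (simp add: h(1)[symmetric])
 qed
 hence "range h = FG" using sub unfolding FG_def by blast
 thus ?thesis using that[of h] h(1) hg[of 0] hg[of 1] hg f unfolding F_def by auto
qed

lemma embed:
 assumes cnt: "countable P" and n: "2 <= n"
  and c: "\<And>x y. [|x : P; y : P|] ==> c (y * x * y^-) = c x" "\<And>x j. [|x : P; j ~= 0|] ==> c (zpow x j) = c x"
   "\<And>x. x : P ==> c x : {1..n - 1}"
   "\<And>i j. [|i : {1..n - 1}; j : {1..n - 1}|] ==> EX y:P. EX y':P. y ~= 1 & y' ~= 1 & y * y' ~= 1 & c y = j & c y' = j & c (y * y') = i"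
 obtains M :: "nat monoid" and f where "group M" "two_generated M" "torsion_free M" "has_nCC M n" "boundedly_simple 2 M"
  "ALL x:P. f x : carrier M" "ALL x:P. ALL y:P. f (x * y) = f x \<otimes>\<^bsub>M\<^esub> f y"
  "inj_on f P" "ALL x:P. ALL y:P. commensurable M (f x) (f y) --> c x = c y"
proof -
 obtain h :: "fg => (nat \<times> 'q) list bperm" where h: "\<And>x y. h (x * y) = h x * h y" "range h = FG"
  "h (fgen 0) = La 1 u" "h (fgen 1) = La 2 u" "\<And>m. EX y:P. h (fgen (m + 2)) = La 0 y" using fg_cover[OF cnt] by metis
 interpret i: inst P u h "\<lambda>k. fgen (k - 1)" by unfold_locales (use h in auto)
 define S where "S = gen {fgen 0, fgen 1}"
 have S: "subgrp S" "fgen (1 - 1) : S" "fgen (2 - 1) : S" unfolding S_def by (auto intro: subgrp_gen gen_incl)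
 note init = i.init[of c, OF c(1,2) S]
 interpret m: amb i.PI i.NI S "i.cI c" by (rule init(1))
 \<comment> \<open>An elementwise lift of \<open>P\<close>; it is multiplicative modulo
   \<open>NI\<close>, which suffices after passing to \<open>M\<close>.\<close>
 define l where "l y = (SOME x. h x = La 0 y)" for y
 have l: "h (l y) = La 0 y" if y: "y : P" for y
 proof -
  have "La 0 y : range h" unfolding h(2) using FG_La1[of 0 y] y by (simp add: Pk_def)
  then obtain x where "h x = La 0 y" by (metis imageE)
  thus ?thesis unfolding l_def by (rule someI)
 qed
 have lPI: "l y : i.PI" if "y : P" for y using l that by (auto simp: i.PI_def)
 have cl: "i.cI c (l y) = c y" if "y : P" for y by (rule i.cI[OF that l[OF that]])
 have lNI: "l y ~: i.NI" if "y : P" "y ~= 1" for y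
  using that l[OF that(1)] i.La0_inj[OF that(1) subgrpD(1)[OF P_sub]] i.La0_1 by (auto simp: i.NI_def)
 have u1: "u ~= 1" using u_inf[of 1] by auto
 have a: "fgen 0 ~: i.NI"
 proof
  assume "fgen 0 : i.NI"
  hence "La 1 u = La 1 1" using h La_1 by (simp add: i.NI_def)
  thus False using La_inj[OF _ zpow_Pk[of 1 1] Pk1] u1 by simp
 qed
 obtain N where N: "normal_sub N" "i.PI \<inter> N = i.NI" "\<And>x m. [|0 < m; x ^ m : N|] ==> x : N" "fgen 0 ~: N"
  "\<And>x x' h. [|x : i.PI; x' : i.PI; h * x * h^- * x'^- : N|] ==> i.cI c x = i.cI c x'"
  "\<And>g. g ~: N ==> EX p:i.PI - i.NI. m.eqc N g p"
  "\<And>p p'. [|p : i.PI - i.NI; p' : i.PI - i.NI; i.cI c p = i.cI c p'|] ==> m.eqc N p p'"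
  using m.limit[OF init(2) lPI[OF u] lNI[OF u u1] countable_fg a] by blast
 interpret fin N i.PI i.NI S "i.cI c" "fgen 0" "fgen 1" n
 proof (unfold_locales, goal_cases)
  case 1 show ?case by (rule N(1))
 next
  case 2 show ?case by (rule countable_fg)
 next
  case 3 show ?case by (rule S_def)
 next
  case 4
  have "fgen m : i.PI \<union> {fgen 0, fgen 1}" for m
  proof (cases "m < 2")
   case True thus ?thesis by (auto simp: less_2_cases_iff)
  next
   case False
   hence "m = (m - 2) + 2" by simp
   thus ?thesis using h(5)[of "m - 2"] unfolding i.PI_def by auto
  qed
  hence "range fgen <= i.PI \<union> {fgen 0, fgen 1}" by blast
  from gen_mono[OF this] show ?case unfolding gen_fgen by blast
 next
  case 5 show ?case by (rule N(2))
 next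
  case 6 thus ?case by (rule N(3))
 next
  case 7 show ?case by (rule N(4))
 next
  case 8 thus ?case by (rule N(5))
 next
  case 9 thus ?case by (rule N(6))
 next
  case 10 thus ?case by (rule N(7))
 next
  case 11 show ?case by (rule n)
 next
  case (12 p)
  then obtain y where "y : P" "h p = La 0 y" by (auto simp: i.PI_def)
  thus ?case using i.cI c(3) by simp
 next
  case (13 i' j)
  from c(4)[OF 13] obtain y y' where y: "y : P" "y' : P" "y ~= 1" "y' ~= 1" "y * y' ~= 1" "c y = j" "c y' = j" "c (y * y') = i'" by blast
  note yy = subgrpD(2)[OF P_sub y(1,2)]
  have e: "h (l y * l y') = La 0 (y * y')" unfolding h(1) l[OF y(1)] l[OF y(2)] by (rule i.La0[OF y(1,2)])
  have "l y * l y' : i.PI" unfolding i.PI_def using e yy by blast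
  moreover have "l y * l y' ~: i.NI" using lNI[OF yy y(5)] e l[OF yy] by (simp add: i.NI_def)
  moreover have "i.cI c (l y * l y') = i'" using i.cI[OF yy e] y by simp
  ultimately show ?case using lPI lNI cl y by (rule_tac bexI[of _ "l y"], rule_tac bexI[of _ "l y'"]) auto
 qed
 show ?thesis
 proof (rule that[of M "\<lambda>y. q (l y)"])
  show "group M" "two_generated M" "torsion_free M" "has_nCC M n" "boundedly_simple 2 M"
   by (rule M_group M_2gen M_tf M_n M_bs)+
  show "ALL x:P. q (l x) : carrier M" by simp
  show "ALL x:P. ALL y:P. q (l (x * y)) = q (l x) \<otimes>\<^bsub>M\<^esub> q (l y)"
  proof (intro ballI)
   fix x y assume that: "x : P" "y : P"
   have "h (l (x * y)) = h (l x * l y)" unfolding h(1) using l subgrpD(2)[OF P_sub that] that i.La0 by simp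
   hence "l (x * y) * (l x * l y)^- : i.NI" by (simp only: i.NI_def i.h_mult i.h_inv mem_Collect_eq right_inv)
   thus "q (l (x * y)) = q (l x) \<otimes>\<^bsub>M\<^esub> q (l y)" using M_mult q_eq P_N by auto
  qed
  show "inj_on (\<lambda>y. q (l y)) P"
  proof (rule inj_onI)
   fix x y assume xy: "x : P" "y : P" "q (l x) = q (l y)"
   note subgrpD(2)[OF i.PI_sub lPI[OF xy(1)] subgrpD(3)[OF i.PI_sub lPI[OF xy(2)]]]
   hence "l x * (l y)^- : i.NI" using xy P_N q_eq by blast
   hence "La 0 x * (La 0 y)^- * La 0 y = La 0 y" using l xy by (simp add: i.NI_def i.h_mult i.h_inv)
   hence "La 0 x = La 0 y" by (simp add: mult.assoc)
   thus "x = y" by (rule i.La0_inj[OF xy(1,2)])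
  qed
  show "ALL x:P. ALL y:P. commensurable M (q (l x)) (q (l y)) --> c x = c y"
  proof (intro ballI impI)
   fix x y assume "x : P" "y : P" "commensurable M (q (l x)) (q (l y))"
   thus "c x = c y" by (metis M_indep lPI cl)
  qed
 qed
qed

end

section \<open>\<open>G\<close> times \<open>Z^2\<close> and its colouring\<close>

locale plane = group G for G :: "('a, 'b) monoid_scheme" (structure) +
 assumes G_tf: "torsion_free G" and G_cnt: "countable (carrier G)"
begin

text \<open>\<open>G \<times> \<int>\<^sup>2\<close> acting on itself by translations; the identity off the carrier.\<close>

definition tr :: "'a => int => int => ('a \<times> int \<times> int) bperm" where
 "tr g i j = Bperm (\<lambda>(x, k, l). if x : carrier G then (g \<otimes> x, i + k, j + l) else (x, k, l))"

lemma papp_tr: assumes g: "g : carrier G"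
 shows "papp (tr g i j) = (\<lambda>(x, k, l). if x : carrier G then (g \<otimes> x, i + k, j + l) else (x, k, l))"
 unfolding tr_def
proof (rule Bperm_inverse, rule CollectI, rule o_bij)
 show "(\<lambda>(x, k, l). if x : carrier G then (inv g \<otimes> x, k - i, l - j) else (x, k, l)) \<circ>
  (\<lambda>(x, k, l). if x : carrier G then (g \<otimes> x, i + k, j + l) else (x, k, l)) = id"
  using g by (auto simp: fun_eq_iff m_assoc[symmetric])
 show "(\<lambda>(x, k, l). if x : carrier G then (g \<otimes> x, i + k, j + l) else (x, k, l)) \<circ>
  (\<lambda>(x, k, l). if x : carrier G then (inv g \<otimes> x, k - i, l - j) else (x, k, l)) = id"
  using g by (auto simp: fun_eq_iff m_assoc[symmetric])
qed

lemma tr_at: "g : carrier G ==> papp (tr g i j) (\<one>, 0, 0) = (g, i, j)" by (simp add: papp_tr)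

lemma tr_mult: "[|g : carrier G; g' : carrier G|] ==> tr g i j * tr g' i' j' = tr (g \<otimes> g') (i + i') (j + j')"
 by (rule bperm_eqI) (auto simp: papp_tr m_assoc)

lemma tr_1: "tr \<one> 0 0 = 1" by (rule bperm_eqI) (auto simp: papp_tr)

lemma tr_inj: "[|g : carrier G; g' : carrier G; tr g i j = tr g' i' j'|] ==> g = g' & i = i' & j = j'"
 by (metis tr_at prod.inject)

lemma tr_inv: "g : carrier G ==> (tr g i j)^- = tr (inv g) (- i) (- j)"
 by (rule grp_class.inv_unique) (simp add: tr_mult tr_1)

lemma tr_pow: "g : carrier G ==> tr g i j ^ n = tr (g [^] n) (int n * i) (int n * j)"
proof (induction n)
 case (Suc n)
 have "g \<otimes> g [^] n = g [^] n \<otimes> g" using Suc.prems nat_pow_Suc2 by simp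
 moreover have "i + int n * i = int (Suc n) * i" "j + int n * j = int (Suc n) * j" by (simp_all add: algebra_simps)
 ultimately show ?case using Suc.IH Suc.prems tr_mult by simp
qed (simp add: tr_1)

lemma tr_zpow: "g : carrier G ==> zpow (tr g i j) k = tr (g [^] k) (k * i) (k * j)"
proof (cases "0 <= k")
 case True
 assume g: "g : carrier G"
 have "zpow (tr g i j) k = tr g i j ^ nat k" "g [^] k = g [^] nat k" "int (nat k) = k"
  using True by (simp_all only: zpow_def int_pow_def2 not_less[symmetric] if_True if_False simp_thms int_nat_eq)
 thus ?thesis by (simp only: tr_pow[OF g])
next
 case False
 assume g: "g : carrier G"
 have "zpow (tr g i j) k = (tr g i j)^- ^ nat (- k)" using False by (simp only: zpow_def if_False)
 also have "... = tr (inv g [^] nat (- k)) (int (nat (- k)) * - i) (int (nat (- k)) * - j)"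
  by (simp only: tr_inv[OF g] tr_pow[OF inv_closed[OF g]])
 also have "inv g [^] nat (- k) = inv (g [^] nat (- k))" by (rule nat_pow_inv[OF g])
 also have "... = g [^] k" unfolding int_pow_def2 using False by (simp only: not_le if_True)
 also have "int (nat (- k)) = - k" using False by linarith
 finally show ?thesis by simp
qed

definition P0 :: "('a \<times> int \<times> int) bperm set" where "P0 = {tr g i j |g i j. g : carrier G}"

lemma P0_sub: "subgrp P0"
 unfolding subgrp_def
proof (intro conjI ballI)
 show "1 : P0" unfolding P0_def tr_1[symmetric] by blast
 fix x assume "x : P0"
 then obtain g i j where x: "x = tr g i j" "g : carrier G" by (auto simp: P0_def)
 thus "x^- : P0" using tr_inv by (auto simp: P0_def)
 fix y assume "y : P0"
 then obtain g' i' j' where y: "y = tr g' i' j'" "g' : carrier G" by (auto simp: P0_def)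
 thus "x * y : P0" unfolding P0_def using x tr_mult m_closed by auto
qed

lemma P0_fprod: "fprod P0 (tr \<one> 1 0)"
proof
 show "subgrp P0" by (rule P0_sub)
 show "tr \<one> 1 0 : P0" by (auto simp: P0_def)
 show "k = 0" if "zpow (tr \<one> 1 0) k = 1" for k
 proof -
  have "tr \<one> k 0 = tr \<one> 0 0" using that tr_zpow[of "\<one>" 1 0 k] by (simp add: tr_1)
  thus ?thesis using tr_inj by blast
 qed
 fix x and m :: nat assume x: "x : P0" "0 < m" "x ^ m = 1"
 then obtain g i j where g: "x = tr g i j" "g : carrier G" by (auto simp: P0_def)
 hence "tr (g [^] m) (int m * i) (int m * j) = tr \<one> 0 0" using x(3) tr_pow[of g i j m] tr_1 by simp
 hence "g [^] m = \<one> & int m * i = 0 & int m * j = 0" by (rule tr_inj[rotated 2]) (use g(2) in simp_all)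
 hence "g = \<one>" "i = 0" "j = 0" using G_tf g(2) x(2) by (auto simp: torsion_free_def)
 thus "x = 1" using g tr_1 by simp
qed

lemma P0_cnt: "countable P0"
proof -
 have "P0 <= (\<lambda>p. tr (fst p) (fst (snd p)) (snd (snd p))) ` (carrier G \<times> (UNIV :: (int \<times> int) set))"
 proof
  fix x assume "x : P0"
  then obtain g i j where "x = tr g i j" "g : carrier G" by (auto simp: P0_def)
  thus "x : (\<lambda>p. tr (fst p) (fst (snd p)) (snd (snd p))) ` (carrier G \<times> UNIV)" by (intro image_eqI[of _ _ "(g, i, j)"]) simp_all
 qed
 moreover have "countable (carrier G \<times> (UNIV :: (int \<times> int) set))" using G_cnt by simp
 ultimately show ?thesis by (simp add: countable_subset)
qed

definition PG :: "('a \<times> int \<times> int) bperm set" where "PG = {tr g 0 0 |g. g : carrier G}"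

lemma PG_sub: "subgrp PG"
 unfolding subgrp_def
proof (intro conjI ballI)
 show "1 : PG" unfolding PG_def tr_1[symmetric] by blast
 fix x assume "x : PG"
 then obtain g where x: "x = tr g 0 0" "g : carrier G" by (auto simp: PG_def)
 thus "x^- : PG" using tr_inv by (auto simp: PG_def)
 fix y assume "y : PG"
 then obtain g' where y: "y = tr g' 0 0" "g' : carrier G" by (auto simp: PG_def)
 thus "x * y : PG" unfolding PG_def using x tr_mult[of g g' 0 0 0 0] m_closed by auto
qed

lemma commensurable_cq: assumes "x : carrier G" "y : carrier G"
 shows "commensurable G x y \<longleftrightarrow> cq PG (tr x 0 0) (tr y 0 0)"
proof -
 have *: "(y [^] l = g \<otimes> x [^] k \<otimes> inv g) \<longleftrightarrow> zpow (tr y 0 0) l = tr g 0 0 * zpow (tr x 0 0) k * (tr g 0 0)^-"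
  if g: "g : carrier G" for k l :: int and g
 proof -
  have "tr g 0 0 * zpow (tr x 0 0) k * (tr g 0 0)^- = tr (g \<otimes> x [^] k \<otimes> inv g) 0 0"
   using g assms by (simp add: tr_zpow tr_mult tr_inv)
  moreover have "zpow (tr y 0 0) l = tr (y [^] l) 0 0" using assms by (simp add: tr_zpow)
  moreover have "y [^] l : carrier G" "g \<otimes> x [^] k \<otimes> inv g : carrier G" using g assms by auto
  ultimately show ?thesis by (metis tr_inj)
 qed
 have "(EX g:carrier G. y [^] l = g \<otimes> x [^] k \<otimes> inv g) \<longleftrightarrow> (EX h:PG. zpow (tr y 0 0) l = h * zpow (tr x 0 0) k * h^-)" for k l :: int
  using * unfolding PG_def by blast
 thus ?thesis unfolding commensurable_def conjugate_def cq_def by simp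
qed

end

context plane
begin

text \<open>The component in \<open>Z^2\<close> decides only where that in \<open>G\<close> is
  trivial; thus elements of \<open>X m\<close> get their colour from commensurability in
  \<open>G\<close> alone.\<close>

definition col :: "nat => (nat => 'a set) => ('a \<times> int \<times> int) bperm => nat" where
 "col N X y = (case papp y (\<one>, 0, 0) of (g, i, j) => if g = \<one> then dirc N i j
   else if \<exists>m. m : {1..N} & (EX x:X m. cq PG (tr g 0 0) (tr x 0 0))
   then SOME m. m : {1..N} & (EX x:X m. cq PG (tr g 0 0) (tr x 0 0)) else 1)"

lemma col_tr: "g : carrier G ==> col N X (tr g i j) = (if g = \<one> then dirc N i j
   else if \<exists>m. m : {1..N} & (EX x:X m. cq PG (tr g 0 0) (tr x 0 0))
   then SOME m. m : {1..N} & (EX x:X m. cq PG (tr g 0 0) (tr x 0 0)) else 1)"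
 by (simp add: col_def tr_at)

lemma col_range: assumes "1 <= N" "y : P0" shows "col N X y : {1..N}"
proof -
 obtain g i j where y: "y = tr g i j" "g : carrier G" using assms(2) by (auto simp: P0_def)
 let ?Q = "\<lambda>m. m : {1..N} & (EX x:X m. cq PG (tr g 0 0) (tr x 0 0))"
 have "(SOME m. ?Q m) : {1..N}" if "\<exists>m. ?Q m" using someI_ex[OF that] by blast
 thus ?thesis unfolding y(1) col_tr[OF y(2)] using dirc_range[OF assms(1), of i j] assms(1) by simp
qed

lemma col_conj: assumes "x : P0" "y : P0" shows "col N X (y * x * y^-) = col N X x"
proof -
 obtain g i j where x: "x = tr g i j" "g : carrier G" using assms(1) by (auto simp: P0_def)
 obtain h k l where y: "y = tr h k l" "h : carrier G" using assms(2) by (auto simp: P0_def)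
 have e: "y * x * y^- = tr (h \<otimes> g \<otimes> inv h) i j" using x y by (simp add: tr_inv tr_mult)
 have e0: "tr (h \<otimes> g \<otimes> inv h) 0 0 = tr h 0 0 * tr g 0 0 * (tr h 0 0)^-" using x y by (simp add: tr_inv tr_mult)
 have c: "h \<otimes> g \<otimes> inv h : carrier G" using x(2) y(2) by simp
 have "h \<otimes> g \<otimes> inv h = \<one> \<longleftrightarrow> g = \<one>"
 proof
  assume "h \<otimes> g \<otimes> inv h = \<one>"
  hence "h \<otimes> g = h" using x(2) y(2) by (metis inv_closed inv_equality inv_inv m_closed)
  thus "g = \<one>" using x(2) y(2) by simp
 qed (use y(2) in simp)
 moreover have "cq PG (tr (h \<otimes> g \<otimes> inv h) 0 0) z \<longleftrightarrow> cq PG (tr g 0 0) z" for z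
  unfolding e0 by (rule cq_conj[OF PG_sub]) (use y(2) in \<open>auto simp: PG_def\<close>)
 ultimately have "col N X (tr (h \<otimes> g \<otimes> inv h) i j) = col N X (tr g i j)" unfolding col_tr[OF c] col_tr[OF x(2)] by (simp only:)
 thus ?thesis unfolding e unfolding x(1) .
qed

lemma col_pow: assumes "x : P0" "k ~= 0" shows "col N X (zpow x k) = col N X x"
proof -
 obtain g i j where x: "x = tr g i j" "g : carrier G" using assms(1) by (auto simp: P0_def)
 have e: "zpow x k = tr (g [^] k) (k * i) (k * j)" unfolding x(1) by (rule tr_zpow[OF x(2)])
 have e0: "tr (g [^] k) 0 0 = zpow (tr g 0 0) k" using tr_zpow[OF x(2), of 0 0 k] by simp
 have c: "g [^] k : carrier G" using x(2) by simp
 have "g [^] k = \<one> \<longleftrightarrow> g = \<one>"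
 proof
  assume z: "g [^] k = \<one>"
  have "g [^] nat \<bar>k\<bar> = \<one>"
  proof (cases "0 <= k")
   case True
   hence "nat \<bar>k\<bar> = nat k" "\<not> k < 0" by simp_all
   hence "g [^] k = g [^] nat \<bar>k\<bar>" unfolding int_pow_def2 by (simp only: if_False)
   thus ?thesis using z by (simp only:)
  next
   case False
   hence "g [^] k = inv (g [^] nat \<bar>k\<bar>)" unfolding int_pow_def2 by (simp only: abs_of_neg not_le if_True)
   hence "inv (g [^] nat \<bar>k\<bar>) = \<one>" using z by (simp only:)
   hence "inv (inv (g [^] nat \<bar>k\<bar>)) = inv \<one>" by (rule arg_cong)
   thus ?thesis by (simp only: inv_inv[OF nat_pow_closed[OF x(2)]] inv_one)
  qed
  moreover have "0 < nat \<bar>k\<bar>" using assms(2) by simp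
  ultimately show "g = \<one>" using G_tf x(2) unfolding torsion_free_def by blast
 qed simp
 moreover have "cq PG (tr (g [^] k) 0 0) z \<longleftrightarrow> cq PG (tr g 0 0) z" for z
  unfolding e0 by (rule cq_pow[OF assms(2)])
 ultimately have "col N X (tr (g [^] k) (k * i) (k * j)) = col N X (tr g i j)"
  unfolding col_tr[OF c] col_tr[OF x(2)] dirc_scale[OF assms(2)] by (simp only:)
 thus ?thesis unfolding e unfolding x(1) .
qed

text \<open>The witnesses have trivial component in \<open>G\<close>; first coordinates 1, 1 and 2
  make them and their product nontrivial.\<close>

lemma col_sum: assumes "i : {1..N}" "j : {1..N}"
 shows "EX y:P0. EX y':P0. y ~= 1 & y' ~= 1 & y * y' ~= 1 & col N X y = j & col N X y' = j & col N X (y * y') = i"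
proof -
 obtain m where m: "dirc N 1 (4 * m) = j" "dirc N 1 (4 * m + 2) = j" "dirc N 2 (8 * m + 2) = i" using dirc_sum[OF assms] .
 have d: "col N X (tr \<one> k l) = dirc N k l" for k l by (simp only: col_tr[OF one_closed] if_True simp_thms)
 have "1 + 1 = (2::int)" "4 * m + (4 * m + 2) = 8 * m + 2" by simp_all
 hence s: "tr \<one> 1 (4 * m) * tr \<one> 1 (4 * m + 2) = tr \<one> 2 (8 * m + 2)"
  by (simp only: tr_mult[OF one_closed one_closed] l_one[OF one_closed])
 have n: "tr \<one> k l ~= 1" if "k ~= 0" for k l using tr_inj[of "\<one>" "\<one>" k l 0 0] that unfolding tr_1 by auto
 have P: "tr \<one> k l : P0" for k l unfolding P0_def by blast
 show ?thesis
  by (rule bexI[OF _ P[of 1 "4 * m"]], rule bexI[OF _ P[of 1 "4 * m + 2"]]) (use n[of 1] n[of 2] in \<open>simp add: s d m del: mult_numeral_left\<close>)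
qed

text \<open>By independence no other set of the family meets the commensurability class of
  \<open>x\<close>, so the choice in \<open>col\<close> is forced.\<close>

lemma col_X: assumes ind: "independent_family G {1..N} X" and x: "x : X m" "m : {1..N}" "x ~= \<one>"
 shows "col N X (tr x 0 0) = m"
proof -
 have xG: "x : carrier G" using ind x unfolding independent_family_def by blast
 have "x [^] (1::int) = \<one> \<otimes> x [^] (1::int) \<otimes> inv \<one>" using xG by simp
 hence "commensurable G x x" unfolding commensurable_def conjugate_def by (intro exI[of _ "1::int"] conjI bexI[of _ "\<one>"]) simp_all
 hence c: "cq PG (tr x 0 0) (tr x 0 0)" using commensurable_cq[OF xG xG] by simp
 let ?Q = "\<lambda>m. m : {1..N} & (EX x':X m. cq PG (tr x 0 0) (tr x' 0 0))"
 have u: "m' = m" if m': "?Q m'" for m'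
 proof (rule ccontr)
  assume ne: "m' ~= m"
  obtain x' where x': "x' : X m'" "cq PG (tr x 0 0) (tr x' 0 0)" using m' by blast
  have "x' : carrier G" using ind x'(1) m' unfolding independent_family_def by blast
  hence "commensurable G x x'" using commensurable_cq[OF xG] x'(2) by simp
  moreover have "\<not> commensurable G x x'"
   using conjunct2[OF ind[unfolded independent_family_def]] x(1,2) x'(1) conjunct1[OF m'] ne by (metis (no_types))
  ultimately show False by contradiction
 qed
 have Q: "?Q m" using c x by blast
 have "(SOME m. ?Q m) = m" by (rule some_equality[of ?Q, OF Q u])
 moreover have "\<exists>m. ?Q m" using Q by (rule exI)
 ultimately show ?thesis unfolding col_tr[OF xG] using x(3) by (simp only: if_True if_False simp_thms)
qed

end

theorem theorem3p5:
  fixes G :: "('a, 'b) monoid_scheme"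
    and n :: nat
    and X :: "nat \<Rightarrow> 'a set"
  assumes "group G"
    and "torsion_free G"
    and "countable (carrier G)"
    and "n \<ge> 2"
    and "\<And>i. i \<in> {1..n - 1} \<Longrightarrow> X i \<noteq> {} \<and> X i \<subseteq> carrier G - {\<one>\<^bsub>G\<^esub>}"
    and "independent_family G {1..n - 1} X"
  shows "\<exists>(M :: nat monoid) \<phi>.
           group M \<and> two_generated M \<and> torsion_free M \<and> has_nCC M n \<and>
           \<phi> \<in> mon G M \<and>
           independent_family M {1..n - 1} (\<lambda>i. \<phi> ` X i) \<and>
           boundedly_simple 2 M"
proof -
 interpret p: plane G using assms(1-3) by (simp add: plane_def plane_axioms_def)
 interpret fprod p.P0 "p.tr \<one>\<^bsub>G\<^esub> 1 0" by (rule p.P0_fprod)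
 define c where "c = p.col (n - 1) X"
 have n1: "1 <= n - 1" using assms(4) by simp
 obtain M :: "nat monoid" and f where M: "group M" "two_generated M" "torsion_free M" "has_nCC M n" "boundedly_simple 2 M"
  "ALL x:p.P0. f x : carrier M" "ALL x:p.P0. ALL y:p.P0. f (x * y) = f x \<otimes>\<^bsub>M\<^esub> f y"
  "inj_on f p.P0" "ALL x:p.P0. ALL y:p.P0. commensurable M (f x) (f y) --> c x = c y"
  using embed[OF p.P0_cnt assms(4), of c, unfolded c_def, OF p.col_conj p.col_pow p.col_range[OF n1] p.col_sum, folded c_def] .
 define \<phi> where "\<phi> g = f (p.tr g 0 0)" for g
 have P: "p.tr g 0 0 : p.P0" if "g : carrier G" for g using that by (auto simp: p.P0_def)
 have "\<phi> : mon G M"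
  unfolding mon_def hom_def
 proof (intro CollectI conjI ballI Pi_I)
  show "\<phi> g : carrier M" if "g : carrier G" for g unfolding \<phi>_def by (rule M(6)[rule_format, OF P[OF that]])
  show "\<phi> (g \<otimes>\<^bsub>G\<^esub> h) = \<phi> g \<otimes>\<^bsub>M\<^esub> \<phi> h" if "g : carrier G" "h : carrier G" for g h
   using M(7)[rule_format, OF P[OF that(1)] P[OF that(2)]] p.tr_mult[OF that, of 0 0 0 0] by (simp add: \<phi>_def)
  show "inj_on \<phi> (carrier G)"
  proof (rule inj_onI)
   fix g h assume gh: "g : carrier G" "h : carrier G" "\<phi> g = \<phi> h"
   hence "p.tr g 0 0 = p.tr h 0 0" using inj_onD[OF M(8)] P unfolding \<phi>_def by blast
   thus "g = h" using p.tr_inj gh by blast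
  qed
 qed
 \<comment> \<open>Commensurable images have equal colours, and \<open>col_X\<close> gives
   \<open>X i\<close> the colour \<open>i\<close>.\<close>
 moreover have "independent_family M {1..n - 1} (\<lambda>i. \<phi> ` X i)"
  unfolding independent_family_def
 proof (intro conjI ballI impI)
  fix i assume i: "i : {1..n - 1}"
  have X: "x : carrier G & c (p.tr x 0 0) = k" if "k : {1..n - 1}" "x : X k" for k x
   using p.col_X[OF assms(6) that(2,1)] assms(5)[OF that(1)] that(2) unfolding c_def by blast
  show "\<phi> ` X i <= carrier M" using M(6)[rule_format, OF P] X[OF i] unfolding \<phi>_def by blast
  fix j x y assume j: "j : {1..n - 1}" "i ~= j" "x : \<phi> ` X i" "y : \<phi> ` X j"
  then obtain x' y' where "x = \<phi> x'" "x' : X i" "y = \<phi> y'" "y' : X j" by blast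
  thus "\<not> commensurable M x y" using M(9)[rule_format, OF P P, of x' y'] X[OF i, of x'] X[OF j(1), of y'] j(2) unfolding \<phi>_def by auto
 qed
 ultimately show ?thesis using M(1-5) by blast
qed

end
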